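(* Let $N=2$. If $m\ge 1$ is an integer, then the space $\mathcal{A}^{m+1}$ of odd unit-speed curves is a $C^{\infty}$ Hilbert manifold. If $m\ge 3$, then $\mathcal{A}^{m+1}$ is a $C^{\infty}$ Hilbert submanifold of the Hilbert space $\mathcal{K}^{m+1}$.
   Context: For integers $j,k\ge 0$ and $\eta\colon[-1,1]\to\mathbb{R}^2$ put $\lVert \eta\rVert_{j,k}^2=\int_{-1}^1(1-s^2)^j\lvert\partial_s^k\eta(s)\rvert^2\,ds$. For an integer $m\ge 0$, $\mathcal{K}^m$ is the space of odd curves $\eta\colon[-1,1]\to\mathbb{R}^2$ (that is, $\eta(-s)=-\eta(s)$) with $\lVert\eta\rVert_{j,j}<\infty$ for all $0\le j\le m$; it is a Hilbert space with squared norm $\sum_{j=0}^m\lVert\eta\rVert_{j,j}^2$. For $m\ge 2$, elements of $\mathcal{K}^m$ are $C^1$ on compact subintervals of $(-1,1)$, and $\mathcal{A}^m=\{\eta\in\mathcal{K}^m : \lvert\eta'(s)\rvert=1 \text{ for all } s\in(-1,1)\}$. *)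

theory Defs
  imports "HOL-Analysis.Analysis"
begin

section \<open>Hilbert spaces on a carrier, smooth maps, manifolds\<close>

text \<open>
  The spaces of curves below form a family indexed by a natural number, so a Hilbert space is a
  linear subspace of a \<^class>\<open>real_vector\<close> type equipped with an inner product of its own.
\<close>

record 'a hspace =
  hcarrier :: "'a set"
  hinner :: "'a \<Rightarrow> 'a \<Rightarrow> real"

definition hnorm :: "'a hspace \<Rightarrow> 'a \<Rightarrow> real" where
  "hnorm E x = sqrt (hinner E x x)"

text \<open>
  The value 0 off the carrier is there because \<^locale>\<open>Metric_space\<close> asks for nonnegativity and
  symmetry on the whole type.
\<close>

definition hdist :: "'a::real_vector hspace \<Rightarrow> 'a \<Rightarrow> 'a \<Rightarrow> real" where
  "hdist E x y = (if x \<in> hcarrier E \<and> y \<in> hcarrier E then hnorm E (x - y) else 0)"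

definition htopology :: "'a::real_vector hspace \<Rightarrow> 'a topology" where
  "htopology E = Metric_space.mtopology (hcarrier E) (hdist E)"

definition hilbert_space :: "'a::real_vector hspace \<Rightarrow> bool" where
  "hilbert_space E \<longleftrightarrow>
     subspace (hcarrier E) \<and>
     (\<forall>x\<in>hcarrier E. \<forall>y\<in>hcarrier E. hinner E x y = hinner E y x) \<and>
     (\<forall>x\<in>hcarrier E. \<forall>y\<in>hcarrier E. \<forall>z\<in>hcarrier E.
        hinner E (x + y) z = hinner E x z + hinner E y z) \<and>
     (\<forall>c. \<forall>x\<in>hcarrier E. \<forall>y\<in>hcarrier E. hinner E (c *\<^sub>R x) y = c * hinner E x y) \<and>
     (\<forall>x\<in>hcarrier E. x \<noteq> 0 \<longrightarrow> 0 < hinner E x x) \<and>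
     Metric_space.mcomplete (hcarrier E) (hdist E)"

text \<open>Bounded \<open>k\<close>-linear maps; the \<open>k\<close> arguments are given as a list of length \<open>k\<close>.\<close>

definition bounded_multilinear ::
    "'a::real_vector hspace \<Rightarrow> 'b::real_vector hspace \<Rightarrow> nat \<Rightarrow> ('a list \<Rightarrow> 'b) \<Rightarrow> bool" where
  "bounded_multilinear E F k T \<longleftrightarrow>
     (\<forall>vs. length vs = k \<and> set vs \<subseteq> hcarrier E \<longrightarrow> T vs \<in> hcarrier F) \<and>
     (\<forall>vs i c. \<forall>x\<in>hcarrier E. \<forall>y\<in>hcarrier E.
        length vs = k \<and> set vs \<subseteq> hcarrier E \<and> i < k \<longrightarrow>
        T (vs[i := c *\<^sub>R x + y]) = c *\<^sub>R T (vs[i := x]) + T (vs[i := y])) \<and>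
     (\<exists>C. \<forall>vs. length vs = k \<and> set vs \<subseteq> hcarrier E \<longrightarrow>
        hnorm F (T vs) \<le> C * prod_list (map (hnorm E) vs))"

text \<open>
  \<open>f\<close> is \<open>C\<^sup>\<infinity>\<close> on the open set \<open>U\<close> in the sense of Frechet: \<open>D k x\<close> is the \<open>k\<close>-th derivative of
  \<open>f\<close> at \<open>x\<close>, and the last clause says that \<open>D (Suc k) x\<close>, with its first argument read as the
  increment, is the Frechet derivative at \<open>x\<close> of \<open>D k\<close> as a map into the space of bounded
  \<open>k\<close>-linear maps with the operator norm.
\<close>

definition hsmooth_on ::
    "'a::real_vector hspace \<Rightarrow> 'b::real_vector hspace \<Rightarrow> 'a set \<Rightarrow> ('a \<Rightarrow> 'b) \<Rightarrow> bool" where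
  "hsmooth_on E F U f \<longleftrightarrow>
     openin (htopology E) U \<and>
     (\<exists>D :: nat \<Rightarrow> 'a \<Rightarrow> 'a list \<Rightarrow> 'b.
        (\<forall>x\<in>U. D 0 x [] = f x) \<and>
        (\<forall>k. \<forall>x\<in>U. bounded_multilinear E F k (D k x)) \<and>
        (\<forall>k. \<forall>x\<in>U. \<forall>\<epsilon>>0. \<exists>\<delta>>0. \<forall>y\<in>U. hnorm E (y - x) < \<delta> \<longrightarrow>
           (\<forall>vs. length vs = k \<and> set vs \<subseteq> hcarrier E \<longrightarrow>
              hnorm F (D k y vs - D k x vs - D (Suc k) x ((y - x) # vs))
                \<le> \<epsilon> * hnorm E (y - x) * prod_list (map (hnorm E) vs))))"

definition hdiffeomorphism ::
    "'a::real_vector hspace \<Rightarrow> 'b::real_vector hspace \<Rightarrow> 'a set \<Rightarrow> 'b set \<Rightarrow> ('a \<Rightarrow> 'b) \<Rightarrow> bool" where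
  "hdiffeomorphism E F U V \<phi> \<longleftrightarrow>
     bij_betw \<phi> U V \<and> hsmooth_on E F U \<phi> \<and> hsmooth_on F E V (inv_into U \<phi>)"

text \<open>
  The topological space \<open>X\<close> carries a \<open>C\<^sup>\<infinity>\<close> atlas, compatible with its topology, of charts
  \<open>(U, \<phi>)\<close> with values in the Hilbert space \<open>E\<close>.
\<close>

definition hilbert_manifold :: "'e::real_vector hspace \<Rightarrow> 'p topology \<Rightarrow> bool" where
  "hilbert_manifold E X \<longleftrightarrow>
     hilbert_space E \<and> Hausdorff_space X \<and>
     (\<exists>\<A> :: ('p set \<times> ('p \<Rightarrow> 'e)) set.
        (\<forall>(U, \<phi>)\<in>\<A>. openin X U \<and> openin (htopology E) (\<phi> ` U) \<and>
           homeomorphic_map (subtopology X U) (subtopology (htopology E) (\<phi> ` U)) \<phi>) \<and>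
        (\<Union>(U, \<phi>)\<in>\<A>. U) = topspace X \<and>
        (\<forall>(U, \<phi>)\<in>\<A>. \<forall>(V, \<psi>)\<in>\<A>.
           hsmooth_on E E (\<phi> ` (U \<inter> V)) (\<psi> \<circ> inv_into U \<phi>)))"

text \<open>
  Submanifolds by straightening charts onto a closed subspace \<open>F\<close>, which is automatically
  complemented because \<open>E\<close> is a Hilbert space.
\<close>

definition hilbert_submanifold :: "'a::real_vector hspace \<Rightarrow> 'a set \<Rightarrow> bool" where
  "hilbert_submanifold E S \<longleftrightarrow>
     hilbert_space E \<and> S \<subseteq> hcarrier E \<and>
     (\<exists>F. subspace F \<and> closedin (htopology E) F \<and>
        (\<forall>p\<in>S. \<exists>U V \<phi>. p \<in> U \<and> hdiffeomorphism E E U V \<phi> \<and> \<phi> ` (U \<inter> S) = V \<inter> F))"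


section \<open>Planar curves modulo equality almost everywhere\<close>

definition curve_rel :: "(real \<Rightarrow> real ^ 2) \<Rightarrow> (real \<Rightarrow> real ^ 2) \<Rightarrow> bool" where
  "curve_rel f g \<longleftrightarrow>
     f \<in> borel_measurable (lebesgue_on {-1..1}) \<and> g \<in> borel_measurable (lebesgue_on {-1..1}) \<and>
     (AE s in lebesgue_on {-1..1}. f s = g s)"

lemma part_equivp_curve_rel: "part_equivp curve_rel"
proof (rule part_equivpI)
  show "\<exists>f. curve_rel f f"
    by (rule exI[of _ "\<lambda>_. 0"]) (simp add: curve_rel_def)
  show "symp curve_rel"
    by (rule sympI) (auto simp: curve_rel_def elim: eventually_mono)
  show "transp curve_rel"
    by (rule transpI) (auto simp: curve_rel_def elim: eventually_elim2)
qed

quotient_type curve = "real \<Rightarrow> real ^ 2" / partial: curve_rel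
  morphisms rep_curve abs_curve
  by (rule part_equivp_curve_rel)

instantiation curve :: real_vector
begin

lift_definition zero_curve :: curve is "\<lambda>s. 0"
  by (simp add: curve_rel_def)

lift_definition plus_curve :: "curve \<Rightarrow> curve \<Rightarrow> curve" is "\<lambda>f g s. f s + g s"
  by (auto simp: curve_rel_def elim: eventually_elim2)

lift_definition uminus_curve :: "curve \<Rightarrow> curve" is "\<lambda>f s. - f s"
  by (auto simp: curve_rel_def)

lift_definition minus_curve :: "curve \<Rightarrow> curve \<Rightarrow> curve" is "\<lambda>f g s. f s - g s"
  by (auto simp: curve_rel_def elim: eventually_elim2)

lift_definition scaleR_curve :: "real \<Rightarrow> curve \<Rightarrow> curve" is "\<lambda>c f s. c *\<^sub>R f s"
  by (auto simp: curve_rel_def)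

instance
proof
  fix x y z :: curve and a b :: real
  show "x + y + z = x + (y + z)"
    by transfer (auto simp: curve_rel_def algebra_simps)
  show "x + y = y + x"
    by transfer (auto simp: curve_rel_def algebra_simps)
  show "0 + x = x"
    by transfer (auto simp: curve_rel_def)
  show "- x + x = 0"
    by transfer (auto simp: curve_rel_def)
  show "x - y = x + - y"
    by transfer (auto simp: curve_rel_def)
  show "a *\<^sub>R (x + y) = a *\<^sub>R x + a *\<^sub>R y"
    by transfer (auto simp: curve_rel_def algebra_simps)
  show "(a + b) *\<^sub>R x = a *\<^sub>R x + b *\<^sub>R x"
    by transfer (auto simp: curve_rel_def algebra_simps)
  show "a *\<^sub>R b *\<^sub>R x = (a * b) *\<^sub>R x"
    by transfer (auto simp: curve_rel_def)
  show "1 *\<^sub>R x = x"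
    by transfer (auto simp: curve_rel_def)
qed

end


section \<open>Weak derivatives and the weighted Sobolev spaces\<close>

text \<open>
  \<open>C\<^sub>c\<^sup>1\<close> test functions on the open interval together with their derivative.  First-order weak
  derivatives are tested against these and higher ones obtained by iteration, as in Brezis,
  Functional Analysis, Sobolev Spaces and PDE, Chapter 8.
\<close>

definition test_function :: "(real \<Rightarrow> real) \<Rightarrow> (real \<Rightarrow> real) \<Rightarrow> bool" where
  "test_function \<phi> \<phi>' \<longleftrightarrow>
     (\<forall>s. (\<phi> has_real_derivative \<phi>' s) (at s)) \<and> continuous_on UNIV \<phi>' \<and>
     (\<exists>a b. -1 < a \<and> b < 1 \<and> (\<forall>s. s \<notin> {a..b} \<longrightarrow> \<phi> s = 0))"

definition locally_integrable :: "curve \<Rightarrow> bool" where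
  "locally_integrable \<eta> \<longleftrightarrow>
     (\<forall>a b. -1 < a \<and> b < 1 \<longrightarrow> rep_curve \<eta> absolutely_integrable_on {a..b})"

definition has_weak_deriv :: "curve \<Rightarrow> curve \<Rightarrow> bool" where
  "has_weak_deriv \<eta> \<zeta> \<longleftrightarrow>
     locally_integrable \<eta> \<and> locally_integrable \<zeta> \<and>
     (\<forall>\<phi> \<phi>'. test_function \<phi> \<phi>' \<longrightarrow>
        (LINT s|lebesgue_on {-1..1}. \<phi>' s *\<^sub>R rep_curve \<eta> s) =
          - (LINT s|lebesgue_on {-1..1}. \<phi> s *\<^sub>R rep_curve \<zeta> s))"

definition weakly_differentiable :: "curve \<Rightarrow> bool" where
  "weakly_differentiable \<eta> \<longleftrightarrow> (\<exists>\<zeta>. has_weak_deriv \<eta> \<zeta>)"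

definition weak_deriv :: "curve \<Rightarrow> curve" where
  "weak_deriv \<eta> = (THE \<zeta>. has_weak_deriv \<eta> \<zeta>)"

definition odd_curve :: "curve \<Rightarrow> bool" where
  "odd_curve \<eta> \<longleftrightarrow> (AE s in lebesgue_on {-1..1}. rep_curve \<eta> (- s) = - rep_curve \<eta> s)"

text \<open>The squared weighted seminorm \<open>\<parallel>\<eta>\<parallel>\<close> with indices \<open>j, k\<close>, possibly infinite.\<close>

definition wnorm_sq :: "nat \<Rightarrow> nat \<Rightarrow> curve \<Rightarrow> ennreal" where
  "wnorm_sq j k \<eta> =
     (\<integral>\<^sup>+ s. ennreal ((1 - s\<^sup>2) ^ j * (norm (rep_curve ((weak_deriv ^^ k) \<eta>) s))\<^sup>2)
        \<partial>lebesgue_on {-1..1})"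

definition K_space :: "nat \<Rightarrow> curve hspace" where
  "K_space m =
     \<lparr>hcarrier =
        {\<eta>. odd_curve \<eta> \<and>
            (\<forall>j<m. weakly_differentiable ((weak_deriv ^^ j) \<eta>)) \<and>
            (\<forall>j\<le>m. wnorm_sq j j \<eta> < \<infinity>)},
      hinner = (\<lambda>\<eta> \<zeta>. \<Sum>j\<le>m. LINT s|lebesgue_on {-1..1}.
        (1 - s\<^sup>2) ^ j * (rep_curve ((weak_deriv ^^ j) \<eta>) s \<bullet> rep_curve ((weak_deriv ^^ j) \<zeta>) s))\<rparr>"

text \<open>The unit-speed condition is imposed on the \<open>C\<^sup>1\<close> representative of the class.\<close>

definition unit_speed :: "curve \<Rightarrow> bool" where
  "unit_speed \<eta> \<longleftrightarrow>
     (\<exists>\<gamma> \<gamma>'. (AE s in lebesgue_on {-1..1}. rep_curve \<eta> s = \<gamma> s) \<and>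
        (\<forall>s\<in>{-1<..<1}. (\<gamma> has_vector_derivative \<gamma>' s) (at s)) \<and>
        continuous_on {-1<..<1} \<gamma>' \<and>
        (\<forall>s\<in>{-1<..<1}. norm (\<gamma>' s) = 1))"

definition A_space :: "nat \<Rightarrow> curve set" where
  "A_space m = {\<eta> \<in> hcarrier (K_space m). unit_speed \<eta>}"

end

theory Submission
  imports Defs
begin

text \<open>
  An odd curve in \<open>K\<^sup>m\<^sup>+\<^sup>1\<close> is determined by its derivative, and unit speed is a pointwise condition on
  the derivative, which is read as a complex-valued function \<open>h\<close> with the weighted norms of
  \<open>h, h', \<dots>\<close> up to order \<open>m\<close>.  For \<open>m \<ge> 3\<close> these functions form a Banach algebra under pointwise
  multiplication, and the unimodular elements are straightened by Cayley transforms, which are smooth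
  in any such algebra.  For \<open>m = 1, 2\<close> the algebra property fails, but \<open>h = exp (\<i> \<theta>)\<close> with a real
  \<open>\<theta>\<close> of the same class: \<open>\<bar>h'\<bar> = \<bar>\<theta>'\<bar>\<close>, and \<open>\<theta>'\<^sup>2\<close> is controlled by Hardy's inequality.  This makes the
  space of unit-speed curves a quotient of a Hilbert space of angle functions by the translations by
  \<open>2 \<pi>\<close>, with charts whose transition maps are locally translations.
\<close>

section \<open>Hilbert spaces on a carrier\<close>

text \<open>The threshold 3 comes from growth rates at the end points. Square integrability of the
  next derivative gives the j-th derivative of h the rate (1 - |s|)^(-(j+1)/2); integrating a rate
  lowers its exponent by one, except that exponent 1 integrates to a logarithm. From j = 2 the
  exponents run 3/2, 1/2, 0 and jump over 1, so h is bounded by its norm; for m = 2 only the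
  exponent 1 of h' is at hand. In the low cases |h| = 1 supplies the bound on h, but products then
  converge by dominated convergence, without a rate. Hence the map from \<theta> to exp (\<i>
  \<theta>) is only shown to be continuous and open. This suffices for a manifold, whose definition
  asks for smoothness of the chart changes, but it does not straighten the ambient space as a
  submanifold requires. No chain rule for \<open>hsmooth_on\<close> is used: chart changes are known
  in closed form, as Moebius maps in the algebra case and as local translations in the
  other.\<close>

text \<open>Completeness is left out, so that the metric facts are available while
  \<open>K_space\<close> and closed subspaces are being shown complete.\<close>

locale pre_hilbert =
  fixes E :: "'a::real_vector hspace"
  assumes subsp: "subspace (hcarrier E)"
    and ip_commute: "\<And>x y. x \<in> hcarrier E \<Longrightarrow> y \<in> hcarrier E \<Longrightarrow> hinner E x y = hinner E y x"
    and ip_add: "\<And>x y z. x \<in> hcarrier E \<Longrightarrow> y \<in> hcarrier E \<Longrightarrow> z \<in> hcarrier E \<Longrightarrow>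
        hinner E (x + y) z = hinner E x z + hinner E y z"
    and ip_scale: "\<And>c x y. x \<in> hcarrier E \<Longrightarrow> y \<in> hcarrier E \<Longrightarrow>
        hinner E (c *\<^sub>R x) y = c * hinner E x y"
    and ip_pos: "\<And>x. x \<in> hcarrier E \<Longrightarrow> x \<noteq> 0 \<Longrightarrow> 0 < hinner E x x"
begin

lemma zero_mem [simp]: "0 \<in> hcarrier E"
  using subsp by (simp add: subspace_0)

lemma add_mem [simp]: "x \<in> hcarrier E \<Longrightarrow> y \<in> hcarrier E \<Longrightarrow> x + y \<in> hcarrier E"
  using subsp by (simp add: subspace_add)

lemma diff_mem [simp]: "x \<in> hcarrier E \<Longrightarrow> y \<in> hcarrier E \<Longrightarrow> x - y \<in> hcarrier E"
  using subsp by (simp add: subspace_diff)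

lemma scale_mem [simp]: "x \<in> hcarrier E \<Longrightarrow> c *\<^sub>R x \<in> hcarrier E"
  using subsp by (simp add: subspace_scale)

lemma uminus_mem [simp]: "x \<in> hcarrier E \<Longrightarrow> - x \<in> hcarrier E"
  using subsp by (simp add: subspace_neg)

lemma ip_zero [simp]: "x \<in> hcarrier E \<Longrightarrow> hinner E 0 x = 0"
  using ip_scale[of 0 x 0] by simp

lemma ip_self_nonneg: "x \<in> hcarrier E \<Longrightarrow> 0 \<le> hinner E x x"
  by (cases "x = 0") (auto simp: ip_pos less_imp_le)

lemma hnorm_nonneg [simp]: "x \<in> hcarrier E \<Longrightarrow> 0 \<le> hnorm E x"
  by (simp add: hnorm_def ip_self_nonneg)

lemma hnorm_power2: "x \<in> hcarrier E \<Longrightarrow> (hnorm E x)\<^sup>2 = hinner E x x"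
  by (simp add: hnorm_def ip_self_nonneg)

lemma hnorm_0 [simp]: "hnorm E 0 = 0"
  by (simp add: hnorm_def)

lemma hnorm_eq_0: "x \<in> hcarrier E \<Longrightarrow> hnorm E x = 0 \<longleftrightarrow> x = 0"
  by (metis hnorm_def ip_pos hnorm_0 real_sqrt_eq_0_iff less_irrefl)

lemma ip_scale_right: "x \<in> hcarrier E \<Longrightarrow> y \<in> hcarrier E \<Longrightarrow> hinner E x (c *\<^sub>R y) = c * hinner E x y"
  by (metis ip_commute ip_scale scale_mem)

lemma ip_add_right: "x \<in> hcarrier E \<Longrightarrow> y \<in> hcarrier E \<Longrightarrow> z \<in> hcarrier E \<Longrightarrow>
    hinner E x (y + z) = hinner E x y + hinner E x z"
  by (metis ip_commute ip_add add_mem)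

lemma hnorm_scale: "x \<in> hcarrier E \<Longrightarrow> hnorm E (c *\<^sub>R x) = \<bar>c\<bar> * hnorm E x"
  by (simp add: hnorm_def ip_scale ip_scale_right real_sqrt_mult flip: mult.assoc power2_eq_square)

lemma hnorm_minus: "x \<in> hcarrier E \<Longrightarrow> hnorm E (- x) = hnorm E x"
  using hnorm_scale[of x "-1"] by simp

lemma hnorm_diff_commute: "x \<in> hcarrier E \<Longrightarrow> y \<in> hcarrier E \<Longrightarrow> hnorm E (x - y) = hnorm E (y - x)"
  using hnorm_minus[of "x - y"] by simp

text \<open>With a and b the norms of x and y, the square of b x - a y is nonnegative and equals 2 a
  b times the difference of the two sides.\<close>

lemma ip_le_hnorm:
  assumes x: "x \<in> hcarrier E" and y: "y \<in> hcarrier E"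
  shows "hinner E x y \<le> hnorm E x * hnorm E y"
proof (cases "x = 0 \<or> y = 0")
  case True
  then show ?thesis using x y ip_commute[of x y] by auto
next
  case False
  define a b where "a = hnorm E x" and "b = hnorm E y"
  have ab: "a > 0" "b > 0"
    using False x y hnorm_eq_0 hnorm_nonneg unfolding a_def b_def by (metis less_eq_real_def)+
  have "0 \<le> hinner E (b *\<^sub>R x + (-a) *\<^sub>R y) (b *\<^sub>R x + (-a) *\<^sub>R y)"
    using x y by (intro ip_self_nonneg) simp
  also have "\<dots> = b*b*hinner E x x - 2*a*b*hinner E x y + a*a*hinner E y y"
    using x y by (simp only: ip_add ip_add_right ip_scale ip_scale_right scale_mem add_mem ip_commute[of y x])
      (simp add: algebra_simps)
  also have "\<dots> = 2*a*b*(a*b - hinner E x y)"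
    using hnorm_power2[OF x] hnorm_power2[OF y]
    by (simp add: a_def[symmetric] b_def[symmetric] algebra_simps power2_eq_square flip: a_def b_def)
  finally have "0 \<le> a*b - hinner E x y"
    using ab mult_pos_pos[OF ab] by (auto simp: zero_le_mult_iff)
  then show ?thesis by (simp add: a_def b_def)
qed

lemma hnorm_triangle:
  assumes x: "x \<in> hcarrier E" and y: "y \<in> hcarrier E"
  shows "hnorm E (x + y) \<le> hnorm E x + hnorm E y"
proof (rule power2_le_imp_le)
  have "(hnorm E (x + y))\<^sup>2 = hinner E x x + 2 * hinner E x y + hinner E y y"
    using x y by (simp add: hnorm_power2 ip_add ip_add_right ip_commute[of y x])
  also have "\<dots> \<le> (hnorm E x + hnorm E y)\<^sup>2"
    using ip_le_hnorm[OF x y] hnorm_power2[OF x] hnorm_power2[OF y] by (simp add: power2_sum)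
  finally show "(hnorm E (x + y))\<^sup>2 \<le> (hnorm E x + hnorm E y)\<^sup>2" .
qed (use x y in simp)

lemma hnorm_triangle_diff:
  assumes "x \<in> hcarrier E" "y \<in> hcarrier E"
  shows "hnorm E (x - y) \<le> hnorm E x + hnorm E y"
  using hnorm_triangle[of x "-y"] assms by (simp add: hnorm_minus)

lemma hnorm_triangle_via:
  assumes "x \<in> hcarrier E" "y \<in> hcarrier E" "z \<in> hcarrier E"
  shows "hnorm E (x - z) \<le> hnorm E (x - y) + hnorm E (y - z)"
  using hnorm_triangle[of "x - y" "y - z"] assms by simp

sublocale M: Metric_space "hcarrier E" "hdist E"
proof
  show "0 \<le> hdist E x y" for x y by (simp add: hdist_def)
  show "hdist E x y = hdist E y x" for x y by (simp add: hdist_def hnorm_diff_commute)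
  show "hdist E x y = 0 \<longleftrightarrow> x = y" if "x \<in> hcarrier E" "y \<in> hcarrier E" for x y
    using that by (simp add: hdist_def hnorm_eq_0)
  show "hdist E x z \<le> hdist E x y + hdist E y z"
    if "x \<in> hcarrier E" "y \<in> hcarrier E" "z \<in> hcarrier E" for x y z
    using that by (simp add: hdist_def hnorm_triangle_via)
qed

lemma topspace_htopology [simp]: "topspace (htopology E) = hcarrier E"
  by (simp add: htopology_def)

lemma openin_htopology:
  "openin (htopology E) U \<longleftrightarrow>
     U \<subseteq> hcarrier E \<and> (\<forall>x\<in>U. \<exists>r>0. \<forall>y\<in>hcarrier E. hnorm E (y - x) < r \<longrightarrow> y \<in> U)"
proof -
  have "M.mball x r \<subseteq> U \<longleftrightarrow> (\<forall>y\<in>hcarrier E. hnorm E (y - x) < r \<longrightarrow> y \<in> U)"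
    if "x \<in> hcarrier E" for x r
    using that by (auto simp: subset_iff M.in_mball hdist_def hnorm_diff_commute[of x])
  then show ?thesis
    unfolding htopology_def M.openin_mtopology by (meson subsetD)
qed

lemma closedin_htopologyI:
  assumes "A \<subseteq> hcarrier E"
    and "\<And>x. x \<in> hcarrier E \<Longrightarrow> (\<And>e. e > 0 \<Longrightarrow> \<exists>y\<in>A. hnorm E (y - x) < e) \<Longrightarrow> x \<in> A"
  shows "closedin (htopology E) A"
  unfolding closedin_def openin_htopology
proof (intro conjI ballI)
  fix x assume x: "x \<in> topspace (htopology E) - A"
  then obtain e where "e > 0" "\<And>y. y \<in> A \<Longrightarrow> \<not> hnorm E (y - x) < e"
    using assms(2)[of x] by auto
  then show "\<exists>r>0. \<forall>y\<in>hcarrier E. hnorm E (y - x) < r \<longrightarrow> y \<in> topspace (htopology E) - A"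
    by (intro exI[of _ e]) auto
qed (use assms(1) in auto)

text \<open>Moves completeness from \<open>hdist\<close>, which is cut off outside the carrier, to
  \<open>hnorm\<close>, in which all later Cauchy estimates are written.\<close>

lemma mcomplete_iff_seq:
  "M.mcomplete \<longleftrightarrow>
     (\<forall>\<sigma>. (\<forall>n. \<sigma> n \<in> hcarrier E) \<longrightarrow>
        (\<forall>e>0. \<exists>n0. \<forall>m\<ge>n0. \<forall>n\<ge>n0. hnorm E (\<sigma> m - \<sigma> n) < e) \<longrightarrow>
        (\<exists>x\<in>hcarrier E. (\<lambda>n. hnorm E (\<sigma> n - x)) \<longlonglongrightarrow> 0))"
proof -
  have 1: "M.MCauchy \<sigma> \<longleftrightarrow> (\<forall>n. \<sigma> n \<in> hcarrier E) \<and>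
        (\<forall>e>0. \<exists>n0. \<forall>m\<ge>n0. \<forall>n\<ge>n0. hnorm E (\<sigma> m - \<sigma> n) < e)" for \<sigma>
  proof (cases "\<forall>n. \<sigma> n \<in> hcarrier E")
    case True
    then have "hdist E (\<sigma> m) (\<sigma> n) = hnorm E (\<sigma> m - \<sigma> n)" for m n
      by (simp add: hdist_def)
    then show ?thesis using True unfolding M.MCauchy_def image_subset_iff by simp
  qed (auto simp: M.MCauchy_def image_subset_iff)
  have 2: "limitin M.mtopology \<sigma> x sequentially \<longleftrightarrow>
        x \<in> hcarrier E \<and> (\<lambda>n. hnorm E (\<sigma> n - x)) \<longlonglongrightarrow> 0" if "\<forall>n. \<sigma> n \<in> hcarrier E" for \<sigma> x
  proof (cases "x \<in> hcarrier E")
    case True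
    then have "hdist E (\<sigma> n) x = hnorm E (\<sigma> n - x)" for n
      using that by (simp add: hdist_def)
    then show ?thesis using that True unfolding M.limitin_metric_dist_null
      by (simp add: eventually_sequentially)
  qed (auto simp: M.limitin_metric_dist_null)
  show ?thesis
  proof (intro iffI allI impI)
    fix \<sigma> :: "nat \<Rightarrow> 'a"
    assume c: M.mcomplete and s: "\<forall>n. \<sigma> n \<in> hcarrier E"
      "\<forall>e>0. \<exists>n0. \<forall>m\<ge>n0. \<forall>n\<ge>n0. hnorm E (\<sigma> m - \<sigma> n) < e"
    then have "M.MCauchy \<sigma>" using 1 by blast
    then show "\<exists>x\<in>hcarrier E. (\<lambda>n. hnorm E (\<sigma> n - x)) \<longlonglongrightarrow> 0"
      using c 2[OF s(1)] unfolding M.mcomplete_def by blast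
  next
    assume r: "\<forall>\<sigma>. (\<forall>n. \<sigma> n \<in> hcarrier E) \<longrightarrow>
        (\<forall>e>0. \<exists>n0. \<forall>m\<ge>n0. \<forall>n\<ge>n0. hnorm E (\<sigma> m - \<sigma> n) < e) \<longrightarrow>
        (\<exists>x\<in>hcarrier E. (\<lambda>n. hnorm E (\<sigma> n - x)) \<longlonglongrightarrow> 0)"
    show M.mcomplete
      unfolding M.mcomplete_def
    proof (intro allI impI)
      fix \<sigma> :: "nat \<Rightarrow> 'a" assume "M.MCauchy \<sigma>"
      then have s: "\<forall>n. \<sigma> n \<in> hcarrier E" "\<forall>e>0. \<exists>n0. \<forall>m\<ge>n0. \<forall>n\<ge>n0. hnorm E (\<sigma> m - \<sigma> n) < e"
        using 1 by blast+
      then obtain x where "x \<in> hcarrier E" "(\<lambda>n. hnorm E (\<sigma> n - x)) \<longlonglongrightarrow> 0" using r by blast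
      then show "\<exists>x. limitin M.mtopology \<sigma> x sequentially" using 2[OF s(1)] by blast
    qed
  qed
qed

lemma continuous_map_into_htopologyI:
  assumes E': "pre_hilbert E'" and U: "U \<subseteq> hcarrier E"
    and f: "\<And>x. x \<in> U \<Longrightarrow> f x \<in> hcarrier E'"
    and c: "\<And>x e. x \<in> U \<Longrightarrow> 0 < e \<Longrightarrow>
      \<exists>d>0. \<forall>y\<in>U. hnorm E (y - x) < d \<longrightarrow> hnorm E' (f y - f x) < e"
  shows "continuous_map (subtopology (htopology E) U) (htopology E') f"
proof -
  interpret E': pre_hilbert E' by fact
  show ?thesis
    unfolding continuous_map
  proof (intro conjI allI impI)
    show "f ` topspace (subtopology (htopology E) U) \<subseteq> topspace (htopology E')"
      using f by auto
    fix W assume W: "openin (htopology E') W"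
    \<comment> \<open>\<open>U\<close> need not be open, so the preimage is exhibited as the trace
      on \<open>U\<close> of a union of open balls.\<close>
    define O' where "O' = {x \<in> hcarrier E. \<exists>x0\<in>U. \<exists>d>0. hnorm E (x - x0) < d \<and>
         (\<forall>y\<in>U. hnorm E (y - x0) < d \<longrightarrow> f y \<in> W)}"
    have "openin (htopology E) O'"
      unfolding openin_htopology
    proof (intro conjI ballI)
      fix x assume "x \<in> O'"
      then obtain x0 d where x: "x \<in> hcarrier E" "x0 \<in> U" "d > 0" "hnorm E (x - x0) < d"
        "\<forall>y\<in>U. hnorm E (y - x0) < d \<longrightarrow> f y \<in> W" unfolding O'_def by blast
      show "\<exists>r>0. \<forall>y\<in>hcarrier E. hnorm E (y - x) < r \<longrightarrow> y \<in> O'"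
      proof (intro exI[of _ "d - hnorm E (x - x0)"] conjI ballI impI)
        fix y assume y: "y \<in> hcarrier E" "hnorm E (y - x) < d - hnorm E (x - x0)"
        then have "hnorm E (y - x0) < d"
          using hnorm_triangle_via[of y x x0] x U by auto
        then show "y \<in> O'" unfolding O'_def using x y by blast
      qed (use x in simp)
    qed (auto simp: O'_def)
    moreover have "{x \<in> topspace (subtopology (htopology E) U). f x \<in> W} = O' \<inter> U"
    proof (intro equalityI subsetI)
      fix x assume "x \<in> {x \<in> topspace (subtopology (htopology E) U). f x \<in> W}"
      then have x: "x \<in> U" "x \<in> hcarrier E" "f x \<in> W" by auto
      obtain r where r: "r > 0" "\<forall>y\<in>hcarrier E'. hnorm E' (y - f x) < r \<longrightarrow> y \<in> W"
        using W x unfolding E'.openin_htopology by blast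
      obtain d where "d > 0" "\<forall>y\<in>U. hnorm E (y - x) < d \<longrightarrow> hnorm E' (f y - f x) < r"
        using c x r by blast
      then have "\<exists>x0\<in>U. \<exists>d>0. hnorm E (x - x0) < d \<and>
         (\<forall>y\<in>U. hnorm E (y - x0) < d \<longrightarrow> f y \<in> W)"
        using r f x by (intro bexI[of _ x] exI[of _ d]) auto
      then show "x \<in> O' \<inter> U" using x unfolding O'_def by blast
    qed (use U in \<open>auto simp: O'_def\<close>)
    ultimately show "openin (subtopology (htopology E) U)
        {x \<in> topspace (subtopology (htopology E) U). f x \<in> W}"
      by (auto simp: openin_subtopology)
  qed
qed

lemma Hausdorff_htopology: "Hausdorff_space (htopology E)"
  unfolding htopology_def by (rule M.Hausdorff_space_mtopology)

lemma hilbert_space_iff: "hilbert_space E \<longleftrightarrow> M.mcomplete"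
  unfolding hilbert_space_def
  using subsp ip_commute ip_add ip_scale ip_pos by blast

lemma pre_hilbert_restrict:
  assumes "subspace F" "F \<subseteq> hcarrier E"
  shows "pre_hilbert (E\<lparr>hcarrier := F\<rparr>)"
  using assms by unfold_locales (auto simp: ip_add ip_scale ip_pos subset_iff intro: ip_commute)

lemma hnorm_restrict [simp]: "hnorm (E\<lparr>hcarrier := F\<rparr>) = hnorm E"
  by (auto simp: hnorm_def)

lemma openin_restrict:
  assumes F: "subspace F" "F \<subseteq> hcarrier E" and U: "openin (htopology E) U"
  shows "openin (htopology (E\<lparr>hcarrier := F\<rparr>)) (U \<inter> F)"
proof -
  interpret F: pre_hilbert "E\<lparr>hcarrier := F\<rparr>" using F by (rule pre_hilbert_restrict)
  show ?thesis
    unfolding F.openin_htopology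
  proof (intro conjI ballI)
    fix x assume "x \<in> U \<inter> F"
    then obtain r where "r > 0" "\<And>y. y \<in> hcarrier E \<Longrightarrow> hnorm E (y - x) < r \<Longrightarrow> y \<in> U"
      using U unfolding openin_htopology by blast
    then show "\<exists>r>0. \<forall>y\<in>hcarrier (E\<lparr>hcarrier := F\<rparr>). hnorm (E\<lparr>hcarrier := F\<rparr>) (y - x) < r \<longrightarrow> y \<in> U \<inter> F"
      using F(2) by (intro exI[of _ r]) auto
  qed auto
qed

lemma htopology_restrict:
  assumes F: "subspace F" "F \<subseteq> hcarrier E"
  shows "htopology (E\<lparr>hcarrier := F\<rparr>) = subtopology (htopology E) F"
proof -
  interpret F: pre_hilbert "E\<lparr>hcarrier := F\<rparr>" using F by (rule pre_hilbert_restrict)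
  interpret S: Submetric "hcarrier E" "hdist E" F
    using F(2) by unfold_locales
  have "Metric_space F (hdist (E\<lparr>hcarrier := F\<rparr>))"
    using F.M.Metric_space_axioms by simp
  then interpret FM: Metric_space F "hdist (E\<lparr>hcarrier := F\<rparr>)" .
  \<comment> \<open>The two metrics differ outside \<open>F\<close>, where \<open>hdist\<close> of
    the restricted space is 0, so the topologies are compared through their balls.\<close>
  have "FM.mball x r = S.sub.mball x r" for x r
    using F(2) unfolding set_eq_iff FM.in_mball S.sub.in_mball
    by (auto simp: hdist_def subset_iff split: if_splits)
  then have "FM.mtopology = S.sub.mtopology"
    by (simp add: topology_eq FM.openin_mtopology S.sub.openin_mtopology)
  then show ?thesis by (simp add: htopology_def S.mtopology_submetric)
qed

lemma hilbert_space_restrict: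
  assumes F: "subspace F" "closedin (htopology E) F" and c: "hilbert_space E"
  shows "hilbert_space (E\<lparr>hcarrier := F\<rparr>)"
proof -
  have FE: "F \<subseteq> hcarrier E" using F(2) closedin_subset by fastforce
  interpret F: pre_hilbert "E\<lparr>hcarrier := F\<rparr>" using F(1) FE by (rule pre_hilbert_restrict)
  show ?thesis
    unfolding F.hilbert_space_iff F.mcomplete_iff_seq
  proof (intro allI impI)
    fix \<sigma> :: "nat \<Rightarrow> 'a" assume s: "\<forall>n. \<sigma> n \<in> hcarrier (E\<lparr>hcarrier := F\<rparr>)"
      and "\<forall>e>0. \<exists>n0. \<forall>m\<ge>n0. \<forall>n\<ge>n0. hnorm (E\<lparr>hcarrier := F\<rparr>) (\<sigma> m - \<sigma> n) < e"
    then obtain x where x: "x \<in> hcarrier E" "(\<lambda>n. hnorm E (\<sigma> n - x)) \<longlonglongrightarrow> 0"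
    proof -
      have "\<forall>n. \<sigma> n \<in> hcarrier E" using s FE by auto
      with \<open>\<forall>e>0. _\<close> c show ?thesis
        unfolding hilbert_space_iff mcomplete_iff_seq using that by (metis hnorm_restrict)
    qed
    have "x \<in> F"
    proof (rule ccontr)
      assume "x \<notin> F"
      then have "x \<in> hcarrier E - F" using x by simp
      then obtain r where r: "r > 0" "\<forall>y\<in>hcarrier E. hnorm E (y - x) < r \<longrightarrow> y \<notin> F"
        using F(2) unfolding closedin_def openin_htopology topspace_htopology by blast
      obtain n where "hnorm E (\<sigma> n - x) < r"
        using order_tendstoD(2)[OF x(2) r(1)] by (auto simp: eventually_sequentially)
      then show False using r s FE by auto
    qed
    then show "\<exists>x\<in>hcarrier (E\<lparr>hcarrier := F\<rparr>). (\<lambda>n. hnorm (E\<lparr>hcarrier := F\<rparr>) (\<sigma> n - x)) \<longlonglongrightarrow> 0"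
      using x by auto
  qed
qed

end

lemma hilbert_space_imp_pre_hilbert: "hilbert_space E \<Longrightarrow> pre_hilbert E"
  unfolding hilbert_space_def by (elim conjE, rule pre_hilbert.intro) simp_all

section \<open>Bounded multilinear maps and families of derivatives\<close>

lemma bounded_multilinear_mem:
  "bounded_multilinear E F k T \<Longrightarrow> length vs = k \<Longrightarrow> set vs \<subseteq> hcarrier E \<Longrightarrow> T vs \<in> hcarrier F"
  unfolding bounded_multilinear_def by blast

lemma bounded_multilinear_linear:
  assumes "bounded_multilinear E F k T" "x \<in> hcarrier E" "y \<in> hcarrier E"
    "length vs = k" "set vs \<subseteq> hcarrier E" "i < k"
  shows "T (vs[i := c *\<^sub>R x + y]) = c *\<^sub>R T (vs[i := x]) + T (vs[i := y])"
proof -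
  have "\<forall>vs i c. \<forall>x\<in>hcarrier E. \<forall>y\<in>hcarrier E.
        length vs = k \<and> set vs \<subseteq> hcarrier E \<and> i < k \<longrightarrow>
        T (vs[i := c *\<^sub>R x + y]) = c *\<^sub>R T (vs[i := x]) + T (vs[i := y])"
    using assms(1) unfolding bounded_multilinear_def by (elim conjE)
  then show ?thesis using assms(2-) by (elim allE ballE impE) blast+
qed

lemma bounded_multilinear_bound:
  assumes "bounded_multilinear E F k T"
  obtains C where "\<And>vs. length vs = k \<Longrightarrow> set vs \<subseteq> hcarrier E \<Longrightarrow>
      hnorm F (T vs) \<le> C * prod_list (map (hnorm E) vs)"
proof -
  from assms obtain C where "\<forall>vs. length vs = k \<and> set vs \<subseteq> hcarrier E \<longrightarrow>
      hnorm F (T vs) \<le> C * prod_list (map (hnorm E) vs)"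
    unfolding bounded_multilinear_def by (elim conjE exE)
  then show ?thesis using that[of C] by simp
qed

text \<open>The body of the existential in \<open>hsmooth_on\<close>, so that a family of
  derivatives can be named and transferred to another domain or map.\<close>

definition hderivs ::
    "'a::real_vector hspace \<Rightarrow> 'b::real_vector hspace \<Rightarrow> 'a set \<Rightarrow> ('a \<Rightarrow> 'b) \<Rightarrow>
      (nat \<Rightarrow> 'a \<Rightarrow> 'a list \<Rightarrow> 'b) \<Rightarrow> bool" where
  "hderivs E F U f D \<longleftrightarrow>
        (\<forall>x\<in>U. D 0 x [] = f x) \<and>
        (\<forall>k. \<forall>x\<in>U. bounded_multilinear E F k (D k x)) \<and>
        (\<forall>k. \<forall>x\<in>U. \<forall>\<epsilon>>0. \<exists>\<delta>>0. \<forall>y\<in>U. hnorm E (y - x) < \<delta> \<longrightarrow>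
           (\<forall>vs. length vs = k \<and> set vs \<subseteq> hcarrier E \<longrightarrow>
              hnorm F (D k y vs - D k x vs - D (Suc k) x ((y - x) # vs))
                \<le> \<epsilon> * hnorm E (y - x) * prod_list (map (hnorm E) vs)))"

lemma hsmooth_on_iff: "hsmooth_on E F U f \<longleftrightarrow> openin (htopology E) U \<and> (\<exists>D. hderivs E F U f D)"
  unfolding hsmooth_on_def hderivs_def ..

lemma hderivsD:
  assumes "hderivs E F U f D"
  shows "x \<in> U \<Longrightarrow> D 0 x [] = f x"
    "x \<in> U \<Longrightarrow> bounded_multilinear E F k (D k x)"
    "x \<in> U \<Longrightarrow> 0 < e \<Longrightarrow> \<exists>d>0. \<forall>y\<in>U. hnorm E (y - x) < d \<longrightarrow>
           (\<forall>vs. length vs = k \<and> set vs \<subseteq> hcarrier E \<longrightarrow>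
              hnorm F (D k y vs - D k x vs - D (Suc k) x ((y - x) # vs))
                \<le> e * hnorm E (y - x) * prod_list (map (hnorm E) vs))"
  using assms unfolding hderivs_def by blast+

text \<open>The remainder estimate of order 0 with \<epsilon> = 1 and the boundedness of
  \<open>D 1 x\<close> give a Lipschitz bound at x; in \<open>C'\<close> the summand 1 stands for
  the remainder and |C| for the linear part.\<close>

lemma hsmooth_on_imp_cont:
  assumes E: "pre_hilbert E" and F: "pre_hilbert F" and f: "hsmooth_on E F U f"
  shows "U \<subseteq> hcarrier E" "x \<in> U \<Longrightarrow> f x \<in> hcarrier F"
    and "x \<in> U \<Longrightarrow> 0 < e \<Longrightarrow> \<exists>d>0. \<forall>y\<in>U. hnorm E (y - x) < d \<longrightarrow> hnorm F (f y - f x) < e"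
proof -
  interpret E: pre_hilbert E by fact
  interpret F: pre_hilbert F by fact
  obtain D where U: "openin (htopology E) U" and D: "hderivs E F U f D"
    using f unfolding hsmooth_on_iff by blast
  note D = hderivsD[OF D]
  show UE: "U \<subseteq> hcarrier E" using U unfolding E.openin_htopology by blast
  show fF: "f x \<in> hcarrier F" if "x \<in> U" for x
    using D(1)[OF that] bounded_multilinear_mem[OF D(2)[OF that, of 0], of "[]"] by simp
  assume x: "x \<in> U" and e: "0 < e"
  obtain d where d: "d > 0" "\<And>y. y \<in> U \<Longrightarrow> hnorm E (y - x) < d \<Longrightarrow>
      hnorm F (f y - f x - D 1 x [y - x]) \<le> 1 * hnorm E (y - x)"
  proof -
    obtain d where d: "d > 0" "\<forall>y\<in>U. hnorm E (y - x) < d \<longrightarrow> (\<forall>vs. length vs = 0 \<and> set vs \<subseteq> hcarrier E \<longrightarrow>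
        hnorm F (D 0 y vs - D 0 x vs - D (Suc 0) x ((y - x) # vs))
          \<le> 1 * hnorm E (y - x) * prod_list (map (hnorm E) vs))"
      using D(3)[OF x zero_less_one, of 0] by blast
    show ?thesis
    proof (rule that[OF d(1)])
      fix y assume y: "y \<in> U" "hnorm E (y - x) < d"
      show "hnorm F (f y - f x - D 1 x [y - x]) \<le> 1 * hnorm E (y - x)"
        using d(2)[rule_format, OF y, of "[]"] D(1)[OF y(1)] D(1)[OF x] by simp
    qed
  qed
  have bm: "bounded_multilinear E F 1 (D 1 x)" using D(2) x by blast
  obtain C where C: "\<And>v. v \<in> hcarrier E \<Longrightarrow> hnorm F (D 1 x [v]) \<le> C * hnorm E v"
  proof -
    obtain C where C: "\<And>vs. length vs = 1 \<Longrightarrow> set vs \<subseteq> hcarrier E \<Longrightarrow>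
        hnorm F (D 1 x vs) \<le> C * prod_list (map (hnorm E) vs)"
      using bounded_multilinear_bound[OF bm] by blast
    show ?thesis
      by (rule that[of C]) (use C[of "[v]" for v] in simp)
  qed
  have Dm: "D 1 x [v] \<in> hcarrier F" if "v \<in> hcarrier E" for v
    using bounded_multilinear_mem[OF bm] that by simp
  define C' where "C' = \<bar>C\<bar> + 1"
  have C': "C' > 0" by (simp add: C'_def)
  show "\<exists>d>0. \<forall>y\<in>U. hnorm E (y - x) < d \<longrightarrow> hnorm F (f y - f x) < e"
  proof (intro exI[of _ "min d (e / C')"] conjI ballI impI)
    show "0 < min d (e / C')" using d e C' by simp
    fix y assume y: "y \<in> U" "hnorm E (y - x) < min d (e / C')"
    have mem: "y - x \<in> hcarrier E" using UE x y by (intro E.diff_mem) auto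
    have "hnorm F (f y - f x) \<le> hnorm F (f y - f x - D 1 x [y - x]) + hnorm F (D 1 x [y - x])"
      using F.hnorm_triangle[of "f y - f x - D 1 x [y - x]" "D 1 x [y - x]"] fF x y Dm mem by simp
    also have "\<dots> \<le> 1 * hnorm E (y - x) + C * hnorm E (y - x)"
      using d(2)[of y] C[OF mem] y by (intro add_mono) auto
    also have "\<dots> \<le> C' * hnorm E (y - x)"
      using E.hnorm_nonneg[OF mem] mult_right_mono[of C "\<bar>C\<bar>" "hnorm E (y - x)"] by (simp add: C'_def algebra_simps)
    also have "\<dots> < e" using y C' by (simp add: field_simps)
    finally show "hnorm F (f y - f x) < e" .
  qed
qed

lemma hsmooth_on_imp_continuous_map:
  assumes "pre_hilbert E" "pre_hilbert F" "hsmooth_on E F U f"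
  shows "continuous_map (subtopology (htopology E) U) (htopology F) f"
  by (intro pre_hilbert.continuous_map_into_htopologyI[OF assms(1,2)] hsmooth_on_imp_cont[OF assms])

lemma hsmooth_on_cong:
  assumes "hsmooth_on E F U f" "\<And>x. x \<in> U \<Longrightarrow> f x = g x"
  shows "hsmooth_on E F U g"
proof -
  have "hderivs E F U f D = hderivs E F U g D" for D
    using assms(2) by (auto simp: hderivs_def)
  then show ?thesis using assms(1) unfolding hsmooth_on_iff by blast
qed

text \<open>Composing all derivatives with a bounded projection onto \<open>F\<close> keeps them inside \<open>F\<close>.\<close>

lemma hsmooth_on_restrict:
  assumes E: "pre_hilbert E" and F: "subspace F" "F \<subseteq> hcarrier E"
    and f: "hsmooth_on E E U f" and fF: "\<And>x. x \<in> U \<inter> F \<Longrightarrow> f x \<in> F"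
    and P: "\<And>x. x \<in> hcarrier E \<Longrightarrow> P x \<in> F" "\<And>x. x \<in> F \<Longrightarrow> P x = x"
      "\<And>x y. x \<in> hcarrier E \<Longrightarrow> y \<in> hcarrier E \<Longrightarrow> P (x + y) = P x + P y"
      "\<And>c x. x \<in> hcarrier E \<Longrightarrow> P (c *\<^sub>R x) = c *\<^sub>R P x"
      "\<And>x. x \<in> hcarrier E \<Longrightarrow> hnorm E (P x) \<le> hnorm E x"
  shows "hsmooth_on (E\<lparr>hcarrier := F\<rparr>) (E\<lparr>hcarrier := F\<rparr>) (U \<inter> F) f"
proof -
  interpret E: pre_hilbert E by fact
  obtain D where U: "openin (htopology E) U" and D: "hderivs E E U f D"
    using f unfolding hsmooth_on_iff by blast
  note D = hderivsD[OF D]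
  have UE: "U \<subseteq> hcarrier E" using U unfolding E.openin_htopology by blast
  have cE: "hcarrier (E\<lparr>hcarrier := F\<rparr>) = F" by simp
  have Dm: "D k x vs \<in> hcarrier E" if "x \<in> U" "length vs = k" "set vs \<subseteq> hcarrier E" for k x vs
    using bounded_multilinear_mem[OF D(2)[OF that(1)] that(2,3)] .
  have Pd: "P (x - y) = P x - P y" if "x \<in> hcarrier E" "y \<in> hcarrier E" for x y
    using P(3)[of x "- y"] P(4)[of y "-1"] that by simp
  show ?thesis
    unfolding hsmooth_on_iff hderivs_def
  proof (intro conjI exI[of _ "\<lambda>k x vs. P (D k x vs)"] ballI allI impI)
    show "openin (htopology (E\<lparr>hcarrier := F\<rparr>)) (U \<inter> F)"
      using F U by (intro E.openin_restrict)
    show "P (D 0 x []) = f x" if "x \<in> U \<inter> F" for x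
      using that D(1)[of x] fF P(2) by auto
  next
    fix k x assume x: "x \<in> U \<inter> F"
    obtain C where C: "\<And>vs. length vs = k \<Longrightarrow> set vs \<subseteq> hcarrier E \<Longrightarrow>
        hnorm E (D k x vs) \<le> C * prod_list (map (hnorm E) vs)"
      using bounded_multilinear_bound[OF D(2)[of x k]] x by blast
    have lin: "D k x (vs[i := c *\<^sub>R v + w]) = c *\<^sub>R D k x (vs[i := v]) + D k x (vs[i := w])"
      if "v \<in> hcarrier E" "w \<in> hcarrier E" "length vs = k" "set vs \<subseteq> hcarrier E" "i < k" for vs i c v w
      using bounded_multilinear_linear[OF D(2)[of x k]] x that by blast
    show "bounded_multilinear (E\<lparr>hcarrier := F\<rparr>) (E\<lparr>hcarrier := F\<rparr>) k (\<lambda>vs. P (D k x vs))"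
      unfolding bounded_multilinear_def
      unfolding E.hnorm_restrict cE
    proof (intro conjI allI ballI impI exI[of _ C])
      show "P (D k x vs) \<in> F" if "length vs = k \<and> set vs \<subseteq> F" for vs
        using that F x by (intro P(1) Dm) auto
      show "hnorm E (P (D k x vs)) \<le> C * prod_list (map (hnorm E) vs)" if "length vs = k \<and> set vs \<subseteq> F" for vs
      proof -
        have "set vs \<subseteq> hcarrier E" using that F by auto
        then show ?thesis using that x Dm[of x vs k] P(5)[of "D k x vs"] C[of vs] by simp
      qed
      fix vs i c v w assume a: "v \<in> F" "w \<in> F" "length vs = k \<and> set vs \<subseteq> F \<and> i < k"
      have sub: "set (vs[i := z]) \<subseteq> hcarrier E" if "z \<in> F" for z
        using a that F(2) by (meson order_trans insert_subset set_update_subset_insert subsetD subsetI)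
      have m: "D k x (vs[i := v]) \<in> hcarrier E" "D k x (vs[i := w]) \<in> hcarrier E"
        using a x sub by (intro Dm; simp)+
      have "D k x (vs[i := c *\<^sub>R v + w]) = c *\<^sub>R D k x (vs[i := v]) + D k x (vs[i := w])"
        using a F(2) by (intro lin) auto
      then show "P (D k x (vs[i := c *\<^sub>R v + w])) = c *\<^sub>R P (D k x (vs[i := v])) + P (D k x (vs[i := w]))"
        using m by (simp add: P)
    qed
  next
    fix k x and e :: real assume x: "x \<in> U \<inter> F" and e: "0 < e"
    obtain d where d: "d > 0" "\<And>y vs. y \<in> U \<Longrightarrow> hnorm E (y - x) < d \<Longrightarrow> length vs = k \<Longrightarrow> set vs \<subseteq> hcarrier E \<Longrightarrow>
              hnorm E (D k y vs - D k x vs - D (Suc k) x ((y - x) # vs))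
                \<le> e * hnorm E (y - x) * prod_list (map (hnorm E) vs)"
    proof -
      have "x \<in> U" using x by simp
      from D(3)[OF this e, of k] show ?thesis using that by blast
    qed
    show "\<exists>d>0. \<forall>y\<in>U \<inter> F. hnorm (E\<lparr>hcarrier := F\<rparr>) (y - x) < d \<longrightarrow>
             (\<forall>vs. length vs = k \<and> set vs \<subseteq> hcarrier (E\<lparr>hcarrier := F\<rparr>) \<longrightarrow>
                hnorm (E\<lparr>hcarrier := F\<rparr>) (P (D k y vs) - P (D k x vs) - P (D (Suc k) x ((y - x) # vs)))
                \<le> e * hnorm (E\<lparr>hcarrier := F\<rparr>) (y - x) * prod_list (map (hnorm (E\<lparr>hcarrier := F\<rparr>)) vs))"
      unfolding E.hnorm_restrict
    proof (intro exI[of _ d] conjI ballI allI impI)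
      fix y vs assume y: "y \<in> U \<inter> F" "hnorm E (y - x) < d"
        and vs: "length vs = k \<and> set vs \<subseteq> hcarrier (E\<lparr>hcarrier := F\<rparr>)"
      then have vs': "set vs \<subseteq> hcarrier E" using F by auto
      have m: "D k y vs \<in> hcarrier E" "D k x vs \<in> hcarrier E" "D (Suc k) x ((y - x) # vs) \<in> hcarrier E"
        using x y vs vs' UE by (intro Dm; auto intro!: E.diff_mem)+
      have "hnorm E (P (D k y vs - D k x vs - D (Suc k) x ((y - x) # vs)))
          \<le> hnorm E (D k y vs - D k x vs - D (Suc k) x ((y - x) # vs))"
        using m by (intro P(5)) simp
      also have "\<dots> \<le> e * hnorm E (y - x) * prod_list (map (hnorm E) vs)"
        using y vs vs' by (intro d(2)) auto
      finally show "hnorm E (P (D k y vs) - P (D k x vs) - P (D (Suc k) x ((y - x) # vs)))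
          \<le> e * hnorm E (y - x) * prod_list (map (hnorm E) vs)"
        using m by (simp add: Pd)
    qed (rule d(1))
  qed
qed

section \<open>Hilbert spaces of functions that are algebras\<close>

text \<open>A real Hilbert space whose elements are determined by complex functions
  \<open>ev x\<close> on \<open>I\<close>. Products, constants and conjugates are only asked to
  exist, because \<open>'a\<close> itself carries no multiplication; the constant K admits norms
  that are submultiplicative up to a factor.\<close>

locale func_algebra = pre_hilbert E for E :: "'a::real_vector hspace" +
  fixes I :: "'s set" and ev :: "'a \<Rightarrow> 's \<Rightarrow> complex" and K :: real
  assumes complete: "hilbert_space E"
    and ev_add: "\<And>x y s. x \<in> hcarrier E \<Longrightarrow> y \<in> hcarrier E \<Longrightarrow> s \<in> I \<Longrightarrow> ev (x + y) s = ev x s + ev y s"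
    and ev_scale: "\<And>c x s. x \<in> hcarrier E \<Longrightarrow> s \<in> I \<Longrightarrow> ev (c *\<^sub>R x) s = of_real c * ev x s"
    and ev_inj: "\<And>x. x \<in> hcarrier E \<Longrightarrow> (\<And>s. s \<in> I \<Longrightarrow> ev x s = 0) \<Longrightarrow> x = 0"
    and ex_mult: "\<And>x y. x \<in> hcarrier E \<Longrightarrow> y \<in> hcarrier E \<Longrightarrow>
        \<exists>z\<in>hcarrier E. (\<forall>s\<in>I. ev z s = ev x s * ev y s) \<and> hnorm E z \<le> K * hnorm E x * hnorm E y"
    and ex_const: "\<And>c. \<exists>z\<in>hcarrier E. \<forall>s\<in>I. ev z s = c"
    and ex_cnj: "\<And>x. x \<in> hcarrier E \<Longrightarrow>
        \<exists>z\<in>hcarrier E. (\<forall>s\<in>I. ev z s = cnj (ev x s)) \<and> hnorm E z = hnorm E x"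
    and K_pos: "0 < K"
begin

text \<open>Computations take place among plain functions in \<open>R\<close>, where ring identities
  hold pointwise; \<open>mk\<close> and \<open>ev\<close> translate to and from the Hilbert space.
  Functions are compared on \<open>I\<close> only, hence the \<open>_cong\<close> lemmas.\<close>

definition R :: "('s \<Rightarrow> complex) set" where
  "R = {g. \<exists>x\<in>hcarrier E. \<forall>s\<in>I. ev x s = g s}"

definition mk :: "('s \<Rightarrow> complex) \<Rightarrow> 'a" where
  "mk g = (THE x. x \<in> hcarrier E \<and> (\<forall>s\<in>I. ev x s = g s))"

definition nn :: "('s \<Rightarrow> complex) \<Rightarrow> real" where
  "nn g = hnorm E (mk g)"

lemma ev_minus: "x \<in> hcarrier E \<Longrightarrow> s \<in> I \<Longrightarrow> ev (- x) s = - ev x s"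
  using ev_scale[of x s "-1"] by simp

lemma ev_diff: "x \<in> hcarrier E \<Longrightarrow> y \<in> hcarrier E \<Longrightarrow> s \<in> I \<Longrightarrow> ev (x - y) s = ev x s - ev y s"
  using ev_add[of x "- y" s] by (simp add: ev_minus)

lemma ev_eqI:
  assumes "x \<in> hcarrier E" "y \<in> hcarrier E" "\<And>s. s \<in> I \<Longrightarrow> ev x s = ev y s"
  shows "x = y"
  using ev_inj[of "x - y"] assms by (simp add: ev_diff)

lemma mk_eqI: "x \<in> hcarrier E \<Longrightarrow> (\<And>s. s \<in> I \<Longrightarrow> ev x s = g s) \<Longrightarrow> mk g = x"
  unfolding mk_def by (rule the_equality) (auto intro: ev_eqI)

lemma mk_ev [simp]: "x \<in> hcarrier E \<Longrightarrow> mk (ev x) = x"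
  by (rule mk_eqI) auto

lemma mk_mem [simp]: "g \<in> R \<Longrightarrow> mk g \<in> hcarrier E"
  unfolding R_def using mk_eqI by auto

lemma ev_mk [simp]: "g \<in> R \<Longrightarrow> s \<in> I \<Longrightarrow> ev (mk g) s = g s"
  unfolding R_def using mk_eqI by auto

lemma ev_R [simp]: "x \<in> hcarrier E \<Longrightarrow> ev x \<in> R"
  by (auto simp: R_def)

lemma RI: "x \<in> hcarrier E \<Longrightarrow> (\<And>s. s \<in> I \<Longrightarrow> ev x s = g s) \<Longrightarrow> g \<in> R"
  by (auto simp: R_def)

lemma R_cong: "f \<in> R \<Longrightarrow> (\<And>s. s \<in> I \<Longrightarrow> f s = g s) \<Longrightarrow> g \<in> R"
  by (auto simp: R_def)

lemma mk_cong: "f \<in> R \<Longrightarrow> (\<And>s. s \<in> I \<Longrightarrow> f s = g s) \<Longrightarrow> mk f = mk g"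
  by (rule sym, rule mk_eqI) auto

lemma nn_cong: "f \<in> R \<Longrightarrow> (\<And>s. s \<in> I \<Longrightarrow> f s = g s) \<Longrightarrow> nn f = nn g"
  by (metis mk_cong nn_def)

lemma mk_add: "f \<in> R \<Longrightarrow> g \<in> R \<Longrightarrow> mk (\<lambda>s. f s + g s) = mk f + mk g"
  by (rule mk_eqI) (auto simp: ev_add)

lemma R_add [intro]: "f \<in> R \<Longrightarrow> g \<in> R \<Longrightarrow> (\<lambda>s. f s + g s) \<in> R"
  by (rule RI[of "mk f + mk g"]) (auto simp: ev_add)

lemma mk_diff: "f \<in> R \<Longrightarrow> g \<in> R \<Longrightarrow> mk (\<lambda>s. f s - g s) = mk f - mk g"
  by (rule mk_eqI) (auto simp: ev_diff)

lemma R_diff [intro]: "f \<in> R \<Longrightarrow> g \<in> R \<Longrightarrow> (\<lambda>s. f s - g s) \<in> R"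
  by (rule RI[of "mk f - mk g"]) (auto simp: ev_diff)

lemma mk_scale: "f \<in> R \<Longrightarrow> mk (\<lambda>s. of_real c * f s) = c *\<^sub>R mk f"
  by (rule mk_eqI) (auto simp: ev_scale)

lemma mk_minus: "f \<in> R \<Longrightarrow> mk (\<lambda>s. - f s) = - mk f"
  by (rule mk_eqI) (auto simp: ev_minus)

lemma R_minus [intro]: "f \<in> R \<Longrightarrow> (\<lambda>s. - f s) \<in> R"
  by (rule RI[of "- mk f"]) (auto simp: ev_minus)

lemma R_const [intro, simp]: "(\<lambda>s. c) \<in> R"
  using ex_const[of c] by (auto simp: R_def)

lemma R_mult [intro]: "f \<in> R \<Longrightarrow> g \<in> R \<Longrightarrow> (\<lambda>s. f s * g s) \<in> R"
  using ex_mult[of "mk f" "mk g"] by (auto simp: R_def)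

lemma nn_mult: "f \<in> R \<Longrightarrow> g \<in> R \<Longrightarrow> nn (\<lambda>s. f s * g s) \<le> K * nn f * nn g"
  using ex_mult[of "mk f" "mk g"] mk_eqI[of _ "\<lambda>s. f s * g s"] by (fastforce simp: nn_def)

lemma R_cnj [intro]: "f \<in> R \<Longrightarrow> (\<lambda>s. cnj (f s)) \<in> R"
  using ex_cnj[of "mk f"] by (auto simp: R_def)

lemma nn_cnj: "f \<in> R \<Longrightarrow> nn (\<lambda>s. cnj (f s)) = nn f"
  using ex_cnj[of "mk f"] mk_eqI[of _ "\<lambda>s. cnj (f s)"] by (fastforce simp: nn_def)

lemma R_power [intro]: "f \<in> R \<Longrightarrow> (\<lambda>s. f s ^ n) \<in> R"
  by (induction n) auto

lemma R_prod_list [intro]: "set vs \<subseteq> hcarrier E \<Longrightarrow> (\<lambda>s. prod_list (map (\<lambda>v. ev v s) vs)) \<in> R"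
  by (induction vs) auto

lemma R_sum [intro]: "(\<And>i. i \<in> S \<Longrightarrow> f i \<in> R) \<Longrightarrow> (\<lambda>s. \<Sum>i\<in>S. f i s) \<in> R"
  by (induction S rule: infinite_finite_induct) auto

lemma nn_nonneg [simp]: "f \<in> R \<Longrightarrow> 0 \<le> nn f"
  by (simp add: nn_def)

lemma nn_add: "f \<in> R \<Longrightarrow> g \<in> R \<Longrightarrow> nn (\<lambda>s. f s + g s) \<le> nn f + nn g"
  by (simp add: nn_def mk_add hnorm_triangle)

lemma nn_minus: "f \<in> R \<Longrightarrow> nn (\<lambda>s. - f s) = nn f"
  by (simp add: nn_def mk_minus hnorm_minus)

lemma nn_diff: "f \<in> R \<Longrightarrow> g \<in> R \<Longrightarrow> nn (\<lambda>s. f s - g s) \<le> nn f + nn g"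
  by (simp add: nn_def mk_diff hnorm_triangle_diff)

lemma nn_ev: "x \<in> hcarrier E \<Longrightarrow> nn (ev x) = hnorm E x"
  by (simp add: nn_def)

lemma nn_mult_le:
  assumes "f \<in> R" "g \<in> R" "nn f \<le> a" "nn g \<le> b"
  shows "nn (\<lambda>s. f s * g s) \<le> K * a * b"
proof -
  have "nn (\<lambda>s. f s * g s) \<le> K * nn f * nn g" using assms by (intro nn_mult)
  also have "\<dots> \<le> K * a * b"
    using assms K_pos order_trans[OF nn_nonneg[OF assms(1)] assms(3)] by (intro mult_mono) auto
  finally show ?thesis .
qed

lemma nn_power: "f \<in> R \<Longrightarrow> nn (\<lambda>s. f s ^ n) \<le> (K * nn f) ^ n * nn (\<lambda>s. 1)"
proof (induction n)
  case (Suc n)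
  have "nn (\<lambda>s. f s * f s ^ n) \<le> K * nn f * ((K * nn f) ^ n * nn (\<lambda>s. 1))"
    using Suc by (intro nn_mult_le) auto
  then show ?case by (simp add: mult_ac)
qed simp

lemma nn_prod_list:
  "set vs \<subseteq> hcarrier E \<Longrightarrow>
     nn (\<lambda>s. prod_list (map (\<lambda>v. ev v s) vs)) \<le> nn (\<lambda>s. 1) * K ^ length vs * prod_list (map (hnorm E) vs)"
proof (induction vs)
  case (Cons v vs)
  have "nn (\<lambda>s. ev v s * prod_list (map (\<lambda>v. ev v s) vs)) \<le>
      K * hnorm E v * (nn (\<lambda>s. 1) * K ^ length vs * prod_list (map (hnorm E) vs))"
    using Cons by (intro nn_mult_le) (auto simp: nn_ev)
  then show ?case by (simp add: mult_ac)
qed simp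

section \<open>Invertible functions\<close>

text \<open>Invertibility within the algebra: a function without zeros may have a reciprocal outside
  \<open>R\<close>.\<close>

definition inv_ok :: "('s \<Rightarrow> complex) \<Rightarrow> bool" where
  "inv_ok g \<longleftrightarrow> g \<in> R \<and> (\<forall>s\<in>I. g s \<noteq> 0) \<and> (\<lambda>s. inverse (g s)) \<in> R"

lemma inv_okI: "g \<in> R \<Longrightarrow> h \<in> R \<Longrightarrow> (\<And>s. s \<in> I \<Longrightarrow> g s * h s = 1) \<Longrightarrow> inv_ok g"
  unfolding inv_ok_def by (metis R_cong inverse_unique mult_zero_left zero_neq_one)

lemma inv_ok_cong: "inv_ok f \<Longrightarrow> (\<And>s. s \<in> I \<Longrightarrow> f s = g s) \<Longrightarrow> inv_ok g"
  unfolding inv_ok_def by (metis R_cong)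

lemma inv_ok_mult: "inv_ok f \<Longrightarrow> inv_ok g \<Longrightarrow> inv_ok (\<lambda>s. f s * g s)"
  unfolding inv_ok_def by (auto simp: inverse_mult_distrib)

text \<open>Neumann series.\<close>

lemma inv_ok_one_minus:
  assumes g: "g \<in> R" and q: "K * nn g < 1"
  shows "inv_ok (\<lambda>s. 1 - g s)"
proof -
  define q where "q = K * nn g"
  define c where "c = nn (\<lambda>s. 1) / (1 - q)"
  have q01: "0 \<le> q" "q < 1" using assms K_pos by (auto simp: q_def)
  have c0: "0 \<le> c" using q01 by (simp add: c_def)
  define y where "y n = mk (\<lambda>s. \<Sum>i<n. g s ^ i)" for n
  have sR: "(\<lambda>s. \<Sum>i<n. g s ^ i) \<in> R" for n using g by (intro R_sum R_power)
  have ym: "y n \<in> hcarrier E" for n unfolding y_def using sR by simp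
  have step: "hnorm E (y (Suc n) - y n) \<le> nn (\<lambda>s. 1) * q ^ n" for n
  proof -
    have "y (Suc n) - y n = mk (\<lambda>s. g s ^ n)"
      unfolding y_def mk_diff[OF sR sR, symmetric] by (rule mk_cong) (use sR g in auto)
    then show ?thesis using nn_power[OF g, of n] by (simp add: nn_def q_def mult.commute)
  qed
  have far: "hnorm E (y (n + k) - y n) \<le> nn (\<lambda>s. 1) * q ^ n * (\<Sum>i<k. q ^ i)" for n k
  proof (induction k)
    case (Suc k)
    have "hnorm E (y (n + Suc k) - y n) \<le> hnorm E (y (Suc (n + k)) - y (n + k)) + hnorm E (y (n + k) - y n)"
      using hnorm_triangle_via ym by simp
    also have "\<dots> \<le> nn (\<lambda>s. 1) * q ^ (n + k) + nn (\<lambda>s. 1) * q ^ n * (\<Sum>i<k. q ^ i)"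
      using step Suc by (intro add_mono) auto
    finally show ?case by (simp add: algebra_simps power_add)
  qed simp
  have gs: "(\<Sum>i<k. q ^ i) \<le> 1 / (1 - q)" for k
    using q01 by (simp add: sum_gp_strict divide_right_mono)
  have far': "hnorm E (y m - y n) \<le> c * q ^ n" if "n \<le> m" for m n
  proof -
    have "hnorm E (y m - y n) \<le> nn (\<lambda>s. 1) * q ^ n * (\<Sum>i<m-n. q ^ i)" using far[of n "m - n"] that by simp
    also have "\<dots> \<le> nn (\<lambda>s. 1) * q ^ n * (1 / (1 - q))" using gs q01 by (intro mult_left_mono) auto
    finally show ?thesis by (simp add: c_def field_simps)
  qed
  have q0: "(\<lambda>n. c * q ^ n) \<longlonglongrightarrow> 0"
    using q01 by (intro tendsto_mult_right_zero LIMSEQ_realpow_zero)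
  have cau: "\<exists>n0. \<forall>m\<ge>n0. \<forall>n\<ge>n0. hnorm E (y m - y n) < e" if e: "e > 0" for e
  proof -
    obtain n0 where n0: "\<And>n. n \<ge> n0 \<Longrightarrow> c * q ^ n < e"
      using order_tendstoD(2)[OF q0 e] by (auto simp: eventually_sequentially)
    have "hnorm E (y m - y n) < e" if "m \<ge> n0" "n \<ge> n0" for m n
      using far'[of m n] far'[of n m] n0[of n] n0[of m] that hnorm_diff_commute[OF ym ym, of m n]
      by (cases "n \<le> m") (auto intro: le_less_trans)
    then show ?thesis by blast
  qed
  obtain x where x: "x \<in> hcarrier E" and lim: "(\<lambda>n. hnorm E (y n - x)) \<longlonglongrightarrow> 0"
    using complete cau ym unfolding hilbert_space_iff mcomplete_iff_seq by blast
  \<comment> \<open>The defect of the limit x as an inverse of 1 - g. Measured against the partial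
    sum \<open>y n\<close> it is (1 - g) (x - y n) - g^n, so its norm is arbitrarily small.\<close>
  define z where "z = (\<lambda>s. (1 - g s) * ev x s - 1)"
  have oR: "(\<lambda>s. 1 - g s) \<in> R" using g by auto
  have zR: "z \<in> R" unfolding z_def using g x by (intro R_diff R_mult R_const) auto
  have zb: "nn z \<le> K * nn (\<lambda>s. 1 - g s) * hnorm E (y n - x) + q ^ n * nn (\<lambda>s. 1)" for n
  proof -
    have xR: "ev (x - y n) \<in> R" using x ym by simp
    have "nn z = nn (\<lambda>s. (1 - g s) * ev (x - y n) s - g s ^ n)"
    proof (rule nn_cong[OF zR])
      fix s assume s: "s \<in> I"
      have "(1 - g s) * (\<Sum>i<n. g s ^ i) = 1 - g s ^ n"
        by (simp add: one_diff_power_eq)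
      then show "z s = (1 - g s) * ev (x - y n) s - g s ^ n"
        using s x ym sR by (simp add: z_def ev_diff y_def algebra_simps)
    qed
    also have "\<dots> \<le> nn (\<lambda>s. (1 - g s) * ev (x - y n) s) + nn (\<lambda>s. g s ^ n)"
      using oR xR g by (intro nn_diff R_mult R_power) auto
    also have "\<dots> \<le> K * nn (\<lambda>s. 1 - g s) * hnorm E (y n - x) + q ^ n * nn (\<lambda>s. 1)"
      unfolding q_def using oR xR g x ym
      by (intro add_mono nn_power nn_mult_le) (auto simp: nn_ev hnorm_diff_commute[of x])
    finally show ?thesis .
  qed
  have "(\<lambda>n. K * nn (\<lambda>s. 1 - g s) * hnorm E (y n - x) + q ^ n * nn (\<lambda>s. 1)) \<longlonglongrightarrow> 0"
    using q01 by (intro tendsto_add_zero tendsto_mult_right_zero[OF lim] tendsto_mult_left_zero LIMSEQ_realpow_zero)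
  then have "nn z \<le> 0" using zb by (intro LIMSEQ_le_const) auto
  then have "mk z = 0" using zR hnorm_eq_0[of "mk z"] nn_nonneg[OF zR] unfolding nn_def by force
  then have "z s = 0" if "s \<in> I" for s using ev_mk[OF zR that] ev_scale[of 0 s 0] that by simp
  then show ?thesis by (intro inv_okI[OF oR ev_R[OF x]]) (auto simp: z_def)
qed

text \<open>Writing g + h = g (1 + h/g) reduces invertibility to the Neumann series. With i and j
  the reciprocals of g and g + h, the identity j = i - i h j bounds j, since the last term has at
  most half the norm of j and can be absorbed.\<close>

lemma inv_ok_perturb:
  assumes g: "inv_ok g" and h: "h \<in> R" and q: "K * K * nn (\<lambda>s. inverse (g s)) * nn h \<le> 1 / 2"
  shows "inv_ok (\<lambda>s. g s + h s)"
    and "nn (\<lambda>s. inverse (g s + h s)) \<le> 2 * nn (\<lambda>s. inverse (g s))"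
proof -
  let ?i = "\<lambda>s. inverse (g s)" and ?j = "\<lambda>s. inverse (g s + h s)"
  have gR: "g \<in> R" "?i \<in> R" "\<And>s. s \<in> I \<Longrightarrow> g s \<noteq> 0" using g by (auto simp: inv_ok_def)
  have ihR: "(\<lambda>s. ?i s * h s) \<in> R" using gR h by auto
  have nih: "nn (\<lambda>s. ?i s * h s) \<le> K * nn ?i * nn h" using gR h by (intro nn_mult)
  have "K * nn (\<lambda>s. ?i s * h s) \<le> 1 / 2"
  proof -
    have "K * nn (\<lambda>s. ?i s * h s) \<le> K * (K * nn ?i * nn h)" using nih K_pos by (intro mult_left_mono) auto
    then show ?thesis using q by (simp add: mult.assoc)
  qed
  then have "inv_ok (\<lambda>s. 1 - (- (?i s * h s)))"
    using ihR by (intro inv_ok_one_minus) (auto simp: nn_minus)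
  then have "inv_ok (\<lambda>s. g s * (1 - (- (?i s * h s))))" by (rule inv_ok_mult[OF g])
  then show ok: "inv_ok (\<lambda>s. g s + h s)"
    by (rule inv_ok_cong) (use gR in \<open>simp add: field_simps\<close>)
  have jR: "?j \<in> R" using ok by (auto simp: inv_ok_def)
  have "nn ?j = nn (\<lambda>s. ?i s - ?i s * h s * ?j s)"
  proof (rule nn_cong[OF jR])
    fix s assume s: "s \<in> I"
    have id: "inverse v = inverse u - inverse u * (v - u) * inverse v" if "u \<noteq> 0" "v \<noteq> 0" for u v :: complex
      using that by (simp add: field_simps)
    show "?j s = ?i s - ?i s * h s * ?j s"
      using id[of "g s" "g s + h s"] s ok gR(3) by (simp add: inv_ok_def)
  qed
  also have "\<dots> \<le> nn ?i + nn (\<lambda>s. ?i s * h s * ?j s)"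
    using gR ihR jR by (intro nn_diff) auto
  also have "nn (\<lambda>s. ?i s * h s * ?j s) \<le> K * (K * nn ?i * nn h) * nn ?j"
    using ihR jR nih by (rule nn_mult_le) simp_all
  also have "\<dots> \<le> 1 / 2 * nn ?j"
    using mult_right_mono[OF q, of "nn ?j"] jR by (simp add: mult_ac)
  finally show "nn ?j \<le> 2 * nn ?i" by simp
qed


lemma prod_list_map_update:
  fixes g :: "'b \<Rightarrow> 'c::comm_monoid_mult"
  shows "i < length vs \<Longrightarrow>
    prod_list (map g (vs[i := z])) = g z * prod_list (map g (take i vs @ drop (Suc i) vs))"
  by (simp add: upd_conv_take_nth_drop mult_ac)

text \<open>The shape of every derivative in this section: the increments are multiplied together
  and with one coefficient function p.\<close>

lemma bounded_multilinear_mk: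
  assumes p: "p \<in> R"
  shows "bounded_multilinear E E k (\<lambda>vs. mk (\<lambda>s. p s * prod_list (map (\<lambda>v. ev v s) vs)))"
  unfolding bounded_multilinear_def
proof (intro conjI allI impI ballI exI[of _ "K * nn p * (nn (\<lambda>s. 1) * K ^ k)"])
  show "mk (\<lambda>s. p s * prod_list (map (\<lambda>v. ev v s) vs)) \<in> hcarrier E"
    if "length vs = k \<and> set vs \<subseteq> hcarrier E" for vs
    using that p by (intro mk_mem R_mult R_prod_list) auto
  show "hnorm E (mk (\<lambda>s. p s * prod_list (map (\<lambda>v. ev v s) vs)))
      \<le> K * nn p * (nn (\<lambda>s. 1) * K ^ k) * prod_list (map (hnorm E) vs)"
    if "length vs = k \<and> set vs \<subseteq> hcarrier E" for vs
  proof -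
    have "nn (\<lambda>s. p s * prod_list (map (\<lambda>v. ev v s) vs))
        \<le> K * nn p * (nn (\<lambda>s. 1) * K ^ k * prod_list (map (hnorm E) vs))"
      using that p nn_prod_list[of vs] by (intro nn_mult_le) auto
    then show ?thesis by (simp add: nn_def mult.assoc)
  qed
  fix vs i c x y
  assume x: "x \<in> hcarrier E" and y: "y \<in> hcarrier E"
    and "length vs = k \<and> set vs \<subseteq> hcarrier E \<and> i < k"
  then have vs: "length vs = k" "set vs \<subseteq> hcarrier E" "i < length vs" by auto
  have R: "(\<lambda>s. p s * prod_list (map (\<lambda>v. ev v s) (vs[i := z]))) \<in> R" if "z \<in> hcarrier E" for z
  proof (intro R_mult R_prod_list p)
    show "set (vs[i := z]) \<subseteq> hcarrier E"
      using vs that by (meson order_trans insert_subset set_update_subset_insert)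
  qed
  show "mk (\<lambda>s. p s * prod_list (map (\<lambda>v. ev v s) (vs[i := c *\<^sub>R x + y]))) =
      c *\<^sub>R mk (\<lambda>s. p s * prod_list (map (\<lambda>v. ev v s) (vs[i := x]))) +
      mk (\<lambda>s. p s * prod_list (map (\<lambda>v. ev v s) (vs[i := y])))"
    using x y R[OF x] R[OF y] vs(3)
    by (intro mk_eqI)
      (simp_all add: ev_add ev_scale prod_list_map_update algebra_simps del: map_append prod_list.append)
qed

section \<open>Moebius maps with coefficients in the algebra\<close>

definition den :: "('s \<Rightarrow> complex) \<Rightarrow> ('s \<Rightarrow> complex) \<Rightarrow> 'a \<Rightarrow> 's \<Rightarrow> complex" where
  "den a b x = (\<lambda>s. a s * ev x s + b s)"

definition W :: "('s \<Rightarrow> complex) \<Rightarrow> ('s \<Rightarrow> complex) \<Rightarrow> 'a set" where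
  "W a b = {x \<in> hcarrier E. inv_ok (den a b x)}"

definition moeb :: "('s \<Rightarrow> complex) \<Rightarrow> ('s \<Rightarrow> complex) \<Rightarrow> ('s \<Rightarrow> complex) \<Rightarrow> ('s \<Rightarrow> complex) \<Rightarrow> 'a \<Rightarrow> 'a"
  where "moeb c d a b x = mk (\<lambda>s. (c s * ev x s + d s) * inverse (den a b x s))"

lemma W_D:
  assumes "x \<in> W a b"
  shows "x \<in> hcarrier E" "den a b x \<in> R" "(\<lambda>s. inverse (den a b x s)) \<in> R" "s \<in> I \<Longrightarrow> den a b x s \<noteq> 0"
  using assms by (auto simp: W_def inv_ok_def)

lemma moeb_mem: "c \<in> R \<Longrightarrow> d \<in> R \<Longrightarrow> x \<in> W a b \<Longrightarrow> moeb c d a b x \<in> hcarrier E"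
  unfolding moeb_def by (intro mk_mem R_mult R_add) (auto dest: W_D)

lemma ev_moeb:
  assumes "c \<in> R" "d \<in> R" "x \<in> W a b" "s \<in> I"
  shows "ev (moeb c d a b x) s = (c s * ev x s + d s) / (a s * ev x s + b s)"
proof -
  have "(\<lambda>s. (c s * ev x s + d s) * inverse (den a b x s)) \<in> R"
    using assms by (intro R_mult R_add) (auto dest: W_D)
  then show ?thesis using assms(4) by (simp add: moeb_def den_def divide_inverse)
qed

text \<open>The denominator at y is the one at x plus \<open>a * ev (y - x)\<close>, so
  \<open>inv_ok_perturb\<close> applies near x. The local bound on the reciprocals is what makes the
  remainders below uniformly quadratic. The summand 1 in the radius guards against q = 0.\<close>

lemma W_nbhd:
  assumes a: "a \<in> R" and x: "x \<in> W a b"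
  obtains r where "r > 0" "\<And>y. y \<in> hcarrier E \<Longrightarrow> hnorm E (y - x) < r \<Longrightarrow>
    y \<in> W a b \<and> nn (\<lambda>s. inverse (den a b y s)) \<le> 2 * nn (\<lambda>s. inverse (den a b x s))"
proof -
  let ?i = "\<lambda>s. inverse (den a b x s)"
  note xD = W_D[OF x]
  define q where "q = K * K * nn ?i * (K * nn a)"
  have q0: "q \<ge> 0" using a xD K_pos by (simp add: q_def)
  show ?thesis
  proof (rule that[of "1 / (2 * (q + 1))"])
    show "1 / (2 * (q + 1)) > 0" using q0 by simp
    fix y assume y: "y \<in> hcarrier E" and n: "hnorm E (y - x) < 1 / (2 * (q + 1))"
    have yx: "y - x \<in> hcarrier E" using y xD by simp
    have hR: "(\<lambda>s. a s * ev (y - x) s) \<in> R" using a yx by auto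
    have "K * K * nn ?i * nn (\<lambda>s. a s * ev (y - x) s) \<le> K * K * nn ?i * (K * nn a * hnorm E (y - x))"
      using nn_mult[OF a ev_R[OF yx]] K_pos xD(3) by (intro mult_left_mono) (auto simp: nn_ev yx)
    also have "\<dots> = q * hnorm E (y - x)" by (simp add: q_def)
    also have "\<dots> \<le> (q + 1) * hnorm E (y - x)" using yx by (intro mult_right_mono) auto
    also have "\<dots> \<le> 1 / 2" using n q0 by (simp add: field_simps)
    finally have q2: "K * K * nn ?i * nn (\<lambda>s. a s * ev (y - x) s) \<le> 1 / 2" .
    have ok: "inv_ok (den a b x)" using x by (simp add: W_def)
    note P = inv_ok_perturb[OF ok hR q2]
    have eq: "den a b x s + a s * ev (y - x) s = den a b y s" if "s \<in> I" for s
      using that y xD by (simp add: den_def ev_diff algebra_simps)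
    have "inv_ok (den a b y)" by (rule inv_ok_cong[OF P(1)]) (rule eq)
    moreover have "nn (\<lambda>s. inverse (den a b x s + a s * ev (y - x) s)) = nn (\<lambda>s. inverse (den a b y s))"
      using P(1) eq by (intro nn_cong) (auto simp: inv_ok_def)
    ultimately show "y \<in> W a b \<and> nn (\<lambda>s. inverse (den a b y s)) \<le> 2 * nn ?i"
      using P(2) y by (simp add: W_def)
  qed
qed

lemma openin_W: "a \<in> R \<Longrightarrow> openin (htopology E) (W a b)"
  unfolding openin_htopology
proof (intro conjI ballI)
  show "W a b \<subseteq> hcarrier E" by (auto simp: W_def)
  fix x assume "a \<in> R" "x \<in> W a b"
  then show "\<exists>r>0. \<forall>y\<in>hcarrier E. hnorm E (y - x) < r \<longrightarrow> y \<in> W a b"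
    by (rule W_nbhd) blast
qed

text \<open>The second order Taylor remainder of the n-th power of the reciprocal denominator. With
  i, j the reciprocals at x and y and w = a (y - x), the remainder for n + 1 is j times the one for
  n plus (n + 1) w^2 i^(n+2) j, and both summands are quadratic in the increment.\<close>

lemma inverse_power_remainder:
  assumes a: "a \<in> R" and x: "x \<in> W a b"
    and B: "\<And>y. y \<in> hcarrier E \<Longrightarrow> hnorm E (y - x) < r \<Longrightarrow>
      y \<in> W a b \<and> nn (\<lambda>s. inverse (den a b y s)) \<le> B"
  shows "\<exists>C\<ge>0. \<forall>y\<in>hcarrier E. hnorm E (y - x) < r \<longrightarrow>
    (\<lambda>s. inverse (den a b y s) ^ n - inverse (den a b x s) ^ n
        + of_nat n * a s * ev (y - x) s * inverse (den a b x s) ^ Suc n) \<in> R \<and>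
    nn (\<lambda>s. inverse (den a b y s) ^ n - inverse (den a b x s) ^ n
        + of_nat n * a s * ev (y - x) s * inverse (den a b x s) ^ Suc n) \<le> C * (hnorm E (y - x))\<^sup>2"
proof (induction n)
  case 0
  have "mk (\<lambda>s. 0) = 0" by (rule mk_eqI) (use ev_scale[of 0 _ 0] in auto)
  then show ?case by (intro exI[of _ 0]) (auto simp: nn_def)
next
  case (Suc n)
  let ?j = "\<lambda>y s. inverse (den a b y s)"
  let ?r = "\<lambda>n y s. ?j y s ^ n - ?j x s ^ n + of_nat n * a s * ev (y - x) s * ?j x s ^ Suc n"
  obtain C where C: "C \<ge> 0" "\<And>y. y \<in> hcarrier E \<Longrightarrow> hnorm E (y - x) < r \<Longrightarrow> ?r n y \<in> R"
     "\<And>y. y \<in> hcarrier E \<Longrightarrow> hnorm E (y - x) < r \<Longrightarrow> nn (?r n y) \<le> C * (hnorm E (y - x))\<^sup>2"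
    using Suc by auto
  note xD = W_D[OF x]
  define p where "p = (\<lambda>s. of_nat (Suc n) * (a s ^ 2 * ?j x s ^ (n + 2)))"
  have pR: "p \<in> R" unfolding p_def using a xD by (intro R_mult R_power R_const)
  define C' where "C' = K * C * B + K * (K * (K * 1 * 1) * nn p) * B"
  \<comment> \<open>The sign of \<open>B\<close> is not assumed, hence the absolute value of
    \<open>C'\<close>.\<close>
  have step: "?r (Suc n) y \<in> R \<and> nn (?r (Suc n) y) \<le> \<bar>C'\<bar> * (hnorm E (y - x))\<^sup>2"
    if y: "y \<in> hcarrier E" "hnorm E (y - x) < r" for y
  proof -
    have yW: "y \<in> W a b" and yB: "nn (?j y) \<le> B" using B[OF y] by auto
    note yD = W_D[OF yW]
    have yx: "y - x \<in> hcarrier E" using y xD by simp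
    let ?h = "ev (y - x)"
    have hR: "?h \<in> R" using yx by simp
    have R1: "(\<lambda>s. ?r n y s * ?j y s) \<in> R" using C(2)[OF y] yD by auto
    have R2: "(\<lambda>s. (?h s * ?h s * p s) * ?j y s) \<in> R" using hR pR yD(3) by (intro R_mult)
    have eq: "?r n y s * ?j y s + (?h s * ?h s * p s) * ?j y s = ?r (Suc n) y s" if s: "s \<in> I" for s
    proof -
      define u v w where "u = den a b x s" and "v = den a b y s" and "w = a s * ?h s"
      have nz: "u \<noteq> 0" "v \<noteq> 0" using xD(4) yD(4) s by (auto simp: u_def v_def)
      have vu: "v = u + w" using s y xD by (simp add: u_def v_def w_def den_def ev_diff algebra_simps)
      have "inverse v = inverse u - w * inverse u * inverse v"
      proof -
        have "w = v - u" by (simp add: vu)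
        then show ?thesis using nz by (simp add: field_simps)
      qed
      then have iv: "w * inverse u * inverse v = inverse u - inverse v"
      proof -
        have "x = b - a" if "a = b - x" for a b x :: complex using that by (simp add: eq_diff_eq add.commute)
        from this[OF \<open>inverse v = _\<close>] show ?thesis .
      qed
      have alg: "(Q - P + m * w * (i * P)) * j + (1 + m) * (w * w * (i * i * P)) * j
          = j * Q - i * P + (1 + m) * w * (i * (i * P))"
        if "w * i * j = i - j" for P Q m w i j :: complex
        using that by algebra
      have l: "?r n y s * ?j y s + (?h s * ?h s * p s) * ?j y s =
          (inverse v ^ n - inverse u ^ n + of_nat n * w * (inverse u * inverse u ^ n)) * inverse v
          + (1 + of_nat n) * (w * w * (inverse u * inverse u * inverse u ^ n)) * inverse v"
        by (simp add: p_def w_def u_def v_def power2_eq_square mult_ac)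
      have r: "?r (Suc n) y s = inverse v * inverse v ^ n - inverse u * inverse u ^ n
          + (1 + of_nat n) * w * (inverse u * (inverse u * inverse u ^ n))"
        by (simp add: w_def u_def v_def mult_ac)
      show ?thesis unfolding l r by (rule alg[OF iv])
    qed
    have R3: "?r (Suc n) y \<in> R" by (rule R_cong[OF R_add[OF R1 R2]]) (rule eq)
    have "nn (?r (Suc n) y) = nn (\<lambda>s. ?r n y s * ?j y s + (?h s * ?h s * p s) * ?j y s)"
      by (rule nn_cong[OF R3]) (rule eq[symmetric])
    also have "\<dots> \<le> nn (\<lambda>s. ?r n y s * ?j y s) + nn (\<lambda>s. (?h s * ?h s * p s) * ?j y s)"
      by (rule nn_add[OF R1 R2])
    also have "\<dots> \<le> K * (C * (hnorm E (y - x))\<^sup>2) * B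
        + K * (K * (K * hnorm E (y - x) * hnorm E (y - x)) * nn p) * B"
      using C(2,3)[OF y] yD yB hR pR yx
      by (intro add_mono nn_mult_le R_mult) (auto simp: nn_ev)
    also have "\<dots> = C' * (hnorm E (y - x))\<^sup>2"
      by (simp add: C'_def power2_eq_square algebra_simps)
    also have "\<dots> \<le> \<bar>C'\<bar> * (hnorm E (y - x))\<^sup>2" by (intro mult_right_mono) auto
    finally show ?thesis using R3 by simp
  qed
  show ?case
    by (rule exI[of _ "\<bar>C'\<bar>"]) (use step in simp)
qed

text \<open>The coefficient of the k-th derivative of a Moebius map. The first derivative is (c b -
  d a) / den^2; each further one contributes -a and the exponent brought down from the denominator,
  which accumulates to a factorial.\<close>

fun mcoef :: "('s \<Rightarrow> complex) \<Rightarrow> ('s \<Rightarrow> complex) \<Rightarrow> ('s \<Rightarrow> complex) \<Rightarrow> ('s \<Rightarrow> complex) \<Rightarrow>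
    nat \<Rightarrow> 'a \<Rightarrow> 's \<Rightarrow> complex" where
  "mcoef c d a b 0 x = (\<lambda>s. (c s * ev x s + d s) * inverse (den a b x s))"
| "mcoef c d a b (Suc k) x = (\<lambda>s. (-1) ^ k * fact (Suc k) * a s ^ k * (c s * b s - d s * a s)
     * inverse (den a b x s) ^ Suc (Suc k))"

lemma mcoef_R:
  assumes "a \<in> R" "b \<in> R" "c \<in> R" "d \<in> R" "x \<in> W a b"
  shows "mcoef c d a b k x \<in> R"
proof (cases k)
  case 0
  show ?thesis unfolding 0 mcoef.simps
    using assms W_D(3)[OF assms(5)] ev_R[OF W_D(1)[OF assms(5)]] by (intro R_mult R_add)
next
  case (Suc l)
  show ?thesis unfolding Suc mcoef.simps
    using assms W_D(3)[OF assms(5)] by (intro R_mult R_diff R_power R_const)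
qed

lemma mcoef_remainder:
  assumes R: "a \<in> R" "b \<in> R" "c \<in> R" "d \<in> R" and x: "x \<in> W a b"
  obtains r C where "r > 0" "C \<ge> 0" "\<And>y. y \<in> hcarrier E \<Longrightarrow> hnorm E (y - x) < r \<Longrightarrow> y \<in> W a b \<and>
    nn (\<lambda>s. mcoef c d a b k y s - mcoef c d a b k x s - mcoef c d a b (Suc k) x s * ev (y - x) s)
      \<le> C * (hnorm E (y - x))\<^sup>2"
proof -
  obtain r where r: "r > 0" "\<And>y. y \<in> hcarrier E \<Longrightarrow> hnorm E (y - x) < r \<Longrightarrow>
    y \<in> W a b \<and> nn (\<lambda>s. inverse (den a b y s)) \<le> 2 * nn (\<lambda>s. inverse (den a b x s))"
    using W_nbhd[OF R(1) x] by blast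
  define B where "B = 2 * nn (\<lambda>s. inverse (den a b x s))"
  let ?j = "\<lambda>y s. inverse (den a b y s)"
  note xD = W_D[OF x]
  show ?thesis
  \<comment> \<open>For k = 0 the numerator varies with x as well; for k > 0 only a power of the
    reciprocal denominator does, and \<open>inverse_power_remainder\<close> applies
    directly.\<close>
  proof (cases k)
    case 0
    define p where "p = (\<lambda>s. - (c s * b s - d s * a s) * a s * ?j x s ^ 2)"
    have pR: "p \<in> R" unfolding p_def using R xD by (intro R_mult R_minus R_diff R_power)
    show ?thesis
    proof (rule that[of r "\<bar>K * (K * (K * 1 * 1) * nn p) * B\<bar>"])
      fix y assume y: "y \<in> hcarrier E" "hnorm E (y - x) < r"
      have yW: "y \<in> W a b" and yB: "nn (?j y) \<le> B" using r(2)[OF y] by (auto simp: B_def)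
      note yD = W_D[OF yW]
      have yx: "y - x \<in> hcarrier E" using y xD by simp
      let ?h = "ev (y - x)"
      have eq: "(?h s * ?h s * p s) * ?j y s =
          mcoef c d a b k y s - mcoef c d a b k x s - mcoef c d a b (Suc k) x s * ?h s" if s: "s \<in> I" for s
      proof -
        have nz: "a s * ev x s + b s \<noteq> 0" "a s * ev y s + b s \<noteq> 0"
          using xD(4) yD(4) s by (auto simp: den_def)
        have id: "h * h * (- D * A * i^2) * j = N' * j - N * i - D * i^2 * h"
          if "u * i = 1" "v * j = 1" "v = u + A * h" "N' * u - N * v = D * h"
          for u v i j h N N' D A :: complex
        proof -
          have "j - i = (u * i) * j - (v * j) * i" using that by simp
          also have "\<dots> = - A * h * i * j" by (simp add: that(3) algebra_simps)
          finally have 1: "j - i = - A * h * i * j" .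
          have "N' * j - N * i = N' * j * (u * i) - N * i * (v * j)" using that by simp
          also have "\<dots> = (N' * u - N * v) * i * j" by (simp add: algebra_simps)
          also have "\<dots> = D * h * i * j" by (simp add: that(4))
          finally have "N' * j - N * i - D * i^2 * h = D * h * i * (j - i)"
            by (simp add: power2_eq_square algebra_simps)
          also have "\<dots> = h * h * (- D * A * i^2) * j" unfolding 1 by (simp add: power2_eq_square algebra_simps)
          finally show ?thesis by simp
        qed
        have "?h s * ?h s * (- (c s * b s - d s * a s) * a s * ?j x s ^ 2) * ?j y s =
          (c s * ev y s + d s) * ?j y s - (c s * ev x s + d s) * ?j x s
            - (c s * b s - d s * a s) * ?j x s ^ 2 * ?h s"
        proof (rule id)
          show "den a b x s * ?j x s = 1" "den a b y s * ?j y s = 1"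
            using nz by (simp_all add: den_def)
          show "den a b y s = den a b x s + a s * ?h s"
            "(c s * ev y s + d s) * den a b x s - (c s * ev x s + d s) * den a b y s = (c s * b s - d s * a s) * ?h s"
            using s y(1) xD(1) by (simp_all add: den_def ev_diff algebra_simps)
        qed
        then show ?thesis unfolding 0 mcoef.simps p_def by (simp only: power_0 fact_1 fact_Suc fact_0 of_nat_1 of_nat_Suc of_nat_0 add_0 add_0_right mult_1 mult_1_right power2_eq_square power_Suc)
      qed
      have R2: "(\<lambda>s. (?h s * ?h s * p s) * ?j y s) \<in> R" using ev_R[OF yx] pR yD(3) by (intro R_mult)
      have "nn (\<lambda>s. mcoef c d a b k y s - mcoef c d a b k x s - mcoef c d a b (Suc k) x s * ?h s)
          = nn (\<lambda>s. (?h s * ?h s * p s) * ?j y s)"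
        by (rule nn_cong[OF R2, symmetric]) (rule eq)
      also have "\<dots> \<le> K * (K * (K * hnorm E (y - x) * hnorm E (y - x)) * nn p) * B"
        using yD yB pR yx by (intro nn_mult_le R_mult) (auto simp: nn_ev)
      also have "\<dots> = (K * (K * (K * 1 * 1) * nn p) * B) * (hnorm E (y - x))\<^sup>2"
        by (simp add: power2_eq_square algebra_simps)
      also have "\<dots> \<le> \<bar>K * (K * (K * 1 * 1) * nn p) * B\<bar> * (hnorm E (y - x))\<^sup>2"
        by (intro mult_right_mono) auto
      finally show "y \<in> W a b \<and>
        nn (\<lambda>s. mcoef c d a b k y s - mcoef c d a b k x s - mcoef c d a b (Suc k) x s * ?h s)
          \<le> \<bar>K * (K * (K * 1 * 1) * nn p) * B\<bar> * (hnorm E (y - x))\<^sup>2" using yW by blast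
    qed (use r in auto)
  next
    case (Suc l)
    define p where "p = (\<lambda>s. (-1) ^ l * fact (Suc l) * a s ^ l * (c s * b s - d s * a s))"
    have pR: "p \<in> R" unfolding p_def using R by (intro R_mult R_diff R_power R_const)
    let ?r = "\<lambda>y s. ?j y s ^ Suc k - ?j x s ^ Suc k + of_nat (Suc k) * a s * ev (y - x) s * ?j x s ^ Suc (Suc k)"
    have "\<exists>C\<ge>0. \<forall>y\<in>hcarrier E. hnorm E (y - x) < r \<longrightarrow>
        ?r y \<in> R \<and> nn (?r y) \<le> C * (hnorm E (y - x))\<^sup>2"
      by (rule inverse_power_remainder[OF R(1) x]) (rule r(2))
    then obtain C where C0: "C \<ge> 0" and Cy: "\<forall>y\<in>hcarrier E. hnorm E (y - x) < r \<longrightarrow>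
        ?r y \<in> R \<and> nn (?r y) \<le> C * (hnorm E (y - x))\<^sup>2"
      by (elim exE conjE)
    have C: "C \<ge> 0" "\<And>y. y \<in> hcarrier E \<Longrightarrow> hnorm E (y - x) < r \<Longrightarrow> ?r y \<in> R"
     "\<And>y. y \<in> hcarrier E \<Longrightarrow> hnorm E (y - x) < r \<Longrightarrow> nn (?r y) \<le> C * (hnorm E (y - x))\<^sup>2"
      using C0 by (simp_all only: Cy[rule_format])
    show ?thesis
    proof (rule that[of r "K * nn p * C"])
      show "K * nn p * C \<ge> 0" using K_pos pR C by simp
      fix y assume y: "y \<in> hcarrier E" "hnorm E (y - x) < r"
      have eq: "p s * ?r y s =
          mcoef c d a b k y s - mcoef c d a b k x s - mcoef c d a b (Suc k) x s * ev (y - x) s" for s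
      proof -
        have f: "fact (Suc (Suc l)) = of_nat (Suc (Suc l)) * (fact (Suc l) :: complex)"
          by (rule fact_Suc)
        have m: "((-1) ^ l * q * A ^ l * D) * (jy - jx + n * A * h * jj)
            = (-1) ^ l * q * A ^ l * D * jy - (-1) ^ l * q * A ^ l * D * jx
              - (-1) ^ Suc l * (n * q) * A ^ Suc l * D * jj * h" for q A D jy jx n h jj :: complex
          by (simp add: ring_distribs mult_ac)
        show ?thesis unfolding Suc mcoef.simps p_def f by (rule m)
      qed
      have "nn (\<lambda>s. p s * ?r y s) \<le> K * nn p * (C * (hnorm E (y - x))\<^sup>2)"
        using pR C(2,3)[OF y] by (intro nn_mult_le) auto
      then show "y \<in> W a b \<and>
        nn (\<lambda>s. mcoef c d a b k y s - mcoef c d a b k x s - mcoef c d a b (Suc k) x s * ev (y - x) s)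
          \<le> K * nn p * C * (hnorm E (y - x))\<^sup>2"
        unfolding eq using r(2)[OF y] by (simp only: mult.assoc)
    qed (rule r(1))
  qed
qed

text \<open>Multiplication by a function of small norm is a multilinear map of small norm, so the
  quadratic remainder of the coefficients is already the remainder in the operator norm.\<close>

theorem hsmooth_on_moeb:
  assumes R: "a \<in> R" "b \<in> R" "c \<in> R" "d \<in> R"
  shows "hsmooth_on E E (W a b) (moeb c d a b)"
  unfolding hsmooth_on_iff hderivs_def
proof (intro conjI exI[of _ "\<lambda>k x vs. mk (\<lambda>s. mcoef c d a b k x s * prod_list (map (\<lambda>v. ev v s) vs))"]
    ballI allI impI)
  show "openin (htopology E) (W a b)" by (rule openin_W[OF R(1)])
  show "mk (\<lambda>s. mcoef c d a b 0 x s * prod_list (map (\<lambda>v. ev v s) [])) = moeb c d a b x" for x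
    by (simp add: moeb_def)
  show "bounded_multilinear E E k (\<lambda>vs. mk (\<lambda>s. mcoef c d a b k x s * prod_list (map (\<lambda>v. ev v s) vs)))"
    if "x \<in> W a b" for k x
    using mcoef_R[OF R that] by (rule bounded_multilinear_mk)
  fix k x and e :: real assume x: "x \<in> W a b" and e: "0 < e"
  obtain r C where r: "r > 0" "C \<ge> 0" "\<And>y. y \<in> hcarrier E \<Longrightarrow> hnorm E (y - x) < r \<Longrightarrow> y \<in> W a b \<and>
    nn (\<lambda>s. mcoef c d a b k y s - mcoef c d a b k x s - mcoef c d a b (Suc k) x s * ev (y - x) s)
      \<le> C * (hnorm E (y - x))\<^sup>2"
    by (rule mcoef_remainder[OF R x, of k], rule that)
  define C' where "C' = K * C * (nn (\<lambda>s. 1) * K ^ k)"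
  have C': "C' \<ge> 0" using r K_pos by (simp add: C'_def)
  show "\<exists>\<delta>>0. \<forall>y\<in>W a b. hnorm E (y - x) < \<delta> \<longrightarrow> (\<forall>vs. length vs = k \<and> set vs \<subseteq> hcarrier E \<longrightarrow>
      hnorm E (mk (\<lambda>s. mcoef c d a b k y s * prod_list (map (\<lambda>v. ev v s) vs))
        - mk (\<lambda>s. mcoef c d a b k x s * prod_list (map (\<lambda>v. ev v s) vs))
        - mk (\<lambda>s. mcoef c d a b (Suc k) x s * prod_list (map (\<lambda>v. ev v s) ((y - x) # vs))))
      \<le> e * hnorm E (y - x) * prod_list (map (hnorm E) vs))"
  proof (intro exI[of _ "min r (e / (C' + 1))"] conjI ballI impI allI)
    show "0 < min r (e / (C' + 1))" using r e C' by simp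
    fix y vs assume yW: "y \<in> W a b" and yn: "hnorm E (y - x) < min r (e / (C' + 1))"
      and vs: "length vs = k \<and> set vs \<subseteq> hcarrier E"
    have y: "y \<in> hcarrier E" "hnorm E (y - x) < r" using yW yn by (auto dest: W_D)
    have yx: "y - x \<in> hcarrier E" using y W_D[OF x] by simp
    let ?p = "\<lambda>s. prod_list (map (\<lambda>v. ev v s) vs)"
    let ?q = "\<lambda>s. mcoef c d a b k y s - mcoef c d a b k x s - mcoef c d a b (Suc k) x s * ev (y - x) s"
    have pR: "?p \<in> R" using vs by auto
    have cR: "mcoef c d a b k y \<in> R" "mcoef c d a b k x \<in> R" "mcoef c d a b (Suc k) x \<in> R"
      using mcoef_R[OF R] x yW by blast+
    have qR: "?q \<in> R" using cR yx by (intro R_diff R_mult) auto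
    have pn: "0 \<le> prod_list (map (hnorm E) vs)"
      using vs by (intro prod_list_nonneg) auto
    have m: "(\<lambda>s. mcoef c d a b k y s * ?p s) \<in> R" "(\<lambda>s. mcoef c d a b k x s * ?p s) \<in> R"
      "(\<lambda>s. mcoef c d a b (Suc k) x s * (ev (y - x) s * ?p s)) \<in> R"
      using cR pR yx by (intro R_mult; simp)+
    have "hnorm E (mk (\<lambda>s. mcoef c d a b k y s * ?p s) - mk (\<lambda>s. mcoef c d a b k x s * ?p s)
        - mk (\<lambda>s. mcoef c d a b (Suc k) x s * (ev (y - x) s * ?p s)))
      = nn (\<lambda>s. mcoef c d a b k y s * ?p s - mcoef c d a b k x s * ?p s
          - mcoef c d a b (Suc k) x s * (ev (y - x) s * ?p s))"
      unfolding nn_def using m by (simp only: mk_diff R_diff)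
    also have "\<dots> = nn (\<lambda>s. ?q s * ?p s)"
      using m by (intro nn_cong R_diff) (simp_all only: left_diff_distrib mult.assoc)
    also have "\<dots> \<le> K * (C * (hnorm E (y - x))\<^sup>2) * (nn (\<lambda>s. 1) * K ^ k * prod_list (map (hnorm E) vs))"
      using qR pR r(3)[OF y] nn_prod_list[of vs] vs by (intro nn_mult_le) auto
    also have "\<dots> = (C' * hnorm E (y - x)) * hnorm E (y - x) * prod_list (map (hnorm E) vs)"
      by (simp add: C'_def power2_eq_square mult_ac)
    also have "\<dots> \<le> e * hnorm E (y - x) * prod_list (map (hnorm E) vs)"
    proof (intro mult_right_mono pn hnorm_nonneg yx)
      have "C' * hnorm E (y - x) \<le> (C' + 1) * hnorm E (y - x)" using yx by (intro mult_right_mono) auto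
      also have "\<dots> \<le> e" using yn C' by (simp add: field_simps)
      finally show "C' * hnorm E (y - x) \<le> e" .
    qed
    finally show "hnorm E (mk (\<lambda>s. mcoef c d a b k y s * prod_list (map (\<lambda>v. ev v s) vs))
        - mk (\<lambda>s. mcoef c d a b k x s * prod_list (map (\<lambda>v. ev v s) vs))
        - mk (\<lambda>s. mcoef c d a b (Suc k) x s * prod_list (map (\<lambda>v. ev v s) ((y - x) # vs))))
      \<le> e * hnorm E (y - x) * prod_list (map (hnorm E) vs)" by simp
  qed
qed

section \<open>Unimodular functions\<close>

definition US :: "'a set" where
  "US = {x \<in> hcarrier E. \<forall>s\<in>I. cmod (ev x s) = 1}"

text \<open>The model space of the manifold: \<i> times the real-valued functions of the
  algebra.\<close>

definition IM :: "'a set" where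
  "IM = {x \<in> hcarrier E. \<forall>s\<in>I. Re (ev x s) = 0}"

lemma IM_cnj: "x \<in> IM \<Longrightarrow> s \<in> I \<Longrightarrow> cnj (ev x s) = - ev x s"
  by (simp add: IM_def complex_eq_iff)

lemma subspace_IM: "subspace IM"
  unfolding subspace_def IM_def using ev_scale[of 0 _ 0] by (auto simp: ev_add ev_scale)

lemma IM_subset: "IM \<subseteq> hcarrier E"
  by (auto simp: IM_def)

text \<open>Evaluation at a point is not assumed to be continuous. Closedness comes from the norm of
  \<open>ev x s + cnj (ev x s)\<close> instead, which isometric conjugation bounds by twice the
  distance from x to any element of \<open>IM\<close>.\<close>

lemma closedin_IM: "closedin (htopology E) IM"
proof (rule closedin_htopologyI[OF IM_subset])
  fix x assume x: "x \<in> hcarrier E" and c: "\<And>e. e > 0 \<Longrightarrow> \<exists>y\<in>IM. hnorm E (y - x) < e"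
  define z where "z = (\<lambda>s. ev x s + cnj (ev x s))"
  have zR: "z \<in> R" unfolding z_def using x by (intro R_add R_cnj) auto
  have "nn z \<le> 0 + e" if e: "e > 0" for e
  proof -
    obtain y where y: "y \<in> IM" "hnorm E (y - x) < e / 2" using c[of "e/2"] e by auto
    have yE: "y \<in> hcarrier E" using y IM_subset by auto
    have d: "ev (y - x) \<in> R" using yE x by simp
    have "nn z = nn (\<lambda>s. - (ev (y - x) s + cnj (ev (y - x) s)))"
      by (rule nn_cong[OF zR]) (use x yE IM_cnj[OF y(1)] in \<open>simp add: z_def ev_diff\<close>)
    also have "\<dots> = nn (\<lambda>s. ev (y - x) s + cnj (ev (y - x) s))"
      using d by (intro nn_minus R_add R_cnj)
    also have "\<dots> \<le> nn (ev (y - x)) + nn (\<lambda>s. cnj (ev (y - x) s))" using d by (intro nn_add R_cnj)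
    also have "\<dots> = 2 * hnorm E (y - x)" using d yE x by (simp add: nn_cnj nn_ev)
    finally show ?thesis using y by simp
  qed
  then have "nn z \<le> 0" by (rule field_le_epsilon)
  then have "mk z = 0" using zR hnorm_eq_0[of "mk z"] nn_nonneg[OF zR] unfolding nn_def by force
  then have "z s = 0" if "s \<in> I" for s using ev_mk[OF zR that] ev_scale[of 0 s 0] that by simp
  then show "x \<in> IM" using x by (auto simp: IM_def z_def complex_eq_iff)
qed

lemma hsmooth_on_open_subset:
  assumes "hsmooth_on E E' U f" "openin (htopology E) V" "V \<subseteq> U"
  shows "hsmooth_on E E' V f"
proof -
  have "hderivs E E' V f D" if "hderivs E E' U f D" for D
    unfolding hderivs_def
  proof (intro conjI allI ballI impI)
    show "D 0 x [] = f x" if "x \<in> V" for x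
      using hderivsD(1)[OF \<open>hderivs E E' U f D\<close>] assms(3) that by blast
    show "bounded_multilinear E E' k (D k x)" if "x \<in> V" for k x
      using hderivsD(2)[OF \<open>hderivs E E' U f D\<close>] assms(3) that by blast
    fix k x and e :: real assume "x \<in> V" "0 < e"
    then show "\<exists>d>0. \<forall>y\<in>V. hnorm E (y - x) < d \<longrightarrow>
           (\<forall>vs. length vs = k \<and> set vs \<subseteq> hcarrier E \<longrightarrow>
              hnorm E' (D k y vs - D k x vs - D (Suc k) x ((y - x) # vs))
                \<le> e * hnorm E (y - x) * prod_list (map (hnorm E) vs))"
      using hderivsD(3)[OF \<open>hderivs E E' U f D\<close>, of x e k] assms(3) by blast
  qed
  then show ?thesis using assms unfolding hsmooth_on_iff by blast
qed

text \<open>Half of x - cnj x projects onto the imaginary functions with norm at most 1, because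
  conjugation is an isometry; this is the projection that \<open>hsmooth_on_restrict\<close> asks
  for.\<close>

lemma hsmooth_on_IM:
  assumes f: "hsmooth_on E E U f" and fIM: "\<And>x. x \<in> U \<inter> IM \<Longrightarrow> f x \<in> IM"
  shows "hsmooth_on (E\<lparr>hcarrier := IM\<rparr>) (E\<lparr>hcarrier := IM\<rparr>) (U \<inter> IM) f"
proof (rule hsmooth_on_restrict[where P = "\<lambda>x. mk (\<lambda>s. of_real (1/2) * (ev x s - cnj (ev x s)))"])
  have pR: "(\<lambda>s. ev x s - cnj (ev x s)) \<in> R" "(\<lambda>s. of_real (1/2) * (ev x s - cnj (ev x s))) \<in> R"
    if "x \<in> hcarrier E" for x
    using that by (intro R_mult R_diff R_cnj R_const; simp)+
  show "pre_hilbert E" by unfold_locales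
  show "mk (\<lambda>s. of_real (1/2) * (ev x s - cnj (ev x s))) \<in> IM" if "x \<in> hcarrier E" for x
    using pR[OF that] by (auto simp: IM_def)
  show "mk (\<lambda>s. of_real (1/2) * (ev x s - cnj (ev x s))) = x" if "x \<in> IM" for x
    using that IM_subset by (intro mk_eqI) (auto simp: IM_cnj)
  show "mk (\<lambda>s. of_real (1/2) * (ev (x + y) s - cnj (ev (x + y) s)))
      = mk (\<lambda>s. of_real (1/2) * (ev x s - cnj (ev x s))) + mk (\<lambda>s. of_real (1/2) * (ev y s - cnj (ev y s)))"
    if "x \<in> hcarrier E" "y \<in> hcarrier E" for x y
    using that pR(2)[OF that(1)] pR(2)[OF that(2)]
    by (intro mk_eqI) (simp_all add: ev_add field_simps)
  show "mk (\<lambda>s. of_real (1/2) * (ev (c *\<^sub>R x) s - cnj (ev (c *\<^sub>R x) s)))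
      = c *\<^sub>R mk (\<lambda>s. of_real (1/2) * (ev x s - cnj (ev x s)))"
    if "x \<in> hcarrier E" for c x
    using that pR(2)[OF that] by (intro mk_eqI) (simp_all add: ev_scale field_simps)
  show "hnorm E (mk (\<lambda>s. of_real (1/2) * (ev x s - cnj (ev x s)))) \<le> hnorm E x" if "x \<in> hcarrier E" for x
  proof -
    have "nn (\<lambda>s. ev x s - cnj (ev x s)) \<le> nn (ev x) + nn (\<lambda>s. cnj (ev x s))"
      using that by (intro nn_diff R_cnj) auto
    also have "\<dots> = 2 * hnorm E x" using that by (simp add: nn_cnj nn_ev)
    finally show ?thesis using pR(1)[OF that] unfolding nn_def mk_scale[OF pR(1)[OF that]]
      by (simp add: hnorm_scale)
  qed
qed (use subspace_IM IM_subset f fIM in auto)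

text \<open>
  Charts are Cayley transforms: near a unimodular \<open>p\<close>, put \<open>w = (x/p - 1) / (x/p + 1)\<close>, so that
  \<open>x\<close> is unimodular if and only if \<open>w\<close> is imaginary; the inverse is \<open>x = p (1 + w) / (1 - w)\<close>.
\<close>

definition ch :: "'a \<Rightarrow> 'a \<Rightarrow> 'a" where
  "ch p = moeb (\<lambda>s. cnj (ev p s)) (\<lambda>s. -1) (\<lambda>s. cnj (ev p s)) (\<lambda>s. 1)"

definition dom :: "'a \<Rightarrow> 'a set" where
  "dom p = W (\<lambda>s. cnj (ev p s)) (\<lambda>s. 1)"

definition hc :: "'a \<Rightarrow> 'a \<Rightarrow> 'a" where
  "hc p = moeb (ev p) (ev p) (\<lambda>s. -1) (\<lambda>s. 1)"

definition cod :: "'a set" where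
  "cod = W (\<lambda>s. -1) (\<lambda>s. 1)"

lemma US_E: "p \<in> US \<Longrightarrow> p \<in> hcarrier E"
  by (simp add: US_def)

lemma US_cnj: "p \<in> US \<Longrightarrow> s \<in> I \<Longrightarrow> ev p s * cnj (ev p s) = 1"
  unfolding complex_norm_square[symmetric] US_def by simp

lemma USI: "p \<in> hcarrier E \<Longrightarrow> (\<And>s. s \<in> I \<Longrightarrow> ev p s * cnj (ev p s) = 1) \<Longrightarrow> p \<in> US"
  unfolding US_def complex_norm_square[symmetric]
  by (auto simp flip: of_real_power simp: abs_square_eq_1)

context
  fixes p assumes p: "p \<in> US"
begin

lemma cR: "(\<lambda>s. cnj (ev p s)) \<in> R"
  using US_E[OF p] by (intro R_cnj) auto

lemma chart_mem_dom: "p \<in> dom p"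
  unfolding dom_def W_def
proof (intro CollectI conjI US_E[OF p])
  have "inv_ok (\<lambda>s. 2)" by (rule inv_okI[of _ "\<lambda>s. 1/2"]) auto
  then show "inv_ok (den (\<lambda>s. cnj (ev p s)) (\<lambda>s. 1) p)"
    by (rule inv_ok_cong) (simp add: den_def US_cnj[OF p] mult.commute)
qed

text \<open>The last clause is the working formula: 1 - w and y + 1, with y = cnj p x, are
  reciprocal up to the factor 2, so one denominator is invertible exactly when the other is, and the
  chart maps \<open>dom p\<close> into \<open>cod\<close>.\<close>

lemma ch_props:
  assumes x: "x \<in> dom p"
  shows "ch p x \<in> cod" and "hc p (ch p x) = x" and "x \<in> US \<Longrightarrow> ch p x \<in> IM"
    and "s \<in> I \<Longrightarrow> 1 - ev (ch p x) s = 2 / (cnj (ev p s) * ev x s + 1)"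
proof -
  let ?y = "\<lambda>s. cnj (ev p s) * ev x s"
  have xE: "x \<in> hcarrier E" and xn: "\<And>s. s \<in> I \<Longrightarrow> ?y s + 1 \<noteq> 0" and xok: "inv_ok (\<lambda>s. ?y s + 1)"
    using x by (auto simp: dom_def W_def inv_ok_def den_def)
  have wE: "ch p x \<in> hcarrier E" using x cR unfolding ch_def dom_def by (intro moeb_mem) auto
  have w: "ev (ch p x) s = (?y s - 1) / (?y s + 1)" if "s \<in> I" for s
    using x cR that ev_moeb[of "\<lambda>s. cnj (ev p s)" "\<lambda>s. -1" x "\<lambda>s. cnj (ev p s)" "\<lambda>s. 1" s]
    unfolding ch_def dom_def by simp
  show w1: "1 - ev (ch p x) s = 2 / (?y s + 1)" if "s \<in> I" for s
    using xn[OF that] by (simp add: w[OF that] field_simps)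
  have "inv_ok (\<lambda>s. 1 - ev (ch p x) s)"
  proof (rule inv_okI)
    show "(\<lambda>s. 1 - ev (ch p x) s) \<in> R" using wE by (intro R_diff) auto
    show "(\<lambda>s. (?y s + 1) * (1/2)) \<in> R" using cR xE by (intro R_mult R_add) auto
    show "(1 - ev (ch p x) s) * ((?y s + 1) * (1/2)) = 1" if "s \<in> I" for s
    proof -
      have "2 / v * (v * (1/2)) = 1" if "v \<noteq> 0" for v :: complex using that by simp
      from this[OF xn[OF that]] show ?thesis unfolding w1[OF that] .
    qed
  qed
  then show wc: "ch p x \<in> cod" using wE by (simp add: cod_def W_def den_def)
  show "hc p (ch p x) = x"
  proof (rule ev_eqI[OF _ xE])
    show "hc p (ch p x) \<in> hcarrier E"
      using wc US_E[OF p] unfolding hc_def cod_def by (intro moeb_mem) auto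
    fix s assume s: "s \<in> I"
    have "ev (hc p (ch p x)) s = (ev p s * ev (ch p x) s + ev p s) / (- 1 * ev (ch p x) s + 1)"
      using wc US_E[OF p] s unfolding hc_def cod_def by (intro ev_moeb) auto
    also have "\<dots> = ev p s * (1 + ev (ch p x) s) / (1 - ev (ch p x) s)" by (simp add: algebra_simps)
    also have "1 + ev (ch p x) s = 2 * ?y s / (?y s + 1)" using xn[OF s] by (simp add: w[OF s] field_simps)
    also have "ev p s * (2 * ?y s / (?y s + 1)) / (1 - ev (ch p x) s) = ev p s * ?y s"
      using xn[OF s] by (simp add: w1[OF s])
    also have "\<dots> = ev x s" using US_cnj[OF p s] by (simp add: mult.assoc[symmetric])
    finally show "ev (hc p (ch p x)) s = ev x s" .
  qed
  show "ch p x \<in> IM" if xS: "x \<in> US"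
    unfolding IM_def
  proof (intro CollectI conjI ballI wE)
    fix s assume s: "s \<in> I"
    define y where "y = ?y s"
    have yy: "y * cnj y = 1"
    proof -
      have "y * cnj y = (ev p s * cnj (ev p s)) * (ev x s * cnj (ev x s))" by (simp add: y_def mult_ac)
      then show ?thesis using US_cnj[OF p s] US_cnj[OF xS s] by simp
    qed
    have y1: "y + 1 \<noteq> 0" "cnj y + 1 \<noteq> 0"
    proof -
      show y1: "y + 1 \<noteq> 0" using xn[OF s] by (simp add: y_def)
      have "cnj y + 1 = cnj (y + 1)" by simp
      then show "cnj y + 1 \<noteq> 0" using y1 by (simp only: complex_cnj_zero_iff not_False_eq_True)
    qed
    have "(y - 1) / (y + 1) + cnj ((y - 1) / (y + 1)) = 0"
      using y1 yy by (simp add: field_simps)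
    then have "2 * Re ((y - 1) / (y + 1)) = 0"
      by (metis complex_add_cnj of_real_eq_0_iff)
    then show "Re (ev (ch p x) s) = 0" by (simp add: w[OF s] y_def)
  qed
qed

lemma hc_props:
  assumes w: "w \<in> cod"
  shows "hc p w \<in> dom p" and "ch p (hc p w) = w" and "w \<in> IM \<Longrightarrow> hc p w \<in> US"
    and "s \<in> I \<Longrightarrow> ev (hc p w) s = ev p s * (1 + ev w s) / (1 - ev w s)"
proof -
  have wE: "w \<in> hcarrier E" and wn: "\<And>s. s \<in> I \<Longrightarrow> 1 - ev w s \<noteq> 0" and wok: "inv_ok (\<lambda>s. 1 - ev w s)"
    using w by (auto simp: cod_def W_def inv_ok_def den_def)
  have xE: "hc p w \<in> hcarrier E" using w US_E[OF p] unfolding hc_def cod_def by (intro moeb_mem) auto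
  show x: "ev (hc p w) s = ev p s * (1 + ev w s) / (1 - ev w s)" if "s \<in> I" for s
    using w US_E[OF p] that ev_moeb[of "ev p" "ev p" w "\<lambda>s. -1" "\<lambda>s. 1" s]
    unfolding hc_def cod_def by (simp add: algebra_simps)
  let ?y = "\<lambda>s. cnj (ev p s) * ev (hc p w) s"
  have y: "?y s = (1 + ev w s) / (1 - ev w s)" if "s \<in> I" for s
  proof -
    have "?y s = (ev p s * cnj (ev p s)) * ((1 + ev w s) / (1 - ev w s))" by (simp add: x[OF that])
    then show ?thesis by (simp add: US_cnj[OF p that])
  qed
  have y1: "?y s + 1 = 2 / (1 - ev w s)" if "s \<in> I" for s
    using wn[OF that] by (simp add: y[OF that] field_simps)
  have "inv_ok (\<lambda>s. ?y s + 1)"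
  proof (rule inv_okI)
    show "(\<lambda>s. ?y s + 1) \<in> R" using cR xE by (intro R_add R_mult) auto
    show "(\<lambda>s. (1 - ev w s) * (1/2)) \<in> R" using wE by (intro R_mult R_diff) auto
    show "(?y s + 1) * ((1 - ev w s) * (1/2)) = 1" if "s \<in> I" for s
      using wn[OF that] by (simp add: y1[OF that])
  qed
  then show d: "hc p w \<in> dom p" using xE by (simp add: dom_def W_def den_def)
  show "ch p (hc p w) = w"
  proof (rule ev_eqI[OF _ wE])
    show "ch p (hc p w) \<in> hcarrier E" using ch_props(1)[OF d] by (simp add: cod_def W_def)
    fix s assume s: "s \<in> I"
    have "1 - ev (ch p (hc p w)) s = 1 - ev w s"
      unfolding ch_props(4)[OF d s] y1[OF s] using wn[OF s] by simp
    then show "ev (ch p (hc p w)) s = ev w s" by simp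
  qed
  show "hc p w \<in> US" if wI: "w \<in> IM"
  proof (rule USI[OF xE])
    fix s assume s: "s \<in> I"
    have "1 + ev w s = cnj (1 - ev w s)" using IM_cnj[OF wI s] by simp
    then have nz: "1 + ev w s \<noteq> 0" using wn[OF s] by (simp only: complex_cnj_zero_iff not_False_eq_True)
    have c: "cnj (ev (hc p w) s) = cnj (ev p s) * (1 - ev w s) / (1 + ev w s)"
      using IM_cnj[OF wI s] by (simp add: x[OF s])
    have "(a * u / v) * (b * v / u) = a * b" if "u \<noteq> 0" "v \<noteq> 0" for a b u v :: complex
      using that by simp
    from this[OF nz wn[OF s]] have "ev (hc p w) s * cnj (ev (hc p w) s) = ev p s * cnj (ev p s)"
      unfolding c unfolding x[OF s] .
    then show "ev (hc p w) s * cnj (ev (hc p w) s) = 1" using US_cnj[OF p s] by simp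
  qed
qed

lemma bij_ch: "bij_betw (ch p) (dom p) cod"
  by (rule bij_betw_byWitness[where f' = "hc p"]) (auto simp: ch_props hc_props)

lemma inv_ch: "w \<in> cod \<Longrightarrow> inv_into (dom p) (ch p) w = hc p w"
  using bij_ch hc_props by (intro inv_into_f_eq) (auto simp: bij_betw_def)

lemma ch_image: "ch p ` (dom p \<inter> US) = cod \<inter> IM"
proof (intro equalityI subsetI)
  fix w assume w: "w \<in> cod \<inter> IM"
  then have "w = ch p (hc p w)" "hc p w \<in> dom p \<inter> US" using hc_props by auto
  then show "w \<in> ch p ` (dom p \<inter> US)" by blast
qed (auto simp: ch_props)

lemma hsmooth_ch: "hsmooth_on E E (dom p) (ch p)"
  unfolding dom_def ch_def using cR by (intro hsmooth_on_moeb) auto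

lemma hsmooth_hc: "hsmooth_on E E cod (hc p)"
  unfolding cod_def hc_def using US_E[OF p] by (intro hsmooth_on_moeb) auto

lemma hdiffeo_ch: "hdiffeomorphism E E (dom p) cod (ch p)"
  unfolding hdiffeomorphism_def
  using bij_ch hsmooth_ch hsmooth_on_cong[OF hsmooth_hc] inv_ch by simp

end

theorem unimodular_hilbert_submanifold: "hilbert_submanifold E US"
  unfolding hilbert_submanifold_def
proof (intro conjI complete)
  show "US \<subseteq> hcarrier E" using US_E by blast
  have "\<exists>U V \<phi>. p \<in> U \<and> hdiffeomorphism E E U V \<phi> \<and> \<phi> ` (U \<inter> US) = V \<inter> IM" if "p \<in> US" for p
    using chart_mem_dom[OF that] hdiffeo_ch[OF that] ch_image[OF that] by blast
  then show "\<exists>F. subspace F \<and> closedin (htopology E) F \<and>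
      (\<forall>p\<in>US. \<exists>U V \<phi>. p \<in> U \<and> hdiffeomorphism E E U V \<phi> \<and> \<phi> ` (U \<inter> US) = V \<inter> F)"
    using subspace_IM closedin_IM by (intro exI[of _ IM]) simp
qed
text \<open>Composing two Cayley transforms gives a Moebius map again, with coefficients built from
  the quotient A of p by q. The chart change is therefore smooth by \<open>hsmooth_on_moeb\<close>,
  without composing derivatives.\<close>

lemma ch_overlap:
  assumes p: "p \<in> US" and q: "q \<in> US"
  defines "A \<equiv> \<lambda>s. cnj (ev q s) * ev p s"
  defines "V \<equiv> W (\<lambda>s. A s - 1) (\<lambda>s. A s + 1) \<inter> cod"
  shows "ch p ` (dom p \<inter> US \<inter> (dom q \<inter> US)) = V \<inter> IM"
    and "w \<in> V \<Longrightarrow> ch q (hc p w) = moeb (\<lambda>s. A s + 1) (\<lambda>s. A s - 1) (\<lambda>s. A s - 1) (\<lambda>s. A s + 1) w"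
proof -
  have AR: "A \<in> R" unfolding A_def using US_E[OF p] US_E[OF q] by (intro R_mult R_cnj) auto
  have qden: "den (\<lambda>s. cnj (ev q s)) (\<lambda>s. 1) (hc p w) s = den (\<lambda>s. A s - 1) (\<lambda>s. A s + 1) w s * inverse (1 - ev w s)"
    and wok: "inv_ok (\<lambda>s. 1 - ev w s)"
    and wn: "1 - ev w s \<noteq> 0" if w: "w \<in> cod" and s: "s \<in> I" for w s
  proof -
    show "inv_ok (\<lambda>s. 1 - ev w s)" using w by (simp add: cod_def W_def den_def)
    then show n: "1 - ev w s \<noteq> 0" using s by (simp add: inv_ok_def)
    then have "1 = (1 - ev w s) * inverse (1 - ev w s)" by simp
    then have "cnj (ev q s) * (ev p s * (1 + ev w s) / (1 - ev w s)) + 1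
        = (A s * (1 + ev w s) + (1 - ev w s)) * inverse (1 - ev w s)"
      by (simp only: A_def divide_inverse distrib_right mult.assoc)
    also have "A s * (1 + ev w s) + (1 - ev w s) = den (\<lambda>s. A s - 1) (\<lambda>s. A s + 1) w s"
      by (simp add: den_def algebra_simps)
    finally show "den (\<lambda>s. cnj (ev q s)) (\<lambda>s. 1) (hc p w) s
        = den (\<lambda>s. A s - 1) (\<lambda>s. A s + 1) w s * inverse (1 - ev w s)"
      by (simp add: den_def hc_props(4)[OF p w s])
  qed
  have wok: "inv_ok (\<lambda>s. 1 - ev w s)" "inv_ok (\<lambda>s. inverse (1 - ev w s))" if w: "w \<in> cod" for w
  proof -
    show ok: "inv_ok (\<lambda>s. 1 - ev w s)" using w by (simp add: cod_def W_def den_def)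
    then show "inv_ok (\<lambda>s. inverse (1 - ev w s))" by (auto simp: inv_ok_def)
  qed
  have iff: "hc p w \<in> dom q \<longleftrightarrow> w \<in> W (\<lambda>s. A s - 1) (\<lambda>s. A s + 1)" if w: "w \<in> cod" for w
  proof
    have wE: "w \<in> hcarrier E" using w by (simp add: cod_def W_def)
    have hE: "hc p w \<in> hcarrier E" using hc_props(1)[OF p w] by (simp add: dom_def W_def)
    {
      assume "hc p w \<in> dom q"
      then have "inv_ok (den (\<lambda>s. cnj (ev q s)) (\<lambda>s. 1) (hc p w))" by (simp add: dom_def W_def)
      then have "inv_ok (\<lambda>s. den (\<lambda>s. cnj (ev q s)) (\<lambda>s. 1) (hc p w) s * (1 - ev w s))"
        using wok(1)[OF w] by (rule inv_ok_mult)
      then have "inv_ok (den (\<lambda>s. A s - 1) (\<lambda>s. A s + 1) w)"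
        by (rule inv_ok_cong) (use qden[OF w] wn[OF w] in simp)
      then show "w \<in> W (\<lambda>s. A s - 1) (\<lambda>s. A s + 1)" using wE by (simp add: W_def)
    next
      assume "w \<in> W (\<lambda>s. A s - 1) (\<lambda>s. A s + 1)"
      then have "inv_ok (den (\<lambda>s. A s - 1) (\<lambda>s. A s + 1) w)" by (simp add: W_def)
      then have "inv_ok (\<lambda>s. den (\<lambda>s. A s - 1) (\<lambda>s. A s + 1) w s * inverse (1 - ev w s))"
        using wok(2)[OF w] by (rule inv_ok_mult)
      then have "inv_ok (den (\<lambda>s. cnj (ev q s)) (\<lambda>s. 1) (hc p w))"
        by (rule inv_ok_cong) (use qden[OF w] in simp)
      then show "hc p w \<in> dom q" using hE by (simp add: dom_def W_def)
    }
  qed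
  show "ch p ` (dom p \<inter> US \<inter> (dom q \<inter> US)) = V \<inter> IM"
  proof (intro equalityI subsetI)
    fix w assume "w \<in> ch p ` (dom p \<inter> US \<inter> (dom q \<inter> US))"
    then obtain x where x: "x \<in> dom p" "x \<in> US" "x \<in> dom q" "w = ch p x" by blast
    then show "w \<in> V \<inter> IM"
      using ch_props(1-3)[OF p x(1)] iff[of w] by (simp add: V_def)
  next
    fix w assume w: "w \<in> V \<inter> IM"
    then have "hc p w \<in> dom p \<inter> US \<inter> (dom q \<inter> US)"
      using hc_props[OF p, of w] iff[of w] by (simp add: V_def)
    moreover have "w = ch p (hc p w)" using hc_props(2)[OF p, of w] w by (simp add: V_def)
    ultimately show "w \<in> ch p ` (dom p \<inter> US \<inter> (dom q \<inter> US))" by blast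
  qed
  assume w: "w \<in> V"
  then have wc: "w \<in> cod" and wW: "w \<in> W (\<lambda>s. A s - 1) (\<lambda>s. A s + 1)" by (auto simp: V_def)
  have d: "hc p w \<in> dom q" using iff[OF wc] wW by simp
  show "ch q (hc p w) = moeb (\<lambda>s. A s + 1) (\<lambda>s. A s - 1) (\<lambda>s. A s - 1) (\<lambda>s. A s + 1) w"
  proof (rule ev_eqI)
    show "ch q (hc p w) \<in> hcarrier E" using ch_props(1)[OF q d] by (simp add: cod_def W_def)
    show "moeb (\<lambda>s. A s + 1) (\<lambda>s. A s - 1) (\<lambda>s. A s - 1) (\<lambda>s. A s + 1) w \<in> hcarrier E"
      using AR wW by (intro moeb_mem) auto
    fix s assume s: "s \<in> I"
    define D where "D = den (\<lambda>s. A s - 1) (\<lambda>s. A s + 1) w s"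
    have D: "D \<noteq> 0" using wW s by (simp add: D_def W_def inv_ok_def)
    have "1 - ev (ch q (hc p w)) s = 2 / (D * inverse (1 - ev w s))"
      using ch_props(4)[OF q d s] qden[OF wc s] by (simp add: den_def D_def)
    then have "ev (ch q (hc p w)) s = 1 - 2 * (1 - ev w s) / D"
      by (simp add: field_simps)
    also have "\<dots> = (D - 2 * (1 - ev w s)) / D" using D by (simp add: diff_divide_distrib)
    also have "D - 2 * (1 - ev w s) = (A s + 1) * ev w s + (A s - 1)"
      by (simp add: D_def den_def algebra_simps)
    also have "((A s + 1) * ev w s + (A s - 1)) / D
        = ev (moeb (\<lambda>s. A s + 1) (\<lambda>s. A s - 1) (\<lambda>s. A s - 1) (\<lambda>s. A s + 1) w) s"
      using AR wW s by (subst ev_moeb) (auto simp: D_def den_def)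
    finally show "ev (ch q (hc p w)) s
        = ev (moeb (\<lambda>s. A s + 1) (\<lambda>s. A s - 1) (\<lambda>s. A s - 1) (\<lambda>s. A s + 1) w) s" .
  qed
qed

theorem unimodular_hilbert_manifold:
  "hilbert_manifold (E\<lparr>hcarrier := IM\<rparr>) (subtopology (htopology E) US)"
  unfolding hilbert_manifold_def
proof (intro conjI)
  show "hilbert_space (E\<lparr>hcarrier := IM\<rparr>)"
    by (rule hilbert_space_restrict[OF subspace_IM closedin_IM complete])
  show "Hausdorff_space (subtopology (htopology E) US)"
    by (intro Hausdorff_space_subtopology Hausdorff_htopology)
  let ?X = "subtopology (htopology E) US" and ?F = "htopology (E\<lparr>hcarrier := IM\<rparr>)"
  have ht: "?F = subtopology (htopology E) IM" by (rule htopology_restrict[OF subspace_IM IM_subset])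
  have sUS: "subtopology ?X (dom p \<inter> US) = subtopology (htopology E) (dom p \<inter> US)" for p
    by (simp add: subtopology_subtopology Int_commute Int_left_commute)
  have sIM: "subtopology ?F (cod \<inter> IM) = subtopology (htopology E) (cod \<inter> IM)"
    by (simp add: ht subtopology_subtopology Int_commute Int_left_commute)
  have pE: "pre_hilbert E" by unfold_locales
  have domo: "openin (htopology E) (dom p)" if "p \<in> US" for p
    using hsmooth_ch[OF that] by (simp add: hsmooth_on_iff)
  have codo: "openin (htopology E) cod" unfolding cod_def by (intro openin_W) auto
  show "\<exists>\<A>. (\<forall>(U, \<phi>)\<in>\<A>. openin ?X U \<and> openin ?F (\<phi> ` U) \<and>
           homeomorphic_map (subtopology ?X U) (subtopology ?F (\<phi> ` U)) \<phi>) \<and>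
        (\<Union>(U, \<phi>)\<in>\<A>. U) = topspace ?X \<and>
        (\<forall>(U, \<phi>)\<in>\<A>. \<forall>(V, \<psi>)\<in>\<A>.
           hsmooth_on (E\<lparr>hcarrier := IM\<rparr>) (E\<lparr>hcarrier := IM\<rparr>) (\<phi> ` (U \<inter> V)) (\<psi> \<circ> inv_into U \<phi>))"
  proof (intro exI[of _ "(\<lambda>p. (dom p \<inter> US, ch p)) ` US"] conjI)
    show "(\<Union>(U, \<phi>)\<in>(\<lambda>p. (dom p \<inter> US, ch p)) ` US. U) = topspace ?X"
      using chart_mem_dom US_E by auto
    show "\<forall>(U, \<phi>)\<in>(\<lambda>p. (dom p \<inter> US, ch p)) ` US. openin ?X U \<and> openin ?F (\<phi> ` U) \<and>
           homeomorphic_map (subtopology ?X U) (subtopology ?F (\<phi> ` U)) \<phi>"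
    proof (clarify, intro conjI)
      fix p assume p: "p \<in> US"
      show "openin ?X (dom p \<inter> US)" using domo[OF p] by (auto simp: openin_subtopology)
      show "openin ?F (ch p ` (dom p \<inter> US))"
        unfolding ch_image[OF p] by (rule openin_restrict[OF subspace_IM IM_subset codo])
      have "homeomorphic_maps (subtopology (htopology E) (dom p \<inter> US))
          (subtopology (htopology E) (cod \<inter> IM)) (ch p) (hc p)"
        unfolding homeomorphic_maps_def
      proof (intro conjI)
        have "continuous_map (subtopology (htopology E) (dom p)) (htopology E) (ch p)"
          by (rule hsmooth_on_imp_continuous_map[OF pE pE hsmooth_ch[OF p]])
        then have "continuous_map (subtopology (htopology E) (dom p \<inter> US)) (htopology E) (ch p)"
          by (rule continuous_map_from_subtopology_mono) auto
        then show "continuous_map (subtopology (htopology E) (dom p \<inter> US))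
            (subtopology (htopology E) (cod \<inter> IM)) (ch p)"
          by (auto simp: continuous_map_in_subtopology ch_props[OF p])
        have "continuous_map (subtopology (htopology E) cod) (htopology E) (hc p)"
          by (rule hsmooth_on_imp_continuous_map[OF pE pE hsmooth_hc[OF p]])
        then have "continuous_map (subtopology (htopology E) (cod \<inter> IM)) (htopology E) (hc p)"
          by (rule continuous_map_from_subtopology_mono) auto
        then show "continuous_map (subtopology (htopology E) (cod \<inter> IM))
            (subtopology (htopology E) (dom p \<inter> US)) (hc p)"
          by (auto simp: continuous_map_in_subtopology hc_props[OF p])
      qed (auto simp: ch_props[OF p] hc_props[OF p])
      then show "homeomorphic_map (subtopology ?X (dom p \<inter> US))
          (subtopology ?F (ch p ` (dom p \<inter> US))) (ch p)"
        unfolding ch_image[OF p] sUS sIM homeomorphic_map_maps by blast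
    qed
    have tr: "hsmooth_on (E\<lparr>hcarrier := IM\<rparr>) (E\<lparr>hcarrier := IM\<rparr>) (ch p ` (dom p \<inter> US \<inter> (dom q \<inter> US)))
        (ch q \<circ> inv_into (dom p \<inter> US) (ch p))" if p: "p \<in> US" and q: "q \<in> US" for p q
    proof -
      define A where "A = (\<lambda>s. cnj (ev q s) * ev p s)"
      define V where "V = W (\<lambda>s. A s - 1) (\<lambda>s. A s + 1) \<inter> cod"
      define m where "m = moeb (\<lambda>s. A s + 1) (\<lambda>s. A s - 1) (\<lambda>s. A s - 1) (\<lambda>s. A s + 1)"
      have AR: "A \<in> R" unfolding A_def using US_E[OF p] US_E[OF q] by (intro R_mult R_cnj) auto
      have img: "ch p ` (dom p \<inter> US \<inter> (dom q \<inter> US)) = V \<inter> IM"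
        unfolding V_def A_def by (rule ch_overlap(1)[OF p q])
      have trm: "ch q (hc p w) = m w" if "w \<in> V" for w
        using that unfolding V_def A_def m_def by (rule ch_overlap(2)[OF p q])
      have inv: "inv_into (dom p \<inter> US) (ch p) w = hc p w" if w: "w \<in> cod \<inter> IM" for w
      proof (rule inv_into_f_eq)
        show "inj_on (ch p) (dom p \<inter> US)"
          using bij_ch[OF p] by (auto simp: bij_betw_def intro: inj_on_subset)
      qed (use w hc_props[OF p, of w] in auto)
      have "hsmooth_on E E (W (\<lambda>s. A s - 1) (\<lambda>s. A s + 1)) m"
        unfolding m_def using AR by (intro hsmooth_on_moeb R_add R_diff R_const)
      then have "hsmooth_on E E V m"
        by (rule hsmooth_on_open_subset) (use AR codo in \<open>auto simp: V_def intro!: openin_Int openin_W\<close>)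
      then have "hsmooth_on (E\<lparr>hcarrier := IM\<rparr>) (E\<lparr>hcarrier := IM\<rparr>) (V \<inter> IM) m"
      proof (rule hsmooth_on_IM)
        fix w assume w: "w \<in> V \<inter> IM"
        then obtain x where x: "x \<in> dom p" "x \<in> US" "x \<in> dom q" "w = ch p x"
          using img by blast
        have "m w = ch q x" using trm[of w] w x ch_props(2)[OF p x(1)] by auto
        then show "m w \<in> IM" using ch_props(3)[OF q x(3) x(2)] by simp
      qed
      then show ?thesis
        unfolding img by (rule hsmooth_on_cong) (auto simp: V_def inv trm)
    qed
    show "\<forall>(U, \<phi>)\<in>(\<lambda>p. (dom p \<inter> US, ch p)) ` US. \<forall>(V, \<psi>)\<in>(\<lambda>p. (dom p \<inter> US, ch p)) ` US.
        hsmooth_on (E\<lparr>hcarrier := IM\<rparr>) (E\<lparr>hcarrier := IM\<rparr>) (\<phi> ` (U \<inter> V)) (\<psi> \<circ> inv_into U \<phi>)"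
      using tr by blast
  qed
qed

end

section \<open>Absolutely continuous functions on the open interval\<close>

text \<open>Local absolute continuity of f on the open interval, with density g. Values at the end
  points do not enter, and g matters only up to null sets.\<close>

definition acd :: "(real \<Rightarrow> complex) \<Rightarrow> (real \<Rightarrow> complex) \<Rightarrow> bool" where
  "acd f g \<longleftrightarrow> (\<forall>a b. -1 < a \<and> a \<le> b \<and> b < 1 \<longrightarrow>
     g absolutely_integrable_on {a..b} \<and> f b - f a = integral {a..b} g)"

lemma acd_integrable: "acd f g \<Longrightarrow> -1 < a \<Longrightarrow> b < 1 \<Longrightarrow> g absolutely_integrable_on {a..b}"
  unfolding acd_def by (cases "a \<le> b") auto

lemma acd_diff_eq: "acd f g \<Longrightarrow> -1 < a \<Longrightarrow> a \<le> b \<Longrightarrow> b < 1 \<Longrightarrow> f b - f a = integral {a..b} g"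
  unfolding acd_def by blast

lemma acdI:
  assumes "\<And>a b. -1 < a \<Longrightarrow> a \<le> b \<Longrightarrow> b < 1 \<Longrightarrow> g absolutely_integrable_on {a..b}"
    "\<And>a b. -1 < a \<Longrightarrow> a \<le> b \<Longrightarrow> b < 1 \<Longrightarrow> f b - f a = integral {a..b} g"
  shows "acd f g"
  using assms unfolding acd_def by blast

lemma absint_imp_int: "f absolutely_integrable_on S \<Longrightarrow> f integrable_on (S::real set)"
  for f :: "real \<Rightarrow> 'a::euclidean_space"
  by (rule set_lebesgue_integral_eq_integral(1))

lemma absint_norm_int: "f absolutely_integrable_on S \<Longrightarrow> (\<lambda>s. norm (f s)) integrable_on (S::real set)"
  for f :: "real \<Rightarrow> 'a::euclidean_space"
  by (rule absint_imp_int[OF absolutely_integrable_norm[unfolded o_def]])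

lemma acd_continuous_on_Icc:
  assumes f: "acd f g" and ab: "-1 < a" "b < 1"
  shows "continuous_on {a..b} f"
proof (cases "a \<le> b")
  case True
  have "continuous_on {a..b} (\<lambda>x. f a + integral {a..x} g)"
    by (intro continuous_intros indefinite_integral_continuous_1 absint_imp_int acd_integrable[OF f] ab)
  then show ?thesis
  proof (rule continuous_on_eq)
    fix x assume x: "x \<in> {a..b}"
    then show "f a + integral {a..x} g = f x" using acd_diff_eq[OF f ab(1), of x, symmetric] ab by simp
  qed
qed auto

lemma acd_continuous_on:
  assumes f: "acd f g"
  shows "continuous_on {-1<..<1} f"
proof (rule continuous_at_imp_continuous_on, rule ballI)
  fix x :: real assume x: "x \<in> {-1<..<1}"
  define a b where "a = (x - 1) / 2" and "b = (x + 1) / 2"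
  have ab: "-1 < a" "a < x" "x < b" "b < 1" using x by (auto simp: a_def b_def)
  have "continuous_on {a..b} f" using acd_continuous_on_Icc[OF f] ab by simp
  then show "isCont f x"
    by (rule continuous_on_interior) (use ab in simp)
qed

lemma acd_norm_diff:
  assumes f: "acd f g" and ab: "-1 < a" "a \<le> b" "b < 1"
  shows "cmod (f b - f a) \<le> integral {a..b} (\<lambda>s. cmod (g s))"
  unfolding acd_diff_eq[OF f ab]
  using acd_integrable[OF f ab(1,3)]
  by (intro integral_norm_bound_integral absint_imp_int absint_norm_int) auto

lemma acd_cong:
  assumes "acd f g" "\<And>s. s \<in> {-1<..<1} \<Longrightarrow> f s = f' s" "\<And>s. s \<in> {-1<..<1} \<Longrightarrow> g s = g' s"
  shows "acd f' g'"
proof (rule acdI)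
  fix a b :: real assume ab: "-1 < a" "a \<le> b" "b < 1"
  have e: "g s = g' s" if "s \<in> {a..b}" for s using assms(3) that ab by auto
  show "g' absolutely_integrable_on {a..b}"
    using acd_integrable[OF assms(1) ab(1,3)] by (rule absolutely_integrable_spike[OF _ negligible_empty]) (use e in auto)
  show "f' b - f' a = integral {a..b} g'"
    using acd_diff_eq[OF assms(1) ab] assms(2)[of a] assms(2)[of b] ab integral_cong[of "{a..b}" g g', OF e]
    by simp
qed

lemma acd_add:
  assumes f: "acd f f'" and g: "acd g g'"
  shows "acd (\<lambda>s. f s + g s) (\<lambda>s. f' s + g' s)"
proof (rule acdI)
  fix a b :: real assume ab: "-1 < a" "a \<le> b" "b < 1"
  note i = acd_integrable[OF f ab(1,3)] acd_integrable[OF g ab(1,3)]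
  show "(\<lambda>s. f' s + g' s) absolutely_integrable_on {a..b}" using i by (rule set_integral_add)
  show "f b + g b - (f a + g a) = integral {a..b} (\<lambda>s. f' s + g' s)"
    using acd_diff_eq[OF f ab] acd_diff_eq[OF g ab] i
    by (simp add: Henstock_Kurzweil_Integration.integral_add absint_imp_int algebra_simps)
qed

lemma acd_diff:
  assumes f: "acd f f'" and g: "acd g g'"
  shows "acd (\<lambda>s. f s - g s) (\<lambda>s. f' s - g' s)"
proof (rule acdI)
  fix a b :: real assume ab: "-1 < a" "a \<le> b" "b < 1"
  note i = acd_integrable[OF f ab(1,3)] acd_integrable[OF g ab(1,3)]
  show "(\<lambda>s. f' s - g' s) absolutely_integrable_on {a..b}" using i by (rule set_integral_diff)
  show "f b - g b - (f a - g a) = integral {a..b} (\<lambda>s. f' s - g' s)"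
    using acd_diff_eq[OF f ab] acd_diff_eq[OF g ab] i
    by (simp add: Henstock_Kurzweil_Integration.integral_diff absint_imp_int algebra_simps)
qed

lemma acd_linear:
  assumes h: "bounded_linear h" and f: "acd f f'"
  shows "acd (\<lambda>s. h (f s)) (\<lambda>s. h (f' s))"
proof (rule acdI)
  fix a b :: real assume ab: "-1 < a" "a \<le> b" "b < 1"
  note i = acd_integrable[OF f ab(1,3)]
  show "(\<lambda>s. h (f' s)) absolutely_integrable_on {a..b}"
    using absolutely_integrable_linear[OF i h] by (simp add: o_def)
  show "h (f b) - h (f a) = integral {a..b} (\<lambda>s. h (f' s))"
    using integral_linear[OF absint_imp_int[OF i] h] acd_diff_eq[OF f ab]
    by (simp add: o_def bounded_linear.linear[OF h] linear_diff[symmetric])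
qed

lemma acd_const: "acd (\<lambda>s. c) (\<lambda>s. 0)"
  by (rule acdI) auto

lemma acd_cmult: "acd f f' \<Longrightarrow> acd (\<lambda>s. c * f s) (\<lambda>s. c * f' s)"
  by (rule acd_linear[OF bounded_linear_mult_right])

lemma acd_cnj: "acd f f' \<Longrightarrow> acd (\<lambda>s. cnj (f s)) (\<lambda>s. cnj (f' s))"
  by (rule acd_linear[OF bounded_linear_cnj])

lemma acd_sum: "(\<And>i. i \<in> A \<Longrightarrow> acd (f i) (f' i)) \<Longrightarrow> acd (\<lambda>s. \<Sum>i\<in>A. f i s) (\<lambda>s. \<Sum>i\<in>A. f' i s)"
  by (induction A rule: infinite_finite_induct) (auto intro: acd_add acd_const)

lemma acd_C1:
  assumes d: "\<And>s. s \<in> {-1<..<1} \<Longrightarrow> (f has_vector_derivative g s) (at s)" and g: "continuous_on {-1<..<1} g"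
  shows "acd f g"
proof (rule acdI)
  fix a b :: real assume ab: "-1 < a" "a \<le> b" "b < 1"
  show "g absolutely_integrable_on {a..b}"
    using g ab by (intro absolutely_integrable_continuous_real continuous_on_subset[OF g]) auto
  show "f b - f a = integral {a..b} g"
    using fundamental_theorem_of_calculus[OF ab(2), of f g] d ab
    by (auto simp: integral_unique has_vector_derivative_at_within)
qed

lemma acd_has_vector_derivative:
  assumes f: "acd f g" and g: "continuous_on {-1<..<1} g" and s: "s \<in> {-1<..<1}"
  shows "(f has_vector_derivative g s) (at s)"
proof -
  define a b where "a = (s - 1) / 2" and "b = (s + 1) / 2"
  have ab: "-1 < a" "a < s" "s < b" "b < 1" using s by (auto simp: a_def b_def)
  have "((\<lambda>u. integral {a..u} g) has_vector_derivative g s) (at s within {a..b})"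
    by (rule integral_has_vector_derivative) (use g ab in \<open>auto intro: continuous_on_subset\<close>)
  then have "((\<lambda>u. f a + integral {a..u} g) has_vector_derivative 0 + g s) (at s within {a..b})"
    by (intro has_vector_derivative_add has_vector_derivative_const)
  then have "(f has_vector_derivative g s) (at s within {a..b})"
    unfolding add_0_left
  proof (rule has_vector_derivative_transform[rotated -1])
    fix x assume x: "x \<in> {a..b}"
    then show "f x = f a + integral {a..x} g" using acd_diff_eq[OF f ab(1), of x, symmetric] ab by simp
  qed (use ab in auto)
  then show ?thesis using ab by (simp add: at_within_Icc_at)
qed

text \<open>The base point 0 makes the primitive of an even function odd.\<close>

definition prim :: "(real \<Rightarrow> complex) \<Rightarrow> real \<Rightarrow> complex" where
  "prim g s = (if 0 \<le> s then integral {0..s} g else - integral {s..0} g)"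

lemma acd_prim:
  assumes "\<And>a b. -1 < a \<Longrightarrow> b < 1 \<Longrightarrow> g absolutely_integrable_on {a..b}"
  shows "acd (prim g) g"
proof (rule acdI)
  fix a b :: real assume ab: "-1 < a" "a \<le> b" "b < 1"
  show "g absolutely_integrable_on {a..b}" using assms ab by blast
  have c: "integral {x..y} g + integral {y..z} g = integral {x..z} g" if "-1 < x" "x \<le> y" "y \<le> z" "z < 1" for x y z
    using that assms by (intro Henstock_Kurzweil_Integration.integral_combine absint_imp_int) auto
  show "prim g b - prim g a = integral {a..b} g"
    using c[of 0 a b] c[of a 0 b] c[of a b 0] ab unfolding prim_def
    by (cases "0 \<le> a"; cases "0 \<le> b") (auto simp: algebra_simps)
qed

lemma prim_0 [simp]: "prim g 0 = 0"
  by (simp add: prim_def)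

text \<open>
  The product and chain rules reduce to this: a function whose increments are quadratically small
  against those of a continuous monotone function is constant.
\<close>

lemma const_if_quadratic_increments:
  fixes G :: "real \<Rightarrow> 'a::real_normed_vector" and A :: "real \<Rightarrow> real"
  assumes ab: "a \<le> b" and A: "continuous_on {a..b} A"
    and mono: "\<And>s t. a \<le> s \<Longrightarrow> s \<le> t \<Longrightarrow> t \<le> b \<Longrightarrow> A s \<le> A t"
    and quad: "\<And>s t. a \<le> s \<Longrightarrow> s \<le> t \<Longrightarrow> t \<le> b \<Longrightarrow> norm (G t - G s) \<le> C * (A t - A s)\<^sup>2"
  shows "G b = G a"
proof -
  have *: "norm (G b - G a) \<le> e * (A b - A a)" if e: "e > 0" for e
  proof -
    \<comment> \<open>The bound with e is additive over adjacent intervals, and on short intervals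
      it follows from the quadratic one, because A is continuous; \<open>Bolzano\<close> then
      carries it to the whole interval.\<close>
    define P where "P s t \<longleftrightarrow> (a \<le> s \<and> s \<le> t \<and> t \<le> b \<longrightarrow> norm (G t - G s) \<le> e * (A t - A s))" for s t
    have trans: "P x z" if xyz: "P x y" "P y z" "x \<le> y" "y \<le> z" for x y z
    proof -
      show ?thesis
        unfolding P_def
      proof
        assume h: "a \<le> x \<and> x \<le> z \<and> z \<le> b"
        have "norm (G z - G x) \<le> norm (G z - G y) + norm (G y - G x)"
          using norm_triangle_ineq[of "G z - G y" "G y - G x"] by simp
        also have "\<dots> \<le> e * (A z - A y) + e * (A y - A x)"
          using xyz h unfolding P_def by (intro add_mono) auto
        finally show "norm (G z - G x) \<le> e * (A z - A x)" by (simp add: algebra_simps)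
      qed
    qed
    have local: "\<exists>d>0. \<forall>s t. s \<le> x \<and> x \<le> t \<and> t - s < d \<longrightarrow> P s t" if x: "a \<le> x" "x \<le> b" for x
    proof -
      \<comment> \<open>Chosen so that (|C| + 1) * 2 \<eta> = e, since the increment of A near x is
        at most 2 \<eta>.\<close>
      define \<eta> where "\<eta> = e / (2 * (\<bar>C\<bar> + 1))"
      have \<eta>: "\<eta> > 0" using e by (simp add: \<eta>_def)
      obtain d where d: "d > 0" "\<And>y. y \<in> {a..b} \<Longrightarrow> dist y x < d \<Longrightarrow> dist (A y) (A x) < \<eta>"
      proof -
        have "x \<in> {a..b}" using x by simp
        then show ?thesis using A \<eta> that unfolding continuous_on_iff by blast
      qed
      have "norm (G t - G s) \<le> e * (A t - A s)"
        if h: "s \<le> x" "x \<le> t" "t - s < d" "a \<le> s" "t \<le> b" for s t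
      proof -
        have "dist (A s) (A x) < \<eta>" "dist (A t) (A x) < \<eta>" using d(2)[of s] d(2)[of t] h x by (auto simp: dist_real_def)
        then have "A t - A s \<le> 2 * \<eta>" by (auto simp: dist_real_def)
        moreover have "0 \<le> A t - A s" using mono[of s t] h by simp
        ultimately have "C * (A t - A s)\<^sup>2 \<le> (\<bar>C\<bar> + 1) * ((2 * \<eta>) * (A t - A s))"
          unfolding power2_eq_square by (intro mult_mono) (auto intro: mult_right_mono)
        also have "\<dots> = ((\<bar>C\<bar> + 1) * (2 * \<eta>)) * (A t - A s)" by simp
        also have "(\<bar>C\<bar> + 1) * (2 * \<eta>) = e" by (simp add: \<eta>_def divide_simps)
        finally show ?thesis using quad[of s t] h by auto
      qed
      then show ?thesis using d(1) unfolding P_def by (intro exI[of _ d]) auto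
    qed
    have "P a b" by (rule Bolzano[of a b P, OF ab trans local])
    then show ?thesis using ab by (simp add: P_def)
  qed
  define M where "M = A b - A a + 1"
  have M: "M > 0" using mono[of a b] ab by (simp add: M_def)
  have "norm (G b - G a) \<le> 0 + e" if "e > 0" for e
  proof -
    have "norm (G b - G a) \<le> (e / M) * (A b - A a)" using *[of "e / M"] M that by simp
    also have "\<dots> \<le> (e / M) * M" using M that by (intro mult_left_mono) (auto simp: M_def)
    finally show ?thesis using M by simp
  qed
  then have "norm (G b - G a) \<le> 0" by (rule field_le_epsilon)
  then show ?thesis by simp
qed

section \<open>Products and exponentials of absolutely continuous functions\<close>

lemma absint_mult_cont:
  fixes f g :: "real \<Rightarrow> complex"
  assumes "continuous_on {a..b} f" "g absolutely_integrable_on {a..b}"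
  shows "(\<lambda>s. f s * g s) absolutely_integrable_on {a..b}" "(\<lambda>s. g s * f s) absolutely_integrable_on {a..b}"
proof -
  show "(\<lambda>s. f s * g s) absolutely_integrable_on {a..b}"
    using assms
    by (intro absolutely_integrable_bounded_measurable_product[of "(*)"] continuous_imp_measurable_on_sets_lebesgue
        compact_imp_bounded compact_continuous_image)
      (auto simp: bilinear_times)
  then show "(\<lambda>s. g s * f s) absolutely_integrable_on {a..b}" by (simp add: mult.commute)
qed

lemma integral_norm_prod_le:
  fixes u v :: "real \<Rightarrow> complex"
  assumes u: "u absolutely_integrable_on {s..t}" and uv: "(\<lambda>r. u r * v r) absolutely_integrable_on {s..t}"
    and B: "\<And>r. r \<in> {s..t} \<Longrightarrow> cmod (v r) \<le> B"
  shows "cmod (integral {s..t} (\<lambda>r. u r * v r)) \<le> integral {s..t} (\<lambda>r. cmod (u r)) * B"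
proof -
  have "cmod (integral {s..t} (\<lambda>r. u r * v r)) \<le> integral {s..t} (\<lambda>r. cmod (u r) * B)"
    using u uv B
    by (intro integral_norm_bound_integral absint_imp_int integrable_on_mult_left absint_norm_int)
      (auto simp: norm_mult intro: mult_left_mono)
  then show ?thesis by simp
qed

lemma integral_norm_mono_increment:
  fixes h :: "real \<Rightarrow> complex"
  assumes h: "h absolutely_integrable_on {a..b}" and st: "a \<le> s" "s \<le> t" "t \<le> b"
  shows "integral {a..t} (\<lambda>r. cmod (h r)) - integral {a..s} (\<lambda>r. cmod (h r)) = integral {s..t} (\<lambda>r. cmod (h r))"
    "h absolutely_integrable_on {s..t}" "0 \<le> integral {s..t} (\<lambda>r. cmod (h r))"
proof -
  show "h absolutely_integrable_on {s..t}"
    using h by (rule absolutely_integrable_on_subinterval) (use st in auto)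
  have "h absolutely_integrable_on {a..t}"
    using h by (rule absolutely_integrable_on_subinterval) (use st in auto)
  then show "integral {a..t} (\<lambda>r. cmod (h r)) - integral {a..s} (\<lambda>r. cmod (h r)) = integral {s..t} (\<lambda>r. cmod (h r))"
    using Henstock_Kurzweil_Integration.integral_combine[of a s t "\<lambda>r. cmod (h r)"] st
    by (simp add: absint_norm_int algebra_simps)
  then show "0 \<le> integral {s..t} (\<lambda>r. cmod (h r))"
    using \<open>h absolutely_integrable_on {s..t}\<close>
    by (intro Henstock_Kurzweil_Integration.integral_nonneg absint_norm_int) auto
qed

text \<open>Take A to be the sum of the variations of f and g. From s to t, the product minus the
  integral of the claimed density changes by (f t - f s) (g t - g s) minus the integrals of f' (g -
  g s) and g' (f - f s). Each of the three terms is at most a product of two variations, hence the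
  constant 3.\<close>

lemma acd_mult:
  assumes f: "acd f f'" and g: "acd g g'"
  shows "acd (\<lambda>s. f s * g s) (\<lambda>s. f' s * g s + f s * g' s)"
proof (rule acdI)
  fix a b :: real assume ab: "-1 < a" "a \<le> b" "b < 1"
  have fc: "continuous_on {a..b} f" and gc: "continuous_on {a..b} g"
    using acd_continuous_on_Icc ab f g by auto
  have fi: "f' absolutely_integrable_on {a..b}" and gi: "g' absolutely_integrable_on {a..b}"
    using acd_integrable ab f g by auto
  let ?h = "\<lambda>s. f' s * g s + f s * g' s"
  show hi: "?h absolutely_integrable_on {a..b}"
    using fc gc fi gi by (intro set_integral_add absint_mult_cont)
  let ?A = "\<lambda>t. integral {a..t} (\<lambda>r. cmod (f' r)) + integral {a..t} (\<lambda>r. cmod (g' r))"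
  define G where "G t = f t * g t - integral {a..t} ?h" for t
  have "G b = G a"
  proof (rule const_if_quadratic_increments[OF ab(2), of ?A _ 3])
    show "continuous_on {a..b} ?A"
      using fi gi by (intro continuous_intros indefinite_integral_continuous_1 absint_norm_int)
    fix s t assume st: "a \<le> s" "s \<le> t" "t \<le> b"
    note F = integral_norm_mono_increment[OF fi st] and G' = integral_norm_mono_increment[OF gi st]
    show "?A s \<le> ?A t" using F(1,3) G'(1,3) by simp
    define \<Phi> \<Gamma> where "\<Phi> = integral {s..t} (\<lambda>r. cmod (f' r))" and "\<Gamma> = integral {s..t} (\<lambda>r. cmod (g' r))"
    have nn: "\<Phi> \<ge> 0" "\<Gamma> \<ge> 0" using F(3) G'(3) by (auto simp: \<Phi>_def \<Gamma>_def)
    have dA: "?A t - ?A s = \<Phi> + \<Gamma>" using F(1) G'(1) by (simp add: \<Phi>_def \<Gamma>_def)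
    have st': "-1 < s" "t < 1" using st ab by auto
    have fd: "cmod (f r - f s) \<le> \<Phi>" and gd: "cmod (g r - g s) \<le> \<Gamma>" if r: "r \<in> {s..t}" for r
    proof -
      have m: "integral {s..r} (\<lambda>x. cmod (k x)) \<le> integral {s..t} (\<lambda>x. cmod (k x))"
        if k: "k absolutely_integrable_on {s..t}" for k
        using r absolutely_integrable_on_subinterval[OF k]
        by (intro integral_subset_le absint_norm_int k) auto
      show "cmod (f r - f s) \<le> \<Phi>"
        using acd_norm_diff[OF f, of s r] r st' m[OF F(2)] by (auto simp: \<Phi>_def)
      show "cmod (g r - g s) \<le> \<Gamma>"
        using acd_norm_diff[OF g, of s r] r st' m[OF G'(2)] by (auto simp: \<Gamma>_def)
    qed
    have cs: "continuous_on {s..t} f" "continuous_on {s..t} g"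
      using fc gc st by (auto intro: continuous_on_subset)
    have i1: "(\<lambda>r. f' r * (g r - g s)) absolutely_integrable_on {s..t}"
      using cs F(2) by (intro absint_mult_cont continuous_intros)
    have i2: "(\<lambda>r. g' r * (f r - f s)) absolutely_integrable_on {s..t}"
      using cs G'(2) by (intro absint_mult_cont continuous_intros)
    have i3: "(\<lambda>r. f' r * g s) absolutely_integrable_on {s..t}" "(\<lambda>r. g' r * f s) absolutely_integrable_on {s..t}"
      using F(2) G'(2) by auto
    have "integral {s..t} ?h = integral {s..t} (\<lambda>r. (f' r * (g r - g s) + g' r * (f r - f s)) + (f' r * g s + g' r * f s))"
      by (intro integral_cong) (simp add: algebra_simps)
    also have "\<dots> = (integral {s..t} (\<lambda>r. f' r * (g r - g s)) + integral {s..t} (\<lambda>r. g' r * (f r - f s)))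
        + (integral {s..t} f' * g s + integral {s..t} g' * f s)"
      using i1 i2 i3 by (simp add: integral_add absint_imp_int integrable_add)
    finally have I: "integral {s..t} ?h = (integral {s..t} (\<lambda>r. f' r * (g r - g s)) + integral {s..t} (\<lambda>r. g' r * (f r - f s)))
        + ((f t - f s) * g s + (g t - g s) * f s)"
      using acd_diff_eq[OF f st'(1) st(2) st'(2)] acd_diff_eq[OF g st'(1) st(2) st'(2)] by simp
    have "?h absolutely_integrable_on {a..t}"
      using hi by (rule absolutely_integrable_on_subinterval) (use st in auto)
    then have "integral {a..s} ?h + integral {s..t} ?h = integral {a..t} ?h"
      using st by (intro Henstock_Kurzweil_Integration.integral_combine absint_imp_int) auto
    then have "G t - G s = f t * g t - f s * g s - integral {s..t} ?h" by (simp add: G_def algebra_simps)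
    also have "\<dots> = (f t - f s) * (g t - g s)
        - integral {s..t} (\<lambda>r. f' r * (g r - g s)) - integral {s..t} (\<lambda>r. g' r * (f r - f s))"
      unfolding I by (simp add: algebra_simps)
    finally have Geq: "G t - G s = \<dots>" .
    have "cmod (G t - G s) \<le> cmod ((f t - f s) * (g t - g s))
        + cmod (integral {s..t} (\<lambda>r. f' r * (g r - g s))) + cmod (integral {s..t} (\<lambda>r. g' r * (f r - f s)))"
      unfolding Geq by (intro order_trans[OF norm_triangle_ineq4] add_mono order_refl norm_triangle_ineq4)
    also have "\<dots> \<le> \<Phi> * \<Gamma> + \<Phi> * \<Gamma> + \<Gamma> * \<Phi>"
    proof (intro add_mono)
      show "cmod ((f t - f s) * (g t - g s)) \<le> \<Phi> * \<Gamma>"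
        using fd[of t] gd[of t] st nn by (auto simp: norm_mult intro: mult_mono)
      show "cmod (integral {s..t} (\<lambda>r. f' r * (g r - g s))) \<le> \<Phi> * \<Gamma>"
        unfolding \<Phi>_def using gd by (intro integral_norm_prod_le F(2) i1)
      show "cmod (integral {s..t} (\<lambda>r. g' r * (f r - f s))) \<le> \<Gamma> * \<Phi>"
        unfolding \<Gamma>_def using fd by (intro integral_norm_prod_le G'(2) i2)
    qed
    also have "\<dots> \<le> 3 * (\<Phi> + \<Gamma>)\<^sup>2" using nn by (simp add: power2_eq_square algebra_simps)
    finally show "cmod (G t - G s) \<le> 3 * (?A t - ?A s)\<^sup>2" unfolding dA .
  qed
  then show "f b * g b - f a * g a = integral {a..b} ?h"
    using ab by (simp add: G_def algebra_simps)
qed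

lemma exp_second_order:
  fixes z w :: complex
  shows "cmod (exp z - exp w - (z - w) * exp w) \<le> exp (cmod w + cmod (z - w)) * (cmod (z - w))\<^sup>2"
    "cmod (exp z - exp w) \<le> exp (cmod w + cmod (z - w)) * cmod (z - w)"
proof -
  have e: "cmod (exp w) \<le> exp (cmod w)" by (rule norm_exp)
  have "exp z - exp w - (z - w) * exp w = exp w * (exp (z - w) - (\<Sum>i\<le>1. (z - w) ^ i / fact i))"
    by (simp add: exp_diff algebra_simps)
  then have "cmod (exp z - exp w - (z - w) * exp w) \<le> exp (cmod w) * (exp (cmod (z - w)) * (cmod (z - w))\<^sup>2)"
    using Taylor_exp_field[of "z - w" 1] by (auto simp: norm_mult power2_eq_square intro!: mult_mono e complex_Re_le_cmod)
  then show "cmod (exp z - exp w - (z - w) * exp w) \<le> exp (cmod w + cmod (z - w)) * (cmod (z - w))\<^sup>2"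
    by (simp add: exp_add mult_ac)
  have "exp z - exp w = exp w * (exp (z - w) - (\<Sum>i\<le>0. (z - w) ^ i / fact i))"
    by (simp add: exp_diff algebra_simps)
  then have "cmod (exp z - exp w) \<le> exp (cmod w) * (exp (cmod (z - w)) * cmod (z - w))"
    using Taylor_exp_field[of "z - w" 0] by (auto simp: norm_mult intro!: mult_mono e complex_Re_le_cmod)
  then show "cmod (exp z - exp w) \<le> exp (cmod w + cmod (z - w)) * cmod (z - w)"
    by (simp add: exp_add mult_ac)
qed

text \<open>The scheme of \<open>acd_mult\<close>, with the Taylor remainder of exp in place of the
  product of increments.\<close>

lemma acd_exp:
  assumes f: "acd f f'"
  shows "acd (\<lambda>s. exp (f s)) (\<lambda>s. f' s * exp (f s))"
proof (rule acdI)
  fix a b :: real assume ab: "-1 < a" "a \<le> b" "b < 1"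
  have fc: "continuous_on {a..b} f" using acd_continuous_on_Icc ab f by auto
  have ec: "continuous_on {a..b} (\<lambda>s. exp (f s))" using fc by (intro continuous_intros)
  have fi: "f' absolutely_integrable_on {a..b}" using acd_integrable ab f by auto
  let ?h = "\<lambda>s. f' s * exp (f s)"
  show hi: "?h absolutely_integrable_on {a..b}" using ec fi by (intro absint_mult_cont)
  let ?A = "\<lambda>t. integral {a..t} (\<lambda>r. cmod (f' r))"
  obtain B where B: "\<And>r. r \<in> {a..b} \<Longrightarrow> cmod (f r) \<le> B"
    using compact_imp_bounded[OF compact_continuous_image[OF fc compact_Icc]] unfolding bounded_iff by blast
  \<comment> \<open>On the interval 3 * B bounds |f s| + |f r - f s|, the exponent in
    \<open>exp_second_order\<close>.\<close>
  define M where "M = exp (3 * B)"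
  define G where "G t = exp (f t) - integral {a..t} ?h" for t
  have "G b = G a"
  proof (rule const_if_quadratic_increments[OF ab(2), of ?A _ "2 * M"])
    show "continuous_on {a..b} ?A"
      using fi by (intro continuous_intros indefinite_integral_continuous_1 absint_norm_int)
    fix s t assume st: "a \<le> s" "s \<le> t" "t \<le> b"
    note F = integral_norm_mono_increment[OF fi st]
    show "?A s \<le> ?A t" using F(1,3) by simp
    define \<Phi> where "\<Phi> = integral {s..t} (\<lambda>r. cmod (f' r))"
    have nn: "\<Phi> \<ge> 0" using F(3) by (auto simp: \<Phi>_def)
    have dA: "?A t - ?A s = \<Phi>" using F(1) by (simp add: \<Phi>_def)
    have st': "-1 < s" "t < 1" using st ab by auto
    have fd: "cmod (f r - f s) \<le> \<Phi>" if r: "r \<in> {s..t}" for r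
    proof -
      have "integral {s..r} (\<lambda>x. cmod (f' x)) \<le> integral {s..t} (\<lambda>x. cmod (f' x))"
        using r absolutely_integrable_on_subinterval[OF F(2)]
        by (intro integral_subset_le absint_norm_int F(2)) auto
      then show "cmod (f r - f s) \<le> \<Phi>"
        using acd_norm_diff[OF f, of s r] r st' by (auto simp: \<Phi>_def)
    qed
    have Mb: "exp (cmod (f s) + cmod (f r - f s)) \<le> M" if "r \<in> {s..t}" for r
      using B[of s] B[of r] norm_triangle_ineq4[of "f r" "f s"] that st unfolding M_def by simp
    have cs: "continuous_on {s..t} f" using fc st by (auto intro: continuous_on_subset)
    have i1: "(\<lambda>r. f' r * (exp (f r) - exp (f s))) absolutely_integrable_on {s..t}"
      using cs F(2) by (intro absint_mult_cont continuous_intros)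
    have i3: "(\<lambda>r. f' r * exp (f s)) absolutely_integrable_on {s..t}" using F(2) by auto
    have "integral {s..t} ?h = integral {s..t} (\<lambda>r. f' r * (exp (f r) - exp (f s)) + f' r * exp (f s))"
      by (intro integral_cong) (simp add: algebra_simps)
    also have "\<dots> = integral {s..t} (\<lambda>r. f' r * (exp (f r) - exp (f s))) + integral {s..t} f' * exp (f s)"
      using i1 i3 by (simp add: integral_add absint_imp_int)
    finally have I: "integral {s..t} ?h
        = integral {s..t} (\<lambda>r. f' r * (exp (f r) - exp (f s))) + (f t - f s) * exp (f s)"
      using acd_diff_eq[OF f st'(1) st(2) st'(2)] by simp
    have "?h absolutely_integrable_on {a..t}"
      using hi by (rule absolutely_integrable_on_subinterval) (use st in auto)
    then have "integral {a..s} ?h + integral {s..t} ?h = integral {a..t} ?h"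
      using st by (intro Henstock_Kurzweil_Integration.integral_combine absint_imp_int) auto
    then have Geq: "G t - G s = (exp (f t) - exp (f s) - (f t - f s) * exp (f s))
        - integral {s..t} (\<lambda>r. f' r * (exp (f r) - exp (f s)))"
      using I by (simp add: G_def algebra_simps)
    have t: "t \<in> {s..t}" using st by simp
    have "cmod (G t - G s) \<le> cmod (exp (f t) - exp (f s) - (f t - f s) * exp (f s))
        + cmod (integral {s..t} (\<lambda>r. f' r * (exp (f r) - exp (f s))))"
      unfolding Geq by (rule norm_triangle_ineq4)
    also have "\<dots> \<le> M * \<Phi>\<^sup>2 + \<Phi> * (M * \<Phi>)"
    proof (intro add_mono)
      show "cmod (exp (f t) - exp (f s) - (f t - f s) * exp (f s)) \<le> M * \<Phi>\<^sup>2"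
        using Mb[OF t] fd[OF t] by (intro order_trans[OF exp_second_order(1)] mult_mono power_mono) (auto simp: M_def)
      show "cmod (integral {s..t} (\<lambda>r. f' r * (exp (f r) - exp (f s)))) \<le> \<Phi> * (M * \<Phi>)"
        unfolding \<Phi>_def
      proof (intro integral_norm_prod_le F(2) i1)
        fix r assume r: "r \<in> {s..t}"
        show "cmod (exp (f r) - exp (f s)) \<le> M * integral {s..t} (\<lambda>r. cmod (f' r))"
          using Mb[OF r] fd[OF r] unfolding \<Phi>_def by (intro order_trans[OF exp_second_order(2)] mult_mono) (auto simp: M_def)
      qed
    qed
    also have "\<dots> = 2 * M * \<Phi>\<^sup>2" by (simp add: power2_eq_square algebra_simps)
    finally show "cmod (G t - G s) \<le> 2 * M * (?A t - ?A s)\<^sup>2" unfolding dA .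
  qed
  then show "exp (f b) - exp (f a) = integral {a..b} ?h"
    using ab by (simp add: G_def algebra_simps)
qed

section \<open>Weighted square-integrable functions\<close>

abbreviation M1 :: "real measure" where
  "M1 \<equiv> lebesgue_on {-1..1}"

definition L2 :: "nat \<Rightarrow> (real \<Rightarrow> complex) \<Rightarrow> bool" where
  "L2 k f \<longleftrightarrow> f \<in> borel_measurable M1 \<and> integrable M1 (\<lambda>s. (1 - s\<^sup>2) ^ k * (cmod (f s))\<^sup>2)"

definition nsq :: "nat \<Rightarrow> (real \<Rightarrow> complex) \<Rightarrow> real" where
  "nsq k f = (LINT s|M1. (1 - s\<^sup>2) ^ k * (cmod (f s))\<^sup>2)"

lemma weight_nonneg: "s \<in> {-1..1} \<Longrightarrow> 0 \<le> (1 - s\<^sup>2 :: real)"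
  by (auto simp: abs_square_le_1 abs_le_iff)

lemma weight_pos: "s \<in> {-1<..<1} \<Longrightarrow> 0 < (1 - s\<^sup>2 :: real)"
  by (auto simp: abs_square_less_1 abs_less_iff)

lemma finite_measure_M1: "finite_measure M1"
  by (intro finite_measure_lebesgue_on) auto

lemma ends_null: "{-1, 1} \<in> null_sets M1"
  by (simp add: null_sets_restrict_space)

lemma AE_M1I:
  assumes "\<And>s. s \<in> {-1<..<1} \<Longrightarrow> P s"
  shows "AE s in M1. P s"
proof (rule AE_I'[OF ends_null])
  show "{s \<in> space M1. \<not> P s} \<subseteq> {-1, 1}"
  proof
    fix s assume "s \<in> {s \<in> space M1. \<not> P s}"
    then have "s \<in> {-1..1}" "\<not> P s" by auto
    then show "s \<in> {-1, 1}" using assms[of s] by (cases "s = -1"; cases "s = 1") auto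
  qed
qed

lemma measurable_M1_open: "f \<in> borel_measurable (lebesgue_on {-1<..<1}) \<Longrightarrow> f \<in> borel_measurable M1"
  for f :: "real \<Rightarrow> 'a::euclidean_space"
proof -
  have "{-1..1} - {-1, 1} = {-1<..<1::real}" by auto
  then show "f \<in> borel_measurable (lebesgue_on {-1<..<1}) \<Longrightarrow> f \<in> borel_measurable M1"
    using borel_measurable_diff_null[OF ends_null, of f] by auto
qed

lemma measurable_M1_cont: "continuous_on {-1<..<1} f \<Longrightarrow> f \<in> borel_measurable M1"
  for f :: "real \<Rightarrow> 'a::euclidean_space"
  by (intro measurable_M1_open continuous_imp_measurable_on_sets_lebesgue) auto

lemma measurable_M1_sub: "f \<in> borel_measurable M1 \<Longrightarrow> {a..b} \<subseteq> {-1..1} \<Longrightarrow> f \<in> borel_measurable (lebesgue_on {a..b})"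
  for f :: "real \<Rightarrow> 'a::euclidean_space"
  by (rule measurable_restrict_mono)

lemma weight_measurable [measurable]: "(\<lambda>s::real. (1 - s\<^sup>2) ^ k) \<in> borel_measurable M1"
  by (intro continuous_imp_measurable_on_sets_lebesgue continuous_intros) auto

lemma L2_measurable [measurable_dest]: "L2 k f \<Longrightarrow> f \<in> borel_measurable M1"
  by (simp add: L2_def)

lemma nsq_nonneg [simp]: "0 \<le> nsq k f"
  unfolding nsq_def
  by (intro integral_nonneg_AE AE_M1I mult_nonneg_nonneg zero_le_power less_imp_le[OF weight_pos]) auto

lemma L2_dominated:
  assumes f: "f \<in> borel_measurable M1" and g: "integrable M1 g"
    and le: "\<And>s. s \<in> {-1<..<1} \<Longrightarrow> (1 - s\<^sup>2) ^ k * (cmod (f s))\<^sup>2 \<le> g s"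
  shows "L2 k f" "nsq k f \<le> (LINT s|M1. g s)"
proof -
  have m: "(\<lambda>s. (1 - s\<^sup>2) ^ k * (cmod (f s))\<^sup>2) \<in> borel_measurable M1" using f by measurable
  have i: "integrable M1 (\<lambda>s. (1 - s\<^sup>2) ^ k * (cmod (f s))\<^sup>2)"
  proof (rule Bochner_Integration.integrable_bound[OF g m], rule AE_M1I)
    fix s :: real assume s: "s \<in> {-1<..<1}"
    have "0 \<le> (1 - s\<^sup>2) ^ k * (cmod (f s))\<^sup>2" using weight_pos[OF s] by simp
    then show "norm ((1 - s\<^sup>2) ^ k * (cmod (f s))\<^sup>2) \<le> norm (g s)" using le[OF s] by simp
  qed
  then show "L2 k f" using f by (simp add: L2_def)
  show "nsq k f \<le> (LINT s|M1. g s)"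
    unfolding nsq_def by (rule integral_mono_AE[OF i g]) (rule AE_M1I[OF le])
qed

lemma L2_int: "L2 k f \<Longrightarrow> integrable M1 (\<lambda>s. (1 - s\<^sup>2) ^ k * (cmod (f s))\<^sup>2)"
  by (simp add: L2_def)

lemma L2_bound:
  assumes f: "f \<in> borel_measurable M1" and g: "L2 l g"
    and le: "\<And>s. s \<in> {-1<..<1} \<Longrightarrow> (1 - s\<^sup>2) ^ k * (cmod (f s))\<^sup>2 \<le> C * ((1 - s\<^sup>2) ^ l * (cmod (g s))\<^sup>2)"
  shows "L2 k f" "nsq k f \<le> C * nsq l g"
  using L2_dominated[OF f integrable_mult_right[OF L2_int[OF g], of C] le] by (auto simp: nsq_def)

lemma norm_add_sq: "(cmod (x + y))\<^sup>2 \<le> 2 * (cmod x)\<^sup>2 + 2 * (cmod y)\<^sup>2"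
proof -
  have "(cmod (x + y))\<^sup>2 \<le> (cmod x + cmod y)\<^sup>2" by (intro power_mono norm_triangle_ineq) auto
  also have "\<dots> \<le> 2 * (cmod x)\<^sup>2 + 2 * (cmod y)\<^sup>2"
    using zero_le_power2[of "cmod x - cmod y"] by (simp add: power2_sum power2_diff)
  finally show ?thesis .
qed

lemma L2_add:
  assumes "L2 k f" "L2 k g"
  shows "L2 k (\<lambda>s. f s + g s)" "nsq k (\<lambda>s. f s + g s) \<le> 2 * nsq k f + 2 * nsq k g"
proof -
  have m: "(\<lambda>s. f s + g s) \<in> borel_measurable M1" using assms by measurable
  have i: "integrable M1 (\<lambda>s. 2 * ((1 - s\<^sup>2) ^ k * (cmod (f s))\<^sup>2) + 2 * ((1 - s\<^sup>2) ^ k * (cmod (g s))\<^sup>2))"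
    using assms by (intro Bochner_Integration.integrable_add integrable_mult_right L2_int)
  have le: "(1 - s\<^sup>2) ^ k * (cmod (f s + g s))\<^sup>2
      \<le> 2 * ((1 - s\<^sup>2) ^ k * (cmod (f s))\<^sup>2) + 2 * ((1 - s\<^sup>2) ^ k * (cmod (g s))\<^sup>2)"
    if "s \<in> {-1<..<1}" for s
    using mult_left_mono[OF norm_add_sq[of "f s" "g s"], of "(1 - s\<^sup>2) ^ k"] weight_pos[OF that]
    by (simp add: distrib_left mult.left_commute)
  show "L2 k (\<lambda>s. f s + g s)" by (rule L2_dominated(1)[OF m i le])
  have "nsq k (\<lambda>s. f s + g s) \<le>
      (LINT s|M1. 2 * ((1 - s\<^sup>2) ^ k * (cmod (f s))\<^sup>2) + 2 * ((1 - s\<^sup>2) ^ k * (cmod (g s))\<^sup>2))"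
    by (rule L2_dominated(2)[OF m i le])
  also have "\<dots> = 2 * nsq k f + 2 * nsq k g"
    using assms unfolding nsq_def by (simp add: L2_int)
  finally show "nsq k (\<lambda>s. f s + g s) \<le> 2 * nsq k f + 2 * nsq k g" .
qed

lemma L2_cmult: "L2 k f \<Longrightarrow> L2 k (\<lambda>s. c * f s)" "nsq k (\<lambda>s. c * f s) = (cmod c)\<^sup>2 * nsq k f"
proof -
  have e: "(1 - s\<^sup>2) ^ k * (cmod (c * f s))\<^sup>2 = (cmod c)\<^sup>2 * ((1 - s\<^sup>2) ^ k * (cmod (f s))\<^sup>2)" for s
    by (simp add: norm_mult power_mult_distrib mult_ac)
  show "nsq k (\<lambda>s. c * f s) = (cmod c)\<^sup>2 * nsq k f" unfolding nsq_def e by simp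
  assume "L2 k f"
  then show "L2 k (\<lambda>s. c * f s)" unfolding L2_def e by auto
qed

lemma L2_minus: "L2 k f \<Longrightarrow> L2 k (\<lambda>s. - f s)" "nsq k (\<lambda>s. - f s) = nsq k f"
  using L2_cmult(1)[where k = k and f = f and c = "-1"] L2_cmult(2)[where k = k and f = f and c = "-1"]
  by auto

lemma L2_diff:
  assumes "L2 k f" "L2 k g"
  shows "L2 k (\<lambda>s. f s - g s)" "nsq k (\<lambda>s. f s - g s) \<le> 2 * nsq k f + 2 * nsq k g"
  using L2_add[OF assms(1) L2_minus(1)[OF assms(2)]] by (auto simp: L2_minus)

lemma L2_cnj: "L2 k f \<Longrightarrow> L2 k (\<lambda>s. cnj (f s))" "nsq k (\<lambda>s. cnj (f s)) = nsq k f"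
proof -
  assume f: "L2 k f"
  have "(\<lambda>s. cnj (f s)) \<in> borel_measurable M1"
    by (rule measurable_compose[OF L2_measurable[OF f] borel_measurable_continuous_onI]) (intro continuous_intros)
  then show "L2 k (\<lambda>s. cnj (f s))" using f unfolding L2_def by simp
qed (simp add: nsq_def)

lemma L2_zero [simp]: "L2 k (\<lambda>s. 0)"
  by (simp add: L2_def)

lemma L2_sum: "(\<And>i. i \<in> A \<Longrightarrow> L2 k (f i)) \<Longrightarrow> L2 k (\<lambda>s. \<Sum>i\<in>A. f i s)"
  by (induction A rule: infinite_finite_induct) (auto intro: L2_add)

lemma L2_const_int: "L2 k (\<lambda>s. c)"
proof (rule L2_dominated(1))
  show "integrable M1 (\<lambda>s. (cmod c)\<^sup>2)" using finite_measure.integrable_const[OF finite_measure_M1] .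
  show "(1 - s\<^sup>2) ^ k * (cmod c)\<^sup>2 \<le> (cmod c)\<^sup>2" if "s \<in> {-1<..<1}" for s
    using weight_pos[OF that] by (intro mult_left_le_one_le power_le_one) auto
qed auto

lemma L2_bounded_mult:
  assumes u: "u \<in> borel_measurable M1" and v: "L2 k v" and B: "\<And>s. s \<in> {-1<..<1} \<Longrightarrow> cmod (u s) \<le> B"
  shows "L2 k (\<lambda>s. u s * v s)" "nsq k (\<lambda>s. u s * v s) \<le> B\<^sup>2 * nsq k v"
proof -
  have m: "(\<lambda>s. u s * v s) \<in> borel_measurable M1" using u v by measurable
  have "(1 - s\<^sup>2) ^ k * (cmod (u s * v s))\<^sup>2 \<le> B\<^sup>2 * ((1 - s\<^sup>2) ^ k * (cmod (v s))\<^sup>2)" if s: "s \<in> {-1<..<1}" for s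
  proof -
    have "(cmod (u s))\<^sup>2 \<le> B\<^sup>2" using B[OF s] by (intro power_mono) auto
    then have "(cmod (u s))\<^sup>2 * ((1 - s\<^sup>2) ^ k * (cmod (v s))\<^sup>2) \<le> B\<^sup>2 * ((1 - s\<^sup>2) ^ k * (cmod (v s))\<^sup>2)"
      using weight_pos[OF s] by (intro mult_right_mono) auto
    then show ?thesis by (simp add: norm_mult power_mult_distrib mult_ac)
  qed
  from L2_bound[OF m v this] show "L2 k (\<lambda>s. u s * v s)" "nsq k (\<lambda>s. u s * v s) \<le> B\<^sup>2 * nsq k v" by auto
qed

lemma L2_HK:
  assumes f: "L2 k f" and ab: "{a..b} \<subseteq> {-1..1}"
  shows "(\<lambda>s. (1 - s\<^sup>2) ^ k * (cmod (f s))\<^sup>2) integrable_on {a..b}"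
    "integral {a..b} (\<lambda>s. (1 - s\<^sup>2) ^ k * (cmod (f s))\<^sup>2) \<le> nsq k f"
proof -
  have i: "(\<lambda>s. (1 - s\<^sup>2) ^ k * (cmod (f s))\<^sup>2) integrable_on {-1..1}"
    by (rule integrable_on_lebesgue_on[OF L2_int[OF f]]) auto
  then show j: "(\<lambda>s. (1 - s\<^sup>2) ^ k * (cmod (f s))\<^sup>2) integrable_on {a..b}"
    by (rule integrable_on_subinterval[OF _ ab])
  have "integral {a..b} (\<lambda>s. (1 - s\<^sup>2) ^ k * (cmod (f s))\<^sup>2) \<le> integral {-1..1} (\<lambda>s. (1 - s\<^sup>2) ^ k * (cmod (f s))\<^sup>2)"
    by (rule integral_subset_le[OF ab j i]) (auto intro!: mult_nonneg_nonneg zero_le_power weight_nonneg simp: abs_square_le_1 abs_le_iff)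
  also have "\<dots> = nsq k f"
    unfolding nsq_def by (rule lebesgue_integral_eq_integral[OF L2_int[OF f], symmetric]) auto
  finally show "integral {a..b} (\<lambda>s. (1 - s\<^sup>2) ^ k * (cmod (f s))\<^sup>2) \<le> nsq k f" .
qed

section \<open>Cauchy-Schwarz and pointwise estimates\<close>

text \<open>The best choice t = sqrt (B / A) turns the family of AM-GM bounds into Cauchy-Schwarz;
  adding e to A and B first keeps both positive.\<close>

lemma square_le_if_AM_GM:
  fixes X A B :: real
  assumes "0 \<le> X" "0 \<le> A" "0 \<le> B" and t: "\<And>t. t > 0 \<Longrightarrow> 2 * X \<le> t * A + B / t"
  shows "X\<^sup>2 \<le> A * B"
proof -
  have *: "X\<^sup>2 \<le> (A + e) * (B + e)" if e: "e > 0" for e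
  proof -
    define x y where "x = sqrt (A + e)" and "y = sqrt (B + e)"
    have pos: "A + e > 0" "B + e > 0" using assms e by auto
    have xy: "x > 0" "y > 0" "A + e = x * x" "B + e = y * y" using pos by (auto simp: x_def y_def)
    have tp: "y / x > 0" using xy by simp
    have "2 * X \<le> (y / x) * A + B / (y / x)" by (rule t[OF tp])
    also have "\<dots> \<le> (y / x) * (A + e) + (B + e) / (y / x)"
      using tp e by (intro add_mono mult_left_mono divide_right_mono) auto
    also have "\<dots> = 2 * (x * y)" unfolding xy(3,4) using xy(1,2) by simp
    finally have "X\<^sup>2 \<le> (x * y)\<^sup>2" using assms by (intro power_mono) auto
    then show ?thesis unfolding xy(3,4) by (simp add: power2_eq_square mult_ac)
  qed
  have "((\<lambda>e. (A + e) * (B + e)) \<longlongrightarrow> (A + 0) * (B + 0)) (at_right 0)"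
    by (intro tendsto_intros)
  then have "X\<^sup>2 \<le> (A + 0) * (B + 0)"
    by (rule tendsto_lowerbound) (auto intro!: eventually_at_rightI[of 0 1] *)
  then show ?thesis by simp
qed

text \<open>Meant for h the weighted square of f and v the reciprocal weight. Integrating 2 |f|
  \<le> t h + v / t gives the inequality through \<open>square_le_if_AM_GM\<close>, and t = 1 gives
  the integrability of f.\<close>

lemma Cauchy_Schwarz_interval:
  fixes f :: "real \<Rightarrow> complex"
  assumes f: "f \<in> borel_measurable (lebesgue_on {a..b})"
    and h: "h integrable_on {a..b}" and v: "v integrable_on {a..b}"
    and le: "\<And>s. s \<in> {a..b} \<Longrightarrow> (cmod (f s))\<^sup>2 \<le> h s * v s"
    and h0: "\<And>s. s \<in> {a..b} \<Longrightarrow> 0 \<le> h s" and v0: "\<And>s. s \<in> {a..b} \<Longrightarrow> 0 \<le> v s"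
  shows "f absolutely_integrable_on {a..b}"
    "(integral {a..b} (\<lambda>s. cmod (f s)))\<^sup>2 \<le> integral {a..b} h * integral {a..b} v"
proof -
  have b: "2 * cmod (f s) \<le> t * h s + v s / t" if s: "s \<in> {a..b}" and t: "t > 0" for s t
  proof (rule power2_le_imp_le)
    have "(2 * cmod (f s))\<^sup>2 \<le> 4 * ((t * h s) * (v s / t))" using le[OF s] t by (simp add: power_mult_distrib)
    also have "\<dots> \<le> (t * h s + v s / t)\<^sup>2"
    proof -
      have "4 * (x * y) \<le> (x + y)\<^sup>2" for x y :: real
        using zero_le_power2[of "x - y"] by (simp add: power2_sum power2_diff)
      then show ?thesis .
    qed
    finally show "(2 * cmod (f s))\<^sup>2 \<le> (t * h s + v s / t)\<^sup>2" .
    show "0 \<le> t * h s + v s / t" using h0[OF s] v0[OF s] t by simp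
  qed
  show fa: "f absolutely_integrable_on {a..b}"
  proof (rule measurable_bounded_by_integrable_imp_absolutely_integrable[OF f])
    show "(\<lambda>s. h s + v s) integrable_on {a..b}" using h v by (rule integrable_add)
    show "cmod (f s) \<le> h s + v s" if "s \<in> {a..b}" for s using b[OF that, of 1] h0[OF that] v0[OF that] by simp
  qed auto
  show "(integral {a..b} (\<lambda>s. cmod (f s)))\<^sup>2 \<le> integral {a..b} h * integral {a..b} v"
  proof (rule square_le_if_AM_GM)
    fix t :: real assume t: "t > 0"
    have "integral {a..b} (\<lambda>s. 2 * cmod (f s)) \<le> integral {a..b} (\<lambda>s. t * h s + v s / t)"
      using h v b t by (intro integral_le integrable_on_mult_right absint_norm_int fa integrable_add integrable_on_divide) auto
    also have "\<dots> = t * integral {a..b} h + integral {a..b} v / t"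
      using h v by (subst Henstock_Kurzweil_Integration.integral_add) (auto intro: integrable_on_mult_right integrable_on_divide)
    finally show "2 * integral {a..b} (\<lambda>s. cmod (f s)) \<le> t * integral {a..b} h + integral {a..b} v / t" by simp
  qed (auto intro!: Henstock_Kurzweil_Integration.integral_nonneg h v absint_norm_int fa h0 v0)
qed

text \<open>Weighted square integrability gives local integrability, since the weight is positive
  inside. The second part lets convergence in \<open>nsq\<close> pass to integrals over compact
  subintervals.\<close>

lemma L2_local:
  assumes f: "L2 k f" and ab: "-1 < a" "b < 1"
  shows "f absolutely_integrable_on {a..b}"
    "(integral {a..b} (\<lambda>s. cmod (f s)))\<^sup>2 \<le> nsq k f * integral {a..b} (\<lambda>s. 1 / (1 - s\<^sup>2) ^ k)"
proof -
  have sub: "{a..b} \<subseteq> {-1..1}" using ab by auto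
  have w: "0 < 1 - s\<^sup>2" if "s \<in> {a..b}" for s using weight_pos[of s] that ab by auto
  have vi: "(\<lambda>s. 1 / (1 - s\<^sup>2) ^ k) integrable_on {a..b}"
    by (intro integrable_continuous_real continuous_intros) (use w in fastforce)
  have v0: "0 \<le> 1 / (1 - s\<^sup>2) ^ k" if "s \<in> {a..b}" for s using w[OF that] by simp
  have h0: "0 \<le> (1 - s\<^sup>2) ^ k * (cmod (f s))\<^sup>2" if "s \<in> {a..b}" for s using w[OF that] by simp
  have le: "(cmod (f s))\<^sup>2 \<le> (1 - s\<^sup>2) ^ k * (cmod (f s))\<^sup>2 * (1 / (1 - s\<^sup>2) ^ k)" if "s \<in> {a..b}" for s
    using w[OF that] by simp
  note CS = Cauchy_Schwarz_interval[OF measurable_M1_sub[OF L2_measurable[OF f] sub] L2_HK(1)[OF f sub] vi le h0 v0]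
  show "f absolutely_integrable_on {a..b}" by (rule CS(1))
  show "(integral {a..b} (\<lambda>s. cmod (f s)))\<^sup>2 \<le> nsq k f * integral {a..b} (\<lambda>s. 1 / (1 - s\<^sup>2) ^ k)"
  proof -
    have "integral {a..b} (\<lambda>s. (1 - s\<^sup>2) ^ k * (cmod (f s))\<^sup>2) * integral {a..b} (\<lambda>s. 1 / (1 - s\<^sup>2) ^ k)
        \<le> nsq k f * integral {a..b} (\<lambda>s. 1 / (1 - s\<^sup>2) ^ k)"
      by (intro mult_right_mono L2_HK(2)[OF f sub] Henstock_Kurzweil_Integration.integral_nonneg vi v0)
    then show ?thesis using CS(2) by linarith
  qed
qed

text \<open>Average |f s| \<le> |f t| + J, with J the integral of |g|, over an interval of length 1
  around s and inside (-1, 1). The constant depends on s, k and l only; this uniformity in f and g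
  is why it is obtained first.\<close>

lemma acd_point_bound:
  assumes s: "s \<in> {-1<..<1}"
  obtains C where "C \<ge> 0" "\<And>f g. acd f g \<Longrightarrow> L2 k f \<Longrightarrow> L2 l g \<Longrightarrow> (cmod (f s))\<^sup>2 \<le> C * (nsq k f + nsq l g)"
proof -
  define a b where "a = (s - 1) / 2" and "b = (s + 1) / 2"
  have ab: "-1 < a" "a < s" "s < b" "b < 1" "b - a = 1" using s by (auto simp: a_def b_def field_simps)
  define V where "V k = integral {a..b} (\<lambda>s. 1 / (1 - s\<^sup>2) ^ k)" for k :: nat
  have V0: "V k \<ge> 0" for k
  proof -
    have w: "0 < 1 - x\<^sup>2" if "x \<in> {a..b}" for x using weight_pos[of x] ab that by auto
    have "(\<lambda>s. 1 / (1 - s\<^sup>2) ^ k) integrable_on {a..b}"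
      by (intro integrable_continuous_real continuous_intros) (use w in fastforce)
    moreover have "0 \<le> 1 / (1 - x\<^sup>2) ^ k" if "x \<in> {a..b}" for x using w[OF that] by simp
    ultimately show ?thesis unfolding V_def by (intro Henstock_Kurzweil_Integration.integral_nonneg)
  qed
  define C where "C = 2 * (V k + V l)"
  show ?thesis
  proof (rule that[of C])
    show "C \<ge> 0" using V0[of k] V0[of l] by (simp add: C_def)
    fix f g assume fg: "acd f g" and f: "L2 k f" and g: "L2 l g"
    note Lf = L2_local[OF f ab(1,4)] and Lg = L2_local[OF g ab(1,4)]
    define J where "J = integral {a..b} (\<lambda>s. cmod (g s))"
    have J0: "J \<ge> 0" unfolding J_def by (intro Henstock_Kurzweil_Integration.integral_nonneg absint_norm_int Lg) auto
    have pt: "cmod (f s) \<le> cmod (f t) + J" if t: "t \<in> {a..b}" for t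
    proof -
      have sub: "integral {x..y} (\<lambda>s. cmod (g s)) \<le> J" if "a \<le> x" "y \<le> b" for x y
        unfolding J_def using that absolutely_integrable_on_subinterval[OF Lg(1), of x y]
        by (intro integral_subset_le absint_norm_int Lg(1)) auto
      have "cmod (f s - f t) \<le> J"
      proof (cases "s \<le> t")
        case True
        then have "cmod (f t - f s) \<le> J"
          using acd_norm_diff[OF fg, of s t] sub[of s t] t ab by auto
        then show ?thesis by (simp add: norm_minus_commute)
      next
        case False
        then show ?thesis using acd_norm_diff[OF fg, of t s] sub[of t s] t ab by auto
      qed
      then show ?thesis using norm_triangle_ineq[of "f t" "f s - f t"] by simp
    qed
    have "integral {a..b} (\<lambda>t. cmod (f s)) \<le> integral {a..b} (\<lambda>t. cmod (f t) + J)"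
      by (intro integral_le integrable_add absint_norm_int Lf integrable_const_ivl pt)
    also have "\<dots> = integral {a..b} (\<lambda>t. cmod (f t)) + J"
      using ab by (subst Henstock_Kurzweil_Integration.integral_add) (auto intro: absint_norm_int Lf)
    finally have "cmod (f s) \<le> integral {a..b} (\<lambda>t. cmod (f t)) + J" using ab by simp
    then have "(cmod (f s))\<^sup>2 \<le> (integral {a..b} (\<lambda>t. cmod (f t)) + J)\<^sup>2" by (intro power_mono) auto
    also have "\<dots> \<le> 2 * (integral {a..b} (\<lambda>t. cmod (f t)))\<^sup>2 + 2 * J\<^sup>2"
      using zero_le_power2[of "integral {a..b} (\<lambda>t. cmod (f t)) - J"] by (simp add: power2_sum power2_diff)
    also have "\<dots> \<le> 2 * (nsq k f * V k) + 2 * (nsq l g * V l)"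
      using Lf(2) Lg(2) unfolding J_def V_def by (intro add_mono mult_left_mono) auto
    also have "\<dots> \<le> C * (nsq k f + nsq l g)"
      using mult_nonneg_nonneg[OF V0[of l] nsq_nonneg[of k f]] mult_nonneg_nonneg[OF V0[of k] nsq_nonneg[of l g]]
      unfolding C_def by (simp add: algebra_simps)
    finally show "(cmod (f s))\<^sup>2 \<le> C * (nsq k f + nsq l g)" .
  qed
qed


text \<open>Replaces the weight by a real power of 1 - |s|, which integrates in closed form. The
  exponent may exceed k, so that the logarithmic exponent 1 can be avoided.\<close>

lemma power_weight_le:
  fixes s :: real
  assumes "s \<in> {-1<..<1}" and "real k \<le> p"
  shows "(1 - \<bar>s\<bar>) powr p \<le> (1 - s\<^sup>2) ^ k"
proof -
  have s: "0 < 1 - \<bar>s\<bar>" "1 - \<bar>s\<bar> \<le> 1" using assms by auto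
  have "(1 - \<bar>s\<bar>) powr p \<le> (1 - \<bar>s\<bar>) powr real k"
    using s assms(2) by (intro powr_mono') auto
  also have "\<dots> = (1 - \<bar>s\<bar>) ^ k" using s by (simp add: powr_realpow)
  also have "\<dots> \<le> (1 - s\<^sup>2) ^ k"
  proof (intro power_mono)
    have "\<bar>s\<bar> * \<bar>s\<bar> \<le> \<bar>s\<bar> * 1" using s by (intro mult_left_mono) auto
    then show "1 - \<bar>s\<bar> \<le> 1 - s\<^sup>2" by (simp add: power2_eq_square abs_mult[symmetric])
  qed (use s in auto)
  finally show ?thesis .
qed

lemma has_integral_powr_weight:
  fixes p :: real
  assumes s: "s \<in> {-1<..<1}" and p: "p \<noteq> 1"
  shows "((\<lambda>t. (1 - \<bar>t\<bar>) powr (-p)) has_integral ((1 - \<bar>s\<bar>) powr (1 - p) - 1) / (p - 1)) {min 0 s..max 0 s}"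
proof -
  define F where "F = (\<lambda>t::real. if 0 \<le> s then (1 - t) powr (1 - p) / (p - 1) else - ((1 + t) powr (1 - p) / (p - 1)))"
  have "((\<lambda>t. (1 - \<bar>t\<bar>) powr (-p)) has_integral F (max 0 s) - F (min 0 s)) {min 0 s..max 0 s}"
  proof (rule fundamental_theorem_of_calculus)
    fix t assume t: "t \<in> {min 0 s..max 0 s}"
    show "(F has_vector_derivative (1 - \<bar>t\<bar>) powr (-p)) (at t within {min 0 s..max 0 s})"
    proof (cases "0 \<le> s")
      case True
      then have t': "0 \<le> t" "t < 1" using t s by auto
      have "((\<lambda>t. (1 - t) powr (1 - p) / (p - 1)) has_real_derivative
          ((1 - p) * (1 - t) powr (1 - p - 1) * (0 - 1)) / (p - 1)) (at t within {min 0 s..max 0 s})"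
        using t' p by (auto intro!: derivative_eq_intros)
      moreover have "((1 - p) * (1 - t) powr (1 - p - 1) * (0 - 1)) / (p - 1) = (1 - \<bar>t\<bar>) powr (-p)"
        using p t' by (simp add: field_simps)
      ultimately show ?thesis using True unfolding F_def has_real_derivative_iff_has_vector_derivative by simp
    next
      case False
      then have t': "t \<le> 0" "-1 < t" using t s by auto
      have "((\<lambda>t. - ((1 + t) powr (1 - p) / (p - 1))) has_real_derivative
          - (((1 - p) * (1 + t) powr (1 - p - 1) * (0 + 1)) / (p - 1))) (at t within {min 0 s..max 0 s})"
        using t' p by (auto intro!: derivative_eq_intros)
      moreover have "- (((1 - p) * (1 + t) powr (1 - p - 1) * (0 + 1)) / (p - 1)) = (1 - \<bar>t\<bar>) powr (-p)"
        using p t' by (simp add: field_simps)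
      ultimately show ?thesis using False unfolding F_def has_real_derivative_iff_has_vector_derivative by simp
    qed
  qed auto
  moreover have "F (max 0 s) - F (min 0 s) = ((1 - \<bar>s\<bar>) powr (1 - p) - 1) / (p - 1)"
    by (cases "0 \<le> s") (auto simp: F_def diff_divide_distrib max_def min_def)
  ultimately show ?thesis by simp
qed

text \<open>Cauchy-Schwarz between 0 and s against the reciprocal weight (1 - |t|)^(-p). For 1 < p
  its integral is at most a pure power of 1 - |s|.\<close>

lemma acd_growth:
  assumes fg: "acd f g" and g: "L2 k g" and kp: "real k \<le> p" "1 < p" and s: "s \<in> {-1<..<1}"
  shows "(cmod (f s - f 0))\<^sup>2 \<le> nsq k g * ((1 - \<bar>s\<bar>) powr (1 - p) / (p - 1))"
proof -
  define a b where "a = min 0 s" and "b = max 0 s"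
  have ab: "-1 < a" "a \<le> b" "b < 1"
    using s by (auto simp: a_def b_def)
  have sub: "{a..b} \<subseteq> {-1..1}" using ab by auto
  have in1: "t \<in> {-1<..<1}" if "t \<in> {a..b}" for t using that ab by auto
  have le: "(cmod (g t))\<^sup>2 \<le> ((1 - t\<^sup>2) ^ k * (cmod (g t))\<^sup>2) * ((1 - \<bar>t\<bar>) powr (-p))" if t: "t \<in> {a..b}" for t
  proof -
    have pos: "0 < 1 - \<bar>t\<bar>" using in1[OF t] by auto
    have "1 = (1 - \<bar>t\<bar>) powr p * (1 - \<bar>t\<bar>) powr (-p)" using pos by (simp add: powr_minus_divide)
    also have "\<dots> \<le> (1 - t\<^sup>2) ^ k * (1 - \<bar>t\<bar>) powr (-p)"
      by (intro mult_right_mono power_weight_le[OF in1[OF t] kp(1)]) auto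
    finally have "1 * (cmod (g t))\<^sup>2 \<le> ((1 - t\<^sup>2) ^ k * (1 - \<bar>t\<bar>) powr (-p)) * (cmod (g t))\<^sup>2"
      by (intro mult_right_mono) auto
    then show ?thesis by (simp add: mult_ac)
  qed
  have h0: "0 \<le> (1 - t\<^sup>2) ^ k * (cmod (g t))\<^sup>2" if "t \<in> {a..b}" for t
    using weight_pos[OF in1[OF that]] by simp
  note hi = has_integral_powr_weight[OF s, of p]
  have vi: "(\<lambda>t. (1 - \<bar>t\<bar>) powr (-p)) integrable_on {a..b}"
    and vI: "integral {a..b} (\<lambda>t. (1 - \<bar>t\<bar>) powr (-p)) = ((1 - \<bar>s\<bar>) powr (1 - p) - 1) / (p - 1)"
    using hi kp by (auto simp: a_def b_def integrable_on_def integral_unique)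
  note CS = Cauchy_Schwarz_interval[OF measurable_M1_sub[OF L2_measurable[OF g] sub] L2_HK(1)[OF g sub] vi le h0]
  have "cmod (f s - f 0) = cmod (f b - f a)"
    unfolding a_def b_def by (cases "0 \<le> s") (auto simp: norm_minus_commute)
  also have "\<dots> \<le> integral {a..b} (\<lambda>s. cmod (g s))" by (rule acd_norm_diff[OF fg ab(1-3)])
  finally have "(cmod (f s - f 0))\<^sup>2 \<le> (integral {a..b} (\<lambda>s. cmod (g s)))\<^sup>2" by (intro power_mono) auto
  also have "\<dots> \<le> integral {a..b} (\<lambda>t. (1 - t\<^sup>2) ^ k * (cmod (g t))\<^sup>2) * integral {a..b} (\<lambda>t. (1 - \<bar>t\<bar>) powr (-p))"
    by (rule CS(2)) auto
  also have "\<dots> \<le> nsq k g * ((1 - \<bar>s\<bar>) powr (1 - p) / (p - 1))"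
  proof (rule mult_mono[OF L2_HK(2)[OF g sub]])
    show "integral {a..b} (\<lambda>t. (1 - \<bar>t\<bar>) powr (-p)) \<le> (1 - \<bar>s\<bar>) powr (1 - p) / (p - 1)"
      unfolding vI using kp by (simp add: divide_right_mono)
  qed (auto intro!: Henstock_Kurzweil_Integration.integral_nonneg vi)
  finally show ?thesis .
qed

section \<open>Completeness of the weighted spaces\<close>

text \<open>By Fatou, an almost everywhere limit of a subsequence is the norm limit of the whole
  Cauchy sequence. It serves both an extracted subsequence and, with r = \<open>id\<close>,
  functions whose pointwise limits are already known.\<close>

lemma L2_Fatou:
  assumes u: "\<And>n. L2 k (u n)"
    and C: "\<And>e. e > 0 \<Longrightarrow> \<exists>N. \<forall>m\<ge>N. \<forall>n\<ge>N. nsq k (\<lambda>s. u m s - u n s) < e"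
    and r: "strict_mono r" and lim: "AE s in M1. (\<lambda>i. u (r i) s) \<longlonglongrightarrow> F s"
    and F: "F \<in> borel_measurable M1"
  shows "L2 k F" "(\<lambda>n. nsq k (\<lambda>s. u n s - F s)) \<longlonglongrightarrow> 0"
proof -
  have um [measurable]: "u n \<in> borel_measurable M1" for n using u by (rule L2_measurable)
  have key: "L2 k (\<lambda>s. u n s - F s) \<and> nsq k (\<lambda>s. u n s - F s) \<le> e"
    if e: "e > 0" and N: "\<forall>m\<ge>N. \<forall>n\<ge>N. nsq k (\<lambda>s. u m s - u n s) < e" and n: "n \<ge> N" for e N n
  proof -
    let ?g = "\<lambda>i s. (1 - s\<^sup>2) ^ k * (cmod (u n s - u (r i) s))\<^sup>2"
    let ?f = "\<lambda>s. (1 - s\<^sup>2) ^ k * (cmod (u n s - F s))\<^sup>2"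
    have fm: "?f \<in> borel_measurable M1" using F by measurable
    have gm: "?g i \<in> borel_measurable M1" for i by measurable
    have "(\<integral>\<^sup>+s. ennreal (?f s) \<partial>M1) = (\<integral>\<^sup>+s. liminf (\<lambda>i. ennreal (?g i s)) \<partial>M1)"
    proof (rule nn_integral_cong_AE)
      show "AE s in M1. ennreal (?f s) = liminf (\<lambda>i. ennreal (?g i s))"
        using lim
      proof eventually_elim
        case (elim s)
        have "(\<lambda>i. ennreal (?g i s)) \<longlonglongrightarrow> ennreal (?f s)"
          by (intro tendsto_ennrealI tendsto_intros elim)
        then show ?case by (metis lim_imp_Liminf trivial_limit_sequentially)
      qed
    qed
    also have "\<dots> \<le> liminf (\<lambda>i. \<integral>\<^sup>+s. ennreal (?g i s) \<partial>M1)"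
      using gm by (intro nn_integral_liminf) measurable
    also have "\<dots> \<le> ennreal e"
    proof (rule Liminf_le)
      have "(\<integral>\<^sup>+s. ennreal (?g i s) \<partial>M1) \<le> ennreal e" if i: "i \<ge> N" for i
      proof -
        have "(\<integral>\<^sup>+s. ennreal (?g i s) \<partial>M1) = ennreal (nsq k (\<lambda>s. u n s - u (r i) s))"
          unfolding nsq_def
        proof (rule nn_integral_eq_integral)
          show "integrable M1 (?g i)" using L2_int[OF L2_diff(1)[OF u u]] .
          show "AE s in M1. 0 \<le> ?g i s" by (intro AE_M1I mult_nonneg_nonneg zero_le_power less_imp_le[OF weight_pos]) auto
        qed
        then show ?thesis using N n i seq_suble[OF r, of i] e by (auto intro!: ennreal_leI less_imp_le)
      qed
      then show "eventually (\<lambda>i. (\<integral>\<^sup>+s. ennreal (?g i s) \<partial>M1) \<le> ennreal e) sequentially"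
        unfolding eventually_sequentially by blast
    qed simp
    finally have fin: "(\<integral>\<^sup>+s. ennreal (?f s) \<partial>M1) \<le> ennreal e" .
    have f0: "AE s in M1. 0 \<le> ?f s" by (intro AE_M1I mult_nonneg_nonneg zero_le_power less_imp_le[OF weight_pos]) auto
    have i: "integrable M1 ?f"
      using fm f0 fin by (intro integrableI_nonneg) (auto intro: le_less_trans)
    have "ennreal (nsq k (\<lambda>s. u n s - F s)) \<le> ennreal e"
      unfolding nsq_def using nn_integral_eq_integral[OF i f0] fin by simp
    then have "nsq k (\<lambda>s. u n s - F s) \<le> e" using e by (simp add: ennreal_le_iff)
    moreover have "(\<lambda>s. u n s - F s) \<in> borel_measurable M1" using F by measurable
    ultimately show ?thesis using i by (simp add: L2_def)
  qed
  obtain N where "\<forall>m\<ge>N. \<forall>n\<ge>N. nsq k (\<lambda>s. u m s - u n s) < 1" using C[of 1] by auto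
  then have "L2 k (\<lambda>s. u N s - F s)" using key[of 1 N N] by simp
  from L2_diff(1)[OF u[of N] this] show "L2 k F" by simp
  show "(\<lambda>n. nsq k (\<lambda>s. u n s - F s)) \<longlonglongrightarrow> 0"
  proof (rule LIMSEQ_I)
    fix e :: real assume e: "e > 0"
    obtain N where "\<forall>m\<ge>N. \<forall>n\<ge>N. nsq k (\<lambda>s. u m s - u n s) < e / 2" using C[of "e/2"] e by auto
    then have "nsq k (\<lambda>s. u n s - F s) \<le> e / 2" if "n \<ge> N" for n using key[of "e/2" N n] e that by simp
    then show "\<exists>no. \<forall>n\<ge>no. norm (nsq k (\<lambda>s. u n s - F s) - 0) < e"
      using e by (intro exI[of _ N] allI impI) (force)
  qed
qed

text \<open>The almost everywhere convergent subsequence comes from L1: weight times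
  \<open>u n\<close> is Cauchy there, by AM-GM with a parameter t and the integrability of the
  weight.\<close>

lemma L2_complete:
  assumes u: "\<And>n. L2 k (u n)"
    and C: "\<And>e. e > 0 \<Longrightarrow> \<exists>N. \<forall>m\<ge>N. \<forall>n\<ge>N. nsq k (\<lambda>s. u m s - u n s) < e"
  obtains F r where "L2 k F" "(\<lambda>n. nsq k (\<lambda>s. u n s - F s)) \<longlonglongrightarrow> 0"
    "strict_mono r" "AE s in M1. (\<lambda>i. u (r i) s) \<longlonglongrightarrow> F s"
proof -
  interpret finite_measure M1 by (rule finite_measure_M1)
  have um [measurable]: "u n \<in> borel_measurable M1" for n using u by (rule L2_measurable)
  define W where "W = (LINT s|M1. (1 - s\<^sup>2) ^ k)"
  have Wi: "integrable M1 (\<lambda>s. (1 - s\<^sup>2) ^ k)"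
  proof (rule Bochner_Integration.integrable_bound[of _ "\<lambda>s. 1 :: real"])
    show "AE s in M1. norm ((1 - s\<^sup>2) ^ k) \<le> norm (1 :: real)"
    proof (rule AE_M1I)
      fix s :: real assume s: "s \<in> {-1<..<1}"
      have "0 \<le> (1 - s\<^sup>2) ^ k" "(1 - s\<^sup>2) ^ k \<le> 1"
        using less_imp_le[OF weight_pos[OF s]] by (auto intro: power_le_one)
      then show "norm ((1 - s\<^sup>2) ^ k) \<le> norm (1 :: real)" by simp
    qed
  qed (auto intro: integrable_const)
  have W0: "W \<ge> 0" unfolding W_def by (intro integral_nonneg_AE AE_M1I zero_le_power less_imp_le[OF weight_pos])
  define v where "v n s = (1 - s\<^sup>2) ^ k *\<^sub>R u n s" for n s
  have vm [measurable]: "v n \<in> borel_measurable M1" for n unfolding v_def by measurable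
  have AG: "cmod (v m s - v n s) \<le> t * (1 - s\<^sup>2) ^ k + ((1 - s\<^sup>2) ^ k * (cmod (u m s - u n s))\<^sup>2) / t"
    if t: "t > 0" and s: "s \<in> {-1<..<1}" for m n s t
  proof -
    define w x where "w = (1 - s\<^sup>2) ^ k" and "x = cmod (u m s - u n s)"
    have w: "w > 0" using weight_pos[OF s] by (simp add: w_def)
    have "x \<le> t + x\<^sup>2 / t"
    proof -
      have "2 * (x * t) \<le> t\<^sup>2 + x\<^sup>2" using zero_le_power2[of "x - t"] by (simp add: power2_diff)
      moreover have "0 \<le> x * t" using t by (simp add: x_def)
      ultimately have "x * t \<le> t\<^sup>2 + x\<^sup>2" by linarith
      then show ?thesis using t by (simp add: field_simps power2_eq_square)
    qed
    then have "w * x \<le> w * (t + x\<^sup>2 / t)" using w by (intro mult_left_mono) auto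
    moreover have "cmod (v m s - v n s) = w * x"
      using w by (simp add: v_def w_def[symmetric] x_def flip: scaleR_diff_right)
    ultimately show ?thesis by (simp add: w_def x_def algebra_simps)
  qed
  have di: "integrable M1 (\<lambda>s. (1 - s\<^sup>2) ^ k * (cmod (u m s - u n s))\<^sup>2)" for m n
    by (rule L2_int[OF L2_diff(1)[OF u u]])
  have vi: "integrable M1 (v n)" for n
  proof (rule Bochner_Integration.integrable_bound)
    show "integrable M1 (\<lambda>s. (1 - s\<^sup>2) ^ k + (1 - s\<^sup>2) ^ k * (cmod (u n s))\<^sup>2)"
      by (intro Bochner_Integration.integrable_add Wi L2_int[OF u])
    show "AE s in M1. norm (v n s) \<le> norm ((1 - s\<^sup>2) ^ k + (1 - s\<^sup>2) ^ k * (cmod (u n s))\<^sup>2)"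
    proof (rule AE_M1I)
      fix s :: real assume s: "s \<in> {-1<..<1}"
      define w x where "w = (1 - s\<^sup>2) ^ k" and "x = cmod (u n s)"
      have w: "w > 0" using weight_pos[OF s] by (simp add: w_def)
      have "2 * x \<le> 1 + x\<^sup>2" using zero_le_power2[of "x - 1"] by (simp add: power2_diff)
      moreover have "0 \<le> x" by (simp add: x_def)
      ultimately have "x \<le> 1 + x\<^sup>2" by linarith
      then have "w * x \<le> w * (1 + x\<^sup>2)" using w by (intro mult_left_mono) auto
      then show "norm (v n s) \<le> norm ((1 - s\<^sup>2) ^ k + (1 - s\<^sup>2) ^ k * (cmod (u n s))\<^sup>2)"
        using w by (simp add: v_def w_def[symmetric] x_def[symmetric] algebra_simps)
    qed
  qed measurable
  have vC: "\<exists>N. \<forall>i\<ge>N. \<forall>j\<ge>N. (LINT s|M1. norm (v i s - v j s)) < e" if e: "e > 0" for e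
  proof -
    \<comment> \<open>Makes t * W smaller than e / 2. The other term is \<open>nsq\<close> divided
      by t, so N is taken for t * e / 2.\<close>
    define t where "t = e / (2 * (W + 1))"
    have t: "t > 0" "t * W < e / 2 + 0" using e W0 by (auto simp: t_def field_simps)
    obtain N where N: "\<forall>m\<ge>N. \<forall>n\<ge>N. nsq k (\<lambda>s. u m s - u n s) < t * e / 2"
      using C[of "t * e / 2"] t e by auto
    have "(LINT s|M1. norm (v i s - v j s)) < e" if "i \<ge> N" "j \<ge> N" for i j
    proof -
      have "(LINT s|M1. norm (v i s - v j s)) \<le>
          (LINT s|M1. t * (1 - s\<^sup>2) ^ k + ((1 - s\<^sup>2) ^ k * (cmod (u i s - u j s))\<^sup>2) / t)"
        using vi Wi di t(1)
        by (intro integral_mono_AE AE_M1I AG integrable_norm Bochner_Integration.integrable_diff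
            Bochner_Integration.integrable_add integrable_mult_right integrable_divide) auto
      also have "\<dots> = t * W + nsq k (\<lambda>s. u i s - u j s) / t"
        using Wi di by (subst Bochner_Integration.integral_add) (auto simp: W_def nsq_def)
      also have "\<dots> < e / 2 + e / 2"
        using N that t by (intro add_strict_mono) (auto simp: field_simps)
      finally show ?thesis by simp
    qed
    then show ?thesis by blast
  qed
  obtain r where r: "strict_mono r" "AE s in M1. Cauchy (\<lambda>i. v (r i) s)"
    by (rule cauchy_L1_AE_cauchy_subseq[OF vi vC])
  have in1: "AE s in M1. s \<in> {-1<..<1}" by (rule AE_M1I)
  define F where "F s = lim (\<lambda>i. u (r i) s)" for s
  have lim: "AE s in M1. (\<lambda>i. u (r i) s) \<longlonglongrightarrow> F s"
    using r(2) in1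
  proof eventually_elim
    case (elim s)
    have w: "(1 - s\<^sup>2) ^ k \<noteq> 0" using weight_pos[of s] elim by auto
    have "convergent (\<lambda>i. v (r i) s)" using elim by (simp add: Cauchy_convergent_iff)
    then obtain l where "(\<lambda>i. v (r i) s) \<longlonglongrightarrow> l" by (auto simp: convergent_def)
    then have "(\<lambda>i. inverse ((1 - s\<^sup>2) ^ k) *\<^sub>R v (r i) s) \<longlonglongrightarrow> inverse ((1 - s\<^sup>2) ^ k) *\<^sub>R l"
      by (intro tendsto_intros)
    then have "(\<lambda>i. u (r i) s) \<longlonglongrightarrow> inverse ((1 - s\<^sup>2) ^ k) *\<^sub>R l" using w by (simp add: v_def)
    then show ?case unfolding F_def by (simp add: limI)
  qed
  have Fm: "F \<in> borel_measurable M1" unfolding F_def by measurable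
  have "L2 k F" "(\<lambda>n. nsq k (\<lambda>s. u n s - F s)) \<longlonglongrightarrow> 0"
    by (rule L2_Fatou[OF u C r(1) lim Fm]; assumption)+
  then show ?thesis by (rule that[OF _ _ r(1) lim])
qed

text \<open>The bounded factor converges pointwise only, so the part (u n - u') v' is treated by
  dominated convergence. This is the step that gives no rate.\<close>

lemma L2_tendsto_mult:
  assumes um: "\<And>n. u n \<in> borel_measurable M1" and uB: "\<And>n s. s \<in> {-1<..<1} \<Longrightarrow> cmod (u n s) \<le> B"
    and u: "\<And>s. s \<in> {-1<..<1} \<Longrightarrow> (\<lambda>n. u n s) \<longlonglongrightarrow> u' s"
    and vL: "\<And>n. L2 k (v n)" and v'L: "L2 k v'" and v: "(\<lambda>n. nsq k (\<lambda>s. v n s - v' s)) \<longlonglongrightarrow> 0"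
  shows "L2 k (\<lambda>s. u' s * v' s)" "(\<lambda>n. nsq k (\<lambda>s. u n s * v n s - u' s * v' s)) \<longlonglongrightarrow> 0"
proof -
  have u'B: "cmod (u' s) \<le> B" if "s \<in> {-1<..<1}" for s
    using LIMSEQ_le_const2[OF tendsto_norm[OF u[OF that]], of B] uB[OF that] by blast
  have u'm: "u' \<in> borel_measurable M1"
  proof (rule measurable_M1_open, rule borel_measurable_LIMSEQ_metric)
    show "u n \<in> borel_measurable (lebesgue_on {-1<..<1})" for n
      using um[of n] by (rule measurable_restrict_mono) auto
    show "(\<lambda>n. u n s) \<longlonglongrightarrow> u' s" if "s \<in> space (lebesgue_on {-1<..<1})" for s using u that by simp
  qed
  show "L2 k (\<lambda>s. u' s * v' s)" by (rule L2_bounded_mult(1)[OF u'm v'L u'B])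
  have d: "(\<lambda>n. nsq k (\<lambda>s. (u n s - u' s) * v' s)) \<longlonglongrightarrow> (LINT s|M1. 0)"
    unfolding nsq_def
  proof (rule integral_dominated_convergence)
    show "integrable M1 (\<lambda>s. (2 * B)\<^sup>2 * ((1 - s\<^sup>2) ^ k * (cmod (v' s))\<^sup>2))"
      using L2_int[OF v'L] by (rule integrable_mult_right)
    show "AE s in M1. (\<lambda>n. (1 - s\<^sup>2) ^ k * (cmod ((u n s - u' s) * v' s))\<^sup>2) \<longlonglongrightarrow> 0"
    proof (rule AE_M1I)
      fix s :: real assume s: "s \<in> {-1<..<1}"
      have "(\<lambda>n. (1 - s\<^sup>2) ^ k * (cmod ((u n s - u' s) * v' s))\<^sup>2) \<longlonglongrightarrow> (1 - s\<^sup>2) ^ k * (cmod ((u' s - u' s) * v' s))\<^sup>2"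
        by (intro tendsto_intros u[OF s])
      then show "(\<lambda>n. (1 - s\<^sup>2) ^ k * (cmod ((u n s - u' s) * v' s))\<^sup>2) \<longlonglongrightarrow> 0" by simp
    qed
    show "AE s in M1. norm ((1 - s\<^sup>2) ^ k * (cmod ((u n s - u' s) * v' s))\<^sup>2) \<le> (2 * B)\<^sup>2 * ((1 - s\<^sup>2) ^ k * (cmod (v' s))\<^sup>2)" for n
    proof (rule AE_M1I)
      fix s :: real assume s: "s \<in> {-1<..<1}"
      have w: "(1 - s\<^sup>2) ^ k > 0" using weight_pos[OF s] by simp
      have "cmod (u n s - u' s) \<le> 2 * B"
        using norm_triangle_ineq4[of "u n s" "u' s"] uB[OF s, of n] u'B[OF s] by linarith
      then have "(cmod (u n s - u' s))\<^sup>2 \<le> (2 * B)\<^sup>2" by (intro power_mono) auto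
      then have "(cmod (u n s - u' s))\<^sup>2 * ((1 - s\<^sup>2) ^ k * (cmod (v' s))\<^sup>2) \<le> (2 * B)\<^sup>2 * ((1 - s\<^sup>2) ^ k * (cmod (v' s))\<^sup>2)"
        using w by (intro mult_right_mono) auto
      then show "norm ((1 - s\<^sup>2) ^ k * (cmod ((u n s - u' s) * v' s))\<^sup>2) \<le> (2 * B)\<^sup>2 * ((1 - s\<^sup>2) ^ k * (cmod (v' s))\<^sup>2)"
        using w by (simp add: norm_mult power_mult_distrib mult_ac abs_mult)
    qed
    show "(\<lambda>s. (1 - s\<^sup>2) ^ k * (cmod ((u n s - u' s) * v' s))\<^sup>2) \<in> borel_measurable M1" for n
      using um[of n] u'm L2_measurable[OF v'L] by measurable
  qed auto
  have b: "nsq k (\<lambda>s. u n s * v n s - u' s * v' s)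
      \<le> 2 * (B\<^sup>2 * nsq k (\<lambda>s. v n s - v' s)) + 2 * nsq k (\<lambda>s. (u n s - u' s) * v' s)" for n
  proof -
    have L1: "L2 k (\<lambda>s. u n s * (v n s - v' s))" and b1: "nsq k (\<lambda>s. u n s * (v n s - v' s)) \<le> B\<^sup>2 * nsq k (\<lambda>s. v n s - v' s)"
      by (rule L2_bounded_mult[OF um L2_diff(1)[OF vL v'L] uB]; assumption)+
    have L2': "L2 k (\<lambda>s. (u n s - u' s) * v' s)"
    proof (rule L2_bounded_mult(1)[OF _ v'L])
      show "(\<lambda>s. u n s - u' s) \<in> borel_measurable M1" using um[of n] u'm by measurable
      show "cmod (u n s - u' s) \<le> B + B" if "s \<in> {-1<..<1}" for s
        using norm_triangle_ineq4[of "u n s" "u' s"] uB[OF that, of n] u'B[OF that] by linarith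
    qed
    have "(\<lambda>s. u n s * v n s - u' s * v' s) = (\<lambda>s. u n s * (v n s - v' s) + (u n s - u' s) * v' s)"
      by (auto simp: algebra_simps)
    then show ?thesis using L2_add(2)[OF L1 L2'] b1 by simp
  qed
  show "(\<lambda>n. nsq k (\<lambda>s. u n s * v n s - u' s * v' s)) \<longlonglongrightarrow> 0"
  proof (rule tendsto_sandwich[OF _ _ tendsto_const])
    have "(\<lambda>n. 2 * (B\<^sup>2 * nsq k (\<lambda>s. v n s - v' s)) + 2 * nsq k (\<lambda>s. (u n s - u' s) * v' s)) \<longlonglongrightarrow> 2 * (B\<^sup>2 * 0) + 2 * 0"
      using d by (intro tendsto_intros v) simp
    then show "(\<lambda>n. 2 * (B\<^sup>2 * nsq k (\<lambda>s. v n s - v' s)) + 2 * nsq k (\<lambda>s. (u n s - u' s) * v' s)) \<longlonglongrightarrow> 0" by simp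
  qed (use b in auto)
qed

section \<open>Weak derivatives are absolutely continuous primitives\<close>

lemma integral_M1_support:
  fixes h :: "real \<Rightarrow> 'a::euclidean_space"
  assumes h: "h absolutely_integrable_on {a..b}" and ab: "{a..b} \<subseteq> {-1..1}"
    and z: "\<And>s. s \<notin> {a..b} \<Longrightarrow> h s = 0"
  shows "integrable M1 h" "integral\<^sup>L M1 h = integral {a..b} h"
proof -
  have e: "(\<lambda>x. indicator {-1..1} x *\<^sub>R h x) = (\<lambda>x. indicator {a..b} x *\<^sub>R h x)"
    using ab z by (auto simp: indicator_def fun_eq_iff subset_iff)
  have h1: "h absolutely_integrable_on {-1..1}"
    using h unfolding set_integrable_def e .
  then show i: "integrable M1 h" by (rule absolutely_integrable_imp_integrable) auto
  have "integral\<^sup>L M1 h = integral {-1..1} h" by (rule lebesgue_integral_eq_integral[OF i]) auto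
  also have "\<dots> = (LINT x:{-1..1}|lebesgue. h x)" using set_lebesgue_integral_eq_integral(2)[OF h1] by simp
  also have "\<dots> = (LINT x:{a..b}|lebesgue. h x)" unfolding set_lebesgue_integral_def e ..
  also have "\<dots> = integral {a..b} h" by (rule set_lebesgue_integral_eq_integral(2)[OF h])
  finally show "integral\<^sup>L M1 h = integral {a..b} h" .
qed

lemma AE_lebesgue_on_iff: "S \<in> sets lebesgue \<Longrightarrow> (AE s in lebesgue_on S. P s) \<longleftrightarrow> (AE s in lebesgue. s \<in> S \<longrightarrow> P s)"
  by (rule AE_restrict_space_iff) simp

text \<open>Continuous functions approximate the conjugate of sgn g almost everywhere, so in the
  limit orthogonality says that the integral of \<kappa> |g| vanishes, where \<kappa> is a cut-off
  that is positive on |s| < r.\<close>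

lemma AE_zero_if_orthogonal:
  fixes g :: "real \<Rightarrow> complex"
  assumes g: "\<And>a b. -1 < a \<Longrightarrow> b < 1 \<Longrightarrow> g absolutely_integrable_on {a..b}"
    and orth: "\<And>\<psi> a b. continuous_on UNIV \<psi> \<Longrightarrow> -1 < a \<Longrightarrow> b < 1 \<Longrightarrow> (\<And>s. s \<notin> {a..b} \<Longrightarrow> \<psi> s = 0) \<Longrightarrow>
      integral {a..b} (\<lambda>s. complex_of_real (\<psi> s) * g s) = 0"
  shows "AE s in M1. g s = 0"
proof -
  have local: "AE s in lebesgue. \<bar>s\<bar> < r \<longrightarrow> g s = 0" if r: "0 < r" "r < 1" for r
  proof -
    let ?S = "{-r..r}"
    have gi: "g absolutely_integrable_on ?S" using g r by simp
    have gm [measurable]: "g \<in> borel_measurable (lebesgue_on ?S)"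
      by (rule absolutely_integrable_imp_borel_measurable[OF gi]) auto
    \<comment> \<open>The hat function makes the test functions vanish outside \<open>?S\<close>
      while staying continuous.\<close>
    define \<kappa> where "\<kappa> s = max 0 (r - \<bar>s\<bar>)" for s
    have \<kappa>c: "continuous_on A \<kappa>" for A unfolding \<kappa>_def by (intro continuous_intros)
    have \<kappa>: "0 \<le> \<kappa> s" "\<kappa> s \<le> r" "s \<notin> ?S \<Longrightarrow> \<kappa> s = 0" "\<bar>s\<bar> < r \<Longrightarrow> \<kappa> s > 0" for s
      using r by (auto simp: \<kappa>_def)
    have \<kappa>m [measurable]: "\<kappa> \<in> borel_measurable (lebesgue_on ?S)"
      by (intro continuous_imp_measurable_on_sets_lebesgue \<kappa>c) auto
    have hm: "(\<lambda>s. cnj (sgn (g s))) \<in> borel_measurable (lebesgue_on ?S)"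
    proof -
      have "(\<lambda>s. sgn (g s)) \<in> borel_measurable (lebesgue_on ?S)" unfolding sgn_div_norm by measurable
      then show ?thesis
        by (rule measurable_compose[OF _ borel_measurable_continuous_onI]) (intro continuous_intros)
    qed
    then have "(\<lambda>s. cnj (sgn (g s))) measurable_on ?S"
      by (subst measurable_on_iff_borel_measurable) auto
    then obtain N h where N: "negligible N" and hc: "\<And>n. continuous_on UNIV (h n)"
      and hl: "\<And>x. x \<notin> N \<Longrightarrow> (\<lambda>n. h n x) \<longlonglongrightarrow> (if x \<in> ?S then cnj (sgn (g x)) else 0)"
      unfolding measurable_on_def by blast
    \<comment> \<open>Scales \<open>h n\<close> back into the unit disc, for a common dominating
      function. The limit keeps its value, because |sgn| is at most 1.\<close>
    define k where "k n s = h n s /\<^sub>R max 1 (cmod (h n s))" for n s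
    have kc: "continuous_on A (k n)" for n A
      unfolding k_def by (intro continuous_intros continuous_on_subset[OF hc]) auto
    have k1: "cmod (k n s) \<le> 1" for n s
      unfolding k_def by (auto simp: field_simps)
    have kl: "(\<lambda>n. k n x) \<longlonglongrightarrow> cnj (sgn (g x))" if "x \<notin> N" "x \<in> ?S" for x
    proof -
      have "(\<lambda>n. k n x) \<longlonglongrightarrow> cnj (sgn (g x)) /\<^sub>R max 1 (cmod (cnj (sgn (g x))))"
        unfolding k_def using hl[OF that(1)] that(2) by (intro tendsto_intros) auto
      then show ?thesis by (simp add: norm_sgn split: if_splits)
    qed
    have km [measurable]: "k n \<in> borel_measurable (lebesgue_on ?S)" for n
      by (intro continuous_imp_measurable_on_sets_lebesgue kc) auto
    have z: "(LINT s|lebesgue_on ?S. complex_of_real (\<kappa> s) * k n s * g s) = 0" for n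
    proof -
      have rr: "-1 < -r" "r < 1" using r by auto
      have c: "continuous_on UNIV (\<lambda>s. \<kappa> s * Re (k n s))" "continuous_on UNIV (\<lambda>s. \<kappa> s * Im (k n s))"
        by (intro continuous_intros \<kappa>c kc)+
      have i: "(\<lambda>s. complex_of_real (\<kappa> s * Re (k n s)) * g s) absolutely_integrable_on ?S"
        "(\<lambda>s. complex_of_real (\<kappa> s * Im (k n s)) * g s) absolutely_integrable_on ?S"
        using gi by (intro absint_mult_cont continuous_intros \<kappa>c kc; simp)+
      have o: "integral ?S (\<lambda>s. complex_of_real (\<kappa> s * Re (k n s)) * g s) = 0"
        "integral ?S (\<lambda>s. complex_of_real (\<kappa> s * Im (k n s)) * g s) = 0"
        using \<kappa>(3) by (intro orth c rr; simp)+
      have eq: "complex_of_real (\<kappa> s) * k n s * g s = complex_of_real (\<kappa> s * Re (k n s)) * g s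
          + \<i> * (complex_of_real (\<kappa> s * Im (k n s)) * g s)" for s
        by (subst complex_eq[of "k n s"]) (simp add: algebra_simps)
      have ii: "(\<lambda>s. complex_of_real (\<kappa> s * Re (k n s)) * g s
          + \<i> * (complex_of_real (\<kappa> s * Im (k n s)) * g s)) absolutely_integrable_on ?S"
        using i by (intro set_integral_add set_integrable_mult_right)
      have "(LINT s|lebesgue_on ?S. complex_of_real (\<kappa> s) * k n s * g s)
          = integral ?S (\<lambda>s. complex_of_real (\<kappa> s) * k n s * g s)"
        unfolding eq by (intro lebesgue_integral_eq_integral absolutely_integrable_imp_integrable ii) auto
      also have "\<dots> = integral ?S (\<lambda>s. complex_of_real (\<kappa> s * Re (k n s)) * g s)
          + \<i> * integral ?S (\<lambda>s. complex_of_real (\<kappa> s * Im (k n s)) * g s)"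
        unfolding eq using i
        by (subst Henstock_Kurzweil_Integration.integral_add)
          (auto intro!: absint_imp_int set_integrable_mult_right simp del: of_real_mult)
      finally show ?thesis using o by simp
    qed
    have AEN: "AE s in lebesgue_on ?S. s \<notin> N"
      using N by (simp add: AE_lebesgue_on_iff negligible_iff_null_sets) (auto simp: eventually_ae_filter)
    have "(\<lambda>n. LINT s|lebesgue_on ?S. complex_of_real (\<kappa> s) * k n s * g s)
        \<longlonglongrightarrow> (LINT s|lebesgue_on ?S. complex_of_real (\<kappa> s * cmod (g s)))"
    proof (rule integral_dominated_convergence)
      show "integrable (lebesgue_on ?S) (\<lambda>s. r * cmod (g s))"
        using absolutely_integrable_imp_integrable[OF gi] by auto
      show "AE s in lebesgue_on ?S. (\<lambda>n. complex_of_real (\<kappa> s) * k n s * g s) \<longlonglongrightarrow> complex_of_real (\<kappa> s * cmod (g s))"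
        using AEN AE_space
      proof eventually_elim
        case (elim s)
        have "(\<lambda>n. complex_of_real (\<kappa> s) * k n s * g s) \<longlonglongrightarrow> complex_of_real (\<kappa> s) * cnj (sgn (g s)) * g s"
          using elim by (intro tendsto_intros kl) auto
        moreover have "cnj (sgn (g s)) * g s = cmod (g s)"
        proof (cases "g s = 0")
          case False
          have "cnj (sgn (g s)) * g s = cnj (g s) * g s / cmod (g s)" by (simp add: sgn_eq)
          also have "cnj (g s) * g s = complex_of_real (cmod (g s)) * cmod (g s)"
            by (metis complex_norm_square mult.commute of_real_mult power2_eq_square)
          finally show ?thesis using False by simp
        qed simp
        ultimately show ?case by (simp add: mult.assoc)
      qed
      show "AE s in lebesgue_on ?S. norm (complex_of_real (\<kappa> s) * k n s * g s) \<le> r * cmod (g s)" for n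
      proof (rule AE_I2)
        fix s
        have "\<kappa> s * cmod (k n s) \<le> r * 1" using \<kappa> k1 r by (intro mult_mono) auto
        then show "norm (complex_of_real (\<kappa> s) * k n s * g s) \<le> r * cmod (g s)"
          using \<kappa>(1)[of s] by (simp add: norm_mult mult_right_mono)
      qed
    qed measurable
    then have "(LINT s|lebesgue_on ?S. complex_of_real (\<kappa> s * cmod (g s))) = 0"
      using z by (simp add: LIMSEQ_const_iff)
    then have "(LINT s|lebesgue_on ?S. \<kappa> s * cmod (g s)) = 0"
      by (simp only: integral_complex_of_real of_real_eq_0_iff)
    moreover have "integrable (lebesgue_on ?S) (\<lambda>s. \<kappa> s * cmod (g s))"
    proof (rule Bochner_Integration.integrable_bound)
      show "integrable (lebesgue_on ?S) (\<lambda>s. r * cmod (g s))"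
        using absolutely_integrable_imp_integrable[OF gi] by auto
      show "AE s in lebesgue_on ?S. norm (\<kappa> s * cmod (g s)) \<le> norm (r * cmod (g s))"
        using \<kappa> r by (auto simp: abs_mult intro!: AE_I2 mult_right_mono)
    qed measurable
    ultimately have "AE s in lebesgue_on ?S. \<kappa> s * cmod (g s) = 0"
      using \<kappa>(1) by (subst (asm) integral_nonneg_eq_0_iff_AE) auto
    then have "AE s in lebesgue. s \<in> ?S \<longrightarrow> \<kappa> s * cmod (g s) = 0"
      by (simp add: AE_lebesgue_on_iff)
    then show ?thesis
    proof eventually_elim
      case (elim s)
      show ?case
      proof
        assume s: "\<bar>s\<bar> < r"
        then have "s \<in> ?S" by auto
        then show "g s = 0" using elim \<kappa>(4)[OF s] by auto
      qed
    qed
  qed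
  \<comment> \<open>Countably many radii increasing to 1 exhaust the open interval.\<close>
  have "AE s in lebesgue. \<forall>n. \<bar>s\<bar> < 1 - 1 / real (n + 2) \<longrightarrow> g s = 0"
    unfolding AE_all_countable by (intro allI local) (auto simp: field_simps)
  then have "AE s in lebesgue. s \<in> {-1<..<1} \<longrightarrow> g s = 0"
  proof eventually_elim
    case (elim s)
    show ?case
    proof
      assume "s \<in> {-1<..<1}"
      then have "1 - \<bar>s\<bar> > 0" by auto
      then obtain n where n: "inverse (real (Suc n)) < 1 - \<bar>s\<bar>" using reals_Archimedean by blast
      have "1 / real (n + 2) \<le> inverse (real (Suc n))" by (simp add: field_simps)
      then have "\<bar>s\<bar> < 1 - 1 / real (n + 2)" using n by linarith
      then show "g s = 0" using elim by blast
    qed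
  qed
  moreover have "AE s in lebesgue. s \<noteq> -1 \<and> s \<noteq> (1::real)"
    by (intro AE_conjI AE_completion AE_lborel_singleton)
  ultimately have "AE s in lebesgue. s \<in> {-1..1} \<longrightarrow> g s = 0" by eventually_elim auto
  then show ?thesis by (simp add: AE_lebesgue_on_iff)
qed


text \<open>All integrals of g over subintervals vanish, so near a point x the factor \<psi> may be
  replaced by \<psi> - \<psi> x, which is small there. \<open>Bolzano\<close> adds up the local
  bounds.\<close>

lemma acd_const_orthogonal:
  assumes g: "acd (\<lambda>s. c) g" and \<psi>: "continuous_on {a..b} \<psi>" and ab: "-1 < a" "a \<le> b" "b < 1"
  shows "integral {a..b} (\<lambda>s. \<psi> s * g s) = 0"
proof -
  note gi = acd_integrable[OF g ab(1,3)]
  let ?h = "\<lambda>s. \<psi> s * g s"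
  have hi: "?h absolutely_integrable_on {a..b}" by (rule absint_mult_cont(1)[OF \<psi> gi])
  define A where "A t = integral {a..t} (\<lambda>s. cmod (g s))" for t
  define G where "G t = integral {a..t} ?h" for t
  have *: "cmod (G b - G a) \<le> e * (A b - A a)" if e: "e > 0" for e
  proof -
    define P where "P s t \<longleftrightarrow> (a \<le> s \<and> s \<le> t \<and> t \<le> b \<longrightarrow> cmod (G t - G s) \<le> e * (A t - A s))" for s t
    have trans: "P x z" if xyz: "P x y" "P y z" "x \<le> y" "y \<le> z" for x y z
    proof -
      show ?thesis
        unfolding P_def
      proof
        assume h: "a \<le> x \<and> x \<le> z \<and> z \<le> b"
        have "cmod (G z - G x) \<le> cmod (G z - G y) + cmod (G y - G x)"
          using norm_triangle_ineq[of "G z - G y" "G y - G x"] by simp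
        also have "\<dots> \<le> e * (A z - A y) + e * (A y - A x)"
          using xyz h unfolding P_def by (intro add_mono) auto
        finally show "cmod (G z - G x) \<le> e * (A z - A x)" by (simp add: algebra_simps)
      qed
    qed
    have local: "\<exists>d>0. \<forall>s t. s \<le> x \<and> x \<le> t \<and> t - s < d \<longrightarrow> P s t" if x: "a \<le> x" "x \<le> b" for x
    proof -
      obtain d where d: "d > 0" "\<And>y. y \<in> {a..b} \<Longrightarrow> dist y x < d \<Longrightarrow> dist (\<psi> y) (\<psi> x) < e"
      proof -
        have "x \<in> {a..b}" using x by simp
        then show ?thesis using \<psi> e that unfolding continuous_on_iff by blast
      qed
      have "cmod (G t - G s) \<le> e * (A t - A s)"
        if h: "s \<le> x" "x \<le> t" "t - s < d" "a \<le> s" "t \<le> b" for s t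
      proof -
        have st: "s \<le> t" using h by simp
        note I = integral_norm_mono_increment[OF gi h(4) st h(5)]
        have cs: "continuous_on {s..t} \<psi>" using \<psi> h by (auto intro: continuous_on_subset)
        have "?h absolutely_integrable_on {a..t}"
          using hi by (rule absolutely_integrable_on_subinterval) (use h in auto)
        then have "integral {a..s} ?h + integral {s..t} ?h = integral {a..t} ?h"
          using h by (intro Henstock_Kurzweil_Integration.integral_combine absint_imp_int) auto
        then have "G t - G s = integral {s..t} ?h" by (simp add: G_def algebra_simps)
        also have "\<dots> = integral {s..t} (\<lambda>r. g r * (\<psi> r - \<psi> x) + \<psi> x * g r)"
          by (intro integral_cong) (simp add: algebra_simps)
        also have "\<dots> = integral {s..t} (\<lambda>r. g r * (\<psi> r - \<psi> x)) + \<psi> x * integral {s..t} g"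
        proof -
          have "(\<lambda>r. g r * (\<psi> r - \<psi> x)) absolutely_integrable_on {s..t}"
            using cs I(2) by (intro absint_mult_cont(2) continuous_intros)
          moreover have "(\<lambda>r. \<psi> x * g r) absolutely_integrable_on {s..t}" using I(2) by auto
          ultimately show ?thesis by (simp add: Henstock_Kurzweil_Integration.integral_add absint_imp_int)
        qed
        also have "integral {s..t} g = 0" using acd_diff_eq[OF g, of s t] h ab by simp
        finally have "G t - G s = integral {s..t} (\<lambda>r. g r * (\<psi> r - \<psi> x))" by simp
        also have "cmod \<dots> \<le> integral {s..t} (\<lambda>r. cmod (g r)) * e"
        proof (intro integral_norm_prod_le I(2) absint_mult_cont(2) continuous_intros cs)
          fix r assume r: "r \<in> {s..t}"
          then have "dist (\<psi> r) (\<psi> x) < e" using h x by (intro d(2)) (auto simp: dist_real_def)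
          then show "cmod (\<psi> r - \<psi> x) \<le> e" by (simp add: dist_norm)
        qed
        finally show ?thesis using I(1) by (simp add: A_def mult.commute)
      qed
      then show ?thesis using d(1) unfolding P_def by (intro exI[of _ d]) auto
    qed
    have "P a b" by (rule Bolzano[of a b P, OF ab(2) trans local])
    then show ?thesis using ab by (simp add: P_def)
  qed
  have M0: "A b - A a \<ge> 0" using integral_norm_mono_increment(1,3)[OF gi, of a b] ab by (simp add: A_def)
  have "cmod (G b - G a) \<le> 0 + e" if "e > 0" for e
  proof -
    have "cmod (G b - G a) \<le> (e / (A b - A a + 1)) * (A b - A a)"
      using *[of "e / (A b - A a + 1)"] M0 that by simp
    also have "\<dots> \<le> (e / (A b - A a + 1)) * (A b - A a + 1)" using M0 that by (intro mult_left_mono) auto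
    finally show ?thesis using M0 by simp
  qed
  then have "cmod (G b - G a) \<le> 0" by (rule field_le_epsilon)
  then show ?thesis by (simp add: G_def)
qed

text \<open>Uniqueness of densities, obtained by duality with continuous functions rather than by
  differentiating an integral.\<close>

lemma acd_const_AE_zero:
  assumes g: "acd (\<lambda>s. c) g"
  shows "AE s in M1. g s = 0"
proof (rule AE_zero_if_orthogonal)
  show "g absolutely_integrable_on {a..b}" if "-1 < a" "b < 1" for a b by (rule acd_integrable[OF g that])
  fix \<psi> :: "real \<Rightarrow> real" and a b :: real
  assume c: "continuous_on UNIV \<psi>" and ab: "-1 < a" "b < 1"
  have cc: "continuous_on {a..b} (\<lambda>s. complex_of_real (\<psi> s))"
    by (intro continuous_intros continuous_on_subset[OF c]) auto
  show "integral {a..b} (\<lambda>s. complex_of_real (\<psi> s) * g s) = 0"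
    using acd_const_orthogonal[OF g cc ab(1) _ ab(2)] by (cases "a \<le> b") auto
qed

lemma continuous_AE_eq:
  fixes f g :: "real \<Rightarrow> complex"
  assumes f: "continuous_on {-1<..<1} f" and g: "continuous_on {-1<..<1} g" and ae: "AE s in M1. f s = g s"
    and s: "s \<in> {-1<..<1}"
  shows "f s = g s"
proof (rule ccontr)
  assume ne: "f s \<noteq> g s"
  let ?U = "{t \<in> {-1<..<1}. f t - g t \<in> - {0}}"
  have "continuous_on {-1<..<1} (\<lambda>t. f t - g t)" using f g by (intro continuous_intros)
  then have o: "open ?U"
    using continuous_open_preimage[of "{-1<..<1}" "\<lambda>t. f t - g t" "- {0}"] by (simp add: vimage_def Int_def open_Compl)
  have "AE t in lebesgue. t \<in> {-1..1} \<longrightarrow> f t = g t" using ae by (simp add: AE_lebesgue_on_iff)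
  then have "AE t \<in> ?U in lebesgue. t \<in> {}" by eventually_elim auto
  from mem_closed_if_AE_lebesgue_open[OF o closed_empty this, of s] ne s show False by auto
qed

lemma AE_M1_reflect:
  assumes "AE s in M1. P s"
  shows "AE s in M1. P (- s)"
proof -
  have "AE s in lebesgue. s \<in> {-1..1} \<longrightarrow> P s" using assms by (simp add: AE_lebesgue_on_iff)
  then obtain N where N: "N \<in> null_sets lebesgue" "{s. \<not> (s \<in> {-1..1} \<longrightarrow> P s)} \<subseteq> N"
    by (auto simp: eventually_ae_filter)
  have "negligible (uminus ` N)"
    using N(1) by (intro negligible_differentiable_image_negligible)
      (auto simp: negligible_iff_null_sets intro!: differentiable_on_minus differentiable_on_id[unfolded id_def])
  then have "uminus ` N \<in> null_sets lebesgue" by (simp add: negligible_iff_null_sets)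
  then have "AE s in lebesgue. s \<in> {-1..1} \<longrightarrow> P (- s)"
  proof (rule AE_I')
    show "{s \<in> space lebesgue. \<not> (s \<in> {-1..1} \<longrightarrow> P (- s))} \<subseteq> uminus ` N"
    proof
      fix s assume "s \<in> {s \<in> space lebesgue. \<not> (s \<in> {-1..1} \<longrightarrow> P (- s))}"
      then have "- s \<in> N" using N(2) by auto
      then show "s \<in> uminus ` N" by (metis image_eqI minus_minus)
    qed
  qed
  then show ?thesis by (simp add: AE_lebesgue_on_iff)
qed

section \<open>Curve classes as complex-valued functions\<close>

definition v2c :: "real ^ 2 \<Rightarrow> complex" where
  "v2c v = Complex (v $ 1) (v $ 2)"

definition c2v :: "complex \<Rightarrow> real ^ 2" where
  "c2v z = vector [Re z, Im z]"

lemma c2v_nth [simp]: "c2v z $ 1 = Re z" "c2v z $ 2 = Im z"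
  by (simp_all add: c2v_def)

lemma v2c_c2v [simp]: "v2c (c2v z) = z"
  by (simp add: v2c_def)

lemma c2v_v2c [simp]: "c2v (v2c v) = v"
  by (simp add: vec_eq_iff forall_2 v2c_def)

lemma inner_c2v: "c2v z \<bullet> c2v w = Re (z * cnj w)"
  by (simp add: inner_vec_def sum_2)

lemma norm_c2v [simp]: "norm (c2v z) = cmod z"
  by (simp add: norm_vec_def L2_set_def sum_2 cmod_def)

lemma norm_v2c [simp]: "cmod (v2c v) = norm v"
  by (metis c2v_v2c norm_c2v)

lemma c2v_simps:
  "c2v (x + y) = c2v x + c2v y" "c2v (x - y) = c2v x - c2v y" "c2v (- x) = - c2v x"
  "c2v (r *\<^sub>R x) = r *\<^sub>R c2v x" "c2v 0 = 0"
  by (simp_all add: vec_eq_iff forall_2)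

lemma v2c_simps:
  "v2c (x + y) = v2c x + v2c y" "v2c (x - y) = v2c x - v2c y" "v2c (- x) = - v2c x"
  "v2c (r *\<^sub>R x) = r *\<^sub>R v2c x" "v2c 0 = 0"
  by (simp_all add: v2c_def complex_eq_iff)

lemma bounded_linear_c2v: "bounded_linear c2v"
  by (rule bounded_linear_intro[of _ 1]) (simp_all add: c2v_simps)

lemma bounded_linear_v2c: "bounded_linear v2c"
  by (rule bounded_linear_intro[of _ 1]) (simp_all add: v2c_simps)

lemma c2v_measurable: "f \<in> borel_measurable M \<Longrightarrow> (\<lambda>s. c2v (f s)) \<in> borel_measurable M"
  using borel_measurable_continuous_onI[OF linear_continuous_on[OF bounded_linear_c2v]]
  by (rule measurable_compose[rotated])

lemma v2c_measurable: "f \<in> borel_measurable M \<Longrightarrow> (\<lambda>s. v2c (f s)) \<in> borel_measurable M"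
  using borel_measurable_continuous_onI[OF linear_continuous_on[OF bounded_linear_v2c]]
  by (rule measurable_compose[rotated])

text \<open>\<open>crv\<close> forms the class of a function and \<open>rp\<close> picks a
  representative of a class; so \<open>crv (rp \<eta>)\<close> is \<eta>, while
  \<open>rp (crv f)\<close> agrees with a measurable f almost everywhere only.\<close>

definition crv :: "(real \<Rightarrow> complex) \<Rightarrow> curve" where
  "crv f = abs_curve (\<lambda>s. c2v (f s))"

definition rp :: "curve \<Rightarrow> real \<Rightarrow> complex" where
  "rp \<eta> s = v2c (rep_curve \<eta> s)"

lemma rep_curve_rel: "curve_rel (rep_curve \<eta>) (rep_curve \<eta>)"
  by (rule Quotient3_rep_reflp[OF Quotient3_curve])

lemma rp_measurable [measurable]: "rp \<eta> \<in> borel_measurable M1"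
  unfolding rp_def using rep_curve_rel[of \<eta>] by (intro v2c_measurable) (simp add: curve_rel_def)

lemma crv_rp [simp]: "crv (rp \<eta>) = \<eta>"
  unfolding crv_def rp_def by (simp add: Quotient3_abs_rep[OF Quotient3_curve])

lemma crv_refl: "f \<in> borel_measurable M1 \<Longrightarrow> curve_rel (\<lambda>s. c2v (f s)) (\<lambda>s. c2v (f s))"
  by (simp add: curve_rel_def c2v_measurable)

lemma rep_crv:
  assumes "f \<in> borel_measurable M1"
  shows "AE s in M1. rep_curve (crv f) s = c2v (f s)"
  using Quotient3_rep_abs[OF Quotient3_curve, of "\<lambda>s. c2v (f s)"] crv_refl[OF assms]
  by (simp add: crv_def curve_rel_def)

lemma rp_crv:
  assumes "f \<in> borel_measurable M1"
  shows "AE s in M1. rp (crv f) s = f s"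
  using rep_crv[OF assms] by eventually_elim (simp add: rp_def)

lemma crv_eqI: "f \<in> borel_measurable M1 \<Longrightarrow> g \<in> borel_measurable M1 \<Longrightarrow> (AE s in M1. f s = g s) \<Longrightarrow> crv f = crv g"
  unfolding crv_def
  by (rule Quotient3_rel_abs[OF Quotient3_curve]) (auto simp: curve_rel_def c2v_measurable elim: eventually_mono)

lemma crv_eqD: "f \<in> borel_measurable M1 \<Longrightarrow> g \<in> borel_measurable M1 \<Longrightarrow> crv f = crv g \<Longrightarrow> AE s in M1. f s = g s"
proof -
  assume "f \<in> borel_measurable M1" "g \<in> borel_measurable M1" and e: "crv f = crv g"
  then have "AE s in M1. rp (crv f) s = f s" "AE s in M1. rp (crv f) s = g s"
    using rp_crv[of f] rp_crv[of g] by simp_all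
  then show ?thesis by eventually_elim simp
qed

lemma crv_add: "f \<in> borel_measurable M1 \<Longrightarrow> g \<in> borel_measurable M1 \<Longrightarrow> crv f + crv g = crv (\<lambda>s. f s + g s)"
  unfolding crv_def by (simp add: plus_curve.abs_eq crv_refl c2v_simps)

lemma crv_diff: "f \<in> borel_measurable M1 \<Longrightarrow> g \<in> borel_measurable M1 \<Longrightarrow> crv f - crv g = crv (\<lambda>s. f s - g s)"
  unfolding crv_def by (simp add: minus_curve.abs_eq crv_refl c2v_simps)

lemma crv_scale: "f \<in> borel_measurable M1 \<Longrightarrow> c *\<^sub>R crv f = crv (\<lambda>s. complex_of_real c * f s)"
  unfolding crv_def by (simp add: scaleR_curve.abs_eq crv_refl c2v_simps flip: scaleR_conv_of_real)

lemma crv_zero: "crv (\<lambda>s. 0) = 0"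
  unfolding crv_def zero_curve_def by (simp add: c2v_simps)

lemma AE_M1_negligible:
  assumes "AE s in M1. P s"
  obtains N where "negligible N" "\<And>s. s \<in> {-1..1} \<Longrightarrow> s \<notin> N \<Longrightarrow> P s"
proof -
  have "AE s in lebesgue. s \<in> {-1..1} \<longrightarrow> P s" using assms by (simp add: AE_lebesgue_on_iff)
  then obtain N where "N \<in> null_sets lebesgue" "{s. \<not> (s \<in> {-1..1} \<longrightarrow> P s)} \<subseteq> N"
    by (auto simp: eventually_ae_filter)
  then show ?thesis by (intro that[of N]) (auto simp: negligible_iff_null_sets)
qed

lemma absint_AE:
  fixes f g :: "real \<Rightarrow> 'a::euclidean_space"
  assumes f: "f absolutely_integrable_on {a..b}" and ab: "-1 < a" "b < 1" and ae: "AE s in M1. f s = g s"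
  shows "g absolutely_integrable_on {a..b}" "integral {a..b} g = integral {a..b} f"
proof -
  obtain N where N: "negligible N" "\<And>s. s \<in> {-1..1} \<Longrightarrow> s \<notin> N \<Longrightarrow> f s = g s"
    using AE_M1_negligible[OF ae] by blast
  show "g absolutely_integrable_on {a..b}"
    by (rule absolutely_integrable_spike[OF f N(1)]) (use N(2) ab in auto)
  show "integral {a..b} g = integral {a..b} f"
    by (rule integral_spike[OF N(1)]) (use N(2) ab in auto)
qed

lemma acd_AE:
  assumes "acd f g" "AE s in M1. g s = g' s"
  shows "acd f g'"
proof (rule acdI)
  fix a b :: real assume ab: "-1 < a" "a \<le> b" "b < 1"
  note i = absint_AE[OF acd_integrable[OF assms(1) ab(1,3)] ab(1,3) assms(2)]
  show "g' absolutely_integrable_on {a..b}" by (rule i(1))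
  show "f b - f a = integral {a..b} g'" using acd_diff_eq[OF assms(1) ab] i(2) by simp
qed

section \<open>Test functions and integration by parts\<close>

text \<open>The given interval is enlarged strictly: every point outside then has a neighbourhood on
  which \<phi> vanishes, so \<phi>' vanishes too. The comparisons with 0 cover the case that the
  given interval is empty.\<close>

lemma test_function_support:
  assumes "test_function \<phi> \<phi>'"
  obtains a b where "-1 < a" "a \<le> b" "b < 1" "\<forall>s. s \<notin> {a..b} \<longrightarrow> \<phi> s = 0" "\<forall>s. s \<notin> {a..b} \<longrightarrow> \<phi>' s = 0"
    "\<phi> a = 0" "\<phi> b = 0"
proof -
  obtain a0 b0 where ab0: "-1 < a0" "b0 < 1" "\<And>s. s \<notin> {a0..b0} \<Longrightarrow> \<phi> s = 0"
    and d: "\<And>s. (\<phi> has_real_derivative \<phi>' s) (at s)"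
    using assms unfolding test_function_def by blast
  define a b where "a = (min a0 0 - 1) / 2" and "b = (max b0 0 + 1) / 2"
  have ab: "-1 < a" "a \<le> b" "b < 1" "a < a0" "b0 < b" using ab0(1,2) by (auto simp: a_def b_def min_def max_def)
  have z: "\<phi> s = 0" if "s \<notin> {a0..b0}" for s using ab0 that by blast
  have z': "\<phi>' s = 0" if s: "s \<notin> {a..b}" for s
  proof -
    have "((\<lambda>_. 0) has_real_derivative 0) (at s)" by simp
    then have "(\<phi> has_real_derivative 0) (at s)"
      by (rule has_field_derivative_transform_within_open[where S = "- {a0..b0}"]) (use s ab z in \<open>auto simp: open_Compl\<close>)
    then show ?thesis using d DERIV_unique by blast
  qed
  show ?thesis by (rule that[of a b]) (use ab z z' in auto)
qed

definition loc_int :: "(real \<Rightarrow> complex) \<Rightarrow> bool" where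
  "loc_int f \<longleftrightarrow> (\<forall>a b. -1 < a \<and> b < 1 \<longrightarrow> f absolutely_integrable_on {a..b})"

lemma loc_intD: "loc_int f \<Longrightarrow> -1 < a \<Longrightarrow> b < 1 \<Longrightarrow> f absolutely_integrable_on {a..b}"
  by (simp add: loc_int_def)

lemma locally_integrable_iff: "locally_integrable \<eta> \<longleftrightarrow> loc_int (rp \<eta>)"
proof -
  have "rep_curve \<eta> absolutely_integrable_on {a..b} \<longleftrightarrow> rp \<eta> absolutely_integrable_on {a..b}" for a b :: real
  proof
    assume "rep_curve \<eta> absolutely_integrable_on {a..b}"
    from absolutely_integrable_linear[OF this bounded_linear_v2c]
    show "rp \<eta> absolutely_integrable_on {a..b}" by (simp add: o_def rp_def[abs_def])
  next
    assume "rp \<eta> absolutely_integrable_on {a..b}"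
    from absolutely_integrable_linear[OF this bounded_linear_c2v]
    show "rep_curve \<eta> absolutely_integrable_on {a..b}" by (simp add: o_def rp_def[abs_def])
  qed
  then show ?thesis by (simp add: locally_integrable_def loc_int_def)
qed

lemma integrable_test_mult:
  assumes g: "loc_int g" and \<psi>: "continuous_on UNIV (\<psi> :: real \<Rightarrow> real)"
    and ab: "-1 < a" "b < 1" and z: "\<forall>s. s \<notin> {a..b} \<longrightarrow> \<psi> s = 0"
  shows "integrable M1 (\<lambda>s. complex_of_real (\<psi> s) * g s)"
    "(LINT s|M1. complex_of_real (\<psi> s) * g s) = integral {a..b} (\<lambda>s. complex_of_real (\<psi> s) * g s)"
    "(\<lambda>s. complex_of_real (\<psi> s) * g s) absolutely_integrable_on {a..b}"
proof -
  show i: "(\<lambda>s. complex_of_real (\<psi> s) * g s) absolutely_integrable_on {a..b}"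
    by (intro absint_mult_cont(1) loc_intD[OF g ab] continuous_intros continuous_on_subset[OF \<psi>]) auto
  show "integrable M1 (\<lambda>s. complex_of_real (\<psi> s) * g s)"
    "(LINT s|M1. complex_of_real (\<psi> s) * g s) = integral {a..b} (\<lambda>s. complex_of_real (\<psi> s) * g s)"
    using ab z by (intro integral_M1_support[OF i]; auto)+
qed

lemma test_function_continuous:
  assumes "test_function \<phi> \<phi>'"
  shows "continuous_on UNIV \<phi>" "continuous_on UNIV \<phi>'" "(\<phi> has_real_derivative \<phi>' s) (at s)"
  using assms unfolding test_function_def
  by (auto intro!: continuous_at_imp_continuous_on DERIV_isCont)

lemma has_weak_deriv_iff:
  "has_weak_deriv \<eta> \<zeta> \<longleftrightarrow> loc_int (rp \<eta>) \<and> loc_int (rp \<zeta>) \<and>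
     (\<forall>\<phi> \<phi>'. test_function \<phi> \<phi>' \<longrightarrow>
        (LINT s|M1. complex_of_real (\<phi>' s) * rp \<eta> s) = - (LINT s|M1. complex_of_real (\<phi> s) * rp \<zeta> s))"
proof -
  have conv: "(LINT s|M1. \<psi> s *\<^sub>R rep_curve \<xi> s) = c2v (LINT s|M1. complex_of_real (\<psi> s) * rp \<xi> s)"
    if "integrable M1 (\<lambda>s. complex_of_real (\<psi> s) * rp \<xi> s)" for \<psi> :: "real \<Rightarrow> real" and \<xi>
  proof -
    have "c2v (LINT s|M1. complex_of_real (\<psi> s) * rp \<xi> s) = (LINT s|M1. c2v (complex_of_real (\<psi> s) * rp \<xi> s))"
      by (rule integral_bounded_linear[OF bounded_linear_c2v that, symmetric])
    also have "(\<lambda>s. c2v (complex_of_real (\<psi> s) * rp \<xi> s)) = (\<lambda>s. \<psi> s *\<^sub>R rep_curve \<xi> s)"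
      by (simp add: fun_eq_iff scaleR_conv_of_real[symmetric] c2v_simps rp_def)
    finally show ?thesis by simp
  qed
  have inj: "c2v x = - c2v y \<longleftrightarrow> x = - y" for x y
    by (metis c2v_simps(3) v2c_c2v)
  have "(LINT s|M1. \<phi>' s *\<^sub>R rep_curve \<eta> s) = - (LINT s|M1. \<phi> s *\<^sub>R rep_curve \<zeta> s) \<longleftrightarrow>
      (LINT s|M1. complex_of_real (\<phi>' s) * rp \<eta> s) = - (LINT s|M1. complex_of_real (\<phi> s) * rp \<zeta> s)"
    if l: "loc_int (rp \<eta>)" "loc_int (rp \<zeta>)" and t: "test_function \<phi> \<phi>'" for \<phi> \<phi>'
  proof -
    obtain a b where ab: "-1 < a" "a \<le> b" "b < 1" "\<forall>s. s \<notin> {a..b} \<longrightarrow> \<phi> s = 0" "\<forall>s. s \<notin> {a..b} \<longrightarrow> \<phi>' s = 0"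
      using test_function_support[OF t] by metis
    note c = test_function_continuous[OF t]
    note i = integrable_test_mult(1)[OF l(1) c(2) ab(1,3) ab(5)] integrable_test_mult(1)[OF l(2) c(1) ab(1,3) ab(4)]
    show ?thesis unfolding conv[OF i(1)] conv[OF i(2)] inj ..
  qed
  then show ?thesis unfolding has_weak_deriv_def locally_integrable_iff by blast
qed

lemma acd_loc_int: "acd f g \<Longrightarrow> loc_int g" "acd f g \<Longrightarrow> loc_int f"
proof -
  assume f: "acd f g"
  show "loc_int g" using acd_integrable[OF f] by (simp add: loc_int_def)
  show "loc_int f"
    unfolding loc_int_def using acd_continuous_on_Icc[OF f] by (auto intro: absolutely_integrable_continuous_real)
qed

lemma loc_int_AE: "loc_int f \<Longrightarrow> AE s in M1. f s = g s \<Longrightarrow> loc_int g"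
  unfolding loc_int_def using absint_AE(1) by blast

lemma acd_measurable: "acd f g \<Longrightarrow> f \<in> borel_measurable M1"
  by (intro measurable_M1_cont acd_continuous_on)

text \<open>Integration by parts: the product rule on an interval that carries \<phi> and \<phi>',
  where the boundary terms vanish.\<close>

lemma has_weak_deriv_acd:
  assumes f: "acd f g" and g: "g \<in> borel_measurable M1"
  shows "has_weak_deriv (crv f) (crv g)"
proof -
  note fm = acd_measurable[OF f]
  have fa: "AE s in M1. f s = rp (crv f) s" and ga: "AE s in M1. g s = rp (crv g) s"
    using rp_crv[OF fm] rp_crv[OF g] by (auto elim: eventually_mono)
  note li = loc_int_AE[OF acd_loc_int(2)[OF f] fa] loc_int_AE[OF acd_loc_int(1)[OF f] ga]
  show ?thesis
    unfolding has_weak_deriv_iff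
  proof (intro conjI li allI impI)
    fix \<phi> \<phi>' assume t: "test_function \<phi> \<phi>'"
    obtain a b where ab: "-1 < a" "a \<le> b" "b < 1" "\<forall>s. s \<notin> {a..b} \<longrightarrow> \<phi> s = 0" "\<forall>s. s \<notin> {a..b} \<longrightarrow> \<phi>' s = 0"
        "\<phi> a = 0" "\<phi> b = 0"
      using test_function_support[OF t] by metis
    note c = test_function_continuous[OF t]
    note i1 = integrable_test_mult[OF li(1) c(2) ab(1,3) ab(5)]
    note i2 = integrable_test_mult[OF li(2) c(1) ab(1,3) ab(4)]
    have "acd (\<lambda>s. complex_of_real (\<phi> s)) (\<lambda>s. complex_of_real (\<phi>' s))"
      using c by (intro acd_C1 has_vector_derivative_of_real continuous_intros continuous_on_subset[OF c(2)])
        (auto simp: has_real_derivative_iff_has_vector_derivative)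
    from acd_diff_eq[OF acd_mult[OF this f] ab(1-3)]
    have "0 = integral {a..b} (\<lambda>s. complex_of_real (\<phi>' s) * f s + complex_of_real (\<phi> s) * g s)"
      using ab by simp
    also have "\<dots> = integral {a..b} (\<lambda>s. complex_of_real (\<phi>' s) * rp (crv f) s + complex_of_real (\<phi> s) * rp (crv g) s)"
    proof (rule absint_AE(2)[symmetric])
      show "(\<lambda>s. complex_of_real (\<phi>' s) * f s + complex_of_real (\<phi> s) * g s) absolutely_integrable_on {a..b}"
        using integrable_test_mult(3)[OF acd_loc_int(2)[OF f] c(2) ab(1,3) ab(5)]
          integrable_test_mult(3)[OF acd_loc_int(1)[OF f] c(1) ab(1,3) ab(4)] by (rule set_integral_add)
      show "AE s in M1. complex_of_real (\<phi>' s) * f s + complex_of_real (\<phi> s) * g s =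
          complex_of_real (\<phi>' s) * rp (crv f) s + complex_of_real (\<phi> s) * rp (crv g) s"
        using fa ga by eventually_elim simp
    qed (use ab in auto)
    also have "\<dots> = (LINT s|M1. complex_of_real (\<phi>' s) * rp (crv f) s) + (LINT s|M1. complex_of_real (\<phi> s) * rp (crv g) s)"
      using i1(2) i2(2) Henstock_Kurzweil_Integration.integral_add[OF absint_imp_int[OF i1(3)] absint_imp_int[OF i2(3)]]
      by (simp only:)
    finally show "(LINT s|M1. complex_of_real (\<phi>' s) * rp (crv f) s) = - (LINT s|M1. complex_of_real (\<phi> s) * rp (crv g) s)"
      by (simp add: eq_neg_iff_add_eq_0)
  qed
qed

text \<open>The lemma of du Bois-Reymond.\<close>

lemma constant_if_weak_deriv_zero:
  assumes u: "loc_int u"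
    and z: "\<And>\<phi> \<phi>'. test_function \<phi> \<phi>' \<Longrightarrow> (LINT s|M1. complex_of_real (\<phi>' s) * u s) = 0"
  obtains c where "AE s in M1. u s = c"
proof -
  define \<rho> where "\<rho> s = max 0 (1/2 - \<bar>s\<bar>)" for s :: real
  have \<rho>c: "continuous_on A \<rho>" for A unfolding \<rho>_def by (intro continuous_intros)
  have \<rho>z: "\<rho> s = 0" if "s \<notin> {-1/2..1/2}" for s using that by (auto simp: \<rho>_def)
  define J where "J = integral {-1/2..1/2} \<rho>"
  have Jp: "J > 0"
  proof -
    have "integral {-1/4..1/4} (\<lambda>s::real. 1/4) \<le> integral {-1/4..1/4} \<rho>"
      by (intro integral_le integrable_continuous_real \<rho>c) (auto simp: \<rho>_def)
    also have "\<dots> \<le> J"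
      unfolding J_def by (intro integral_subset_le integrable_continuous_real \<rho>c) (auto simp: \<rho>_def)
    finally show ?thesis by simp
  qed
  \<comment> \<open>The mean of u with respect to the normalised bump \<rho>.\<close>
  define c where "c = (LINT s|M1. complex_of_real (\<rho> s) * u s) / J"
  have "AE s in M1. u s - c = 0"
  proof (rule AE_zero_if_orthogonal)
    show "(\<lambda>s. u s - c) absolutely_integrable_on {a..b}" if "-1 < a" "b < 1" for a b
      by (intro set_integral_diff loc_intD[OF u that]) auto
    fix \<psi> :: "real \<Rightarrow> real" and a b :: real
    assume \<psi>c: "continuous_on UNIV \<psi>" and ab: "-1 < a" "b < 1" and \<psi>z: "\<And>s. s \<notin> {a..b} \<Longrightarrow> \<psi> s = 0"
    \<comment> \<open>An interval inside (-1, 1) that contains the supports of both \<psi> and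
      \<rho> in its interior.\<close>
    define a' b' where "a' = (min a (-1/2) - 1) / 2" and "b' = (max b (1/2) + 1) / 2"
    have ab': "-1 < a'" "a' \<le> b'" "b' < 1" "a' < a" "b < b'" "a' < -1/2" "1/2 < b'"
      using ab by (auto simp: a'_def b'_def min_def max_def field_simps)
    \<comment> \<open>Subtracting k \<rho> from \<psi> leaves mean zero, so a primitive of p returns
      to its initial value and, shifted by it, is a test function with derivative p.\<close>
    define k where "k = integral {a'..b'} \<psi> / J"
    define p where "p s = \<psi> s - k * \<rho> s" for s
    have pc: "continuous_on A p" for A
      unfolding p_def by (intro continuous_intros \<rho>c continuous_on_subset[OF \<psi>c]) auto
    have pz: "p s = 0" if "s \<le> a' \<or> b' \<le> s" for s
      using that ab' \<psi>z[of s] \<rho>z[of s] by (auto simp: p_def)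
    have J': "integral {a'..b'} \<rho> = J"
      unfolding J_def
    proof -
      have "integral {-1/2..1/2} \<rho> = integral UNIV (\<lambda>x. if x \<in> {-1/2..1/2} then \<rho> x else 0)"
        by (rule integral_restrict_UNIV[symmetric])
      also have "(\<lambda>x. if x \<in> {-1/2..1/2} then \<rho> x else 0) = (\<lambda>x. if x \<in> {a'..b'} then \<rho> x else 0)"
        using \<rho>z ab' by (auto simp: fun_eq_iff)
      also have "integral UNIV \<dots> = integral {a'..b'} \<rho>" by (rule integral_restrict_UNIV)
      finally show "integral {a'..b'} \<rho> = integral {-1/2..1/2} \<rho>" by simp
    qed
    have "\<exists>F. \<forall>x. (F has_vector_derivative p x) (at x)"
      using einterval_antiderivative[of "-\<infinity>" "\<infinity>" p] pc[of UNIV] by (auto simp: continuous_on_eq_continuous_at)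
    then obtain F where F: "\<And>x. (F has_real_derivative p x) (at x)"
      by (auto simp: has_real_derivative_iff_has_vector_derivative)
    have FT: "F y - F x = integral {x..y} p" if "x \<le> y" for x y
      using fundamental_theorem_of_calculus[OF that, of F p] F
      by (simp add: has_real_derivative_iff_has_vector_derivative has_vector_derivative_at_within integral_unique)
    have i: "\<psi> integrable_on {a'..b'}" "\<rho> integrable_on {a'..b'}"
      by (intro integrable_continuous_real \<rho>c continuous_on_subset[OF \<psi>c]; simp)+
    have "integral {a'..b'} p = integral {a'..b'} \<psi> - k * integral {a'..b'} \<rho>"
      unfolding p_def using i by (simp add: Henstock_Kurzweil_Integration.integral_diff integrable_on_mult_right)
    also have "\<dots> = 0" using Jp by (simp add: J' k_def)
    finally have ip: "F b' = F a'" using FT[OF ab'(2)] by simp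
    have lz: "F s = F a'" if "s \<notin> {a'..b'}" for s
    proof (cases "s < a'")
      case True
      have "integral {s..a'} p = integral {s..a'} (\<lambda>_. 0)" by (intro integral_cong pz) auto
      then show ?thesis using FT[of s a'] True by simp
    next
      case False
      then have s: "b' \<le> s" using that by auto
      have "integral {b'..s} p = integral {b'..s} (\<lambda>_. 0)" by (intro integral_cong pz) auto
      then show ?thesis using FT[OF s] ip by simp
    qed
    have "test_function (\<lambda>s. F s - F a') p"
      unfolding test_function_def
    proof (intro conjI allI)
      show "((\<lambda>s. F s - F a') has_real_derivative p s) (at s)" for s
        using F[of s] by (auto intro!: derivative_eq_intros)
      show "\<exists>a b. -1 < a \<and> b < 1 \<and> (\<forall>s. s \<notin> {a..b} \<longrightarrow> F s - F a' = 0)"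
        by (rule exI[of _ a'], rule exI[of _ b']) (use ab' lz in auto)
    qed (rule pc)
    from z[OF this] have z0: "(LINT s|M1. complex_of_real (p s) * u s) = 0" .
    have \<psi>z': "\<forall>s. s \<notin> {a'..b'} \<longrightarrow> \<psi> s = 0" using \<psi>z ab' by auto
    have \<rho>z': "\<forall>s. s \<notin> {a'..b'} \<longrightarrow> \<rho> s = 0" using \<rho>z ab' by auto
    have \<psi>z0: "\<forall>s. s \<notin> {a..b} \<longrightarrow> \<psi> s = 0" using \<psi>z by auto
    note m1 = integrable_test_mult[OF u \<psi>c ab'(1,3) \<psi>z'] and m2 = integrable_test_mult[OF u \<rho>c ab'(1,3) \<rho>z']
    have "complex_of_real (p s) * u s = complex_of_real (\<psi> s) * u s - k * (complex_of_real (\<rho> s) * u s)" for s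
      by (simp add: p_def algebra_simps)
    then have "0 = (LINT s|M1. complex_of_real (\<psi> s) * u s) - k * (LINT s|M1. complex_of_real (\<rho> s) * u s)"
      using z0 m1(1) m2(1) by simp
    then have e1: "(LINT s|M1. complex_of_real (\<psi> s) * u s) = k * (c * J)"
      using Jp by (simp add: c_def)
    have cl: "loc_int (\<lambda>s. u s - c)"
      unfolding loc_int_def by (auto intro!: set_integral_diff loc_intD[OF u])
    have cl1: "loc_int (\<lambda>s. 1)" by (simp add: loc_int_def)
    note m3 = integrable_test_mult[OF cl \<psi>c ab \<psi>z0] and m4 = integrable_test_mult[OF cl1 \<psi>c ab'(1,3) \<psi>z']
    have "integral {a..b} (\<lambda>s. complex_of_real (\<psi> s) * (u s - c)) = (LINT s|M1. complex_of_real (\<psi> s) * (u s - c))"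
      using m3(2) by simp
    also have "\<dots> = (LINT s|M1. complex_of_real (\<psi> s) * u s) - c * (LINT s|M1. complex_of_real (\<psi> s) * 1)"
      using m1(1) m4(1) by (simp add: algebra_simps)
    also have "(LINT s|M1. complex_of_real (\<psi> s) * 1) = integral {a'..b'} (\<lambda>s. complex_of_real (\<psi> s))"
      using m4(2) by simp
    also have "\<dots> = complex_of_real (integral {a'..b'} \<psi>)"
      using integral_linear[OF i(1) bounded_linear_of_real[where 'a = complex]] by (simp add: o_def)
    also have "integral {a'..b'} \<psi> = k * J" using Jp by (simp add: k_def)
    finally show "integral {a..b} (\<lambda>s. complex_of_real (\<psi> s) * (u s - c)) = 0" using e1 by simp
  qed
  then show ?thesis by (intro that[of c]) auto
qed

text \<open>The difference of \<eta> and a primitive of \<zeta> has weak derivative 0, so it is a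
  constant; adding that constant to the primitive gives f.\<close>

lemma acd_if_has_weak_deriv:
  assumes w: "has_weak_deriv \<eta> \<zeta>"
  obtains f where "acd f (rp \<zeta>)" "\<eta> = crv f"
proof -
  define Z where "Z = prim (rp \<zeta>)"
  have li: "loc_int (rp \<eta>)" "loc_int (rp \<zeta>)"
    and wz: "\<And>\<phi> \<phi>'. test_function \<phi> \<phi>' \<Longrightarrow>
        (LINT s|M1. complex_of_real (\<phi>' s) * rp \<eta> s) = - (LINT s|M1. complex_of_real (\<phi> s) * rp \<zeta> s)"
    using w by (auto simp: has_weak_deriv_iff)
  have Z: "acd Z (rp \<zeta>)" unfolding Z_def by (intro acd_prim loc_intD[OF li(2)])
  have wZ: "has_weak_deriv (crv Z) \<zeta>" using has_weak_deriv_acd[OF Z] by simp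
  have li': "loc_int (rp (crv Z))"
    and wz': "\<And>\<phi> \<phi>'. test_function \<phi> \<phi>' \<Longrightarrow>
        (LINT s|M1. complex_of_real (\<phi>' s) * rp (crv Z) s) = - (LINT s|M1. complex_of_real (\<phi> s) * rp \<zeta> s)"
    using wZ by (auto simp: has_weak_deriv_iff)
  have "loc_int (\<lambda>s. rp \<eta> s - rp (crv Z) s)"
    unfolding loc_int_def by (auto intro!: set_integral_diff loc_intD[OF li(1)] loc_intD[OF li'])
  then obtain c where c: "AE s in M1. rp \<eta> s - rp (crv Z) s = c"
  proof (rule constant_if_weak_deriv_zero)
    fix \<phi> \<phi>' assume t: "test_function \<phi> \<phi>'"
    obtain a b where ab: "-1 < a" "a \<le> b" "b < 1" "\<forall>s. s \<notin> {a..b} \<longrightarrow> \<phi> s = 0" "\<forall>s. s \<notin> {a..b} \<longrightarrow> \<phi>' s = 0"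
      using test_function_support[OF t] by metis
    note k = test_function_continuous[OF t]
    show "(LINT s|M1. complex_of_real (\<phi>' s) * (rp \<eta> s - rp (crv Z) s)) = 0"
      using integrable_test_mult(1)[OF li(1) k(2) ab(1,3) ab(5)] integrable_test_mult(1)[OF li' k(2) ab(1,3) ab(5)]
        wz[OF t] wz'[OF t] by (simp add: right_diff_distrib)
  qed
  have f: "acd (\<lambda>s. Z s + c) (rp \<zeta>)" using acd_add[OF Z acd_const[of c]] by simp
  have "crv (rp \<eta>) = crv (\<lambda>s. Z s + c)"
  proof (rule crv_eqI[OF _ acd_measurable[OF f]])
    show "AE s in M1. rp \<eta> s = Z s + c"
      using c rp_crv[OF acd_measurable[OF Z]] by eventually_elim (auto simp: algebra_simps)
  qed measurable
  then show ?thesis by (intro that[OF f]) simp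
qed

text \<open>Both weak derivatives have primitives representing \<eta>. These are continuous, hence
  equal on the open interval, and uniqueness of densities finishes.\<close>

lemma has_weak_deriv_unique:
  assumes "has_weak_deriv \<eta> \<zeta>" "has_weak_deriv \<eta> \<zeta>'"
  shows "\<zeta> = \<zeta>'"
proof -
  obtain f where f: "acd f (rp \<zeta>)" "\<eta> = crv f" using acd_if_has_weak_deriv[OF assms(1)] by blast
  obtain f' where f': "acd f' (rp \<zeta>')" "\<eta> = crv f'" using acd_if_has_weak_deriv[OF assms(2)] by blast
  have "AE s in M1. f s = f' s"
    using f f' by (intro crv_eqD acd_measurable) auto
  then have eq: "f s = f' s" if "s \<in> {-1<..<1}" for s
    using continuous_AE_eq[OF acd_continuous_on[OF f(1)] acd_continuous_on[OF f'(1)] _ that] by blast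
  have "acd (\<lambda>s. 0) (\<lambda>s. rp \<zeta> s - rp \<zeta>' s)"
    by (rule acd_cong[OF acd_diff[OF f(1) f'(1)]]) (auto simp: eq)
  from acd_const_AE_zero[OF this] have "crv (rp \<zeta>) = crv (rp \<zeta>')"
    by (intro crv_eqI) (auto elim: eventually_mono)
  then show ?thesis by simp
qed

lemma weak_deriv_eq: "has_weak_deriv \<eta> \<zeta> \<Longrightarrow> weak_deriv \<eta> = \<zeta>"
  unfolding weak_deriv_def using has_weak_deriv_unique by blast

section \<open>The weighted Sobolev spaces as spaces of derivative chains\<close>

text \<open>Represents an element of \<open>K_space M\<close> by functions: below M,
  \<open>f j\<close> is the absolutely continuous representative of the j-th derivative, while
  \<open>f M\<close> is just square integrable with its weight.\<close>

definition Kchain :: "nat \<Rightarrow> (nat \<Rightarrow> real \<Rightarrow> complex) \<Rightarrow> bool" where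
  "Kchain M f \<longleftrightarrow> (\<forall>j<M. acd (f j) (f (Suc j))) \<and> (\<forall>j\<le>M. L2 j (f j)) \<and>
     (\<forall>s\<in>{-1<..<1}. f 0 (- s) = - f 0 s)"

lemma KchainD:
  assumes "Kchain M f"
  shows "j < M \<Longrightarrow> acd (f j) (f (Suc j))" "j \<le> M \<Longrightarrow> L2 j (f j)" "s \<in> {-1<..<1} \<Longrightarrow> f 0 (- s) = - f 0 s"
    "j \<le> M \<Longrightarrow> f j \<in> borel_measurable M1"
proof -
  show "j < M \<Longrightarrow> acd (f j) (f (Suc j))" "s \<in> {-1<..<1} \<Longrightarrow> f 0 (- s) = - f 0 s"
    using assms unfolding Kchain_def by simp_all
  show "j \<le> M \<Longrightarrow> L2 j (f j)" using assms unfolding Kchain_def by simp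
  then show "j \<le> M \<Longrightarrow> f j \<in> borel_measurable M1" by (rule L2_measurable)
qed

lemma Kchain_weak_deriv:
  assumes f: "Kchain M f" and j: "j \<le> M"
  shows "(weak_deriv ^^ j) (crv (f 0)) = crv (f j)"
  using j
proof (induction j)
  case (Suc j)
  then have "has_weak_deriv (crv (f j)) (crv (f (Suc j)))"
    using KchainD[OF f] by (intro has_weak_deriv_acd) auto
  then show ?case using Suc by (simp add: weak_deriv_eq)
qed simp

lemma wnorm_crv:
  assumes "f \<in> borel_measurable M1"
  shows "(\<integral>\<^sup>+ s. ennreal ((1 - s\<^sup>2) ^ j * (norm (rep_curve (crv f) s))\<^sup>2) \<partial>M1) < \<infinity> \<longleftrightarrow> L2 j f"
proof -
  have e: "(\<integral>\<^sup>+ s. ennreal ((1 - s\<^sup>2) ^ j * (norm (rep_curve (crv f) s))\<^sup>2) \<partial>M1)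
      = (\<integral>\<^sup>+ s. ennreal (norm ((1 - s\<^sup>2) ^ j * (cmod (f s))\<^sup>2)) \<partial>M1)"
  proof (rule nn_integral_cong_AE)
    have "AE s in M1. 0 \<le> (1 - s\<^sup>2 :: real)" by (rule AE_M1I) (rule less_imp_le[OF weight_pos])
    then show "AE s in M1. ennreal ((1 - s\<^sup>2) ^ j * (norm (rep_curve (crv f) s))\<^sup>2)
        = ennreal (norm ((1 - s\<^sup>2) ^ j * (cmod (f s))\<^sup>2))"
      using rep_crv[OF assms] by eventually_elim simp
  qed
  have m: "(\<lambda>s. (1 - s\<^sup>2) ^ j * (cmod (f s))\<^sup>2) \<in> borel_measurable M1" using assms by measurable
  show ?thesis unfolding e L2_def integrable_iff_bounded using m assms by simp
qed

lemma odd_curve_crv: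
  assumes f: "f \<in> borel_measurable M1"
  shows "odd_curve (crv f) \<longleftrightarrow> (AE s in M1. f (- s) = - f s)"
proof -
  note r = rep_crv[OF f]
  note r' = AE_M1_reflect[OF r]
  have "AE s in M1. (rep_curve (crv f) (- s) = - rep_curve (crv f) s) = (f (- s) = - f s)"
    using r r'
  proof eventually_elim
    case (elim s)
    have "c2v (f (- s)) = - c2v (f s) \<longleftrightarrow> f (- s) = - f s" by (metis c2v_simps(3) v2c_c2v)
    then show ?case using elim by simp
  qed
  then show ?thesis unfolding odd_curve_def
    by (rule eventually_subst)
qed

lemma Kchain_mem:
  assumes f: "Kchain M f"
  shows "crv (f 0) \<in> hcarrier (K_space M)"
proof -
  note D = KchainD[OF f]
  have "odd_curve (crv (f 0))"
    unfolding odd_curve_crv[OF D(4)[of 0, simplified]] by (rule AE_M1I) (rule D(3))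
  moreover have "weakly_differentiable ((weak_deriv ^^ j) (crv (f 0)))" if "j < M" for j
  proof -
    have "has_weak_deriv (crv (f j)) (crv (f (Suc j)))" using D that by (intro has_weak_deriv_acd) auto
    then show ?thesis using that by (auto simp: weakly_differentiable_def Kchain_weak_deriv[OF f])
  qed
  moreover have "wnorm_sq j j (crv (f 0)) < \<infinity>" if "j \<le> M" for j
    unfolding wnorm_sq_def Kchain_weak_deriv[OF f that] wnorm_crv[OF D(4)[OF that]] by (rule D(2)[OF that])
  ultimately show ?thesis by (simp add: K_space_def)
qed

lemma K_space_chain:
  assumes \<eta>: "\<eta> \<in> hcarrier (K_space M)" and M: "0 < M"
  obtains f where "Kchain M f" "\<eta> = crv (f 0)"
proof -
  define d where "d j = (weak_deriv ^^ j) \<eta>" for j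
  have odd: "odd_curve \<eta>" and wd: "\<And>j. j < M \<Longrightarrow> weakly_differentiable (d j)"
    and fin: "\<And>j. j \<le> M \<Longrightarrow> wnorm_sq j j \<eta> < \<infinity>"
    using \<eta> by (auto simp: K_space_def d_def)
  have hwd: "has_weak_deriv (d j) (d (Suc j))" if "j < M" for j
    using wd[OF that] weak_deriv_eq unfolding weakly_differentiable_def d_def by auto
  have "\<exists>F. acd F (rp (d (Suc j))) \<and> d j = crv F" if "j < M" for j
    using acd_if_has_weak_deriv[OF hwd[OF that]] by blast
  then obtain F where F: "\<And>j. j < M \<Longrightarrow> acd (F j) (rp (d (Suc j)))" "\<And>j. j < M \<Longrightarrow> d j = crv (F j)"
    by metis
  \<comment> \<open>Below M the primitive of the next derivative is taken, at M any
    representative.\<close>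
  define f where "f j = (if j < M then F j else rp (d j))" for j
  have fm: "f j \<in> borel_measurable M1" for j
    using F(1) acd_measurable by (auto simp: f_def)
  have dc: "d j = crv (f j)" for j using F(2) by (auto simp: f_def)
  have ae: "AE s in M1. rp (d j) s = f j s" for j
    using rp_crv[OF fm[of j]] by (simp add: dc)
  have "Kchain M f"
    unfolding Kchain_def
  proof (intro conjI allI impI ballI)
    show a: "acd (f j) (f (Suc j))" if "j < M" for j
      using acd_AE[OF F(1)[OF that] ae] that by (simp add: f_def)
    show "L2 j (f j)" if "j \<le> M" for j
      using fin[OF that] wnorm_crv[OF fm[of j]] unfolding wnorm_sq_def d_def[symmetric] dc by simp
    \<comment> \<open>Oddness of the class holds almost everywhere; continuity of
      \<open>f 0\<close>, which rests on 0 < M, makes it hold at every point.\<close>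
    have c: "continuous_on {-1<..<1} (f 0)" using acd_continuous_on[OF a[OF M]] .
    have c': "continuous_on {-1<..<1} (\<lambda>s. f 0 (- s))"
      by (rule continuous_on_compose2[OF c]) (auto intro: continuous_intros)
    have "d 0 = \<eta>" by (simp add: d_def)
    then have "AE s in M1. f 0 (- s) = - f 0 s"
      using odd odd_curve_crv[OF fm[of 0]] dc[of 0] by simp
    moreover have "continuous_on {-1<..<1} (\<lambda>s. - f 0 s)" by (intro continuous_intros c)
    ultimately show "f 0 (- s) = - f 0 s" if "s \<in> {-1<..<1}" for s
      using continuous_AE_eq[OF c' _ _ that] by blast
  qed
  moreover have "\<eta> = crv (f 0)" using dc[of 0] by (simp add: d_def)
  ultimately show ?thesis by (rule that)
qed

lemma L2_inner_integrable:
  assumes "L2 k f" "L2 k g"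
  shows "integrable M1 (\<lambda>s. (1 - s\<^sup>2) ^ k * Re (f s * cnj (g s)))"
proof (rule Bochner_Integration.integrable_bound)
  show "integrable M1 (\<lambda>s. (1 - s\<^sup>2) ^ k * (cmod (f s))\<^sup>2 + (1 - s\<^sup>2) ^ k * (cmod (g s))\<^sup>2)"
    using assms by (intro Bochner_Integration.integrable_add L2_int)
  have "(\<lambda>s. cnj (g s)) \<in> borel_measurable M1" using L2_measurable[OF L2_cnj(1)[OF assms(2)]] .
  then show "(\<lambda>s. (1 - s\<^sup>2) ^ k * Re (f s * cnj (g s))) \<in> borel_measurable M1"
    using L2_measurable[OF assms(1)] by measurable
  show "AE s in M1. norm ((1 - s\<^sup>2) ^ k * Re (f s * cnj (g s)))
      \<le> norm ((1 - s\<^sup>2) ^ k * (cmod (f s))\<^sup>2 + (1 - s\<^sup>2) ^ k * (cmod (g s))\<^sup>2)"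
  proof (rule AE_M1I)
    fix s :: real assume s: "s \<in> {-1<..<1}"
    define w where "w = (1 - s\<^sup>2) ^ k"
    have w: "w \<ge> 0" using weight_pos[OF s] by (simp add: w_def)
    have "\<bar>Re (f s * cnj (g s))\<bar> \<le> cmod (f s) * cmod (g s)"
      using abs_Re_le_cmod[of "f s * cnj (g s)"] by (simp add: norm_mult)
    also have "\<dots> \<le> (cmod (f s))\<^sup>2 + (cmod (g s))\<^sup>2"
      using zero_le_power2[of "cmod (f s) - cmod (g s)"] mult_nonneg_nonneg[OF norm_ge_zero[of "f s"] norm_ge_zero[of "g s"]]
      unfolding power2_diff by linarith
    finally have "w * \<bar>Re (f s * cnj (g s))\<bar> \<le> w * ((cmod (f s))\<^sup>2 + (cmod (g s))\<^sup>2)" using w by (intro mult_left_mono)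
    moreover have "0 \<le> w * ((cmod (f s))\<^sup>2 + (cmod (g s))\<^sup>2)" using w by simp
    ultimately have "norm (w * Re (f s * cnj (g s))) \<le> norm (w * (cmod (f s))\<^sup>2 + w * (cmod (g s))\<^sup>2)"
      using w by (simp only: real_norm_def abs_mult abs_of_nonneg distrib_left)
    then show "norm ((1 - s\<^sup>2) ^ k * Re (f s * cnj (g s)))
      \<le> norm ((1 - s\<^sup>2) ^ k * (cmod (f s))\<^sup>2 + (1 - s\<^sup>2) ^ k * (cmod (g s))\<^sup>2)" unfolding w_def .
  qed
qed

lemma hinner_K:
  assumes f: "Kchain M f" and g: "Kchain M g"
  shows "hinner (K_space M) (crv (f 0)) (crv (g 0)) = (\<Sum>j\<le>M. LINT s|M1. (1 - s\<^sup>2) ^ j * Re (f j s * cnj (g j s)))"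
proof -
  have "(LINT s|M1. (1 - s\<^sup>2) ^ j * (rep_curve ((weak_deriv ^^ j) (crv (f 0))) s \<bullet> rep_curve ((weak_deriv ^^ j) (crv (g 0))) s))
      = (LINT s|M1. (1 - s\<^sup>2) ^ j * Re (f j s * cnj (g j s)))" if j: "j \<le> M" for j
    unfolding Kchain_weak_deriv[OF f j] Kchain_weak_deriv[OF g j]
  proof (rule integral_cong_AE)
    note fm = KchainD(4)[OF f j] and gm = KchainD(4)[OF g j]
    show "AE s in M1. (1 - s\<^sup>2) ^ j * (rep_curve (crv (f j)) s \<bullet> rep_curve (crv (g j)) s) = (1 - s\<^sup>2) ^ j * Re (f j s * cnj (g j s))"
      using rep_crv[OF fm] rep_crv[OF gm] by eventually_elim (simp only: inner_c2v)
    show "(\<lambda>s. (1 - s\<^sup>2) ^ j * Re (f j s * cnj (g j s))) \<in> borel_measurable M1"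
      using L2_inner_integrable[OF KchainD(2)[OF f j] KchainD(2)[OF g j]] by simp
    have "rep_curve (crv (f j)) \<in> borel_measurable M1" "rep_curve (crv (g j)) \<in> borel_measurable M1"
      using rep_curve_rel by (auto simp: curve_rel_def)
    then show "(\<lambda>s. (1 - s\<^sup>2) ^ j * (rep_curve (crv (f j)) s \<bullet> rep_curve (crv (g j)) s)) \<in> borel_measurable M1"
      by measurable
  qed
  then show ?thesis by (simp add: K_space_def)
qed

lemma hinner_K_self:
  assumes f: "Kchain M f"
  shows "hinner (K_space M) (crv (f 0)) (crv (f 0)) = (\<Sum>j\<le>M. nsq j (f j))"
proof -
  have "Re (z * cnj z) = (cmod z)\<^sup>2" for z by (simp add: complex_norm_square[symmetric] flip: of_real_power)
  then show ?thesis unfolding hinner_K[OF f f] nsq_def by simp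
qed

lemma Kchain_add:
  assumes f: "Kchain M f" and g: "Kchain M g"
  shows "Kchain M (\<lambda>j s. f j s + g j s)"
  using KchainD[OF f] KchainD[OF g] unfolding Kchain_def by (auto intro!: acd_add L2_add(1))

lemma Kchain_diff:
  assumes f: "Kchain M f" and g: "Kchain M g"
  shows "Kchain M (\<lambda>j s. f j s - g j s)"
  using KchainD[OF f] KchainD[OF g] unfolding Kchain_def by (auto intro!: acd_diff L2_diff(1))

lemma Kchain_cmult:
  assumes f: "Kchain M f"
  shows "Kchain M (\<lambda>j s. c * f j s)"
  using KchainD[OF f] unfolding Kchain_def by (auto intro!: acd_cmult L2_cmult(1))

lemma crv_chain_ops:
  assumes f: "Kchain M f" and g: "Kchain M g"
  shows "crv (f 0) + crv (g 0) = crv (\<lambda>s. f 0 s + g 0 s)" "crv (f 0) - crv (g 0) = crv (\<lambda>s. f 0 s - g 0 s)"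
    "c *\<^sub>R crv (f 0) = crv (\<lambda>s. complex_of_real c * f 0 s)"
  using KchainD(4)[OF f, of 0] KchainD(4)[OF g, of 0] by (simp_all add: crv_add crv_diff crv_scale)

lemma pre_hilbert_K:
  assumes M: "0 < M"
  shows "pre_hilbert (K_space M)"
proof
  let ?K = "K_space M"
  have zero: "Kchain M (\<lambda>j s. 0)" by (simp add: Kchain_def acd_const)
  show "subspace (hcarrier ?K)"
    unfolding subspace_def
  proof (intro conjI ballI allI)
    show "0 \<in> hcarrier ?K" using Kchain_mem[OF zero] by (simp add: crv_zero)
    show "x + y \<in> hcarrier ?K" if x: "x \<in> hcarrier ?K" and y: "y \<in> hcarrier ?K" for x y
    proof -
      obtain f where f: "Kchain M f" "x = crv (f 0)" using K_space_chain[OF x M] .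
      obtain g where g: "Kchain M g" "y = crv (g 0)" using K_space_chain[OF y M] .
      show ?thesis using Kchain_mem[OF Kchain_add[OF f(1) g(1)]] by (simp add: f g crv_chain_ops[OF f(1) g(1)])
    qed
    show "c *\<^sub>R x \<in> hcarrier ?K" if x: "x \<in> hcarrier ?K" for c x
    proof -
      obtain f where f: "Kchain M f" "x = crv (f 0)" using K_space_chain[OF x M] .
      show ?thesis using Kchain_mem[OF Kchain_cmult[OF f(1), of "complex_of_real c"]]
        by (simp add: f crv_chain_ops[OF f(1) f(1)])
    qed
  qed
  fix x assume x: "x \<in> hcarrier ?K"
  obtain f where f: "Kchain M f" "x = crv (f 0)" using K_space_chain[OF x M] .
  note fD = KchainD[OF f(1)]
  show "0 < hinner ?K x x" if nz: "x \<noteq> 0"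
  proof -
    have "nsq 0 (f 0) \<noteq> 0"
    proof
      assume "nsq 0 (f 0) = 0"
      then have "AE s in M1. (cmod (f 0 s))\<^sup>2 = 0"
        unfolding nsq_def using L2_int[OF fD(2)[of 0]] by (subst (asm) integral_nonneg_eq_0_iff_AE) auto
      then have "crv (f 0) = crv (\<lambda>s. 0)" using fD(4)[of 0] by (intro crv_eqI) auto
      then show False using nz f by (simp add: crv_zero)
    qed
    then have "0 < nsq 0 (f 0)" using nsq_nonneg[of 0 "f 0"] by linarith
    also have "\<dots> \<le> (\<Sum>j\<le>M. nsq j (f j))" by (rule member_le_sum) auto
    finally show ?thesis by (simp add: f(2) hinner_K_self[OF f(1)])
  qed
  fix y assume y: "y \<in> hcarrier ?K"
  obtain g where g: "Kchain M g" "y = crv (g 0)" using K_space_chain[OF y M] .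
  note gD = KchainD[OF g(1)]
  show "hinner ?K x y = hinner ?K y x"
    unfolding f(2) g(2) hinner_K[OF f(1) g(1)] hinner_K[OF g(1) f(1)] by (simp add: mult_ac)
  show "hinner ?K (c *\<^sub>R x) y = c * hinner ?K x y" for c
  proof -
    have "hinner ?K (c *\<^sub>R x) y = (\<Sum>j\<le>M. LINT s|M1. (1 - s\<^sup>2) ^ j * Re ((complex_of_real c * f j s) * cnj (g j s)))"
      unfolding f(2) crv_chain_ops(3)[OF f(1) f(1)] g(2)
      using hinner_K[OF Kchain_cmult[OF f(1), of "complex_of_real c"] g(1)] by simp
    also have "\<dots> = (\<Sum>j\<le>M. c * (LINT s|M1. (1 - s\<^sup>2) ^ j * Re (f j s * cnj (g j s))))"
    proof (rule sum.cong[OF refl])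
      fix j
      have "(\<lambda>s. (1 - s\<^sup>2) ^ j * Re ((complex_of_real c * f j s) * cnj (g j s))) = (\<lambda>s. c * ((1 - s\<^sup>2) ^ j * Re (f j s * cnj (g j s))))"
        by (simp add: fun_eq_iff algebra_simps)
      then show "(LINT s|M1. (1 - s\<^sup>2) ^ j * Re ((complex_of_real c * f j s) * cnj (g j s)))
          = c * (LINT s|M1. (1 - s\<^sup>2) ^ j * Re (f j s * cnj (g j s)))" by simp
    qed
    finally show ?thesis unfolding f(2) g(2) hinner_K[OF f(1) g(1)] by (simp add: sum_distrib_left)
  qed
  fix z assume z: "z \<in> hcarrier ?K"
  obtain h where h: "Kchain M h" "z = crv (h 0)" using K_space_chain[OF z M] .
  note hD = KchainD[OF h(1)]
  have "hinner ?K (x + y) z = (\<Sum>j\<le>M. LINT s|M1. (1 - s\<^sup>2) ^ j * Re ((f j s + g j s) * cnj (h j s)))"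
    unfolding f(2) g(2) h(2) crv_chain_ops(1)[OF f(1) g(1)]
    using hinner_K[OF Kchain_add[OF f(1) g(1)] h(1)] by simp
  also have "\<dots> = (\<Sum>j\<le>M. (LINT s|M1. (1 - s\<^sup>2) ^ j * Re (f j s * cnj (h j s))) + (LINT s|M1. (1 - s\<^sup>2) ^ j * Re (g j s * cnj (h j s))))"
  proof (rule sum.cong[OF refl])
    fix j assume "j \<in> {..M}"
    then have j: "j \<le> M" by simp
    have "(\<lambda>s. (1 - s\<^sup>2) ^ j * Re ((f j s + g j s) * cnj (h j s)))
        = (\<lambda>s. (1 - s\<^sup>2) ^ j * Re (f j s * cnj (h j s)) + (1 - s\<^sup>2) ^ j * Re (g j s * cnj (h j s)))"
      by (simp add: fun_eq_iff algebra_simps)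
    then show "(LINT s|M1. (1 - s\<^sup>2) ^ j * Re ((f j s + g j s) * cnj (h j s)))
        = (LINT s|M1. (1 - s\<^sup>2) ^ j * Re (f j s * cnj (h j s))) + (LINT s|M1. (1 - s\<^sup>2) ^ j * Re (g j s * cnj (h j s)))"
      using L2_inner_integrable[OF fD(2)[OF j] hD(2)[OF j]] L2_inner_integrable[OF gD(2)[OF j] hD(2)[OF j]]
      by (simp only: Bochner_Integration.integral_add)
  qed
  finally show "hinner ?K (x + y) z = hinner ?K x z + hinner ?K y z"
    unfolding f(2) g(2) h(2) hinner_K[OF f(1) h(1)] hinner_K[OF g(1) h(1)] by (simp add: sum.distrib)
qed

lemma hnorm_K:
  assumes f: "Kchain M f"
  shows "(hnorm (K_space M) (crv (f 0)))\<^sup>2 = (\<Sum>j\<le>M. nsq j (f j))"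
  unfolding hnorm_def hinner_K_self[OF f] by (simp add: sum_nonneg)

text \<open>Weighted convergence of the densities gives convergence of their integrals over compact
  subintervals, so the increment identity passes to the limit.\<close>

lemma acd_limit:
  assumes uv: "\<And>n. acd (u n) (v n)" and vL: "\<And>n. L2 k (v n)" and VL: "L2 k V"
    and u: "\<And>s. s \<in> {-1<..<1} \<Longrightarrow> (\<lambda>n. u n s) \<longlonglongrightarrow> U s"
    and v: "(\<lambda>n. nsq k (\<lambda>s. v n s - V s)) \<longlonglongrightarrow> 0"
  shows "acd U V"
proof (rule acdI)
  fix a b :: real assume ab: "-1 < a" "a \<le> b" "b < 1"
  show Vi: "V absolutely_integrable_on {a..b}" by (rule L2_local(1)[OF VL ab(1,3)])
  define c where "c = integral {a..b} (\<lambda>s. 1 / (1 - s\<^sup>2) ^ k)"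
  have b: "(cmod (integral {a..b} (v n) - integral {a..b} V))\<^sup>2 \<le> nsq k (\<lambda>s. v n s - V s) * c" for n
  proof -
    have vi: "v n absolutely_integrable_on {a..b}" by (rule L2_local(1)[OF vL ab(1,3)])
    note L = L2_local[OF L2_diff(1)[OF vL VL] ab(1,3)]
    have "cmod (integral {a..b} (v n) - integral {a..b} V) = cmod (integral {a..b} (\<lambda>s. v n s - V s))"
      using vi Vi by (simp add: Henstock_Kurzweil_Integration.integral_diff absint_imp_int)
    also have "\<dots> \<le> integral {a..b} (\<lambda>s. cmod (v n s - V s))"
      using L(1)[of n] by (intro integral_norm_bound_integral absint_imp_int absint_norm_int) auto
    finally have "(cmod (integral {a..b} (v n) - integral {a..b} V))\<^sup>2 \<le> (integral {a..b} (\<lambda>s. cmod (v n s - V s)))\<^sup>2"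
      by (intro power_mono) auto
    then show ?thesis using L(2)[of n] unfolding c_def by linarith
  qed
  have "(\<lambda>n. (cmod (integral {a..b} (v n) - integral {a..b} V))\<^sup>2) \<longlonglongrightarrow> 0"
  proof (rule tendsto_sandwich[OF _ _ tendsto_const])
    show "(\<lambda>n. nsq k (\<lambda>s. v n s - V s) * c) \<longlonglongrightarrow> 0" using tendsto_mult_left_zero[OF v] .
  qed (use b in auto)
  then have "(\<lambda>n. sqrt ((cmod (integral {a..b} (v n) - integral {a..b} V))\<^sup>2)) \<longlonglongrightarrow> sqrt 0"
    by (rule tendsto_real_sqrt)
  then have "(\<lambda>n. integral {a..b} (v n) - integral {a..b} V) \<longlonglongrightarrow> 0"
    by (simp add: tendsto_norm_zero_iff)
  then have "(\<lambda>n. integral {a..b} (v n)) \<longlonglongrightarrow> integral {a..b} V" by (simp add: LIM_zero_iff)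
  then have "(\<lambda>n. u n b - u n a) \<longlonglongrightarrow> integral {a..b} V"
    using acd_diff_eq[OF uv ab] by simp
  moreover have "(\<lambda>n. u n b - u n a) \<longlonglongrightarrow> U b - U a" using ab by (intro tendsto_intros u) auto
  ultimately show "U b - U a = integral {a..b} V" using LIMSEQ_unique by blast
qed

theorem hilbert_space_K:
  assumes M: "0 < M"
  shows "hilbert_space (K_space M)"
proof -
  interpret pre_hilbert "K_space M" by (rule pre_hilbert_K[OF M])
  show ?thesis
    unfolding hilbert_space_iff mcomplete_iff_seq
  proof (intro allI impI)
    fix \<sigma> :: "nat \<Rightarrow> curve"
    assume s: "\<forall>n. \<sigma> n \<in> hcarrier (K_space M)"
      and C: "\<forall>e>0. \<exists>n0. \<forall>m\<ge>n0. \<forall>n\<ge>n0. hnorm (K_space M) (\<sigma> m - \<sigma> n) < e"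
    have "\<exists>f. Kchain M f \<and> \<sigma> n = crv (f 0)" for n using K_space_chain[of "\<sigma> n" M] s M by blast
    then obtain f where f: "\<And>n. Kchain M (f n)" "\<And>n. \<sigma> n = crv (f n 0)" by metis
    note D = KchainD[OF f(1)]
    have diffn: "(hnorm (K_space M) (\<sigma> m - \<sigma> n))\<^sup>2 = (\<Sum>j\<le>M. nsq j (\<lambda>s. f m j s - f n j s))" for m n
      unfolding f(2) crv_chain_ops(2)[OF f(1) f(1)] using hnorm_K[OF Kchain_diff[OF f(1) f(1)]] by simp
    have nC: "\<exists>N. \<forall>m\<ge>N. \<forall>n\<ge>N. nsq j (\<lambda>s. f m j s - f n j s) < e" if j: "j \<le> M" and e: "e > 0" for j e
    proof -
      obtain N where N: "\<forall>m\<ge>N. \<forall>n\<ge>N. hnorm (K_space M) (\<sigma> m - \<sigma> n) < sqrt e"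
        using C[rule_format, of "sqrt e"] e by auto
      have "nsq j (\<lambda>s. f m j s - f n j s) < e" if "m \<ge> N" "n \<ge> N" for m n
      proof -
        have "nsq j (\<lambda>s. f m j s - f n j s) \<le> (\<Sum>j\<le>M. nsq j (\<lambda>s. f m j s - f n j s))"
          using j by (intro member_le_sum) auto
        also have "\<dots> = (hnorm (K_space M) (\<sigma> m - \<sigma> n))\<^sup>2" by (rule diffn[symmetric])
        also have "\<dots> < (sqrt e)\<^sup>2" using N that s by (intro power_strict_mono hnorm_nonneg diff_mem) auto
        finally show ?thesis using e by simp
      qed
      then show ?thesis by blast
    qed
    \<comment> \<open>Only the top derivative needs an abstract limit. The lower ones converge at
      every point by \<open>acd_point_bound\<close>, which makes the increment identities and
      oddness pass to the limit.\<close>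
    obtain F where F: "L2 M F" "(\<lambda>n. nsq M (\<lambda>s. f n M s - F s)) \<longlonglongrightarrow> 0"
    proof (rule L2_complete[of M "\<lambda>n. f n M"])
      show "L2 M (f n M)" for n using D(2) by simp
      show "\<exists>N. \<forall>m\<ge>N. \<forall>n\<ge>N. nsq M (\<lambda>s. f m M s - f n M s) < e" if "e > 0" for e using nC that by simp
    qed
    have conv: "convergent (\<lambda>n. f n j s)" if j: "j < M" and s: "s \<in> {-1<..<1}" for j s
    proof -
      obtain B where B: "B \<ge> 0" "\<And>f g. acd f g \<Longrightarrow> L2 j f \<Longrightarrow> L2 (Suc j) g \<Longrightarrow> (cmod (f s))\<^sup>2 \<le> B * (nsq j f + nsq (Suc j) g)"
        using acd_point_bound[OF s] by blast
      have "Cauchy (\<lambda>n. f n j s)"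
      proof (rule metric_CauchyI)
        fix e :: real assume e: "e > 0"
        define d where "d = e\<^sup>2 / (2 * (B + 1))"
        have d: "d > 0" using e B by (simp add: d_def)
        obtain N1 where N1: "\<forall>m\<ge>N1. \<forall>n\<ge>N1. nsq j (\<lambda>s. f m j s - f n j s) < d" using nC[of j d] j d by auto
        obtain N2 where N2: "\<forall>m\<ge>N2. \<forall>n\<ge>N2. nsq (Suc j) (\<lambda>s. f m (Suc j) s - f n (Suc j) s) < d" using nC[of "Suc j" d] j d by auto
        have "dist (f m j s) (f n j s) < e" if mn: "m \<ge> max N1 N2" "n \<ge> max N1 N2" for m n
        proof -
          have "(cmod (f m j s - f n j s))\<^sup>2 \<le> B * (nsq j (\<lambda>s. f m j s - f n j s) + nsq (Suc j) (\<lambda>s. f m (Suc j) s - f n (Suc j) s))"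
            using j D by (intro B(2) acd_diff L2_diff(1)) auto
          also have "\<dots> \<le> B * (d + d)"
            using N1 N2 mn by (intro mult_left_mono[OF _ B(1)] add_mono) (auto intro: less_imp_le)
          also have "\<dots> < (B + 1) * (d + d)" using d by (intro mult_strict_right_mono) auto
          also have "\<dots> = e\<^sup>2"
          proof -
            have "x * (e\<^sup>2 / (2 * x) + e\<^sup>2 / (2 * x)) = e\<^sup>2" if "x > 0" for x :: real using that by simp
            from this[of "B + 1"] B(1) show ?thesis unfolding d_def by linarith
          qed
          finally have "cmod (f m j s - f n j s) < e" using e by (simp add: power2_less_imp_less)
          then show ?thesis by (simp add: dist_norm)
        qed
        then show "\<exists>N. \<forall>m\<ge>N. \<forall>n\<ge>N. dist (f m j s) (f n j s) < e" by blast
      qed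
      then show ?thesis by (simp add: Cauchy_convergent_iff)
    qed
    define H where "H j s = (if j < M then lim (\<lambda>n. f n j s) else F s)" for j s
    have Hl: "(\<lambda>n. f n j s) \<longlonglongrightarrow> H j s" if "j < M" "s \<in> {-1<..<1}" for j s
      using conv[OF that] that by (simp add: H_def convergent_LIMSEQ_iff)
    have HL: "L2 j (H j) \<and> (\<lambda>n. nsq j (\<lambda>s. f n j s - H j s)) \<longlonglongrightarrow> 0" if j: "j \<le> M" for j
    proof (cases "j < M")
      case True
      have m: "H j \<in> borel_measurable M1"
      proof (rule measurable_M1_open, rule borel_measurable_LIMSEQ_metric)
        show "f n j \<in> borel_measurable (lebesgue_on {-1<..<1})" for n
          using D(4)[OF j, of n] by (rule measurable_restrict_mono) auto
        show "(\<lambda>n. f n j s) \<longlonglongrightarrow> H j s" if "s \<in> space (lebesgue_on {-1<..<1})" for s using Hl True that by simp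
      qed
      have ae: "AE s in M1. (\<lambda>i. f (id i) j s) \<longlonglongrightarrow> H j s" using Hl[OF True] by (intro AE_M1I) simp
      show ?thesis
      proof
        show "L2 j (H j)" by (rule L2_Fatou(1)[of j "\<lambda>n. f n j" id, OF D(2)[OF j] nC[OF j] _ ae m]; simp add: strict_mono_def)
        show "(\<lambda>n. nsq j (\<lambda>s. f n j s - H j s)) \<longlonglongrightarrow> 0"
          by (rule L2_Fatou(2)[of j "\<lambda>n. f n j" id, OF D(2)[OF j] nC[OF j] _ ae m]; simp add: strict_mono_def)
      qed
    next
      case False
      then have "j = M" "H j = F" using j by (auto simp: H_def fun_eq_iff)
      then show ?thesis using F by simp
    qed
    have Hc: "Kchain M H"
      unfolding Kchain_def
    proof (intro conjI allI impI ballI)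
      show "acd (H j) (H (Suc j))" if j: "j < M" for j
      proof (rule acd_limit)
        show "acd (f n j) (f n (Suc j))" for n using D(1) j by blast
        show "L2 (Suc j) (f n (Suc j))" for n using D(2)[of "Suc j" n] j by simp
        show "L2 (Suc j) (H (Suc j))" "(\<lambda>n. nsq (Suc j) (\<lambda>s. f n (Suc j) s - H (Suc j) s)) \<longlonglongrightarrow> 0"
          using HL[of "Suc j"] j by auto
        show "(\<lambda>n. f n j s) \<longlonglongrightarrow> H j s" if "s \<in> {-1<..<1}" for s using Hl[OF j that] .
      qed
      show "L2 j (H j)" if "j \<le> M" for j using HL[OF that] by blast
      show "H 0 (- s) = - H 0 s" if s: "s \<in> {-1<..<1}" for s
      proof (rule LIMSEQ_unique)
        show "(\<lambda>n. f n 0 (- s)) \<longlonglongrightarrow> H 0 (- s)" using M s by (intro Hl) auto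
        have "(\<lambda>n. - f n 0 s) \<longlonglongrightarrow> - H 0 s" using M s by (intro tendsto_minus Hl) auto
        then show "(\<lambda>n. f n 0 (- s)) \<longlonglongrightarrow> - H 0 s" using D(3)[OF s] by simp
      qed
    qed
    show "\<exists>x\<in>hcarrier (K_space M). (\<lambda>n. hnorm (K_space M) (\<sigma> n - x)) \<longlonglongrightarrow> 0"
    proof (intro bexI[of _ "crv (H 0)"])
      show "crv (H 0) \<in> hcarrier (K_space M)" by (rule Kchain_mem[OF Hc])
      have "(hnorm (K_space M) (\<sigma> n - crv (H 0)))\<^sup>2 = (\<Sum>j\<le>M. nsq j (\<lambda>s. f n j s - H j s))" for n
        unfolding f(2) crv_chain_ops(2)[OF f(1) Hc] using hnorm_K[OF Kchain_diff[OF f(1) Hc]] by simp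
      moreover have "(\<lambda>n. \<Sum>j\<le>M. nsq j (\<lambda>s. f n j s - H j s)) \<longlonglongrightarrow> (\<Sum>j\<le>M. 0)"
        using HL by (intro tendsto_sum) auto
      ultimately have "(\<lambda>n. (hnorm (K_space M) (\<sigma> n - crv (H 0)))\<^sup>2) \<longlonglongrightarrow> 0" by simp
      then have "(\<lambda>n. sqrt ((hnorm (K_space M) (\<sigma> n - crv (H 0)))\<^sup>2)) \<longlonglongrightarrow> sqrt 0" by (rule tendsto_real_sqrt)
      then show "(\<lambda>n. hnorm (K_space M) (\<sigma> n - crv (H 0))) \<longlonglongrightarrow> 0"
        using s Kchain_mem[OF Hc] by simp
    qed
  qed
qed

section \<open>The derivative of a curve\<close>

text \<open>Continuity determines the derivative at every point of the open interval, so that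
  \<open>dv\<close> can be read as a function and not as a class.\<close>

definition isdv :: "curve \<Rightarrow> (real \<Rightarrow> complex) \<Rightarrow> bool" where
  "isdv \<eta> h \<longleftrightarrow> continuous_on {-1<..<1} h \<and> (\<exists>f. acd f h \<and> \<eta> = crv f)"

definition dv :: "curve \<Rightarrow> real \<Rightarrow> complex" where
  "dv \<eta> = (SOME h. isdv \<eta> h)"

lemma isdv_unique:
  assumes "isdv \<eta> h" "isdv \<eta> k" "s \<in> {-1<..<1}"
  shows "h s = k s"
proof -
  obtain f where f: "acd f h" "\<eta> = crv f" using assms(1) by (auto simp: isdv_def)
  obtain g where g: "acd g k" "\<eta> = crv g" using assms(2) by (auto simp: isdv_def)
  have "AE s in M1. f s = g s" using f g by (intro crv_eqD acd_measurable) auto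
  then have eq: "f s = g s" if "s \<in> {-1<..<1}" for s
    using continuous_AE_eq[OF acd_continuous_on[OF f(1)] acd_continuous_on[OF g(1)] _ that] by blast
  have "acd (\<lambda>s. 0) (\<lambda>s. h s - k s)" by (rule acd_cong[OF acd_diff[OF f(1) g(1)]]) (auto simp: eq)
  from acd_const_AE_zero[OF this] have ae: "AE s in M1. h s = k s" by (auto elim: eventually_mono)
  show ?thesis using continuous_AE_eq[OF _ _ ae assms(3)] assms(1,2) by (simp add: isdv_def)
qed

lemma dv_eqI:
  assumes "isdv \<eta> h" "s \<in> {-1<..<1}"
  shows "dv \<eta> s = h s"
  unfolding dv_def using isdv_unique[OF someI[of "isdv \<eta>", OF assms(1)] assms] .

lemma Kchain_isdv:
  assumes f: "Kchain M f" and M: "2 \<le> M"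
  shows "isdv (crv (f 0)) (f 1)"
proof -
  have "acd (f 0) (f (Suc 0))" "acd (f 1) (f (Suc 1))" using KchainD(1)[OF f, of 0] KchainD(1)[OF f, of 1] M by auto
  then show ?thesis unfolding isdv_def using acd_continuous_on by auto
qed

lemma dv_chain: "Kchain M f \<Longrightarrow> 2 \<le> M \<Longrightarrow> s \<in> {-1<..<1} \<Longrightarrow> dv (crv (f 0)) s = f 1 s"
  by (rule dv_eqI[OF Kchain_isdv])

lemma Kchain_even:
  assumes f: "Kchain M f" and M: "2 \<le> M" and s: "s \<in> {-1<..<1}"
  shows "f 1 (- s) = f 1 s"
proof -
  have c: "continuous_on {-1<..<1} (f 1)" using Kchain_isdv[OF f M] by (simp add: isdv_def)
  have a: "acd (f 0) (f 1)" using KchainD(1)[OF f, of 0] M by simp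
  have d: "(f 0 has_vector_derivative f 1 t) (at t)" if "t \<in> {-1<..<1}" for t
    by (rule acd_has_vector_derivative[OF a c that])
  have "((f 0 \<circ> uminus) has_vector_derivative (-1) *\<^sub>R f 1 (- s)) (at s)"
    by (rule vector_diff_chain_at) (use s d[of "- s"] in \<open>auto intro!: derivative_eq_intros\<close>)
  then have "((\<lambda>t. f 0 (- t)) has_vector_derivative - f 1 (- s)) (at s)" by (simp add: o_def)
  then have "((\<lambda>t. - f 0 t) has_vector_derivative - f 1 (- s)) (at s)"
    by (rule has_vector_derivative_transform_within_open[where S = "{-1<..<1}"])
      (use s KchainD(3)[OF f] in auto)
  moreover have "((\<lambda>t. - f 0 t) has_vector_derivative - f 1 s) (at s)"
    by (intro has_vector_derivative_minus d s)
  ultimately show ?thesis using vector_derivative_unique_at by fastforce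
qed

text \<open>\<open>unit_speed\<close> speaks of some C1 representative. Uniqueness of the continuous
  derivative replaces it by the fixed function \<open>dv \<eta>\<close>.\<close>

lemma A_space_eq:
  assumes M: "2 \<le> M"
  shows "A_space M = {\<eta> \<in> hcarrier (K_space M). \<forall>s\<in>{-1<..<1}. cmod (dv \<eta> s) = 1}"
proof -
  have "unit_speed \<eta> \<longleftrightarrow> (\<forall>s\<in>{-1<..<1}. cmod (dv \<eta> s) = 1)" if \<eta>: "\<eta> \<in> hcarrier (K_space M)" for \<eta>
  proof
    assume "unit_speed \<eta>"
    then obtain \<gamma> \<gamma>' where g: "AE s in M1. rep_curve \<eta> s = \<gamma> s"
      "\<And>s. s \<in> {-1<..<1} \<Longrightarrow> (\<gamma> has_vector_derivative \<gamma>' s) (at s)" "continuous_on {-1<..<1} \<gamma>'"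
      "\<And>s. s \<in> {-1<..<1} \<Longrightarrow> norm (\<gamma>' s) = 1"
      unfolding unit_speed_def by blast
    have c: "continuous_on {-1<..<1} (\<lambda>s. v2c (\<gamma>' s))"
      by (rule bounded_linear.continuous_on[OF bounded_linear_v2c g(3)])
    have a: "acd (\<lambda>s. v2c (\<gamma> s)) (\<lambda>s. v2c (\<gamma>' s))"
      by (rule acd_C1[OF bounded_linear.has_vector_derivative[OF bounded_linear_v2c g(2)] c])
    have "crv (rp \<eta>) = crv (\<lambda>s. v2c (\<gamma> s))"
    proof (rule crv_eqI)
      show "AE s in M1. rp \<eta> s = v2c (\<gamma> s)" using g(1) by eventually_elim (simp add: rp_def)
    qed (auto intro: acd_measurable[OF a])
    then have "isdv \<eta> (\<lambda>s. v2c (\<gamma>' s))" using a c unfolding isdv_def by auto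
    then show "\<forall>s\<in>{-1<..<1}. cmod (dv \<eta> s) = 1" using dv_eqI g(4) by simp
  next
    assume u: "\<forall>s\<in>{-1<..<1}. cmod (dv \<eta> s) = 1"
    obtain f where f: "Kchain M f" "\<eta> = crv (f 0)" using K_space_chain[OF \<eta>] M by auto
    have c: "continuous_on {-1<..<1} (f 1)" using Kchain_isdv[OF f(1) M] by (simp add: isdv_def)
    have a: "acd (f 0) (f 1)" using KchainD(1)[OF f(1), of 0] M by simp
    show "unit_speed \<eta>"
      unfolding unit_speed_def
    proof (rule exI[of _ "\<lambda>s. c2v (f 0 s)"], rule exI[of _ "\<lambda>s. c2v (f 1 s)"], intro conjI ballI)
      show "AE s in M1. rep_curve \<eta> s = c2v (f 0 s)" unfolding f(2) by (rule rep_crv[OF KchainD(4)[OF f(1)]]) simp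
      show "((\<lambda>s. c2v (f 0 s)) has_vector_derivative c2v (f 1 s)) (at s)" if "s \<in> {-1<..<1}" for s
        by (rule bounded_linear.has_vector_derivative[OF bounded_linear_c2v acd_has_vector_derivative[OF a c that]])
      show "continuous_on {-1<..<1} (\<lambda>s. c2v (f 1 s))" by (rule bounded_linear.continuous_on[OF bounded_linear_c2v c])
      show "norm (c2v (f 1 s)) = 1" if "s \<in> {-1<..<1}" for s
        using bspec[OF u that] dv_chain[OF f(1) M that] by (simp add: f(2))
    qed
  qed
  then show ?thesis by (auto simp: A_space_def)
qed

section \<open>Chains of derivatives that start at the derivative of the curve\<close>

text \<open>Level j of the chain of \<eta>' is level j + 1 of the chain of \<eta>, hence the weight
  exponent \<open>Suc j\<close>, and oddness turns into evenness. All algebra and all angle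
  arguments take place here.\<close>

definition Bchain :: "nat \<Rightarrow> (nat \<Rightarrow> real \<Rightarrow> complex) \<Rightarrow> bool" where
  "Bchain m h \<longleftrightarrow> (\<forall>j<m. acd (h j) (h (Suc j))) \<and> (\<forall>j\<le>m. L2 (Suc j) (h j)) \<and>
     (\<forall>s\<in>{-1<..<1}. h 0 (- s) = h 0 s)"

text \<open>The squared norm of the curve without its term of order 0; the two are equivalent by
  \<open>Kchain_up\<close>.\<close>

definition Nsum :: "nat \<Rightarrow> (nat \<Rightarrow> real \<Rightarrow> complex) \<Rightarrow> real" where
  "Nsum m h = (\<Sum>j\<le>m. nsq (Suc j) (h j))"

lemma BchainD:
  assumes "Bchain m h"
  shows "j < m \<Longrightarrow> acd (h j) (h (Suc j))" "j \<le> m \<Longrightarrow> L2 (Suc j) (h j)" "s \<in> {-1<..<1} \<Longrightarrow> h 0 (- s) = h 0 s"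
  using assms by (auto simp: Bchain_def)

lemma Nsum_nonneg [simp]: "0 \<le> Nsum m h"
  by (simp add: Nsum_def sum_nonneg)

lemma nsq_le_Nsum: "j \<le> m \<Longrightarrow> nsq (Suc j) (h j) \<le> Nsum m h"
  unfolding Nsum_def by (rule member_le_sum) auto

lemma Bchain_of_Kchain:
  assumes f: "Kchain (Suc m) f" and m: "1 \<le> m"
  shows "Bchain m (\<lambda>j. f (Suc j))" "Nsum m (\<lambda>j. f (Suc j)) \<le> (hnorm (K_space (Suc m)) (crv (f 0)))\<^sup>2"
proof -
  show "Bchain m (\<lambda>j. f (Suc j))"
    unfolding Bchain_def
  proof (intro conjI allI impI ballI)
    show "acd (f (Suc j)) (f (Suc (Suc j)))" if "j < m" for j using KchainD(1)[OF f] that by simp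
    show "L2 (Suc j) (f (Suc j))" if "j \<le> m" for j using KchainD(2)[OF f] that by simp
    show "f (Suc 0) (- s) = f (Suc 0) s" if "s \<in> {-1<..<1}" for s
      using Kchain_even[OF f _ that] m by simp
  qed
  have "Nsum m (\<lambda>j. f (Suc j)) = (\<Sum>j\<in>{1..Suc m}. nsq j (f j))"
    unfolding Nsum_def by (rule sum.reindex_bij_witness[of _ "\<lambda>j. j - 1" Suc]) auto
  also have "\<dots> \<le> (\<Sum>j\<le>Suc m. nsq j (f j))" by (intro sum_mono2) auto
  finally show "Nsum m (\<lambda>j. f (Suc j)) \<le> (hnorm (K_space (Suc m)) (crv (f 0)))\<^sup>2" unfolding hnorm_K[OF f] .
qed

text \<open>Undoes the index shift: the primitive based at 0 is put in front of the chain.\<close>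

definition up :: "(nat \<Rightarrow> real \<Rightarrow> complex) \<Rightarrow> nat \<Rightarrow> real \<Rightarrow> complex" where
  "up h j = (case j of 0 \<Rightarrow> prim (h 0) | Suc i \<Rightarrow> h i)"

lemma up_simps [simp]: "up h 0 = prim (h 0)" "up h (Suc i) = h i"
  by (simp_all add: up_def)

text \<open>The exponent -1/2 is 1 - p for p = 3/2 in \<open>acd_growth\<close>.\<close>

lemma integrable_sqrt_weight:
  "integrable M1 (\<lambda>s. (1 - \<bar>s\<bar>) powr (-1/2))"
proof -
  have "((\<lambda>s. (1 - \<bar>s\<bar>) powr (-1/2)) has_integral (- 2 * (1 - 1) powr (1/2)) - (- 2 * (1 - 0) powr (1/2))) {0..1::real}"
  proof (rule fundamental_theorem_of_calculus_interior)
    show "continuous_on {0..1} (\<lambda>s::real. - 2 * (1 - s) powr (1/2))"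
      by (intro continuous_on_mult continuous_on_const continuous_on_powr' continuous_on_diff continuous_on_id) auto
    fix s :: real assume s: "s \<in> {0<..<1}"
    have "((\<lambda>s. - 2 * (1 - s) powr (1/2)) has_real_derivative - 2 * ((1/2) * (1 - s) powr (1/2 - 1) * (0 - 1))) (at s)"
      using s by (auto intro!: derivative_eq_intros)
    then show "((\<lambda>s. - 2 * (1 - s) powr (1/2)) has_vector_derivative (1 - \<bar>s\<bar>) powr (-1/2)) (at s)"
      using s by (simp add: has_real_derivative_iff_has_vector_derivative)
  qed auto
  then have i1: "(\<lambda>s. (1 - \<bar>s\<bar>) powr (-1/2)) integrable_on {0..1::real}" by (rule has_integral_integrable)
  have i2: "(\<lambda>s. (1 - \<bar>s\<bar>) powr (-1/2)) integrable_on {-1..0::real}"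
    using i1 Henstock_Kurzweil_Integration.integrable_reflect_real[where f = "\<lambda>s::real. (1 - \<bar>s\<bar>) powr (-1/2)" and a = 0 and b = 1] by simp
  have "(\<lambda>s. (1 - \<bar>s\<bar>) powr (-1/2)) integrable_on {-1..1::real}"
    by (rule Henstock_Kurzweil_Integration.integrable_combine[OF _ _ i2 i1]) auto
  then have "(\<lambda>s. (1 - \<bar>s\<bar>) powr (-1/2)) absolutely_integrable_on {-1..1::real}"
    by (rule nonnegative_absolutely_integrable_1) auto
  then show ?thesis by (rule absolutely_integrable_imp_integrable) auto
qed

text \<open>\<open>acd_growth\<close> needs an exponent above 1 although the weight exponent is 1.
  The choice p = 3/2 leaves an integrable bound, and the factor 2 is 1 / (p - 1).\<close>

lemma prim_L2_bound:
  obtains C where "C \<ge> 0" "\<And>h. acd (prim h) h \<Longrightarrow> L2 1 h \<Longrightarrow> L2 0 (prim h) \<and> nsq 0 (prim h) \<le> C * nsq 1 h"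
proof -
  define C where "C = 2 * (LINT s|M1. (1 - \<bar>s\<bar>) powr (-1/2))"
  show ?thesis
  proof (rule that[of C])
    show "C \<ge> 0" unfolding C_def by (simp add: integral_nonneg_AE)
    fix h assume a: "acd (prim h) h" and h: "L2 1 h"
    have le: "(1 - s\<^sup>2) ^ 0 * (cmod (prim h s))\<^sup>2 \<le> (2 * nsq 1 h) * (1 - \<bar>s\<bar>) powr (-1/2)" if "s \<in> {-1<..<1}" for s
      using acd_growth[OF a h, of "3/2" s] that by simp
    have i: "integrable M1 (\<lambda>s. (2 * nsq 1 h) * (1 - \<bar>s\<bar>) powr (-1/2))"
      using integrable_sqrt_weight by (rule integrable_mult_right)
    from L2_dominated[OF acd_measurable[OF a] i le]
    show "L2 0 (prim h) \<and> nsq 0 (prim h) \<le> C * nsq 1 h" by (simp add: C_def mult_ac)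
  qed
qed

lemma prim_odd:
  assumes a: "acd (prim h) h" and e: "\<And>s. s \<in> {-1<..<1} \<Longrightarrow> h (- s) = h s" and s: "s \<in> {-1<..<1}"
  shows "prim h (- s) = - prim h s"
proof -
  have r: "integral {-b..-a} h = integral {a..b} h" if "-1 < a" "b < 1" for a b
  proof -
    have "integral {a..b} h = integral {a..b} (\<lambda>s. h (- s))" using e that by (intro integral_cong) auto
    also have "\<dots> = integral {-b..-a} h" using Henstock_Kurzweil_Integration.integral_reflect_real[of "-a" "-b" h] by simp
    finally show ?thesis by simp
  qed
  show ?thesis using r[of 0 s] r[of s 0] s by (auto simp: prim_def)
qed

text \<open>The converse of \<open>Bchain_of_Kchain\<close>: every chain of derivatives comes from a
  curve whose norm it controls, with one constant for all chains.\<close>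

lemma Kchain_up:
  assumes m: "1 \<le> m"
  obtains C where "C \<ge> 0" "\<And>h. Bchain m h \<Longrightarrow> Kchain (Suc m) (up h) \<and>
    (hnorm (K_space (Suc m)) (crv (prim (h 0))))\<^sup>2 \<le> C * Nsum m h"
proof -
  obtain C where C: "C \<ge> 0" "\<And>h. acd (prim h) h \<Longrightarrow> L2 1 h \<Longrightarrow> L2 0 (prim h) \<and> nsq 0 (prim h) \<le> C * nsq 1 h"
    using prim_L2_bound by blast
  show ?thesis
  proof (rule that[of "C + 1"])
    show "C + 1 \<ge> 0" using C(1) by simp
    fix h assume h: "Bchain m h"
    note D = BchainD[OF h]
    have L: "L2 1 (h 0)" using D(2)[of 0] by simp
    have a: "acd (prim (h 0)) (h 0)" by (intro acd_prim L2_local(1)[OF L])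
    note P = C(2)[OF a L]
    have k: "Kchain (Suc m) (up h)"
      unfolding Kchain_def
    proof (intro conjI allI impI ballI)
      show "acd (up h j) (up h (Suc j))" if "j < Suc m" for j using that a D(1) by (cases j) auto
      show "L2 j (up h j)" if "j \<le> Suc m" for j using that P D(2) by (cases j) auto
      show "up h 0 (- s) = - up h 0 s" if "s \<in> {-1<..<1}" for s using prim_odd[OF a D(3) that] by simp
    qed
    have "(hnorm (K_space (Suc m)) (crv (prim (h 0))))\<^sup>2 = (\<Sum>j\<le>Suc m. nsq j (up h j))" using hnorm_K[OF k] by simp
    also have "\<dots> = nsq 0 (prim (h 0)) + Nsum m h" unfolding Nsum_def by (subst sum.atMost_Suc_shift) simp
    also have "\<dots> \<le> C * Nsum m h + Nsum m h"
      using P nsq_le_Nsum[of 0 m h] C(1) by (auto intro: order_trans mult_left_mono)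
    finally show "Kchain (Suc m) (up h) \<and> (hnorm (K_space (Suc m)) (crv (prim (h 0))))\<^sup>2 \<le> (C + 1) * Nsum m h"
      using k by (simp add: algebra_simps)
  qed
qed


section \<open>The algebra property\<close>

text \<open>The counterpart of \<open>acd_growth\<close> in which a pointwise rate of g is
  integrated instead of a norm.\<close>

lemma acd_step:
  assumes a: "acd f g" and g: "\<And>t. t \<in> {-1<..<1} \<Longrightarrow> cmod (g t) \<le> A * (1 - \<bar>t\<bar>) powr (-p)"
    and p: "p \<noteq> 1" and s: "s \<in> {-1<..<1}"
  shows "cmod (f s - f 0) \<le> A * (((1 - \<bar>s\<bar>) powr (1 - p) - 1) / (p - 1))"
proof -
  let ?S = "{min 0 s..max 0 s}"
  have ab: "-1 < min 0 s" "min 0 s \<le> max 0 s" "max 0 s < 1" using s by auto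
  have hi: "((\<lambda>t. A * (1 - \<bar>t\<bar>) powr (-p)) has_integral A * (((1 - \<bar>s\<bar>) powr (1 - p) - 1) / (p - 1))) ?S"
    by (rule has_integral_mult_right[OF has_integral_powr_weight[OF s p]])
  have "cmod (f s - f 0) = cmod (f (max 0 s) - f (min 0 s))"
    by (cases "0 \<le> s") (auto simp: norm_minus_commute max_def min_def)
  also have "\<dots> \<le> integral ?S (\<lambda>s. cmod (g s))" by (rule acd_norm_diff[OF a ab])
  also have "\<dots> \<le> integral ?S (\<lambda>t. A * (1 - \<bar>t\<bar>) powr (-p))"
    using hi s by (intro integral_le absint_norm_int acd_integrable[OF a ab(1,3)] g) auto
  also have "\<dots> = A * (((1 - \<bar>s\<bar>) powr (1 - p) - 1) / (p - 1))" by (rule integral_unique[OF hi])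
  finally show ?thesis .
qed

text \<open>The rate is uniform: the constant A serves all chains, with the norm of the chain as a
  factor.\<close>

definition growth :: "nat \<Rightarrow> nat \<Rightarrow> real \<Rightarrow> bool" where
  "growth m j p \<longleftrightarrow> (\<exists>A\<ge>0. \<forall>h. Bchain m h \<longrightarrow>
     (\<forall>s\<in>{-1<..<1}. cmod (h j s) \<le> A * sqrt (Nsum m h) * (1 - \<bar>s\<bar>) powr (-p)))"

lemma growthE:
  assumes "growth m j p"
  obtains A where "A \<ge> 0" "\<And>h s. Bchain m h \<Longrightarrow> s \<in> {-1<..<1} \<Longrightarrow>
    cmod (h j s) \<le> A * sqrt (Nsum m h) * (1 - \<bar>s\<bar>) powr (-p)"
  using assms unfolding growth_def by blast

lemma growthI:
  assumes "A \<ge> 0" "\<And>h s. Bchain m h \<Longrightarrow> s \<in> {-1<..<1} \<Longrightarrow>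
    cmod (h j s) \<le> A * sqrt (Nsum m h) * (1 - \<bar>s\<bar>) powr (-p)"
  shows "growth m j p"
  using assms unfolding growth_def by blast

lemma powr_ge_1: "s \<in> {-1<..<1} \<Longrightarrow> 0 \<le> p \<Longrightarrow> 1 \<le> (1 - \<bar>s\<bar>) powr (-p)" for s p :: real
proof -
  assume "s \<in> {-1<..<1}" "0 \<le> p"
  then have "0 < 1 - \<bar>s\<bar>" "1 - \<bar>s\<bar> \<le> 1" by auto
  then show "1 \<le> (1 - \<bar>s\<bar>) powr (-p)" using powr_mono'[of "-p" 0 "1 - \<bar>s\<bar>"] \<open>0 \<le> p\<close> by simp
qed

lemma Bchain_zero_bound:
  assumes j: "j < m"
  obtains B where "B \<ge> 0" "\<And>h. Bchain m h \<Longrightarrow> cmod (h j 0) \<le> B * sqrt (Nsum m h)"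
proof -
  have z: "(0::real) \<in> {-1<..<1}" by simp
  obtain C where C: "C \<ge> 0" "\<And>f g. acd f g \<Longrightarrow> L2 (Suc j) f \<Longrightarrow> L2 (Suc (Suc j)) g \<Longrightarrow>
      (cmod (f 0))\<^sup>2 \<le> C * (nsq (Suc j) f + nsq (Suc (Suc j)) g)"
    using acd_point_bound[OF z] by blast
  show ?thesis
  proof (rule that[of "sqrt (2 * C)"])
    fix h assume h: "Bchain m h"
    note D = BchainD[OF h]
    have "(cmod (h j 0))\<^sup>2 \<le> C * (nsq (Suc j) (h j) + nsq (Suc (Suc j)) (h (Suc j)))"
      using D j by (intro C(2)) auto
    also have "\<dots> \<le> C * (Nsum m h + Nsum m h)"
      using j C(1) by (intro mult_left_mono add_mono nsq_le_Nsum) auto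
    also have "\<dots> = (sqrt (2 * C) * sqrt (Nsum m h))\<^sup>2" using C(1) by (simp add: power_mult_distrib)
    finally show "cmod (h j 0) \<le> sqrt (2 * C) * sqrt (Nsum m h)"
      by (rule power2_le_imp_le) (use C(1) in simp)
  qed (use C in simp)
qed

text \<open>\<open>acd_growth\<close> for the next derivative, with weight exponent and p both equal
  to j + 2, bounds the square by the power 1 - p = -(j + 1). The square root halves this.\<close>

lemma growth_top:
  assumes j: "j < m"
  shows "growth m j (real (Suc j) / 2)"
proof -
  obtain B where B: "B \<ge> 0" "\<And>h. Bchain m h \<Longrightarrow> cmod (h j 0) \<le> B * sqrt (Nsum m h)"
    using Bchain_zero_bound[OF j] by blast
  show ?thesis
  proof (rule growthI[of "B + 1"])
    fix h and s :: real assume h: "Bchain m h" and s: "s \<in> {-1<..<1}"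
    note D = BchainD[OF h]
    define x where "x = 1 - \<bar>s\<bar>"
    define N where "N = Nsum m h"
    have x: "x > 0" using s by (auto simp: x_def)
    define q where "q = x powr (- (real (Suc j) / 2))"
    have q: "q \<ge> 1" unfolding q_def x_def by (rule powr_ge_1[OF s]) simp
    have q2: "x powr (1 - (real (Suc j) + 1)) = q\<^sup>2"
    proof -
      have "q\<^sup>2 = x powr (- (real (Suc j) / 2) + - (real (Suc j) / 2))"
        unfolding q_def power2_eq_square by (rule powr_add[symmetric])
      also have "- (real (Suc j) / 2) + - (real (Suc j) / 2) = 1 - (real (Suc j) + 1)" by simp
      finally show ?thesis by simp
    qed
    have L: "L2 (Suc (Suc j)) (h (Suc j))" using D(2)[of "Suc j"] j by simp
    have a: "acd (h j) (h (Suc j))" using D(1) j by simp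
    have "(cmod (h j s - h j 0))\<^sup>2 \<le> nsq (Suc (Suc j)) (h (Suc j)) * ((1 - \<bar>s\<bar>) powr (1 - (real (Suc j) + 1)) / ((real (Suc j) + 1) - 1))"
      by (rule acd_growth[OF a L _ _ s]) auto
    also have "\<dots> \<le> N * (x powr (1 - (real (Suc j) + 1)) / 1)"
      unfolding x_def[symmetric] N_def using j
      by (intro mult_mono nsq_le_Nsum divide_left_mono) auto
    also have "\<dots> = (sqrt N * q)\<^sup>2" unfolding q2 N_def by (simp add: power_mult_distrib)
    finally have d: "cmod (h j s - h j 0) \<le> sqrt N * q" by (rule power2_le_imp_le) (use q in \<open>simp add: N_def\<close>)
    have "cmod (h j s) \<le> cmod (h j 0) + cmod (h j s - h j 0)" using norm_triangle_ineq[of "h j 0" "h j s - h j 0"] by simp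
    also have "\<dots> \<le> B * sqrt N * q + sqrt N * q"
    proof (rule add_mono[OF _ d])
      have "cmod (h j 0) \<le> B * sqrt N * 1" using B(2)[OF h] by (simp add: N_def)
      also have "\<dots> \<le> B * sqrt N * q" using q B(1) by (intro mult_left_mono) (auto simp: N_def)
      finally show "cmod (h j 0) \<le> B * sqrt N * q" .
    qed
    finally show "cmod (h j s) \<le> (B + 1) * sqrt (Nsum m h) * (1 - \<bar>s\<bar>) powr - (real (Suc j) / 2)"
      by (simp add: q_def x_def N_def algebra_simps)
  qed (use B in simp)
qed

text \<open>Integrating a rate lowers the exponent by one, but not below 0, where the value at 0
  dominates. At p = 1 the integral is a logarithm, hence the exclusion.\<close>

lemma growth_step:
  assumes j: "j < m" and g: "growth m (Suc j) p" and p: "p \<noteq> 1" and r: "r = max 0 (p - 1)"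
  shows "growth m j r"
proof -
  obtain B where B: "B \<ge> 0" "\<And>h. Bchain m h \<Longrightarrow> cmod (h j 0) \<le> B * sqrt (Nsum m h)"
    using Bchain_zero_bound[OF j] by blast
  obtain A where A: "A \<ge> 0" "\<And>h s. Bchain m h \<Longrightarrow> s \<in> {-1<..<1} \<Longrightarrow>
    cmod (h (Suc j) s) \<le> A * sqrt (Nsum m h) * (1 - \<bar>s\<bar>) powr (-p)"
    using growthE[OF g] by blast
  show ?thesis
  proof (rule growthI[of "B + A / \<bar>p - 1\<bar>"])
    fix h and s :: real assume h: "Bchain m h" and s: "s \<in> {-1<..<1}"
    define x where "x = 1 - \<bar>s\<bar>"
    define n where "n = sqrt (Nsum m h)"
    have n: "n \<ge> 0" by (simp add: n_def)
    have x: "x > 0" "x \<le> 1" using s by (auto simp: x_def)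
    have q: "x powr (-r) \<ge> 1" unfolding x_def by (rule powr_ge_1[OF s]) (simp add: r)
    have "cmod (h j s - h j 0) \<le> (A * n) * ((x powr (1 - p) - 1) / (p - 1))"
      unfolding x_def n_def by (rule acd_step[OF BchainD(1)[OF h j] A(2)[OF h] p s])
    also have "\<dots> \<le> (A * n) * (x powr (-r) / \<bar>p - 1\<bar>)"
    proof (intro mult_left_mono)
      show "(x powr (1 - p) - 1) / (p - 1) \<le> x powr (-r) / \<bar>p - 1\<bar>"
      proof (cases "p > 1")
        case True
        then show ?thesis by (simp add: r divide_right_mono)
      next
        case False
        then have p1: "1 - p > 0" using p by simp
        have "(x powr (1 - p) - 1) / (p - 1) = (1 - x powr (1 - p)) / (1 - p)"
          using p1 by (simp add: field_simps)
        also have "\<dots> \<le> 1 / (1 - p)" using p1 by (intro divide_right_mono) auto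
        also have "\<dots> \<le> x powr (-r) / \<bar>p - 1\<bar>" using p1 q by (simp add: divide_right_mono)
        finally show ?thesis .
      qed
    qed (use A n in simp)
    finally have d: "cmod (h j s - h j 0) \<le> (A * n) * (x powr (-r) / \<bar>p - 1\<bar>)" .
    have "cmod (h j s) \<le> cmod (h j 0) + cmod (h j s - h j 0)" using norm_triangle_ineq[of "h j 0" "h j s - h j 0"] by simp
    also have "\<dots> \<le> B * n * x powr (-r) + (A * n) * (x powr (-r) / \<bar>p - 1\<bar>)"
    proof (rule add_mono[OF _ d])
      have "cmod (h j 0) \<le> B * n * 1" using B(2)[OF h] by (simp add: n_def)
      also have "\<dots> \<le> B * n * x powr (-r)" using q B(1) n by (intro mult_left_mono) auto
      finally show "cmod (h j 0) \<le> B * n * x powr (-r)" .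
    qed
    finally show "cmod (h j s) \<le> (B + A / \<bar>p - 1\<bar>) * sqrt (Nsum m h) * (1 - \<bar>s\<bar>) powr (-r)"
      unfolding x_def n_def by (simp add: algebra_simps)
  qed (use A B in simp)
qed

text \<open>One integration of the rate of \<open>h (Suc i)\<close> yields i/2 unless i = 0, where
  that rate has the forbidden exponent 1. For i = 0 the start is one level higher, with exponents
  3/2, 1/2, 0; this is where 3 \<le> m enters.\<close>

lemma growth_half:
  assumes m: "3 \<le> m" and i: "i + 2 \<le> m"
  shows "growth m i (real i / 2)"
proof (cases "i = 0")
  case True
  have "growth m 2 (3 / 2)" using growth_top[of 2 m] m by simp
  then have "growth m (Suc 1) (3 / 2)" by (simp add: numeral_2_eq_2)
  then have "growth m 1 (1 / 2)" using m by (intro growth_step[of 1 m "3/2"]) auto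
  then have "growth m 0 0" using m by (intro growth_step[of 0 m "1/2"]) auto
  then show ?thesis using True by simp
next
  case False
  have "growth m (Suc i) (real (Suc (Suc i)) / 2)" using growth_top[of "Suc i" m] i by simp
  then show ?thesis using i False by (intro growth_step[of i m "real (Suc (Suc i)) / 2"]) (auto simp: field_simps)
qed

text \<open>Squaring the rate i/2 gives (1 - |s|)^(-i), which the i-th power of the weight
  compensates exactly.\<close>

lemma Bchain_sup:
  assumes m: "3 \<le> m"
  obtains C where "C \<ge> 0" "\<And>i h s. i + 2 \<le> m \<Longrightarrow> Bchain m h \<Longrightarrow> s \<in> {-1<..<1} \<Longrightarrow>
    (1 - s\<^sup>2) ^ i * (cmod (h i s))\<^sup>2 \<le> C * Nsum m h"
proof -
  have "\<exists>C\<ge>0. \<forall>h s. Bchain m h \<longrightarrow> s \<in> {-1<..<1} \<longrightarrow> (1 - s\<^sup>2) ^ i * (cmod (h i s))\<^sup>2 \<le> C * Nsum m h"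
    if i: "i + 2 \<le> m" for i
  proof -
    obtain A where A: "A \<ge> 0" "\<And>h s. Bchain m h \<Longrightarrow> s \<in> {-1<..<1} \<Longrightarrow>
      cmod (h i s) \<le> A * sqrt (Nsum m h) * (1 - \<bar>s\<bar>) powr (- (real i / 2))"
      using growthE[OF growth_half[OF m i]] by blast
    have "(1 - s\<^sup>2) ^ i * (cmod (h i s))\<^sup>2 \<le> (2 ^ i * A\<^sup>2) * Nsum m h" if h: "Bchain m h" and s: "s \<in> {-1<..<1}" for h s
    proof -
      define x where "x = 1 - \<bar>s\<bar>"
      have x: "x > 0" using s by (auto simp: x_def)
      have "1 - s\<^sup>2 = x * (1 + \<bar>s\<bar>)" by (simp add: x_def algebra_simps power2_eq_square abs_mult_self_eq)
      also have "\<dots> \<le> x * 2" using x s by (intro mult_left_mono) auto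
      finally have w: "(1 - s\<^sup>2) ^ i \<le> (x * 2) ^ i" using weight_pos[OF s] by (intro power_mono) auto
      have "(cmod (h i s))\<^sup>2 \<le> (A * sqrt (Nsum m h) * x powr (- (real i / 2)))\<^sup>2"
        unfolding x_def by (intro power_mono A(2)[OF h s]) auto
      also have "\<dots> = A\<^sup>2 * Nsum m h * inverse (x ^ i)"
      proof -
        have "(x powr (- (real i / 2)))\<^sup>2 = x powr (- (real i / 2) + - (real i / 2))"
          unfolding power2_eq_square by (rule powr_add[symmetric])
        also have "\<dots> = x powr (- real i)" by simp
        also have "\<dots> = inverse (x ^ i)" using x by (simp add: powr_minus powr_realpow)
        finally show ?thesis by (simp add: power_mult_distrib)
      qed
      finally have "(1 - s\<^sup>2) ^ i * (cmod (h i s))\<^sup>2 \<le> (x * 2) ^ i * (A\<^sup>2 * Nsum m h * inverse (x ^ i))"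
        using x by (intro mult_mono[OF w]) auto
      also have "\<dots> = (2 ^ i * A\<^sup>2) * Nsum m h" using x by (simp add: power_mult_distrib field_simps)
      finally show ?thesis .
    qed
    then show ?thesis by (intro exI[of _ "2 ^ i * A\<^sup>2"]) auto
  qed
  then have "\<forall>i. \<exists>C. i + 2 \<le> m \<longrightarrow> C \<ge> 0 \<and>
      (\<forall>h s. Bchain m h \<longrightarrow> s \<in> {-1<..<1} \<longrightarrow> (1 - s\<^sup>2) ^ i * (cmod (h i s))\<^sup>2 \<le> C * Nsum m h)" by simp
  from choice[OF this] obtain c where cc: "\<forall>i. i + 2 \<le> m \<longrightarrow> c i \<ge> 0 \<and>
      (\<forall>h s. Bchain m h \<longrightarrow> s \<in> {-1<..<1} \<longrightarrow> (1 - s\<^sup>2) ^ i * (cmod (h i s))\<^sup>2 \<le> c i * Nsum m h)"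
    by (elim exE)
  have c: "(1 - s\<^sup>2) ^ i * (cmod (h i s))\<^sup>2 \<le> c i * Nsum m h"
    if "i + 2 \<le> m" "Bchain m h" "s \<in> {-1<..<1}" for i h s
    using cc that by simp
  show ?thesis
  proof (rule that[of "\<Sum>i\<le>m. \<bar>c i\<bar>"])
    fix i h and s :: real assume a: "i + 2 \<le> m" "Bchain m h" "s \<in> {-1<..<1}"
    have "\<bar>c i\<bar> \<le> (\<Sum>i\<le>m. \<bar>c i\<bar>)" using a by (intro member_le_sum) auto
    then have "c i \<le> (\<Sum>i\<le>m. \<bar>c i\<bar>)" by linarith
    then have "c i * Nsum m h \<le> (\<Sum>i\<le>m. \<bar>c i\<bar>) * Nsum m h" by (rule mult_right_mono) simp
    then show "(1 - s\<^sup>2) ^ i * (cmod (h i s))\<^sup>2 \<le> (\<Sum>i\<le>m. \<bar>c i\<bar>) * Nsum m h" using c[OF a] by linarith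
  qed (simp add: sum_nonneg)
qed

section \<open>Products of chains\<close>

text \<open>The Leibniz formula for the j-th derivative of a product.\<close>

definition lei :: "(nat \<Rightarrow> real \<Rightarrow> complex) \<Rightarrow> (nat \<Rightarrow> real \<Rightarrow> complex) \<Rightarrow> nat \<Rightarrow> real \<Rightarrow> complex" where
  "lei f g j s = (\<Sum>i\<le>j. of_nat (j choose i) * (f i s * g (j - i) s))"

text \<open>Pascal's rule, arranged in the form that \<open>acd_mult\<close> produces term by
  term.\<close>

lemma lei_Suc:
  "lei f g (Suc j) s = (\<Sum>i\<le>j. of_nat (j choose i) * (f (Suc i) s * g (j - i) s + f i s * g (Suc (j - i)) s))"
proof -
  define T where "T i = f i s * g (Suc j - i) s" for i
  have "lei f g (Suc j) s = (\<Sum>i\<le>Suc j. of_nat (Suc j choose i) * T i)" by (simp only: lei_def T_def)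
  also have "\<dots> = T 0 + (\<Sum>i\<le>j. of_nat (Suc j choose Suc i) * T (Suc i))" by (subst sum.atMost_Suc_shift) simp
  also have "\<dots> = (\<Sum>i\<le>j. of_nat (j choose i) * T (Suc i)) + (T 0 + (\<Sum>i\<le>j. of_nat (j choose Suc i) * T (Suc i)))"
    by (simp add: sum.distrib algebra_simps)
  also have "T 0 + (\<Sum>i\<le>j. of_nat (j choose Suc i) * T (Suc i)) = (\<Sum>i\<le>Suc j. of_nat (j choose i) * T i)"
    by (subst sum.atMost_Suc_shift) simp
  also have "\<dots> = (\<Sum>i\<le>j. of_nat (j choose i) * T i)" by simp
  also have "(\<Sum>i\<le>j. of_nat (j choose i) * T (Suc i)) + (\<Sum>i\<le>j. of_nat (j choose i) * T i)
      = (\<Sum>i\<le>j. of_nat (j choose i) * (T (Suc i) + T i))" by (simp add: sum.distrib distrib_left)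
  also have "\<dots> = (\<Sum>i\<le>j. of_nat (j choose i) * (f (Suc i) s * g (j - i) s + f i s * g (Suc (j - i)) s))"
    by (intro sum.cong) (auto simp: T_def Suc_diff_le)
  finally show ?thesis .
qed

lemma nsq_sum:
  assumes "finite A" "\<And>i. i \<in> A \<Longrightarrow> L2 k (F i)"
  shows "nsq k (\<lambda>s. \<Sum>i\<in>A. F i s) \<le> 2 ^ card A * (\<Sum>i\<in>A. nsq k (F i))"
  using assms
proof (induction A)
  case (insert a A)
  have "nsq k (\<lambda>s. \<Sum>i\<in>insert a A. F i s) = nsq k (\<lambda>s. F a s + (\<Sum>i\<in>A. F i s))" using insert by simp
  also have "\<dots> \<le> 2 * nsq k (F a) + 2 * nsq k (\<lambda>s. \<Sum>i\<in>A. F i s)"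
    using insert by (intro L2_add(2) L2_sum) auto
  also have "\<dots> \<le> 2 * (2 ^ card A * nsq k (F a)) + 2 * (2 ^ card A * (\<Sum>i\<in>A. nsq k (F i)))"
    using insert mult_right_mono[of 1 "2 ^ card A" "nsq k (F a)"] by (intro add_mono mult_left_mono) auto
  finally show ?case using insert by (simp add: algebra_simps)
qed (simp add: nsq_def)

text \<open>In each Leibniz term one of the two orders is at most j/2. That factor is bounded by
  \<open>Bchain_sup\<close> with its order as weight exponent, the other one is taken in weighted
  L2, and the exponents i and j - i + 1 add up to j + 1.\<close>

lemma Bchain_mult:
  assumes m: "3 \<le> m"
  obtains C where "C \<ge> 0" "\<And>f g. Bchain m f \<Longrightarrow> Bchain m g \<Longrightarrow>
    Bchain m (lei f g) \<and> Nsum m (lei f g) \<le> C * Nsum m f * Nsum m g"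
proof -
  obtain C where C: "C \<ge> 0" "\<And>i h s. i + 2 \<le> m \<Longrightarrow> Bchain m h \<Longrightarrow> s \<in> {-1<..<1} \<Longrightarrow>
    (1 - s\<^sup>2) ^ i * (cmod (h i s))\<^sup>2 \<le> C * Nsum m h"
    using Bchain_sup[OF m] by blast
  have half: "L2 (Suc j) (\<lambda>s. f i s * g (j - i) s) \<and> nsq (Suc j) (\<lambda>s. f i s * g (j - i) s) \<le> C * Nsum m f * Nsum m g"
    if f: "Bchain m f" and g: "Bchain m g" and j: "j \<le> m" and i: "2 * i \<le> j" for f g i j
  proof -
    \<comment> \<open>From 2 i \<le> m and 3 \<le> m; for m = 2 the order i = 1 would violate
      it.\<close>
    have i2: "i + 2 \<le> m" using i j m by auto
    have gL: "L2 (Suc (j - i)) (g (j - i))" using BchainD(2)[OF g] j by simp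
    have fm: "f i \<in> borel_measurable M1" using L2_measurable[OF BchainD(2)[OF f]] i2 by simp
    have mm: "(\<lambda>s. f i s * g (j - i) s) \<in> borel_measurable M1" using fm L2_measurable[OF gL] by measurable
    have le: "(1 - s\<^sup>2) ^ Suc j * (cmod (f i s * g (j - i) s))\<^sup>2
        \<le> (C * Nsum m f) * ((1 - s\<^sup>2) ^ Suc (j - i) * (cmod (g (j - i) s))\<^sup>2)" if s: "s \<in> {-1<..<1}" for s
    proof -
      have "Suc j = i + Suc (j - i)" using i by simp
      then have "(1 - s\<^sup>2) ^ Suc j = (1 - s\<^sup>2) ^ i * (1 - s\<^sup>2) ^ Suc (j - i)"
        by (simp only: power_add)
      then have "(1 - s\<^sup>2) ^ Suc j * (cmod (f i s * g (j - i) s))\<^sup>2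
          = ((1 - s\<^sup>2) ^ i * (cmod (f i s))\<^sup>2) * ((1 - s\<^sup>2) ^ Suc (j - i) * (cmod (g (j - i) s))\<^sup>2)"
        by (simp only: norm_mult power_mult_distrib mult_ac)
      also have "\<dots> \<le> (C * Nsum m f) * ((1 - s\<^sup>2) ^ Suc (j - i) * (cmod (g (j - i) s))\<^sup>2)"
        using C(2)[OF i2 f s] weight_pos[OF s] by (intro mult_right_mono) auto
      finally show ?thesis .
    qed
    note b = L2_bound[OF mm gL le]
    have "(C * Nsum m f) * nsq (Suc (j - i)) (g (j - i)) \<le> (C * Nsum m f) * Nsum m g"
      using C(1) j by (intro mult_left_mono nsq_le_Nsum) auto
    then show ?thesis using b by (auto intro: order_trans)
  qed
  have trm: "L2 (Suc j) (\<lambda>s. f i s * g (j - i) s) \<and> nsq (Suc j) (\<lambda>s. f i s * g (j - i) s) \<le> C * Nsum m f * Nsum m g"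
    if f: "Bchain m f" and g: "Bchain m g" and j: "j \<le> m" and i: "i \<le> j" for f g i j
  proof (cases "2 * i \<le> j")
    case True
    then show ?thesis using half[OF f g j] by simp
  next
    case False
    then have "2 * (j - i) \<le> j" "j - (j - i) = i" using i by auto
    then show ?thesis using half[OF g f j, of "j - i"] by (simp add: mult_ac)
  qed
  define D where "D j = 2 ^ Suc j * (\<Sum>i\<le>j. (cmod (of_nat (j choose i)))\<^sup>2 * C)" for j
  have D0: "D j \<ge> 0" for j using C(1) by (auto simp: D_def intro!: mult_nonneg_nonneg sum_nonneg)
  show ?thesis
  proof (rule that[of "\<Sum>j\<le>m. D j"])
    show "0 \<le> (\<Sum>j\<le>m. D j)" using D0 by (simp add: sum_nonneg)
    fix f g assume f: "Bchain m f" and g: "Bchain m g"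
    have leiL: "L2 (Suc j) (lei f g j)" and lein: "nsq (Suc j) (lei f g j) \<le> D j * Nsum m f * Nsum m g" if j: "j \<le> m" for j
    proof -
      have t: "L2 (Suc j) (\<lambda>s. of_nat (j choose i) * (f i s * g (j - i) s))" if "i \<in> {..j}" for i
        using trm[OF f g j, of i] that by (intro L2_cmult(1)) auto
      have e: "lei f g j = (\<lambda>s. \<Sum>i\<le>j. of_nat (j choose i) * (f i s * g (j - i) s))" by (simp add: lei_def fun_eq_iff)
      show "L2 (Suc j) (lei f g j)" unfolding e by (rule L2_sum[OF t])
      have "nsq (Suc j) (lei f g j) \<le> 2 ^ card {..j} * (\<Sum>i\<le>j. nsq (Suc j) (\<lambda>s. of_nat (j choose i) * (f i s * g (j - i) s)))"
        unfolding e by (rule nsq_sum[OF _ t]) auto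
      also have "\<dots> \<le> 2 ^ Suc j * (\<Sum>i\<le>j. (cmod (of_nat (j choose i)))\<^sup>2 * (C * Nsum m f * Nsum m g))"
        unfolding L2_cmult(2) using trm[OF f g j] by (intro mult_mono sum_mono mult_left_mono) (auto intro!: sum_nonneg)
      also have "\<dots> = D j * Nsum m f * Nsum m g" by (simp add: D_def sum_distrib_right sum_distrib_left mult_ac)
      finally show "nsq (Suc j) (lei f g j) \<le> D j * Nsum m f * Nsum m g" .
    qed
    have "Bchain m (lei f g)"
      unfolding Bchain_def
    proof (intro conjI allI impI ballI leiL)
      show "acd (lei f g j) (lei f g (Suc j))" if j: "j < m" for j
      proof -
        have "acd (\<lambda>s. \<Sum>i\<le>j. of_nat (j choose i) * (f i s * g (j - i) s))
          (\<lambda>s. \<Sum>i\<le>j. of_nat (j choose i) * (f (Suc i) s * g (j - i) s + f i s * g (Suc (j - i)) s))"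
          using BchainD(1)[OF f] BchainD(1)[OF g] j by (intro acd_sum acd_cmult acd_mult) auto
        moreover have "lei f g j = (\<lambda>s. \<Sum>i\<le>j. of_nat (j choose i) * (f i s * g (j - i) s))"
          by (rule ext) (rule lei_def)
        moreover have "lei f g (Suc j) = (\<lambda>s. \<Sum>i\<le>j. of_nat (j choose i) * (f (Suc i) s * g (j - i) s + f i s * g (Suc (j - i)) s))"
          by (rule ext) (rule lei_Suc)
        ultimately show ?thesis by (simp only:)
      qed
      show "lei f g 0 (- s) = lei f g 0 s" if "s \<in> {-1<..<1}" for s
        using BchainD(3)[OF f that] BchainD(3)[OF g that] by (simp add: lei_def)
    qed
    moreover have "Nsum m (lei f g) \<le> (\<Sum>j\<le>m. D j * Nsum m f * Nsum m g)"
      unfolding Nsum_def[of m "lei f g"] using lein by (intro sum_mono) auto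
    ultimately show "Bchain m (lei f g) \<and> Nsum m (lei f g) \<le> (\<Sum>j\<le>m. D j) * Nsum m f * Nsum m g"
      by (simp add: sum_distrib_right)
  qed
qed

theorem func_algebra_K:
  assumes m: "3 \<le> m"
  obtains K where "func_algebra (K_space (Suc m)) {-1<..<1} dv K"
proof -
  let ?E = "K_space (Suc m)"
  have M2: "2 \<le> Suc m" and m1: "1 \<le> m" using m by auto
  interpret E: pre_hilbert ?E by (rule pre_hilbert_K) simp
  obtain C where C: "C \<ge> 0" "\<And>h. Bchain m h \<Longrightarrow> Kchain (Suc m) (up h) \<and>
    (hnorm ?E (crv (prim (h 0))))\<^sup>2 \<le> C * Nsum m h"
    by (rule Kchain_up[OF m1], rule that)
  obtain D where D: "D \<ge> 0" "\<And>f g. Bchain m f \<Longrightarrow> Bchain m g \<Longrightarrow>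
    Bchain m (lei f g) \<and> Nsum m (lei f g) \<le> D * Nsum m f * Nsum m g"
    by (rule Bchain_mult[OF m], rule that)
  \<comment> \<open>D bounds the product of the derivatives, C the return to the curve; the root
    appears because both concern squared norms. Adding 1 keeps K positive.\<close>
  define K where "K = sqrt (C * D) + 1"
  have chain: "\<exists>f. Kchain (Suc m) f \<and> x = crv (f 0)" if "x \<in> hcarrier ?E" for x
    by (rule K_space_chain[OF that zero_less_Suc]) blast
  have upI: "crv (prim (h 0)) \<in> hcarrier ?E" "s \<in> {-1<..<1} \<Longrightarrow> dv (crv (prim (h 0))) s = h 0 s" if "Bchain m h" for h s
  proof -
    have k: "Kchain (Suc m) (up h)" using C(2)[OF that] by blast
    show "crv (prim (h 0)) \<in> hcarrier ?E" using Kchain_mem[OF k] by simp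
    show "s \<in> {-1<..<1} \<Longrightarrow> dv (crv (prim (h 0))) s = h 0 s" using dv_chain[OF k M2] by simp
  qed
  have "func_algebra ?E {-1<..<1} dv K"
  proof (intro func_algebra.intro func_algebra_axioms.intro)
    show "pre_hilbert ?E" by unfold_locales
    show "hilbert_space ?E" by (rule hilbert_space_K) simp
    show "0 < K" unfolding K_def using C(1) D(1) by (intro add_nonneg_pos) auto
    fix x assume x: "x \<in> hcarrier ?E"
    obtain f where f: "Kchain (Suc m) f" "x = crv (f 0)" using chain[OF x] by blast
    show "dv (c *\<^sub>R x) s = of_real c * dv x s" if "s \<in> {-1<..<1}" for c s
      using dv_chain[OF Kchain_cmult[OF f(1), of "of_real c"] M2 that] dv_chain[OF f(1) M2 that]
      by (simp add: f(2) crv_chain_ops(3)[OF f(1) f(1)])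
    show "x = 0" if z: "\<And>s. s \<in> {-1<..<1} \<Longrightarrow> dv x s = 0"
    proof -
      have a: "acd (f 0) (f 1)" using KchainD(1)[OF f(1), of 0] by simp
      have f1: "f 1 s = 0" if "s \<in> {-1<..<1}" for s using z[OF that] dv_chain[OF f(1) M2 that] by (simp add: f(2))
      \<comment> \<open>A vanishing derivative leaves a constant of integration; oddness forces the
        value at 0 to be 0.\<close>
      have c: "continuous_on {-1<..<1} (f 1)" using Kchain_isdv[OF f(1) M2] by (simp add: isdv_def)
      have "f 0 0 = 0"
      proof -
        have e: "f 0 (- 0) = - f 0 0" by (rule KchainD(3)[OF f(1)]) simp
        have "f 0 0 + f 0 0 = 0" using e unfolding minus_zero by (simp only: eq_neg_iff_add_eq_0)
        then show ?thesis by (simp only: mult_2[symmetric] mult_eq_0_iff) simp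
      qed
      moreover have "cmod (f 0 s - f 0 0) \<le> 0" if s: "s \<in> {-1<..<1}" for s
      proof -
        have "cmod (f 0 s - f 0 0) \<le> 0 * (((1 - \<bar>s\<bar>) powr (1 - 2) - 1) / (2 - 1))"
        proof (rule acd_step[OF a _ _ s])
          show "cmod (f 1 t) \<le> 0 * (1 - \<bar>t\<bar>) powr (-2)" if "t \<in> {-1<..<1}" for t
            unfolding f1[OF that] by simp
        qed simp
        then show ?thesis by simp
      qed
      ultimately have "f 0 s = 0" if "s \<in> {-1<..<1}" for s using that by auto
      then have "crv (f 0) = crv (\<lambda>s. 0)" using KchainD(4)[OF f(1), of 0] by (intro crv_eqI AE_M1I) auto
      then show ?thesis by (simp add: f(2) crv_zero)
    qed
    show "\<exists>z\<in>hcarrier ?E. (\<forall>s\<in>{-1<..<1}. dv z s = cnj (dv x s)) \<and> hnorm ?E z = hnorm ?E x"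
    proof -
      have k: "Kchain (Suc m) (\<lambda>j s. cnj (f j s))"
        unfolding Kchain_def
      proof (intro conjI allI impI ballI)
        show "acd (\<lambda>s. cnj (f j s)) (\<lambda>s. cnj (f (Suc j) s))" if "j < Suc m" for j
          by (rule acd_cnj[OF KchainD(1)[OF f(1) that]])
        show "L2 j (\<lambda>s. cnj (f j s))" if "j \<le> Suc m" for j by (rule L2_cnj(1)[OF KchainD(2)[OF f(1) that]])
        show "cnj (f 0 (- s)) = - cnj (f 0 s)" if "s \<in> {-1<..<1}" for s
          unfolding KchainD(3)[OF f(1) that] by simp
      qed
      have "(hnorm ?E (crv (\<lambda>s. cnj (f 0 s))))\<^sup>2 = (hnorm ?E x)\<^sup>2"
        using hnorm_K[OF k] hnorm_K[OF f(1)] by (simp add: L2_cnj(2) f(2))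
      then have "hnorm ?E (crv (\<lambda>s. cnj (f 0 s))) = hnorm ?E x"
        using Kchain_mem[OF k] x by (simp add: power2_eq_iff_nonneg)
      moreover have "dv (crv (\<lambda>s. cnj (f 0 s))) s = cnj (dv x s)" if "s \<in> {-1<..<1}" for s
        unfolding dv_chain[OF k M2 that] f(2) dv_chain[OF f(1) M2 that] ..
      ultimately show ?thesis
        using Kchain_mem[OF k] by blast
    qed
    fix y assume y: "y \<in> hcarrier ?E"
    obtain g where g: "Kchain (Suc m) g" "y = crv (g 0)" using chain[OF y] by blast
    show "dv (x + y) s = dv x s + dv y s" if "s \<in> {-1<..<1}" for s
      using dv_chain[OF Kchain_add[OF f(1) g(1)] M2 that] dv_chain[OF f(1) M2 that] dv_chain[OF g(1) M2 that]
      by (simp add: f(2) g(2) crv_chain_ops(1)[OF f(1) g(1)])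
    show "\<exists>z\<in>hcarrier ?E. (\<forall>s\<in>{-1<..<1}. dv z s = dv x s * dv y s) \<and> hnorm ?E z \<le> K * hnorm ?E x * hnorm ?E y"
    proof -
      let ?f = "\<lambda>j. f (Suc j)" and ?g = "\<lambda>j. g (Suc j)"
      note bf = Bchain_of_Kchain[OF f(1) m1] and bg = Bchain_of_Kchain[OF g(1) m1]
      define h where "h = lei ?f ?g"
      have h: "Bchain m h" and hN: "Nsum m h \<le> D * Nsum m ?f * Nsum m ?g"
        using D(2)[OF bf(1) bg(1)] by (auto simp: h_def)
      have h0: "h 0 s = f 1 s * g 1 s" for s by (simp add: h_def lei_def)
      have nx: "0 \<le> hnorm ?E x" "0 \<le> hnorm ?E y" using x y by auto
      have "(hnorm ?E (crv (prim (h 0))))\<^sup>2 \<le> C * Nsum m h" using C(2)[OF h] by blast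
      also have "\<dots> \<le> C * (D * Nsum m ?f * Nsum m ?g)" using hN C(1) by (rule mult_left_mono)
      also have "\<dots> \<le> C * (D * (hnorm ?E x)\<^sup>2 * (hnorm ?E y)\<^sup>2)"
        by (intro mult_left_mono[OF _ C(1)] mult_mono[OF mult_left_mono[OF _ D(1)]] bf(2)[folded f(2)] bg(2)[folded g(2)]
            mult_nonneg_nonneg D(1) zero_le_power2 Nsum_nonneg)
      also have "\<dots> = (sqrt (C * D) * hnorm ?E x * hnorm ?E y)\<^sup>2"
      proof -
        have "(sqrt (C * D))\<^sup>2 = C * D" using mult_nonneg_nonneg[OF C(1) D(1)] by simp
        then show ?thesis unfolding power_mult_distrib by (simp only: mult.assoc)
      qed
      finally have sq: "(hnorm ?E (crv (prim (h 0))))\<^sup>2 \<le> (sqrt (C * D) * hnorm ?E x * hnorm ?E y)\<^sup>2" .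
      have "0 \<le> sqrt (C * D)" using mult_nonneg_nonneg[OF C(1) D(1)] by simp
      then have "hnorm ?E (crv (prim (h 0))) \<le> sqrt (C * D) * hnorm ?E x * hnorm ?E y"
        using nx by (intro power2_le_imp_le[OF sq] mult_nonneg_nonneg)
      also have "\<dots> \<le> K * hnorm ?E x * hnorm ?E y"
        by (intro mult_right_mono nx) (simp add: K_def)
      finally have "hnorm ?E (crv (prim (h 0))) \<le> K * hnorm ?E x * hnorm ?E y" .
      moreover have "dv (crv (prim (h 0))) s = dv x s * dv y s" if s: "s \<in> {-1<..<1}" for s
        unfolding upI(2)[OF h s] h0 f(2) g(2) dv_chain[OF f(1) M2 s] dv_chain[OF g(1) M2 s] ..
      ultimately show ?thesis using upI(1)[OF h] by blast
    qed
  next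
    fix c :: complex
    define h where "h j s = (if j = 0 then c else 0)" for j :: nat and s :: real
    have "Bchain m h"
      unfolding Bchain_def
    proof (intro conjI allI impI ballI)
      show "acd (h j) (h (Suc j))" for j by (cases "j = 0") (simp_all add: h_def[abs_def] acd_const)
      show "L2 (Suc j) (h j)" for j by (cases "j = 0") (simp_all add: h_def[abs_def] L2_const_int)
    qed (simp add: h_def)
    then show "\<exists>z\<in>hcarrier ?E. \<forall>s\<in>{-1<..<1}. dv z s = c"
      using upI[of h] by (intro bexI[of _ "crv (prim (h 0))"]) (auto simp: h_def)
  qed
  then show ?thesis by (rule that)
qed

theorem A_space_algebra_case:
  assumes m: "3 \<le> m"
  shows "hilbert_submanifold (K_space (m + 1)) (A_space (m + 1))"
    "\<exists>E :: curve hspace. hilbert_manifold E (subtopology (htopology (K_space (m + 1))) (A_space (m + 1)))"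
proof -
  obtain K where K: "func_algebra (K_space (Suc m)) {-1<..<1} dv K" using func_algebra_K[OF m] .
  interpret func_algebra "K_space (Suc m)" "{-1<..<1}" dv K by (rule K)
  have "2 \<le> Suc m" using m by simp
  from A_space_eq[OF this] have e: "A_space (Suc m) = US" unfolding US_def by simp
  show "hilbert_submanifold (K_space (m + 1)) (A_space (m + 1))"
    unfolding Suc_eq_plus1[symmetric] e by (rule unimodular_hilbert_submanifold)
  show "\<exists>E :: curve hspace. hilbert_manifold E (subtopology (htopology (K_space (m + 1))) (A_space (m + 1)))"
    unfolding Suc_eq_plus1[symmetric] e by (rule exI, rule unimodular_hilbert_manifold)
qed

section \<open>Quotients of Hilbert spaces by discrete translations\<close>

text \<open>The vector v may vary with x, so f need not be one translation. Its first derivative is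
  the identity, the higher ones vanish, and near x the remainders are exactly 0.\<close>

lemma hsmooth_on_translation:
  assumes F: "pre_hilbert F" and U: "openin (htopology F) U"
    and f: "\<And>x. x \<in> U \<Longrightarrow> \<exists>v\<in>hcarrier F. \<exists>d>0. \<forall>y\<in>U. hnorm F (y - x) < d \<longrightarrow> f y = y + v"
  shows "hsmooth_on F F U f"
proof -
  interpret F: pre_hilbert F by fact
  have UF: "U \<subseteq> hcarrier F" using U F.openin_htopology by blast
  define D where "D k x vs = (if k = 0 then f x else if k = 1 then hd vs else 0)" for k :: nat and x and vs :: "'a list"
  have fF: "f x \<in> hcarrier F" if x: "x \<in> U" for x
  proof -
    obtain v d where v: "v \<in> hcarrier F" "0 < d" "\<forall>y\<in>U. hnorm F (y - x) < d \<longrightarrow> f y = y + v"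
      using f[OF x] by blast
    then have "f x = x + v" using x by simp
    then show ?thesis using v(1) x UF subspace_add[OF F.subsp] by auto
  qed
  have "hderivs F F U f D"
    unfolding hderivs_def
  proof (intro conjI ballI allI impI)
    show "D 0 x [] = f x" for x by (simp add: D_def)
    show "bounded_multilinear F F k (D k x)" if x: "x \<in> U" for k x
      unfolding bounded_multilinear_def
    proof (intro conjI allI impI ballI)
      have c: "vs = []" if "k = 0" "length vs = k" for vs :: "'a list" using that by simp
      show "D k x vs \<in> hcarrier F" if "length vs = k \<and> set vs \<subseteq> hcarrier F" for vs
        using that fF[OF x] subspace_0[OF F.subsp] by (cases vs) (auto simp: D_def)
      show "D k x (vs[i := c *\<^sub>R a + b]) = c *\<^sub>R D k x (vs[i := a]) + D k x (vs[i := b])"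
        if "length vs = k \<and> set vs \<subseteq> hcarrier F \<and> i < k" for vs i c a b
        using that by (cases vs) (auto simp: D_def)
      show "\<exists>C. \<forall>vs. length vs = k \<and> set vs \<subseteq> hcarrier F \<longrightarrow> hnorm F (D k x vs) \<le> C * prod_list (map (hnorm F) vs)"
      proof (intro exI[of _ "if k = 0 then hnorm F (f x) else if k = 1 then 1 else 0"] allI impI)
        fix vs assume "length vs = k \<and> set vs \<subseteq> hcarrier F"
        then show "hnorm F (D k x vs) \<le> (if k = 0 then hnorm F (f x) else if k = 1 then 1 else 0) * prod_list (map (hnorm F) vs)"
          by (cases vs; cases "tl vs") (auto simp: D_def)
      qed
    qed
    fix k x and e :: real assume x: "x \<in> U" and e: "0 < e"
    obtain v d where v: "v \<in> hcarrier F" "0 < d" "\<forall>y\<in>U. hnorm F (y - x) < d \<longrightarrow> f y = y + v"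
      using f[OF x] by blast
    show "\<exists>d>0. \<forall>y\<in>U. hnorm F (y - x) < d \<longrightarrow> (\<forall>vs. length vs = k \<and> set vs \<subseteq> hcarrier F \<longrightarrow>
        hnorm F (D k y vs - D k x vs - D (Suc k) x ((y - x) # vs)) \<le> e * hnorm F (y - x) * prod_list (map (hnorm F) vs))"
    proof (intro exI[of _ d] conjI ballI impI allI)
      show "0 < d" by fact
      fix y vs assume y: "y \<in> U" "hnorm F (y - x) < d" and vs: "length vs = k \<and> set vs \<subseteq> hcarrier F"
      have fx: "f x = x + v" "f y = y + v" using v y x by auto
      have z: "D k y vs - D k x vs - D (Suc k) x ((y - x) # vs) = 0"
        by (simp add: D_def fx)
      have "0 \<le> prod_list (map (hnorm F) vs)" using vs by (intro prod_list_nonneg) auto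
      moreover have "y - x \<in> hcarrier F" using x y UF subspace_diff[OF F.subsp] by blast
      ultimately show "hnorm F (D k y vs - D k x vs - D (Suc k) x ((y - x) # vs))
          \<le> e * hnorm F (y - x) * prod_list (map (hnorm F) vs)"
        unfolding z F.hnorm_0 using e by simp
    qed
  qed
  then show ?thesis unfolding hsmooth_on_iff using U by blast
qed

text \<open>
  A continuous open surjection whose fibres are the orbits of translations by multiples of \<open>p\<close>
  along \<open>u\<close>; the slabs of width \<open>p\<close> transversal to \<open>u\<close> are the chart domains.
\<close>

theorem hilbert_manifold_translation_quotient:
  fixes K :: "'b::real_vector hspace" and F :: "'a::real_vector hspace"
  assumes K: "pre_hilbert K" and F: "hilbert_space F" and A: "\<psi> ` hcarrier F = A" "A \<subseteq> hcarrier K"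
    and cont: "\<And>x e. x \<in> hcarrier F \<Longrightarrow> 0 < e \<Longrightarrow>
      \<exists>d>0. \<forall>y\<in>hcarrier F. hnorm F (y - x) < d \<longrightarrow> hnorm K (\<psi> y - \<psi> x) < e"
    and lift: "\<And>x e. x \<in> hcarrier F \<Longrightarrow> 0 < e \<Longrightarrow>
      \<exists>d>0. \<forall>z\<in>A. hnorm K (z - \<psi> x) < d \<longrightarrow> (\<exists>y\<in>hcarrier F. hnorm F (y - x) < e \<and> \<psi> y = z)"
    and p: "0 < p" and u: "u \<in> hcarrier F"
    and fib: "\<And>x y. x \<in> hcarrier F \<Longrightarrow> y \<in> hcarrier F \<Longrightarrow> \<psi> x = \<psi> y \<Longrightarrow>
      \<exists>c. y = x + c *\<^sub>R u \<and> (c = 0 \<or> p \<le> \<bar>c\<bar>) \<and> (\<forall>z\<in>hcarrier F. \<psi> (z + c *\<^sub>R u) = \<psi> z)"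
    and \<tau>: "\<And>x y. x \<in> hcarrier F \<Longrightarrow> y \<in> hcarrier F \<Longrightarrow> \<bar>\<tau> y - \<tau> x\<bar> \<le> C * hnorm F (y - x)"
      "\<And>x c. x \<in> hcarrier F \<Longrightarrow> \<tau> (x + c *\<^sub>R u) = \<tau> x + c"
  shows "hilbert_manifold F (subtopology (htopology K) A)"
proof -
  interpret K: pre_hilbert K by fact
  interpret F: pre_hilbert F by (rule hilbert_space_imp_pre_hilbert[OF F])
  let ?X = "subtopology (htopology K) A"
  \<comment> \<open>Two distinct points of one fibre differ by c u with |c| at least p, and \<tau>
    sees c; so \<psi> is injective on a set where \<tau> varies by less than p.\<close>
  define V where "V w = {x \<in> hcarrier F. \<bar>\<tau> x - w\<bar> < p / 2}" for w
  have VF: "V w \<subseteq> hcarrier F" for w by (auto simp: V_def)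
  have Vo: "openin (htopology F) (V w)" for w
    unfolding F.openin_htopology
  proof (intro conjI ballI VF)
    fix x assume x: "x \<in> V w"
    define r where "r = (p / 2 - \<bar>\<tau> x - w\<bar>) / (\<bar>C\<bar> + 1)"
    show "\<exists>r>0. \<forall>y\<in>hcarrier F. hnorm F (y - x) < r \<longrightarrow> y \<in> V w"
    proof (intro exI[of _ r] conjI ballI impI)
      show "0 < r" using x by (auto simp: r_def V_def intro: divide_pos_pos)
      fix y assume y: "y \<in> hcarrier F" "hnorm F (y - x) < r"
      have xF: "x \<in> hcarrier F" using x VF by blast
      have n: "0 \<le> hnorm F (y - x)" using subspace_diff[OF F.subsp y(1) xF] by simp
      have "\<bar>\<tau> y - \<tau> x\<bar> \<le> C * hnorm F (y - x)" by (rule \<tau>(1)[OF xF y(1)])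
      also have "\<dots> \<le> (\<bar>C\<bar> + 1) * hnorm F (y - x)" using n by (intro mult_right_mono) auto
      also have "\<dots> < (\<bar>C\<bar> + 1) * r" using y(2) by (intro mult_strict_left_mono) auto
      also have "\<dots> = p / 2 - \<bar>\<tau> x - w\<bar>" by (simp add: r_def)
      finally have "\<bar>\<tau> y - w\<bar> < p / 2"
        using abs_triangle_ineq[of "\<tau> y - \<tau> x" "\<tau> x - w"] by (simp only: diff_add_cancel add_diff_eq)
      then show "y \<in> V w" using y(1) unfolding V_def by blast
    qed
  qed
  have inj: "inj_on \<psi> (V w)" for w
  proof (rule inj_onI)
    fix x y assume xy: "x \<in> V w" "y \<in> V w" "\<psi> x = \<psi> y"
    then have m: "x \<in> hcarrier F" "y \<in> hcarrier F" using VF by auto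
    obtain c where c: "y = x + c *\<^sub>R u" "c = 0 \<or> p \<le> \<bar>c\<bar>" using fib[OF m xy(3)] by blast
    have "\<tau> y = \<tau> x + c" unfolding c(1) by (rule \<tau>(2)[OF m(1)])
    then have "\<bar>\<tau> x - w\<bar> < p / 2" "\<bar>\<tau> x + c - w\<bar> < p / 2" using xy(1,2) unfolding V_def by auto
    moreover have "\<bar>c\<bar> \<le> \<bar>\<tau> x + c - w\<bar> + \<bar>\<tau> x - w\<bar>"
      using abs_triangle_ineq4[of "\<tau> x + c - w" "\<tau> x - w"] by simp
    ultimately have "\<bar>c\<bar> < p / 2 + p / 2" by (meson add_strict_mono order_le_less_trans)
    then have "\<bar>c\<bar> < p" by simp
    then show "x = y" using c by auto
  qed
  have img: "openin ?X (\<psi> ` W)" if W: "openin (htopology F) W" for W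
  proof -
    have WF: "W \<subseteq> hcarrier F" using W F.openin_htopology by blast
    define d where "d x = (SOME d. 0 < d \<and> (\<forall>z\<in>A. hnorm K (z - \<psi> x) < d \<longrightarrow> z \<in> \<psi> ` W))" for x
    have d: "0 < d x" "z \<in> A \<Longrightarrow> hnorm K (z - \<psi> x) < d x \<Longrightarrow> z \<in> \<psi> ` W" if x: "x \<in> W" for x z
    proof -
      obtain r where r: "0 < r" "\<forall>y\<in>hcarrier F. hnorm F (y - x) < r \<longrightarrow> y \<in> W"
        using W x unfolding F.openin_htopology by blast
      obtain e where e: "0 < e" "\<forall>z\<in>A. hnorm K (z - \<psi> x) < e \<longrightarrow> (\<exists>y\<in>hcarrier F. hnorm F (y - x) < r \<and> \<psi> y = z)"
        using lift[of x r] x WF r(1) by blast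
      have "0 < e \<and> (\<forall>z\<in>A. hnorm K (z - \<psi> x) < e \<longrightarrow> z \<in> \<psi> ` W)" using e r(2) by blast
      then have "0 < d x \<and> (\<forall>z\<in>A. hnorm K (z - \<psi> x) < d x \<longrightarrow> z \<in> \<psi> ` W)" unfolding d_def by (rule someI)
      then show "0 < d x" "z \<in> A \<Longrightarrow> hnorm K (z - \<psi> x) < d x \<Longrightarrow> z \<in> \<psi> ` W" by blast+
    qed
    \<comment> \<open>A union of balls in the ambient space whose trace on \<open>A\<close> is the
      image of \<open>W\<close>; the radii come from \<open>lift\<close>.\<close>
    define O' where "O' = {z \<in> hcarrier K. \<exists>x\<in>W. hnorm K (z - \<psi> x) < d x}"
    have \<psi>K: "\<psi> x \<in> hcarrier K" if "x \<in> W" for x using that WF A by blast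
    have "openin (htopology K) O'"
      unfolding K.openin_htopology
    proof (intro conjI ballI)
      fix z assume "z \<in> O'"
      then obtain x where z: "z \<in> hcarrier K" "x \<in> W" "hnorm K (z - \<psi> x) < d x" unfolding O'_def by blast
      show "\<exists>r>0. \<forall>y\<in>hcarrier K. hnorm K (y - z) < r \<longrightarrow> y \<in> O'"
      proof (intro exI[of _ "d x - hnorm K (z - \<psi> x)"] conjI ballI impI)
        fix y assume y: "y \<in> hcarrier K" "hnorm K (y - z) < d x - hnorm K (z - \<psi> x)"
        then have "hnorm K (y - \<psi> x) < d x" using K.hnorm_triangle_via[OF y(1) z(1) \<psi>K[OF z(2)]] by linarith
        then show "y \<in> O'" unfolding O'_def using y z(2) by blast
      qed (use z in simp)
    qed (auto simp: O'_def)
    moreover have "\<psi> ` W = O' \<inter> A"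
    proof (intro equalityI subsetI)
      fix z assume "z \<in> \<psi> ` W"
      then obtain x where x: "x \<in> W" "z = \<psi> x" by blast
      have "hnorm K (z - \<psi> x) < d x" using d(1)[OF x(1)] by (simp add: x(2))
      then show "z \<in> O' \<inter> A" unfolding O'_def using x \<psi>K[OF x(1)] A(1) WF by blast
    next
      fix z assume "z \<in> O' \<inter> A"
      then show "z \<in> \<psi> ` W" unfolding O'_def using d(2) by blast
    qed
    ultimately show ?thesis by (auto simp: openin_subtopology)
  qed
  have ct: "continuous_map (htopology F) ?X \<psi>"
  proof -
    have "continuous_map (subtopology (htopology F) (hcarrier F)) (htopology K) \<psi>"
      by (rule F.continuous_map_into_htopologyI[OF K subset_refl _ cont]) (use A in blast)
    then have "continuous_map (htopology F) (htopology K) \<psi>"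
      using subtopology_topspace[of "htopology F"] by simp
    then show ?thesis using A(1) by (auto simp: continuous_map_in_subtopology)
  qed
  define g where "g w = inv_into (V w) \<psi>" for w
  have g: "g w (\<psi> x) = x" if "x \<in> V w" for w x unfolding g_def by (rule inv_into_f_f[OF inj that])
  have gi: "g w ` \<psi> ` W = W" if "W \<subseteq> V w" for w W using g that by (force simp: image_image)
  have bij: "inj_on (g w) (\<psi> ` V w)" for w by (rule inj_on_inverseI[of _ \<psi>]) (auto simp: g)
  have home: "homeomorphic_map (subtopology ?X (\<psi> ` V w)) (subtopology (htopology F) (V w)) (g w)" for w
  proof -
    have "homeomorphic_map (subtopology (htopology F) (V w)) (subtopology ?X (\<psi> ` V w)) \<psi>"
    proof (rule bijective_open_imp_homeomorphic_map)
      show "continuous_map (subtopology (htopology F) (V w)) (subtopology ?X (\<psi> ` V w)) \<psi>"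
        using continuous_map_from_subtopology[OF ct] by (auto simp: continuous_map_in_subtopology)
      show "open_map (subtopology (htopology F) (V w)) (subtopology ?X (\<psi> ` V w)) \<psi>"
        unfolding open_map_def
      proof (intro allI impI)
        fix W assume "openin (subtopology (htopology F) (V w)) W"
        then have W: "openin (htopology F) W" "W \<subseteq> V w" using openin_trans_full[OF _ Vo] openin_subset
          by (auto simp: openin_open_subtopology[OF Vo])
        show "openin (subtopology ?X (\<psi> ` V w)) (\<psi> ` W)"
          unfolding openin_open_subtopology[OF img[OF Vo]] using img[OF W(1)] W(2) by blast
      qed
      show "\<psi> ` topspace (subtopology (htopology F) (V w)) = topspace (subtopology ?X (\<psi> ` V w))"
        using A VF[of w] by auto
      show "inj_on \<psi> (topspace (subtopology (htopology F) (V w)))" using inj by (rule inj_on_subset) auto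
    qed
    then obtain h where h: "homeomorphic_maps (subtopology (htopology F) (V w)) (subtopology ?X (\<psi> ` V w)) \<psi> h"
      by (auto simp: homeomorphic_map_maps)
    have t: "topspace (subtopology ?X (\<psi> ` V w)) = \<psi> ` V w" using A VF[of w] by auto
    have "homeomorphic_map (subtopology ?X (\<psi> ` V w)) (subtopology (htopology F) (V w)) h"
      using h unfolding homeomorphic_map_maps homeomorphic_maps_sym[of "subtopology (htopology F) (V w)"] by blast
    moreover have "h z = g w z" if "z \<in> topspace (subtopology ?X (\<psi> ` V w))" for z
    proof -
      obtain x where x: "x \<in> V w" "z = \<psi> x" using \<open>z \<in> _\<close> unfolding t by blast
      have "h (\<psi> x) = x" using h x(1) VF[of w] unfolding homeomorphic_maps_def by auto
      then show ?thesis using x g by simp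
    qed
    ultimately show ?thesis by (rule homeomorphic_map_eq)
  qed
  have tr: "hsmooth_on F F (g w ` (\<psi> ` V w \<inter> \<psi> ` V v)) (g v \<circ> inv_into (\<psi> ` V w) (g w))" for w v
  proof -
    let ?U = "g w ` (\<psi> ` V w \<inter> \<psi> ` V v)"
    have U: "x \<in> ?U \<longleftrightarrow> x \<in> V w \<and> \<psi> x \<in> \<psi> ` V v" for x
    proof
      assume "x \<in> ?U"
      then obtain y where y: "y \<in> V w" "x = g w (\<psi> y)" "\<psi> y \<in> \<psi> ` V v" by blast
      then show "x \<in> V w \<and> \<psi> x \<in> \<psi> ` V v" by (simp add: g)
    next
      assume x: "x \<in> V w \<and> \<psi> x \<in> \<psi> ` V v"
      then have "g w (\<psi> x) \<in> ?U" by blast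
      then show "x \<in> ?U" using g x by simp
    qed
    have Uo: "openin (htopology F) ?U"
    proof -
      have "?U = V w \<inter> {x \<in> topspace (htopology F). \<psi> x \<in> \<psi> ` V v}"
      proof (rule set_eqI)
        show "x \<in> ?U \<longleftrightarrow> x \<in> V w \<inter> {x \<in> topspace (htopology F). \<psi> x \<in> \<psi> ` V v}" for x
          unfolding U using VF[of w] by auto
      qed
      then show ?thesis using openin_Int[OF Vo openin_continuous_map_preimage[OF ct img[OF Vo]]] by simp
    qed
    have ii: "inv_into (\<psi> ` V w) (g w) x = \<psi> x" if "x \<in> V w" for x
      using inv_into_f_f[OF bij, of "\<psi> x" w] g[OF that] that by simp
    show ?thesis
    proof (rule hsmooth_on_translation[OF F.pre_hilbert_axioms Uo])
      fix x assume "x \<in> ?U"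
      then have x: "x \<in> V w" "\<psi> x \<in> \<psi> ` V v" unfolding U by auto
      then obtain x' where x': "x' \<in> V v" "\<psi> x = \<psi> x'" by blast
      have m: "x \<in> hcarrier F" "x' \<in> hcarrier F" using x x' VF by auto
      \<comment> \<open>The shift found for the single pair x, x' works for all y near x: \<psi> is
        invariant under it, and y + c u lies in the slab on which \<open>g v\<close> inverts
        \<psi>.\<close>
      obtain c where c: "x' = x + c *\<^sub>R u" "\<forall>z\<in>hcarrier F. \<psi> (z + c *\<^sub>R u) = \<psi> z" using fib[OF m x'(2)] by blast
      obtain r where r: "0 < r" "\<forall>y\<in>hcarrier F. hnorm F (y - x') < r \<longrightarrow> y \<in> V v"
        using Vo[of v] x'(1) unfolding F.openin_htopology by blast
      show "\<exists>b\<in>hcarrier F. \<exists>d>0. \<forall>y\<in>?U. hnorm F (y - x) < d \<longrightarrow> (g v \<circ> inv_into (\<psi> ` V w) (g w)) y = y + b"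
      proof (intro bexI[of _ "c *\<^sub>R u"] exI[of _ r] conjI ballI impI)
        show cu: "c *\<^sub>R u \<in> hcarrier F" by (rule subspace_scale[OF F.subsp u])
        show "0 < r" by fact
        fix y assume "y \<in> ?U" and y: "hnorm F (y - x) < r"
        then have yV: "y \<in> V w" unfolding U by blast
        have yF: "y \<in> hcarrier F" using yV VF by blast
        have "y + c *\<^sub>R u \<in> hcarrier F" by (rule subspace_add[OF F.subsp yF cu])
        moreover have "hnorm F ((y + c *\<^sub>R u) - x') < r" using y by (simp add: c(1))
        ultimately have "y + c *\<^sub>R u \<in> V v" using r(2) by blast
        from g[OF this] have "g v (\<psi> y) = y + c *\<^sub>R u" using c(2) yF by simp
        then show "(g v \<circ> inv_into (\<psi> ` V w) (g w)) y = y + c *\<^sub>R u" by (simp add: ii[OF yV])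
      qed
    qed
  qed
  show ?thesis
    unfolding hilbert_manifold_def
  proof (intro conjI)
    show "hilbert_space F" by fact
    show "Hausdorff_space ?X" by (intro Hausdorff_space_subtopology K.Hausdorff_htopology)
    show "\<exists>\<A>. (\<forall>(U, \<phi>)\<in>\<A>. openin ?X U \<and> openin (htopology F) (\<phi> ` U) \<and>
           homeomorphic_map (subtopology ?X U) (subtopology (htopology F) (\<phi> ` U)) \<phi>) \<and>
        (\<Union>(U, \<phi>)\<in>\<A>. U) = topspace ?X \<and>
        (\<forall>(U, \<phi>)\<in>\<A>. \<forall>(V, \<psi>)\<in>\<A>. hsmooth_on F F (\<phi> ` (U \<inter> V)) (\<psi> \<circ> inv_into U \<phi>))"
    proof (intro exI[of _ "range (\<lambda>w. (\<psi> ` V w, g w))"] conjI)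
      show "\<forall>(U, \<phi>)\<in>range (\<lambda>w. (\<psi> ` V w, g w)). openin ?X U \<and> openin (htopology F) (\<phi> ` U) \<and>
           homeomorphic_map (subtopology ?X U) (subtopology (htopology F) (\<phi> ` U)) \<phi>"
      proof -
        have "openin ?X (\<psi> ` V w) \<and> openin (htopology F) (g w ` \<psi> ` V w) \<and>
          homeomorphic_map (subtopology ?X (\<psi> ` V w)) (subtopology (htopology F) (g w ` \<psi> ` V w)) (g w)" for w
          unfolding gi[OF subset_refl] by (intro conjI img Vo home)
        then show ?thesis by blast
      qed
      show "(\<Union>(U, \<phi>)\<in>range (\<lambda>w. (\<psi> ` V w, g w)). U) = topspace ?X"
      proof -
        have "x \<in> V (\<tau> x)" if "x \<in> hcarrier F" for x using that p by (simp add: V_def)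
        then have "(\<Union>w. V w) = hcarrier F" using VF by blast
        then have "(\<Union>w. \<psi> ` V w) = A" unfolding A(1)[symmetric] by (metis image_UN)
        then show ?thesis using A(2) by auto
      qed
      show "\<forall>(U, \<phi>)\<in>range (\<lambda>w. (\<psi> ` V w, g w)). \<forall>(V, \<psi>)\<in>range (\<lambda>w. (\<psi> ` V w, g w)).
          hsmooth_on F F (\<phi> ` (U \<inter> V)) (\<psi> \<circ> inv_into U \<phi>)"
        using tr by blast
    qed
  qed
qed

section \<open>The angle function in low regularity\<close>

lemma acd_reflect:
  assumes f: "acd f g"
  shows "acd (\<lambda>s. f (- s)) (\<lambda>s. - g (- s))"
proof (rule acdI)
  fix a b :: real assume ab: "-1 < a" "a \<le> b" "b < 1"
  have i: "g absolutely_integrable_on {-b..-a}" using acd_integrable[OF f, of "-b" "-a"] ab by simp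
  then have "(\<lambda>s. g (- s)) absolutely_integrable_on {a..b}"
    using absolutely_integrable_reflect_real[where f = g and a = "-b" and b = "-a"] by simp
  then have "(\<lambda>s. (-1) * g (- s)) absolutely_integrable_on {a..b}" by (rule set_integrable_mult_right)
  then show "(\<lambda>s. - g (- s)) absolutely_integrable_on {a..b}" by simp
  have r: "integral {a..b} (\<lambda>s. - g (- s)) = - integral {-b..-a} g"
    using Henstock_Kurzweil_Integration.integral_reflect_real[of "-a" "-b" g] by simp
  have "-1 < -b" "-b \<le> -a" "-a < 1" using ab by auto
  note d = acd_diff_eq[OF f this]
  show "f (- b) - f (- a) = integral {a..b} (\<lambda>s. - g (- s))"
    unfolding r d[symmetric] by (rule minus_diff_eq[symmetric])
qed

lemma acd_zero_const:
  assumes "acd f g" "AE s in M1. g s = 0" "s \<in> {-1<..<1}"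
  shows "f s = f 0"
proof -
  have a: "acd f (\<lambda>s. 0)" by (rule acd_AE[OF assms(1,2)])
  show ?thesis
  proof (cases "0 \<le> s")
    case True
    then have "f s - f 0 = integral {0..s} (\<lambda>s. 0)" using assms(3) by (intro acd_diff_eq[OF a]) auto
    then show ?thesis unfolding integral_0 right_minus_eq .
  next
    case False
    then have "f 0 - f s = integral {s..0} (\<lambda>s. 0)" using assms(3) by (intro acd_diff_eq[OF a]) auto
    then show ?thesis unfolding integral_0 right_minus_eq by (rule sym)
  qed
qed

text \<open>Monotone convergence over growing symmetric intervals: bounds on compact subintervals
  that do not depend on r bound the global norm.\<close>

lemma L2_exhaust:
  assumes g: "continuous_on {-1<..<1} g"
    and b: "\<And>r. 0 < r \<Longrightarrow> r < 1 \<Longrightarrow> integral {-r..r} (\<lambda>s. (1 - s\<^sup>2) ^ Suc k * (cmod (g s))\<^sup>2) \<le> B"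
  shows "L2 (Suc k) g" "nsq (Suc k) g \<le> B"
proof -
  let ?G = "\<lambda>s. (1 - s\<^sup>2) ^ Suc k * (cmod (g s))\<^sup>2"
  define r where "r n = 1 - 1 / real (n + 2)" for n
  have r: "0 < r n" "r n < 1" "r n \<le> r (Suc n)" for n by (auto simp: r_def field_simps)
  define F where "F n s = (if s \<in> {-r n..r n} then ?G s else 0)" for n s
  have G0: "0 \<le> ?G s" if "s \<in> {-1..1}" for s using weight_nonneg[OF that] by simp
  have c: "continuous_on {-r n..r n} ?G" for n
    using r[of n] by (intro continuous_intros continuous_on_subset[OF g]) auto
  have Fh: "(F n has_integral integral {-r n..r n} ?G) {-1..1}" for n
  proof -
    have sub: "{-r n..r n} \<subseteq> {-1..1}" using r[of n] by auto
    have "(?G has_integral integral {-r n..r n} ?G) {-r n..r n}"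
      by (rule integrable_integral[OF integrable_continuous_real[OF c]])
    then show ?thesis unfolding F_def has_integral_restrict[OF sub] .
  qed
  then have Fi: "F n integrable_on {-1..1}" for n by (rule has_integral_integrable)
  have FI: "integral {-1..1} (F n) \<le> B" for n
    unfolding integral_unique[OF Fh] by (rule b[OF r(1,2)])
  have F0: "0 \<le> integral {-1..1} (F n)" for n
  proof (rule Henstock_Kurzweil_Integration.integral_nonneg[OF Fi])
    show "0 \<le> F n s" if "s \<in> {-1..1}" for s unfolding F_def using G0[OF that] by simp
  qed
  have lim: "(\<lambda>n. F n s) \<longlonglongrightarrow> ?G s" if s: "s \<in> {-1..1}" for s
  proof (cases "s \<in> {-1<..<1}")
    case True
    then have "1 - \<bar>s\<bar> > 0" by auto
    then obtain n0 where n0: "inverse (real (Suc n0)) < 1 - \<bar>s\<bar>" using reals_Archimedean by blast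
    have "F n s = ?G s" if n: "n \<ge> n0" for n
    proof -
      have "1 / real (n + 2) \<le> inverse (real (Suc n0))" using n by (simp add: field_simps)
      then have "\<bar>s\<bar> \<le> r n" using n0 by (simp add: r_def)
      then have "s \<in> {-r n..r n}" unfolding atLeastAtMost_iff by linarith
      then show ?thesis unfolding F_def by (rule if_P)
    qed
    then have "\<forall>\<^sub>F n in sequentially. F n s = ?G s" unfolding eventually_sequentially by blast
    then show ?thesis by (rule tendsto_eventually)
  next
    case False
    \<comment> \<open>The truncated functions vanish at the end points. The limit does so as well
      because the weight exponent is \<open>Suc k\<close>.\<close>
    then have "s = -1 \<or> s = 1" using s by auto
    then have z: "?G s = 0" by (elim disjE) simp_all
    have "F n s = 0" for n unfolding F_def z by (rule if_cancel)
    then show ?thesis unfolding z by simp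
  qed
  have mono: "F n s \<le> F (Suc n) s" if "s \<in> {-1..1}" for n s
  proof (cases "s \<in> {-r n..r n}")
    case True
    then have "s \<in> {-r (Suc n)..r (Suc n)}" using r(3)[of n] unfolding atLeastAtMost_iff by linarith
    then show ?thesis unfolding F_def using True by simp
  next
    case False
    then have "F n s = 0" unfolding F_def by (rule if_not_P)
    moreover have "0 \<le> F (Suc n) s" unfolding F_def using G0[OF that] by simp
    ultimately show ?thesis by simp
  qed
  have bd: "bounded (range (\<lambda>n. integral {-1..1} (F n)))"
    unfolding bounded_iff
  proof (intro exI[of _ B] ballI)
    fix x assume "x \<in> range (\<lambda>n. integral {-1..1} (F n))"
    then obtain n where x: "x = integral {-1..1} (F n)" by blast
    show "norm x \<le> B" unfolding x using F0[of n] FI[of n] by simp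
  qed
  have mc: "?G integrable_on {-1..1} \<and> (\<lambda>n. integral {-1..1} (F n)) \<longlonglongrightarrow> integral {-1..1} ?G"
    by (rule monotone_convergence_increasing[OF Fi mono lim bd])
  then have "?G absolutely_integrable_on {-1..1}"
    using G0 by (intro nonnegative_absolutely_integrable_1) blast+
  then have i: "integrable M1 ?G" by (rule absolutely_integrable_imp_integrable) auto
  then show "L2 (Suc k) g" using measurable_M1_cont[OF g] by (simp add: L2_def)
  have "nsq (Suc k) g = integral {-1..1} ?G" unfolding nsq_def by (rule lebesgue_integral_eq_integral[OF i]) auto
  also have "\<dots> \<le> B" using mc FI by (intro LIMSEQ_le_const2[of "\<lambda>n. integral {-1..1} (F n)"]) blast+
  finally show "nsq (Suc k) g \<le> B" .
qed

text \<open>Hardy's inequality, from the derivative of \<open>s (1 - s\<^sup>2)\<^sup>2 |g|\<^sup>2\<close>.\<close>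

lemma Hardy:
  assumes a: "acd g g'" and g: "L2 2 g" and g': "L2 3 g'"
  shows "L2 1 g" "nsq 1 g \<le> 2 * (nsq 2 g + nsq 3 g')"
proof -
  have c: "continuous_on {-1<..<1} g" by (rule acd_continuous_on[OF a])
  define B where "B = 2 * (nsq 2 g + nsq 3 g')"
  have b: "integral {-r..r} (\<lambda>s. (1 - s\<^sup>2) ^ Suc 0 * (cmod (g s))\<^sup>2) \<le> B" if r: "0 < r" "r < 1" for r
  proof -
    let ?S = "{-r..r}"
    have sub: "?S \<subseteq> {-1..1}" using r by auto
    define P where "P s = s * (1 - s\<^sup>2)\<^sup>2" for s :: real
    define P' where "P' s = (1 - s\<^sup>2)\<^sup>2 - 4 * s\<^sup>2 * (1 - s\<^sup>2)" for s :: real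
    have dP: "(P has_real_derivative P' s) (at s)" for s
      unfolding P_def P'_def by (auto intro!: derivative_eq_intros simp: power2_eq_square algebra_simps)
    have aP: "acd (\<lambda>s. complex_of_real (P s)) (\<lambda>s. complex_of_real (P' s))"
    proof (rule acd_C1)
      show "((\<lambda>s. complex_of_real (P s)) has_vector_derivative complex_of_real (P' s)) (at s)" for s
        using dP by (intro has_vector_derivative_of_real) (simp add: has_real_derivative_iff_has_vector_derivative)
      show "continuous_on {-1<..<1} (\<lambda>s. complex_of_real (P' s))" unfolding P'_def by (intro continuous_intros)
    qed
    define u where "u s = complex_of_real (P' s) * (g s * cnj (g s)) + complex_of_real (P s) * (g' s * cnj (g s) + g s * cnj (g' s))" for s
    have au: "acd (\<lambda>s. complex_of_real (P s) * (g s * cnj (g s))) u"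
      unfolding u_def by (rule acd_mult[OF aP acd_mult[OF a acd_cnj[OF a]]])
    have ab: "-1 < -r" "-r \<le> r" "r < 1" using r by auto
    have ui: "u absolutely_integrable_on ?S" by (rule acd_integrable[OF au ab(1,3)])
    have "integral ?S (\<lambda>s. Re (u s)) = Re (integral ?S u)"
      using integral_linear[OF absint_imp_int[OF ui] bounded_linear_Re] by (simp add: o_def)
    also have "integral ?S u = complex_of_real (P r) * (g r * cnj (g r)) - complex_of_real (P (-r)) * (g (-r) * cnj (g (-r)))"
      by (rule acd_diff_eq[OF au ab, symmetric])
    also have "Re \<dots> = P r * ((cmod (g r))\<^sup>2 + (cmod (g (-r)))\<^sup>2)"
      unfolding cmod_power2 by (simp add: P_def power2_eq_square[of "Re _"] power2_eq_square[of "Im _"] algebra_simps)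
    finally have pos: "0 \<le> integral ?S (\<lambda>s. Re (u s))" using r by (simp add: P_def)
    have ru: "(\<lambda>s. Re (u s)) integrable_on ?S"
      using integrable_linear[OF absint_imp_int[OF ui] bounded_linear_Re] by (simp add: o_def)
    let ?A = "\<lambda>s. (1 - s\<^sup>2) ^ Suc 0 * (cmod (g s))\<^sup>2"
    have Ai: "?A integrable_on ?S"
      using r by (intro integrable_continuous_real continuous_intros continuous_on_subset[OF c]) auto
    note G = L2_HK[OF g sub] and G' = L2_HK[OF g' sub]
    \<comment> \<open>With w = 1 - s^2, P' = 5 w^2 - 4 w supplies -4 w |g|^2. AM-GM splits the mixed
      term 2 P Re (g' cnj g) into w |g|^2 + w^3 |g'|^2, and 3 w |g|^2 remains.\<close>
    have pt: "3 * ?A s \<le> (5 * ((1 - s\<^sup>2) ^ 2 * (cmod (g s))\<^sup>2) + (1 - s\<^sup>2) ^ 3 * (cmod (g' s))\<^sup>2) - Re (u s)"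
      if s: "s \<in> ?S" for s
    proof -
      define w x y where "w = 1 - s\<^sup>2" and "x = cmod (g s)" and "y = cmod (g' s)"
      have w: "w > 0" using weight_pos[of s] s r by (auto simp: w_def)
      have xy: "x \<ge> 0" "y \<ge> 0" by (auto simp: x_def y_def)
      have s1: "\<bar>s\<bar> \<le> 1" using s r by auto
      have p': "P' s = 5 * w\<^sup>2 - 4 * w" by (simp add: P'_def w_def power2_eq_square algebra_simps)
      have "Re (u s) = P' s * x\<^sup>2 + 2 * (P s * Re (g' s * cnj (g s)))"
        unfolding u_def x_def cmod_power2 by (simp add: power2_eq_square[of "Re _"] power2_eq_square[of "Im _"] algebra_simps)
      also have "2 * (P s * Re (g' s * cnj (g s))) \<le> w * x\<^sup>2 + w ^ 3 * y\<^sup>2"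
      proof -
        have "P s * Re (g' s * cnj (g s)) \<le> \<bar>P s\<bar> * \<bar>Re (g' s * cnj (g s))\<bar>"
          by (metis abs_ge_self abs_mult)
        also have "\<dots> \<le> w\<^sup>2 * (y * x)"
        proof (rule mult_mono)
          have "\<bar>P s\<bar> = \<bar>s\<bar> * w\<^sup>2" by (simp add: P_def w_def abs_mult)
          also have "\<dots> \<le> 1 * w\<^sup>2" using s1 by (intro mult_right_mono) auto
          finally show "\<bar>P s\<bar> \<le> w\<^sup>2" by simp
          show "\<bar>Re (g' s * cnj (g s))\<bar> \<le> y * x"
            using abs_Re_le_cmod[of "g' s * cnj (g s)"] by (simp add: norm_mult x_def y_def)
        qed auto
        finally have 1: "P s * Re (g' s * cnj (g s)) \<le> w\<^sup>2 * (y * x)" .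
        have "0 \<le> w * (x - w * y)\<^sup>2" using w by simp
        then have "2 * (w\<^sup>2 * (y * x)) \<le> w * x\<^sup>2 + w ^ 3 * y\<^sup>2"
          by (simp add: power2_eq_square power3_eq_cube algebra_simps)
        with 1 show ?thesis by linarith
      qed
      finally have "Re (u s) \<le> (5 * w\<^sup>2 - 4 * w) * x\<^sup>2 + (w * x\<^sup>2 + w ^ 3 * y\<^sup>2)" unfolding p' by simp
      then show ?thesis unfolding w_def[symmetric] x_def[symmetric] y_def[symmetric] by (simp add: algebra_simps)
    qed
    have "3 * integral ?S ?A = integral ?S (\<lambda>s. 3 * ?A s)" by simp
    also have "\<dots> \<le> integral ?S (\<lambda>s. (5 * ((1 - s\<^sup>2) ^ 2 * (cmod (g s))\<^sup>2) + (1 - s\<^sup>2) ^ 3 * (cmod (g' s))\<^sup>2) - Re (u s))"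
      using Ai G(1) G'(1) ru
      by (intro integral_le pt integrable_diff integrable_add integrable_on_mult_right) auto
    also have "\<dots> = (5 * integral ?S (\<lambda>s. (1 - s\<^sup>2) ^ 2 * (cmod (g s))\<^sup>2) + integral ?S (\<lambda>s. (1 - s\<^sup>2) ^ 3 * (cmod (g' s))\<^sup>2))
        - integral ?S (\<lambda>s. Re (u s))"
    proof -
      have i5: "(\<lambda>s. 5 * ((1 - s\<^sup>2) ^ 2 * (cmod (g s))\<^sup>2)) integrable_on ?S" by (rule integrable_on_mult_right[OF G(1)])
      show ?thesis
        unfolding Henstock_Kurzweil_Integration.integral_diff[OF integrable_add[OF i5 G'(1)] ru]
          Henstock_Kurzweil_Integration.integral_add[OF i5 G'(1)] by simp
    qed
    also have "\<dots> \<le> 5 * nsq 2 g + nsq 3 g'" using pos G(2) G'(2) by linarith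
    finally have 3: "3 * integral ?S ?A \<le> 5 * nsq 2 g + nsq 3 g'" .
    \<comment> \<open>The constants 5/3 and 1/3 are rounded up to a common 2.\<close>
    have ar: "x \<le> 2 * (p + q)" if "3 * x \<le> 5 * p + q" "0 \<le> p" "0 \<le> q" for x p q :: real
    proof -
      have "x \<le> (5 * p + q) / 3" using that(1) by simp
      also have "\<dots> \<le> 2 * (p + q)" using that(2,3) by (simp add: field_simps)
      finally show ?thesis .
    qed
    show "integral ?S ?A \<le> B" unfolding B_def by (rule ar[OF 3 nsq_nonneg nsq_nonneg])
  qed
  from L2_exhaust[OF c b] show "L2 1 g" "nsq 1 g \<le> 2 * (nsq 2 g + nsq 3 g')" by (simp_all add: B_def)
qed

lemma one_minus_sq_le: "s \<in> {-1<..<1} \<Longrightarrow> 1 - s\<^sup>2 \<le> 2 * (1 - \<bar>s\<bar>)" for s :: real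
proof -
  assume s: "s \<in> {-1<..<1}"
  have "1 - s\<^sup>2 = (1 - \<bar>s\<bar>) * (1 + \<bar>s\<bar>)" by (simp add: algebra_simps power2_eq_square abs_mult_self_eq)
  also have "\<dots> \<le> (1 - \<bar>s\<bar>) * 2" using s by (intro mult_left_mono) auto
  finally show ?thesis by simp
qed

text \<open>\<open>acd_growth\<close> at p = k + 1, where the growth of f is exactly compensated by
  the k-th power of the weight.\<close>

lemma acd_sup_weight:
  assumes a: "acd f g" and g: "L2 (k + 1) g" and k: "1 \<le> k" and s: "s \<in> {-1<..<1}"
  shows "(1 - s\<^sup>2) ^ k * (cmod (f s - f 0))\<^sup>2 \<le> 2 ^ k * nsq (k + 1) g"
proof -
  define x where "x = 1 - \<bar>s\<bar>"
  have x: "x > 0" using s by (auto simp: x_def)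
  have "(cmod (f s - f 0))\<^sup>2 \<le> nsq (k + 1) g * ((1 - \<bar>s\<bar>) powr (1 - (real k + 1)) / ((real k + 1) - 1))"
    by (rule acd_growth[OF a g _ _ s]) (use k in auto)
  also have "\<dots> \<le> nsq (k + 1) g * (x powr (- real k) / 1)"
    unfolding x_def using k by (intro mult_left_mono frac_le) auto
  also have "x powr (- real k) / 1 = inverse (x ^ k)" using x by (simp add: powr_minus powr_realpow)
  finally have 1: "(cmod (f s - f 0))\<^sup>2 \<le> nsq (k + 1) g * inverse (x ^ k)" .
  have "(1 - s\<^sup>2) ^ k \<le> (2 * x) ^ k"
    using one_minus_sq_le[OF s] weight_pos[OF s] by (intro power_mono) (auto simp: x_def)
  then have "(1 - s\<^sup>2) ^ k * (cmod (f s - f 0))\<^sup>2 \<le> (2 * x) ^ k * (nsq (k + 1) g * inverse (x ^ k))"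
    using 1 x by (intro mult_mono) auto
  also have "\<dots> = 2 ^ k * nsq (k + 1) g" using x by (simp add: power_mult_distrib)
  finally show ?thesis .
qed

lemma integral_M1_const: "(LINT s|M1. c :: real) = 2 * c" "integrable M1 (\<lambda>s. c :: real)"
proof -
  show i: "integrable M1 (\<lambda>s. c :: real)" using finite_measure.integrable_const[OF finite_measure_M1] .
  show "(LINT s|M1. c :: real) = 2 * c" using lebesgue_integral_eq_integral[OF i] by simp
qed

text \<open>For angle functions: the norm of the angle is controlled by its derivative together with
  its value at 0.\<close>

lemma acd_L2_1:
  assumes a: "acd u v" and v: "L2 2 v"
  shows "L2 1 u" "nsq 1 u \<le> 8 * (nsq 2 v + (cmod (u 0))\<^sup>2)"
proof -
  have v': "L2 (1 + 1) v" using v by (simp add: numeral_2_eq_2)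
  have m: "(\<lambda>s. u s - u 0) \<in> borel_measurable M1" using acd_measurable[OF a] by measurable
  have le: "(1 - s\<^sup>2) ^ 1 * (cmod (u s - u 0))\<^sup>2 \<le> 2 * nsq 2 v" if "s \<in> {-1<..<1}" for s
    using acd_sup_weight[OF a v' _ that] by (simp add: numeral_2_eq_2)
  note L = L2_dominated[OF m integral_M1_const(2) le]
  have c: "L2 1 (\<lambda>s. u 0)" by (rule L2_const_int)
  have "nsq 1 (\<lambda>s. u 0) \<le> (LINT s|M1. (cmod (u 0))\<^sup>2)"
  proof (rule L2_dominated(2)[OF _ integral_M1_const(2)])
    show "(1 - s\<^sup>2) ^ 1 * (cmod (u 0))\<^sup>2 \<le> (cmod (u 0))\<^sup>2" if "s \<in> {-1<..<1}" for s
      using weight_pos[OF that] by (intro mult_left_le_one_le) auto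
  qed simp
  then have cn: "nsq 1 (\<lambda>s. u 0) \<le> 2 * (cmod (u 0))\<^sup>2" unfolding integral_M1_const(1) .
  have arith: "x \<le> 8 * (p + q)" if "x \<le> 2 * y + 2 * z" "y \<le> 2 * (2 * p)" "z \<le> 2 * q" "0 \<le> p" "0 \<le> q" for x y z p q :: real
  proof -
    have "2 * y \<le> 8 * p" "2 * z \<le> 4 * q" using that by auto
    then have "x \<le> 8 * p + 4 * q" using that(1) by linarith
    then show ?thesis using that(5) by (simp add: algebra_simps)
  qed
  from L2_add[OF L(1) c] have "L2 1 (\<lambda>s. (u s - u 0) + u 0)"
    "nsq 1 (\<lambda>s. (u s - u 0) + u 0) \<le> 2 * nsq 1 (\<lambda>s. u s - u 0) + 2 * nsq 1 (\<lambda>s. u 0)" by auto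
  then have u: "L2 1 u" "nsq 1 u \<le> 2 * nsq 1 (\<lambda>s. u s - u 0) + 2 * nsq 1 (\<lambda>s. u 0)" unfolding diff_add_cancel by auto
  show "L2 1 u" by (rule u(1))
  show "nsq 1 u \<le> 8 * (nsq 2 v + (cmod (u 0))\<^sup>2)"
    by (rule arith[OF u(2) L(2)[unfolded integral_M1_const(1)] cn nsq_nonneg zero_le_power2])
qed

text \<open>The weight exponent 3 is split as 2 + 1: the square of a times the second power of the
  weight is bounded pointwise, and b is integrable with exponent 1 by Hardy's inequality.\<close>

lemma quadratic_bound:
  obtains C where "C \<ge> 0" "\<And>a a' b b'. acd a a' \<Longrightarrow> L2 2 a \<Longrightarrow> L2 3 a' \<Longrightarrow> acd b b' \<Longrightarrow> L2 2 b \<Longrightarrow> L2 3 b' \<Longrightarrow>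
    L2 3 (\<lambda>s. a s * b s) \<and> nsq 3 (\<lambda>s. a s * b s) \<le> C * (nsq 2 a + nsq 3 a') * (nsq 2 b + nsq 3 b')"
proof -
  have z: "(0::real) \<in> {-1<..<1}" by simp
  obtain D where D: "D \<ge> 0" "\<And>f g. acd f g \<Longrightarrow> L2 2 f \<Longrightarrow> L2 3 g \<Longrightarrow> (cmod (f 0))\<^sup>2 \<le> D * (nsq 2 f + nsq 3 g)"
    by (rule acd_point_bound[OF z, of 2 3], rule that)
  define E where "E = 8 + 2 * D"
  have sup: "(1 - s\<^sup>2)\<^sup>2 * (cmod (a s))\<^sup>2 \<le> E * (nsq 2 a + nsq 3 a')"
    if a: "acd a a'" "L2 2 a" "L2 3 a'" and s: "s \<in> {-1<..<1}" for a a' s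
  proof -
    have a': "L2 (2 + 1) a'" using a(3) by simp
    have 1: "(1 - s\<^sup>2)\<^sup>2 * (cmod (a s - a 0))\<^sup>2 \<le> 4 * nsq 3 a'" using acd_sup_weight[OF a(1) a' _ s] by simp
    have w: "0 \<le> (1 - s\<^sup>2)\<^sup>2" "(1 - s\<^sup>2)\<^sup>2 \<le> 1" using weight_pos[OF s] by (auto intro: power_le_one)
    have "(1 - s\<^sup>2)\<^sup>2 * (cmod (a s))\<^sup>2 \<le> (1 - s\<^sup>2)\<^sup>2 * (2 * (cmod (a s - a 0))\<^sup>2 + 2 * (cmod (a 0))\<^sup>2)"
      using norm_add_sq[of "a s - a 0" "a 0"] by (intro mult_left_mono) auto
    also have "\<dots> \<le> 2 * (4 * nsq 3 a') + 2 * (cmod (a 0))\<^sup>2"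
      using 1 mult_right_mono[OF w(2), of "(cmod (a 0))\<^sup>2"] by (simp add: algebra_simps)
    also have "\<dots> \<le> 2 * (4 * nsq 3 a') + 2 * (D * (nsq 2 a + nsq 3 a'))" using D(2)[OF a] by simp
    also have "\<dots> \<le> E * (nsq 2 a + nsq 3 a')" by (simp add: E_def algebra_simps)
    finally show ?thesis .
  qed
  show ?thesis
  proof (rule that[of "2 * E"])
    show "2 * E \<ge> 0" using D(1) by (simp add: E_def)
    fix a a' b b' assume a: "acd a a'" "L2 2 a" "L2 3 a'" and b: "acd b b'" "L2 2 b" "L2 3 b'"
    note H = Hardy[OF b]
    have m: "(\<lambda>s. a s * b s) \<in> borel_measurable M1" using a(2) b(2) by measurable
    have le: "(1 - s\<^sup>2) ^ 3 * (cmod (a s * b s))\<^sup>2 \<le> (E * (nsq 2 a + nsq 3 a')) * ((1 - s\<^sup>2) ^ 1 * (cmod (b s))\<^sup>2)"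
      if s: "s \<in> {-1<..<1}" for s
    proof -
      have "(1 - s\<^sup>2) ^ 3 * (cmod (a s * b s))\<^sup>2 = ((1 - s\<^sup>2)\<^sup>2 * (cmod (a s))\<^sup>2) * ((1 - s\<^sup>2) ^ 1 * (cmod (b s))\<^sup>2)"
        by (simp add: norm_mult power_mult_distrib power2_eq_square power3_eq_cube mult_ac)
      also have "\<dots> \<le> (E * (nsq 2 a + nsq 3 a')) * ((1 - s\<^sup>2) ^ 1 * (cmod (b s))\<^sup>2)"
        using sup[OF a s] weight_pos[OF s] by (intro mult_right_mono) auto
      finally show ?thesis .
    qed
    note L = L2_bound[OF m H(1) le]
    have "(E * (nsq 2 a + nsq 3 a')) * nsq 1 b \<le> (E * (nsq 2 a + nsq 3 a')) * (2 * (nsq 2 b + nsq 3 b'))"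
      using H(2) D(1) by (intro mult_left_mono mult_nonneg_nonneg add_nonneg_nonneg nsq_nonneg) (auto simp: E_def)
    then have "nsq 3 (\<lambda>s. a s * b s) \<le> (E * (nsq 2 a + nsq 3 a')) * (2 * (nsq 2 b + nsq 3 b'))"
      using L(2) by (rule order_trans[rotated])
    also have "\<dots> = 2 * E * (nsq 2 a + nsq 3 a') * (nsq 2 b + nsq 3 b')" by (simp only: mult_ac)
    finally show "L2 3 (\<lambda>s. a s * b s) \<and> nsq 3 (\<lambda>s. a s * b s) \<le> 2 * E * (nsq 2 a + nsq 3 a') * (nsq 2 b + nsq 3 b')"
      using L(1) by blast
  qed
qed

text \<open>Since t^2 - u^2 = (t - u) ((t - u) + 2 u), the bilinear bound gives convergence of the
  squares.\<close>

lemma quadratic_tendsto: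
  assumes t: "\<And>n. acd (t n) (t' n)" "\<And>n. L2 2 (t n)" "\<And>n. L2 3 (t' n)" and u: "acd u u'" "L2 2 u" "L2 3 u'"
    and l: "(\<lambda>n. nsq 2 (\<lambda>s. t n s - u s)) \<longlonglongrightarrow> 0" "(\<lambda>n. nsq 3 (\<lambda>s. t' n s - u' s)) \<longlonglongrightarrow> 0"
  shows "(\<lambda>n. nsq 3 (\<lambda>s. t n s * t n s - u s * u s)) \<longlonglongrightarrow> 0"
proof -
  obtain C where C: "C \<ge> 0" "\<And>a a' b b'. acd a a' \<Longrightarrow> L2 2 a \<Longrightarrow> L2 3 a' \<Longrightarrow> acd b b' \<Longrightarrow> L2 2 b \<Longrightarrow> L2 3 b' \<Longrightarrow>
    L2 3 (\<lambda>s. a s * b s) \<and> nsq 3 (\<lambda>s. a s * b s) \<le> C * (nsq 2 a + nsq 3 a') * (nsq 2 b + nsq 3 b')"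
    by (rule quadratic_bound, rule that)
  define x where "x n = nsq 2 (\<lambda>s. t n s - u s) + nsq 3 (\<lambda>s. t' n s - u' s)" for n
  define y where "y = 8 * (nsq 2 u + nsq 3 u')"
  have x0: "x n \<ge> 0" for n by (simp add: x_def)
  have xl: "x \<longlonglongrightarrow> 0" unfolding x_def using tendsto_add[OF l] by simp
  have b: "nsq 3 (\<lambda>s. t n s * t n s - u s * u s) \<le> C * x n * (2 * x n + y)" for n
  proof -
    note d = acd_diff[OF t(1)[of n] u(1)] L2_diff(1)[OF t(2)[of n] u(2)] L2_diff(1)[OF t(3)[of n] u(3)]
    note u2 = acd_cmult[OF u(1), of 2] L2_cmult(1)[OF u(2), of 2] L2_cmult(1)[OF u(3), of 2]
    note p = acd_add[OF d(1) u2(1)] L2_add[OF d(2) u2(2)] L2_add[OF d(3) u2(3)]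
    have "nsq 3 (\<lambda>s. (t n s - u s) * ((t n s - u s) + 2 * u s))
        \<le> C * x n * (nsq 2 (\<lambda>s. (t n s - u s) + 2 * u s) + nsq 3 (\<lambda>s. (t' n s - u' s) + 2 * u' s))"
      using C(2)[OF d p(1,2,4)] unfolding x_def by blast
    also have "\<dots> \<le> C * x n * (2 * x n + y)"
      using p(3,5) C(1) x0 by (intro mult_left_mono) (auto simp: L2_cmult(2) x_def y_def)
    finally show ?thesis by (simp add: algebra_simps)
  qed
  have "(\<lambda>n. C * x n * (2 * x n + y)) \<longlonglongrightarrow> C * 0 * (2 * 0 + y)" by (intro tendsto_intros xl)
  then have lb: "(\<lambda>n. C * x n * (2 * x n + y)) \<longlonglongrightarrow> 0" by simp
  show ?thesis
  proof (rule tendsto_sandwich[OF _ _ tendsto_const lb])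
    show "\<forall>\<^sub>F n in sequentially. 0 \<le> nsq 3 (\<lambda>s. t n s * t n s - u s * u s)" by simp
    show "\<forall>\<^sub>F n in sequentially. nsq 3 (\<lambda>s. t n s * t n s - u s * u s) \<le> C * x n * (2 * x n + y)" using b by simp
  qed
qed

section \<open>Point values and convergence of chains\<close>

lemma Bchain_points:
  assumes m: "1 \<le> m" and s: "s \<in> {-1<..<1}"
  obtains C where "C \<ge> 0" "\<And>h. Bchain m h \<Longrightarrow> (cmod (h 0 s))\<^sup>2 \<le> C * Nsum m h"
proof -
  obtain C where C: "C \<ge> 0" "\<And>f g. acd f g \<Longrightarrow> L2 1 f \<Longrightarrow> L2 2 g \<Longrightarrow> (cmod (f s))\<^sup>2 \<le> C * (nsq 1 f + nsq 2 g)"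
    by (rule acd_point_bound[OF s, of 1 2], rule that)
  show ?thesis
  proof (rule that[of "C * 2"])
    show "0 \<le> C * 2" using C(1) by simp
    fix h assume h: "Bchain m h"
    have a: "acd (h 0) (h (Suc 0))" using BchainD(1)[OF h, of 0] m by simp
    have l: "L2 1 (h 0)" "L2 2 (h (Suc 0))" using BchainD(2)[OF h, of 0] BchainD(2)[OF h, of 1] m by (simp_all add: numeral_2_eq_2)
    have "(cmod (h 0 s))\<^sup>2 \<le> C * (nsq 1 (h 0) + nsq 2 (h (Suc 0)))" by (rule C(2)[OF a l])
    also have "\<dots> \<le> C * (Nsum m h + Nsum m h)"
      using nsq_le_Nsum[of 0 m h] nsq_le_Nsum[of 1 m h] m by (intro mult_left_mono[OF _ C(1)] add_mono) (simp_all add: numeral_2_eq_2)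
    finally show "(cmod (h 0 s))\<^sup>2 \<le> C * 2 * Nsum m h" by (simp add: mult.assoc mult.left_commute)
  qed
qed

lemma Bchain_diff:
  assumes "Bchain m f" "Bchain m g"
  shows "Bchain m (\<lambda>j s. f j s - g j s)"
  unfolding Bchain_def
proof (intro conjI allI impI ballI)
  show "acd (\<lambda>s. f j s - g j s) (\<lambda>s. f (Suc j) s - g (Suc j) s)" if "j < m" for j
    by (intro acd_diff BchainD(1)[OF assms(1)] BchainD(1)[OF assms(2)] that)
  show "L2 (Suc j) (\<lambda>s. f j s - g j s)" if "j \<le> m" for j
    by (intro L2_diff(1) BchainD(2)[OF assms(1)] BchainD(2)[OF assms(2)] that)
  show "f 0 (- s) - g 0 (- s) = f 0 s - g 0 s" if "s \<in> {-1<..<1}" for s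
    using BchainD(3)[OF assms(1) that] BchainD(3)[OF assms(2) that] by simp
qed

text \<open>Continuity in the low cases is handled by sequences, because dominated convergence
  yields limits and no estimates.\<close>

definition Btendsto :: "nat \<Rightarrow> (nat \<Rightarrow> nat \<Rightarrow> real \<Rightarrow> complex) \<Rightarrow> (nat \<Rightarrow> real \<Rightarrow> complex) \<Rightarrow> bool" where
  "Btendsto m F f \<longleftrightarrow> (\<forall>n. Bchain m (F n)) \<and> Bchain m f \<and> (\<lambda>n. Nsum m (\<lambda>j s. F n j s - f j s)) \<longlonglongrightarrow> 0"

lemma BtendstoD:
  assumes "Btendsto m F f"
  shows "Bchain m (F n)" "Bchain m f" "(\<lambda>n. Nsum m (\<lambda>j s. F n j s - f j s)) \<longlonglongrightarrow> 0"
    "j \<le> m \<Longrightarrow> (\<lambda>n. nsq (Suc j) (\<lambda>s. F n j s - f j s)) \<longlonglongrightarrow> 0"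
proof -
  show 1: "Bchain m (F n)" "Bchain m f" "(\<lambda>n. Nsum m (\<lambda>j s. F n j s - f j s)) \<longlonglongrightarrow> 0" for n
    using assms by (auto simp: Btendsto_def)
  assume j: "j \<le> m"
  show "(\<lambda>n. nsq (Suc j) (\<lambda>s. F n j s - f j s)) \<longlonglongrightarrow> 0"
  proof (rule tendsto_sandwich[OF _ _ tendsto_const 1(3)])
    show "\<forall>\<^sub>F n in sequentially. nsq (Suc j) (\<lambda>s. F n j s - f j s) \<le> Nsum m (\<lambda>j s. F n j s - f j s)"
      using nsq_le_Nsum[OF j, of "\<lambda>j s. F _ j s - f j s"] by simp
  qed simp
qed

lemma BtendstoI:
  assumes "\<And>n. Bchain m (F n)" "Bchain m f" "\<And>j. j \<le> m \<Longrightarrow> (\<lambda>n. nsq (Suc j) (\<lambda>s. F n j s - f j s)) \<longlonglongrightarrow> 0"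
  shows "Btendsto m F f"
  unfolding Btendsto_def Nsum_def
  using assms(1,2) tendsto_sum[of "{..m}" "\<lambda>j n. nsq (Suc j) (\<lambda>s. F n j s - f j s)" "\<lambda>_. 0" sequentially] assms(3) by simp

lemma Btendsto_point:
  assumes F: "Btendsto m F f" and m: "1 \<le> m" and s: "s \<in> {-1<..<1}"
  shows "(\<lambda>n. F n 0 s) \<longlonglongrightarrow> f 0 s"
proof -
  obtain C where C: "C \<ge> 0" "\<And>h. Bchain m h \<Longrightarrow> (cmod (h 0 s))\<^sup>2 \<le> C * Nsum m h"
    by (rule Bchain_points[OF m s], rule that)
  have l: "(\<lambda>n. C * Nsum m (\<lambda>j s. F n j s - f j s)) \<longlonglongrightarrow> 0"
    using tendsto_mult_right_zero[OF BtendstoD(3)[OF F]] .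
  have "(\<lambda>n. (cmod (F n 0 s - f 0 s))\<^sup>2) \<longlonglongrightarrow> 0"
  proof (rule tendsto_sandwich[OF _ _ tendsto_const l])
    show "\<forall>\<^sub>F n in sequentially. (cmod (F n 0 s - f 0 s))\<^sup>2 \<le> C * Nsum m (\<lambda>j s. F n j s - f j s)"
      using C(2)[OF Bchain_diff[OF BtendstoD(1)[OF F] BtendstoD(2)[OF F]]] by simp
  qed simp
  then have "(\<lambda>n. sqrt ((cmod (F n 0 s - f 0 s))\<^sup>2)) \<longlonglongrightarrow> sqrt 0" by (rule tendsto_real_sqrt)
  then have "(\<lambda>n. cmod (F n 0 s - f 0 s)) \<longlonglongrightarrow> 0" by simp
  then show ?thesis by (simp add: tendsto_norm_zero_iff LIM_zero_iff)
qed

lemma acd_eqI: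
  assumes "acd f h" "acd g h" "f 0 = g 0" "s \<in> {-1<..<1}"
  shows "f s = g s"
proof -
  have "acd (\<lambda>s. f s - g s) (\<lambda>s. h s - h s)" by (rule acd_diff[OF assms(1,2)])
  from acd_zero_const[OF this _ assms(4)] have "f s - g s = f 0 - g 0" by simp
  then show ?thesis using assms(3) by simp
qed

lemma nsq_Im:
  assumes "L2 k f"
  shows "L2 k (\<lambda>s. complex_of_real (Im (f s)))" "nsq k (\<lambda>s. complex_of_real (Im (f s))) \<le> nsq k f"
proof -
  have m: "(\<lambda>s. complex_of_real (Im (f s))) \<in> borel_measurable M1" using assms by measurable
  have le: "(1 - s\<^sup>2) ^ k * (cmod (complex_of_real (Im (f s))))\<^sup>2 \<le> 1 * ((1 - s\<^sup>2) ^ k * (cmod (f s))\<^sup>2)"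
    if s: "s \<in> {-1<..<1}" for s
    using weight_pos[OF s] abs_Im_le_cmod[of "f s"]
    by (simp only: mult_1 norm_of_real) (intro mult_left_mono power_mono; simp)
  show "L2 k (\<lambda>s. complex_of_real (Im (f s)))" "nsq k (\<lambda>s. complex_of_real (Im (f s))) \<le> nsq k f"
    using L2_bound[OF m assms le] by simp_all
qed

lemma nsq_Im_tendsto:
  assumes F: "\<And>n. L2 k (F n)" and f: "L2 k f" and l: "(\<lambda>n. nsq k (\<lambda>s. F n s - f s)) \<longlonglongrightarrow> 0"
  shows "(\<lambda>n. nsq k (\<lambda>s. complex_of_real (Im (F n s)) - complex_of_real (Im (f s)))) \<longlonglongrightarrow> 0"
proof (rule tendsto_sandwich[OF _ _ tendsto_const l])
  show "\<forall>\<^sub>F n in sequentially. nsq k (\<lambda>s. complex_of_real (Im (F n s)) - complex_of_real (Im (f s))) \<le> nsq k (\<lambda>s. F n s - f s)"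
    using nsq_Im(2)[OF L2_diff(1)[OF F f]] by simp
qed simp

section \<open>From the angle to the unimodular function\<close>

text \<open>The derivatives of exp (\<i> t) up to order 2, enough for m \<le> 2; the value 0 at
  higher orders is a default.\<close>

definition cexp :: "(nat \<Rightarrow> real \<Rightarrow> complex) \<Rightarrow> nat \<Rightarrow> real \<Rightarrow> complex" where
  "cexp t j s = exp (\<i> * t 0 s) *
     (if j = 0 then 1 else if j = 1 then \<i> * t 1 s else if j = 2 then \<i> * t 2 s - t 1 s * t 1 s else 0)"

lemma cexp_unimodular: "Im (t 0 s) = 0 \<Longrightarrow> cmod (cexp t 0 s) = 1"
  by (simp add: cexp_def norm_exp_eq_Re)

text \<open>The exponential has modulus 1 for real angles, so only the factor behind it has to be
  estimated. Its nonlinear part, the square of \<open>t 1\<close>, occurs at order 2 and is covered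
  by \<open>quadratic_bound\<close>.\<close>

lemma cexp_Bchain:
  assumes t: "Bchain m t" "\<And>s. s \<in> {-1<..<1} \<Longrightarrow> Im (t 0 s) = 0" and m: "m = 1 \<or> m = 2"
  shows "Bchain m (cexp t)"
proof -
  have a0: "acd (t 0) (t 1)" using BchainD(1)[OF t(1), of 0] m by auto
  have ae: "acd (\<lambda>s. exp (\<i> * t 0 s)) (\<lambda>s. (\<i> * t 1 s) * exp (\<i> * t 0 s))" by (rule acd_exp[OF acd_cmult[OF a0]])
  have em: "(\<lambda>s. exp (\<i> * t 0 s)) \<in> borel_measurable M1" by (rule acd_measurable[OF ae])
  have eb: "cmod (exp (\<i> * t 0 s)) \<le> 1" if "s \<in> {-1<..<1}" for s using t(2)[OF that] by (simp add: norm_exp_eq_Re)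
  have L: "L2 2 (t 1)" using BchainD(2)[OF t(1), of 1] m by (auto simp: numeral_2_eq_2)
  have c: "cexp t 0 = (\<lambda>s. exp (\<i> * t 0 s) * 1)" "cexp t 1 = (\<lambda>s. exp (\<i> * t 0 s) * (\<i> * t 1 s))"
    "cexp t 2 = (\<lambda>s. exp (\<i> * t 0 s) * (\<i> * t 2 s - t 1 s * t 1 s))" by (auto simp: cexp_def)
  have l0: "L2 1 (cexp t 0)" unfolding c(1) by (rule L2_bounded_mult(1)[OF em L2_const_int eb])
  have l1: "L2 2 (cexp t 1)" unfolding c(2) by (rule L2_bounded_mult(1)[OF em L2_cmult(1)[OF L] eb])
  have d0: "acd (cexp t 0) (cexp t 1)" unfolding c by (rule acd_cong[OF ae]) (auto simp: mult_ac)
  have ev: "cexp t 0 (- s) = cexp t 0 s" if "s \<in> {-1<..<1}" for s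
    using BchainD(3)[OF t(1) that] by (simp add: cexp_def)
  show ?thesis
  proof (cases "m = 1")
    case True
    have "acd (cexp t j) (cexp t (Suc j))" if "j < m" for j using that d0 True by simp
    moreover have "L2 (Suc j) (cexp t j)" if "j \<le> m" for j
    proof -
      have "j = 0 \<or> j = 1" using that True by auto
      then show ?thesis using l0 l1 by (auto simp: numeral_2_eq_2)
    qed
    ultimately show ?thesis using ev by (simp add: Bchain_def)
  next
    case False
    then have m2: "m = 2" using m by simp
    have a1: "acd (t 1) (t 2)" using BchainD(1)[OF t(1), of 1] m2 by (simp add: numeral_2_eq_2)
    have L3: "L2 3 (t 2)" using BchainD(2)[OF t(1), of 2] m2 by (simp add: eval_nat_numeral)
    obtain C where C: "C \<ge> 0" "\<And>a a' b b'. acd a a' \<Longrightarrow> L2 2 a \<Longrightarrow> L2 3 a' \<Longrightarrow> acd b b' \<Longrightarrow> L2 2 b \<Longrightarrow> L2 3 b' \<Longrightarrow>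
      L2 3 (\<lambda>s. a s * b s) \<and> nsq 3 (\<lambda>s. a s * b s) \<le> C * (nsq 2 a + nsq 3 a') * (nsq 2 b + nsq 3 b')"
      by (rule quadratic_bound, rule that)
    have "L2 3 (\<lambda>s. t 1 s * t 1 s)" using C(2)[OF a1 L L3 a1 L L3] by blast
    from L2_diff(1)[OF L2_cmult(1)[OF L3, of \<i>] this] have v: "L2 3 (\<lambda>s. \<i> * t 2 s - t 1 s * t 1 s)" .
    have l2: "L2 3 (cexp t 2)" unfolding c(3) by (rule L2_bounded_mult(1)[OF em v eb])
    have d1: "acd (cexp t 1) (cexp t 2)" unfolding c
      by (rule acd_cong[OF acd_mult[OF ae acd_cmult[OF a1, of \<i>]]]) (auto simp: algebra_simps)
    have "acd (cexp t j) (cexp t (Suc j))" if "j < m" for j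
    proof -
      have "j = 0 \<or> j = 1" using that m2 by auto
      then show ?thesis using d0 d1 by (auto simp: numeral_2_eq_2)
    qed
    moreover have "L2 (Suc j) (cexp t j)" if "j \<le> m" for j
    proof -
      have "j = 0 \<or> j = 1 \<or> j = 2" using that m2 by auto
      then show ?thesis using l0 l1 l2 by (auto simp: eval_nat_numeral)
    qed
    ultimately show ?thesis using ev by (simp add: Bchain_def)
  qed
qed

text \<open>The exponentials converge pointwise and stay bounded, the cofactors converge in norm;
  \<open>L2_tendsto_mult\<close> joins the two.\<close>

lemma cexp_tendsto:
  assumes T: "Btendsto m T t" and r: "\<And>n s. s \<in> {-1<..<1} \<Longrightarrow> Im (T n 0 s) = 0" "\<And>s. s \<in> {-1<..<1} \<Longrightarrow> Im (t 0 s) = 0"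
    and m: "m = 1 \<or> m = 2"
  shows "Btendsto m (\<lambda>n. cexp (T n)) (cexp t)"
proof (rule BtendstoI)
  have m1: "1 \<le> m" using m by auto
  note Tn = BtendstoD(1)[OF T] and Tt = BtendstoD(2)[OF T]
  show "Bchain m (cexp (T n))" for n by (rule cexp_Bchain[OF Tn r(1) m])
  show "Bchain m (cexp t)" by (rule cexp_Bchain[OF Tt r(2) m])
  have em: "(\<lambda>s. exp (\<i> * h 0 s)) \<in> borel_measurable M1" if h: "Bchain m h" for h
    using acd_measurable[OF acd_exp[OF acd_cmult[OF BchainD(1)[OF h, of 0]]]] m1 by simp
  have eb: "cmod (exp (\<i> * T n 0 s)) \<le> 1" if "s \<in> {-1<..<1}" for n s using r(1)[OF that] by (simp add: norm_exp_eq_Re)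
  have el: "(\<lambda>n. exp (\<i> * T n 0 s)) \<longlonglongrightarrow> exp (\<i> * t 0 s)" if "s \<in> {-1<..<1}" for s
    by (intro tendsto_intros Btendsto_point[OF T m1 that])
  fix j assume j: "j \<le> m"
  show "(\<lambda>n. nsq (Suc j) (\<lambda>s. cexp (T n) j s - cexp t j s)) \<longlonglongrightarrow> 0"
  proof -
    \<comment> \<open>The cofactor of the exponential at the fixed order j.\<close>
    define v where "v h s = (if j = 0 then 1 else if j = 1 then \<i> * h 1 s else if j = 2 then \<i> * h 2 s - h 1 s * h 1 s else 0)"
      for h :: "nat \<Rightarrow> real \<Rightarrow> complex" and s
    have c: "cexp h j = (\<lambda>s. exp (\<i> * h 0 s) * v h s)" for h by (simp add: cexp_def v_def fun_eq_iff)
    have main: "L2 (Suc j) (v t) \<and> (\<forall>n. L2 (Suc j) (v (T n))) \<and> (\<lambda>n. nsq (Suc j) (\<lambda>s. v (T n) s - v t s)) \<longlonglongrightarrow> 0"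
    proof -
      consider "j = 0" | "j = 1" | "j = 2" "m = 2" using j m by force
      then show ?thesis
      proof cases
        case 1
        then have v1: "v h = (\<lambda>s. 1)" for h by (simp add: v_def fun_eq_iff)
        show ?thesis unfolding v1 by (simp add: L2_const_int nsq_def)
      next
        case 2
        then have v1: "v h = (\<lambda>s. \<i> * h 1 s)" for h by (simp add: v_def fun_eq_iff)
        have n: "nsq k (\<lambda>s. \<i> * f s - \<i> * g s) = nsq k (\<lambda>s. f s - g s)" if "L2 k f" "L2 k g" for k f g
          using L2_cmult(2)[of k \<i> "\<lambda>s. f s - g s"] by (simp add: right_diff_distrib)
        have L: "L2 (Suc j) (T n 1)" "L2 (Suc j) (t 1)" for n
          using BchainD(2)[OF Tn j] BchainD(2)[OF Tt j] 2 by auto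
        have "nsq (Suc j) (\<lambda>s. \<i> * T k 1 s - \<i> * t 1 s) = nsq (Suc j) (\<lambda>s. T k 1 s - t 1 s)" for k by (rule n[OF L])
        moreover have "(\<lambda>n. nsq (Suc j) (\<lambda>s. T n 1 s - t 1 s)) \<longlonglongrightarrow> 0" using BtendstoD(4)[OF T j] 2 by simp
        ultimately show ?thesis unfolding v1 using L2_cmult(1)[OF L(1), of \<i>] L2_cmult(1)[OF L(2), of \<i>] by simp
      next
        case 3
        then have v1: "v h = (\<lambda>s. \<i> * h 2 s - h 1 s * h 1 s)" for h by (simp add: v_def fun_eq_iff)
        have B: "acd (h 1) (h 2)" "L2 2 (h 1)" "L2 3 (h 2)" if h: "Bchain m h" for h
          using BchainD(1)[OF h, of 1] BchainD(2)[OF h, of 1] BchainD(2)[OF h, of 2] 3 by (simp_all add: eval_nat_numeral)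
        have l: "(\<lambda>n. nsq 2 (\<lambda>s. T n 1 s - t 1 s)) \<longlonglongrightarrow> 0" "(\<lambda>n. nsq 3 (\<lambda>s. T n 2 s - t 2 s)) \<longlonglongrightarrow> 0"
          using BtendstoD(4)[OF T, of 1] BtendstoD(4)[OF T, of 2] 3 by (simp_all add: eval_nat_numeral)
        have q: "(\<lambda>n. nsq 3 (\<lambda>s. T n 1 s * T n 1 s - t 1 s * t 1 s)) \<longlonglongrightarrow> 0"
          by (rule quadratic_tendsto[OF B(1)[OF Tn] B(2)[OF Tn] B(3)[OF Tn] B(1)[OF Tt] B(2)[OF Tt] B(3)[OF Tt] l])
        obtain C where C: "C \<ge> 0" "\<And>a a' b b'. acd a a' \<Longrightarrow> L2 2 a \<Longrightarrow> L2 3 a' \<Longrightarrow> acd b b' \<Longrightarrow> L2 2 b \<Longrightarrow> L2 3 b' \<Longrightarrow>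
          L2 3 (\<lambda>s. a s * b s) \<and> nsq 3 (\<lambda>s. a s * b s) \<le> C * (nsq 2 a + nsq 3 a') * (nsq 2 b + nsq 3 b')"
          by (rule quadratic_bound, rule that)
        have Lq: "L2 3 (\<lambda>s. h 1 s * h 1 s)" if h: "Bchain m h" for h
          using C(2)[OF B(1)[OF h] B(2)[OF h] B(3)[OF h] B(1)[OF h] B(2)[OF h] B(3)[OF h]] by blast
        have Lv: "L2 3 (v h)" if h: "Bchain m h" for h
          unfolding v1 by (rule L2_diff(1)[OF L2_cmult(1)[OF B(3)[OF h]] Lq[OF h]])
        have b: "nsq 3 (\<lambda>s. v (T n) s - v t s) \<le>
            2 * nsq 3 (\<lambda>s. T n 2 s - t 2 s) + 2 * nsq 3 (\<lambda>s. T n 1 s * T n 1 s - t 1 s * t 1 s)" for n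
        proof -
          note d = L2_diff(1)[OF B(3)[OF Tn[of n]] B(3)[OF Tt]]
          have e: "(\<lambda>s. v (T n) s - v t s) = (\<lambda>s. \<i> * (T n 2 s - t 2 s) - (T n 1 s * T n 1 s - t 1 s * t 1 s))"
            unfolding v1 by (rule ext) (simp add: algebra_simps)
          have i: "nsq 3 (\<lambda>s. \<i> * (T n 2 s - t 2 s)) = nsq 3 (\<lambda>s. T n 2 s - t 2 s)"
            using L2_cmult(2)[of 3 \<i> "\<lambda>s. T n 2 s - t 2 s"] by simp
          show ?thesis
            using L2_diff(2)[OF L2_cmult(1)[OF d, of \<i>] L2_diff(1)[OF Lq[OF Tn[of n]] Lq[OF Tt]]]
            unfolding e i .
        qed
        have lb: "(\<lambda>n. 2 * nsq 3 (\<lambda>s. T n 2 s - t 2 s) + 2 * nsq 3 (\<lambda>s. T n 1 s * T n 1 s - t 1 s * t 1 s)) \<longlonglongrightarrow> 0"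
          using tendsto_add[OF tendsto_mult_right_zero[OF l(2), of 2] tendsto_mult_right_zero[OF q, of 2]] by simp
        have "(\<lambda>n. nsq 3 (\<lambda>s. v (T n) s - v t s)) \<longlonglongrightarrow> 0"
        proof (rule tendsto_sandwich[OF _ _ tendsto_const lb])
          show "\<forall>\<^sub>F n in sequentially. nsq 3 (\<lambda>s. v (T n) s - v t s) \<le>
            2 * nsq 3 (\<lambda>s. T n 2 s - t 2 s) + 2 * nsq 3 (\<lambda>s. T n 1 s * T n 1 s - t 1 s * t 1 s)" using b by simp
        qed simp
        moreover have "Suc j = 3" using 3 by simp
        ultimately show ?thesis using Lv Tn Tt by simp
      qed
    qed
    show ?thesis
      unfolding c by (rule L2_tendsto_mult(2)[OF em[OF Tn] eb el main[THEN conjunct2, THEN conjunct1, rule_format]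
          main[THEN conjunct1] main[THEN conjunct2, THEN conjunct2]])
  qed
qed

section \<open>From the unimodular function back to the angle\<close>

lemma unimodular_cnj: "cmod z = 1 \<Longrightarrow> z * cnj z = 1"
  using complex_norm_square[of z] by simp

text \<open>Differentiating f cnj f = 1 shows that cnj f g is purely imaginary almost everywhere;
  multiplying by f recovers g.\<close>

lemma unimodular_tangent:
  assumes f: "acd f g" and u: "\<forall>s\<in>{-1<..<1}. cmod (f s) = 1"
  shows "AE s in M1. g s = f s * (\<i> * complex_of_real (Im (cnj (f s) * g s)))"
proof -
  have "acd (\<lambda>s. 1) (\<lambda>s. g s * cnj (f s) + f s * cnj (g s))"
    by (rule acd_cong[OF acd_mult[OF f acd_cnj[OF f]]]) (auto simp: unimodular_cnj u)
  from acd_const_AE_zero[OF this] have z: "AE s in M1. g s * cnj (f s) + f s * cnj (g s) = 0" .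
  have w: "AE s in M1. f s * cnj (f s) = 1" by (rule AE_M1I) (rule unimodular_cnj[OF bspec[OF u]])
  have alg: "y = x * (\<i> * complex_of_real (Im (cnj x * y)))" if "y * cnj x + x * cnj y = 0" "x * cnj x = 1" for x y
  proof -
    have "Re (y * cnj x + x * cnj y) = 2 * Re (cnj x * y)" by (simp add: algebra_simps)
    then have "Re (cnj x * y) = 0" unfolding that(1) by simp
    then have "cnj x * y = \<i> * complex_of_real (Im (cnj x * y))" by (intro complex_eqI) simp_all
    then have "x * (\<i> * complex_of_real (Im (cnj x * y))) = (x * cnj x) * y" by (simp only: mult.assoc)
    then show ?thesis unfolding that(2) by simp
  qed
  show ?thesis using z w
  proof eventually_elim
    case (elim s)
    then show ?case by (intro alg)
  qed
qed

text \<open>exp (\<i> (t - u)) is constantly 1, and its density is \<i> (t' - u') times itself; so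
  t' = u' almost everywhere, without choosing a logarithm.\<close>

lemma angle_unique:
  assumes t: "acd t t'" and u: "acd u u'" and e: "\<And>s. s \<in> {-1<..<1} \<Longrightarrow> exp (\<i> * t s) = exp (\<i> * u s)"
    and s: "s \<in> {-1<..<1}"
  shows "t s - u s = t 0 - u 0"
proof -
  have "acd (\<lambda>s. 1) (\<lambda>s. (\<i> * (t' s - u' s)) * exp (\<i> * (t s - u s)))"
    by (rule acd_cong[OF acd_exp[OF acd_cmult[OF acd_diff[OF t u], of \<i>]]]) (auto simp: right_diff_distrib exp_diff e)
  from acd_const_AE_zero[OF this] have "AE s in M1. t' s - u' s = 0" by eventually_elim simp
  from acd_zero_const[OF acd_diff[OF t u] this s] show ?thesis .
qed

text \<open>For unimodular \<open>f 0\<close> and j = 1 this is the angular velocity. For j = 2 it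
  is the derivative of the angular velocity, because \<open>cnj (f 1 s) * f 1 s\<close> is
  real.\<close>

definition speed :: "(nat \<Rightarrow> real \<Rightarrow> complex) \<Rightarrow> nat \<Rightarrow> real \<Rightarrow> complex" where
  "speed f j s = complex_of_real (Im (cnj (f 0 s) * f j s))"

text \<open>The angular velocity integrated from the initial angle c at 0; the higher levels are the
  derivatives of that angle.\<close>

definition angle :: "real \<Rightarrow> (nat \<Rightarrow> real \<Rightarrow> complex) \<Rightarrow> nat \<Rightarrow> real \<Rightarrow> complex" where
  "angle c f j s = (if j = 0 then complex_of_real c + prim (speed f 1) s else speed f j s)"

lemma speed_L2:
  assumes f: "Bchain m f" and u: "\<forall>s\<in>{-1<..<1}. cmod (f 0 s) = 1" and m: "1 \<le> m" and j: "j \<le> m"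
  shows "L2 (Suc j) (\<lambda>s. cnj (f 0 s) * f j s)" "L2 (Suc j) (speed f j)"
proof -
  have fm: "(\<lambda>s. cnj (f 0 s)) \<in> borel_measurable M1" using BchainD(2)[OF f, of 0] by (intro L2_measurable L2_cnj(1)) simp
  have b: "cmod (cnj (f 0 s)) \<le> 1" if "s \<in> {-1<..<1}" for s using bspec[OF u that] by simp
  show 1: "L2 (Suc j) (\<lambda>s. cnj (f 0 s) * f j s)" by (rule L2_bounded_mult(1)[OF fm BchainD(2)[OF f j] b])
  show "L2 (Suc j) (speed f j)" unfolding speed_def[abs_def] by (rule nsq_Im(1)[OF 1])
qed

lemma angle_acd:
  assumes f: "Bchain m f" and u: "\<forall>s\<in>{-1<..<1}. cmod (f 0 s) = 1" and m: "1 \<le> m"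
  shows "acd (angle c f 0) (speed f 1)" "angle c f 0 0 = complex_of_real c"
proof -
  have "acd (prim (speed f 1)) (speed f 1)" by (rule acd_prim[OF L2_local(1)[OF speed_L2(2)[OF f u m m]]])
  from acd_add[OF acd_const this] have "acd (\<lambda>s. complex_of_real c + prim (speed f 1) s) (\<lambda>s. 0 + speed f 1 s)" .
  then show "acd (angle c f 0) (speed f 1)" by (rule acd_cong) (auto simp: angle_def)
qed (simp add: angle_def)

text \<open>f exp (-\<i> \<theta>) has density 0 by \<open>unimodular_tangent\<close>, and c is
  chosen so that its value at 0 is 1.\<close>

lemma angle_exp:
  assumes f: "Bchain m f" and u: "\<forall>s\<in>{-1<..<1}. cmod (f 0 s) = 1" and m: "1 \<le> m"
    and c: "exp (\<i> * complex_of_real c) = f 0 0" and s: "s \<in> {-1<..<1}"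
  shows "exp (\<i> * angle c f 0 s) = f 0 s" "Im (angle c f 0 s) = 0"
proof -
  have a: "acd (f 0) (f 1)" using BchainD(1)[OF f, of 0] m by simp
  note b = angle_acd[OF f u m, of c]
  have d: "acd (\<lambda>s. f 0 s * exp (- \<i> * angle c f 0 s))
      (\<lambda>s. f 1 s * exp (- \<i> * angle c f 0 s) + f 0 s * ((- \<i> * speed f 1 s) * exp (- \<i> * angle c f 0 s)))"
    by (rule acd_mult[OF a acd_exp[OF acd_cmult[OF b(1)]]])
  have tg: "AE s in M1. f 1 s = f 0 s * (\<i> * complex_of_real (Im (cnj (f 0 s) * f 1 s)))"
    by (rule unimodular_tangent[OF a u])
  have "AE s in M1. f 1 s * exp (- \<i> * angle c f 0 s) + f 0 s * ((- \<i> * speed f 1 s) * exp (- \<i> * angle c f 0 s)) = 0"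
    using tg
  proof eventually_elim
    case (elim s)
    have "f 1 s = f 0 s * (\<i> * speed f 1 s)" unfolding speed_def by (rule elim)
    then show ?case by simp
  qed
  from acd_zero_const[OF d this s] have "f 0 s * exp (- \<i> * angle c f 0 s) = f 0 0 * exp (- \<i> * complex_of_real c)"
    unfolding b(2) .
  also have "\<dots> = 1" unfolding c[symmetric] by (simp add: exp_minus)
  finally show "exp (\<i> * angle c f 0 s) = f 0 s" by (simp add: exp_minus field_simps)
  have l: "bounded_linear (\<lambda>z. complex_of_real (Im z))"
    by (rule bounded_linear_compose[OF bounded_linear_of_real bounded_linear_Im])
  have "AE s in M1. complex_of_real (Im (speed f 1 s)) = 0" by (simp add: speed_def)
  from acd_zero_const[OF acd_linear[OF l b(1)] this s] show "Im (angle c f 0 s) = 0" unfolding b(2) by simp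
qed

lemma angle_Bchain:
  assumes f: "Bchain m f" and u: "\<forall>s\<in>{-1<..<1}. cmod (f 0 s) = 1" and m: "m = 1 \<or> m = 2"
  shows "Bchain m (angle c f)"
proof -
  have m1: "1 \<le> m" using m by auto
  have a: "acd (f 0) (f 1)" using BchainD(1)[OF f, of 0] m1 by simp
  note b = angle_acd[OF f u m1, of c]
  have ang: "angle c f j = speed f j" if "j \<noteq> 0" for j using that by (simp add: angle_def fun_eq_iff)
  have d1: "acd (speed f 1) (speed f 2)" if "m = 2"
  proof -
    have a1: "acd (f 1) (f 2)" using BchainD(1)[OF f, of 1] that by (simp add: numeral_2_eq_2)
    have l: "bounded_linear (\<lambda>z. complex_of_real (Im z))"
      by (rule bounded_linear_compose[OF bounded_linear_of_real bounded_linear_Im])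
    show ?thesis
      by (rule acd_cong[OF acd_linear[OF l acd_mult[OF acd_cnj[OF a] a1]]]) (auto simp: speed_def)
  qed
  have "L2 2 (speed f 1)" using speed_L2(2)[OF f u m1 m1] by (simp add: numeral_2_eq_2)
  then have L0: "L2 1 (angle c f 0)" by (rule acd_L2_1(1)[OF b(1)])
  \<comment> \<open>\<open>f 1\<close> is known to be odd only almost everywhere, by uniqueness of
    the density of the even \<open>f 0\<close>. That makes the angular velocity odd and its
    primitive even.\<close>
  have "angle c f 0 (- s) = angle c f 0 s" if s: "s \<in> {-1<..<1}" for s
  proof -
    have "acd (\<lambda>s. 0) (\<lambda>s. - f 1 (- s) - f 1 s)"
      by (rule acd_cong[OF acd_diff[OF acd_reflect[OF a] a]]) (auto simp: BchainD(3)[OF f])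
    from acd_const_AE_zero[OF this] have z: "AE s in M1. - f 1 (- s) - f 1 s = 0" .
    have w: "AE s in M1. f 0 (- s) = f 0 s" by (rule AE_M1I) (rule BchainD(3)[OF f])
    have "AE s in M1. - speed f 1 (- s) - speed f 1 s = 0"
      using z w
    proof eventually_elim
      case (elim s)
      have "- f 1 (- s) = f 1 s" using elim(1) unfolding right_minus_eq .
      then have e: "f 1 (- s) = - f 1 s" by (metis minus_minus)
      show ?case unfolding speed_def e elim(2) by simp
    qed
    from acd_zero_const[OF acd_diff[OF acd_reflect[OF b(1)] b(1)] this s] show ?thesis by simp
  qed
  moreover have "acd (angle c f j) (angle c f (Suc j))" if "j < m" for j
  proof (cases "j = 0")
    case True
    then show ?thesis using b(1) ang[of 1] by simp
  next
    case False
    then have "j = 1" "m = 2" using that m by auto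
    then show ?thesis using d1 ang[of 1] ang[of 2] by (simp add: numeral_2_eq_2)
  qed
  moreover have "L2 (Suc j) (angle c f j)" if "j \<le> m" for j
    using L0 speed_L2(2)[OF f u m1 that] ang[of j] by (cases "j = 0") auto
  ultimately show ?thesis unfolding Bchain_def by blast
qed

text \<open>At positive order \<open>L2_tendsto_mult\<close> applies, with the bounded factor
  \<open>cnj (F n 0 s)\<close>. At order 0 the angle follows from its velocity and the initial
  values through \<open>acd_L2_1\<close>.\<close>

lemma angle_tendsto:
  assumes F: "Btendsto m F f" and m: "m = 1 \<or> m = 2"
    and uF': "\<forall>n. \<forall>s\<in>{-1<..<1}. cmod (F n 0 s) = 1" and u: "\<forall>s\<in>{-1<..<1}. cmod (f 0 s) = 1"
    and c: "C \<longlonglongrightarrow> c"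
  shows "Btendsto m (\<lambda>n. angle (C n) (F n)) (angle c f)"
proof (rule BtendstoI)
  have m1: "1 \<le> m" using m by auto
  note Fn = BtendstoD(1)[OF F] and Ff = BtendstoD(2)[OF F]
  have uF: "\<forall>s\<in>{-1<..<1}. cmod (F n 0 s) = 1" for n using uF' by blast
  show "Bchain m (angle (C n) (F n))" for n by (rule angle_Bchain[OF Fn uF m])
  show "Bchain m (angle c f)" by (rule angle_Bchain[OF Ff u m])
  have S: "(\<lambda>n. nsq (Suc j) (\<lambda>s. speed (F n) j s - speed f j s)) \<longlonglongrightarrow> 0" if j: "j \<le> m" for j
  proof -
    have Fm: "(\<lambda>s. cnj (F n 0 s)) \<in> borel_measurable M1" for n
      using BchainD(2)[OF Fn, of 0] by (intro L2_measurable L2_cnj(1)) simp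
    have bd: "cmod (cnj (F n 0 s)) \<le> 1" if "s \<in> {-1<..<1}" for n s using bspec[OF uF that] by simp
    have l: "(\<lambda>n. cnj (F n 0 s)) \<longlonglongrightarrow> cnj (f 0 s)" if "s \<in> {-1<..<1}" for s
      by (intro tendsto_intros Btendsto_point[OF F m1 that])
    have q: "(\<lambda>n. nsq (Suc j) (\<lambda>s. cnj (F n 0 s) * F n j s - cnj (f 0 s) * f j s)) \<longlonglongrightarrow> 0"
      by (rule L2_tendsto_mult(2)[OF Fm bd l BchainD(2)[OF Fn j] BchainD(2)[OF Ff j] BtendstoD(4)[OF F j]])
    show ?thesis unfolding speed_def by (rule nsq_Im_tendsto[OF speed_L2(1)[OF Fn uF m1 j] speed_L2(1)[OF Ff u m1 j] q])
  qed
  fix j assume j: "j \<le> m"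
  show "(\<lambda>n. nsq (Suc j) (\<lambda>s. angle (C n) (F n) j s - angle c f j s)) \<longlonglongrightarrow> 0"
  proof (cases "j = 0")
    case False
    then show ?thesis using S[OF j] by (simp add: angle_def)
  next
    case True
    let ?N = "\<lambda>n. 8 * (nsq 2 (\<lambda>s. speed (F n) 1 s - speed f 1 s) + (cmod (complex_of_real (C n) - complex_of_real c))\<^sup>2)"
    have le: "nsq 1 (\<lambda>s. angle (C n) (F n) 0 s - angle c f 0 s) \<le> ?N n" for n
    proof -
      have b: "acd (angle (C n) (F n) 0) (speed (F n) 1)" "angle (C n) (F n) 0 0 = complex_of_real (C n)"
        by (rule angle_acd[OF Fn uF m1])+
      note b' = angle_acd[OF Ff u m1, of c]
      have L: "L2 2 (\<lambda>s. speed (F n) 1 s - speed f 1 s)"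
        using L2_diff(1)[OF speed_L2(2)[OF Fn uF m1 m1] speed_L2(2)[OF Ff u m1 m1]] by (simp add: numeral_2_eq_2)
      show ?thesis using acd_L2_1(2)[OF acd_diff[OF b(1) b'(1)] L] unfolding b(2) b'(2) .
    qed
    have s1: "(\<lambda>n. nsq 2 (\<lambda>s. speed (F n) 1 s - speed f 1 s)) \<longlonglongrightarrow> 0" using S[OF m1] by (simp add: numeral_2_eq_2)
    have "?N \<longlonglongrightarrow> 8 * (0 + (cmod (complex_of_real c - complex_of_real c))\<^sup>2)" by (intro tendsto_intros s1 c)
    then have lb: "?N \<longlonglongrightarrow> 0" by simp
    have "(\<lambda>n. nsq 1 (\<lambda>s. angle (C n) (F n) 0 s - angle c f 0 s)) \<longlonglongrightarrow> 0"
    proof (rule tendsto_sandwich[OF _ _ tendsto_const lb])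
      show "\<forall>\<^sub>F n in sequentially. nsq 1 (\<lambda>s. angle (C n) (F n) 0 s - angle c f 0 s) \<le> ?N n"
        using le by (intro always_eventually allI)
    qed simp
    then show ?thesis unfolding True by simp
  qed
qed

section \<open>Curves through their derivatives\<close>

context
  fixes m :: nat
  assumes m1: "1 \<le> m"
begin

abbreviation "KK \<equiv> K_space (Suc m)"

lemma pre_hilbert_KK: "pre_hilbert KK"
  by (rule pre_hilbert_K) simp

interpretation K: pre_hilbert KK by (rule pre_hilbert_KK)

lemma Bchain_curve:
  assumes h: "Bchain m h"
  shows "crv (prim (h 0)) \<in> hcarrier KK" "s \<in> {-1<..<1} \<Longrightarrow> dv (crv (prim (h 0))) s = h 0 s"
    "Nsum m h \<le> (hnorm KK (crv (prim (h 0))))\<^sup>2"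
proof -
  obtain C where C: "C \<ge> 0" "\<And>h. Bchain m h \<Longrightarrow> Kchain (Suc m) (up h) \<and>
    (hnorm KK (crv (prim (h 0))))\<^sup>2 \<le> C * Nsum m h"
    by (rule Kchain_up[OF m1], rule that)
  have k: "Kchain (Suc m) (up h)" using C(2)[OF h] by blast
  have M2: "2 \<le> Suc m" using m1 by simp
  show "crv (prim (h 0)) \<in> hcarrier KK" using Kchain_mem[OF k] by simp
  show "s \<in> {-1<..<1} \<Longrightarrow> dv (crv (prim (h 0))) s = h 0 s" using dv_chain[OF k M2] by simp
  show "Nsum m h \<le> (hnorm KK (crv (prim (h 0))))\<^sup>2" using Bchain_of_Kchain(2)[OF k m1] by simp
qed

text \<open>Oddness gives \<open>f 0 0 = 0\<close>, so a curve is the primitive from 0 of its own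
  derivative. In this normal form a curve is handled through the chain of its derivative
  alone.\<close>

lemma K_rep:
  assumes x: "x \<in> hcarrier KK"
  obtains h where "Bchain m h" "x = crv (prim (h 0))"
proof -
  obtain f where f: "Kchain (Suc m) f" "x = crv (f 0)" by (rule K_space_chain[OF x zero_less_Suc])
  have a: "acd (f 0) (f 1)" using KchainD(1)[OF f(1), of 0] by simp
  have p: "acd (prim (f 1)) (f 1)" by (rule acd_prim[OF acd_integrable[OF a]])
  have "f 0 0 = 0"
  proof -
    have e: "f 0 (- 0) = - f 0 0" by (rule KchainD(3)[OF f(1)]) simp
    have "f 0 0 + f 0 0 = 0" using e unfolding minus_zero by (simp only: eq_neg_iff_add_eq_0)
    then show ?thesis by (simp only: mult_2[symmetric] mult_eq_0_iff) simp
  qed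
  then have "f 0 s = prim (f 1) s" if "s \<in> {-1<..<1}" for s by (intro acd_eqI[OF a p _ that]) simp
  then have "crv (f 0) = crv (prim (f 1))"
    by (intro crv_eqI AE_M1I acd_measurable[OF a] acd_measurable[OF p])
  then show ?thesis using that[OF Bchain_of_Kchain(1)[OF f(1) m1]] f(2) by simp
qed

lemma K_eqI:
  assumes x: "x \<in> hcarrier KK" and y: "y \<in> hcarrier KK" and e: "\<And>s. s \<in> {-1<..<1} \<Longrightarrow> dv x s = dv y s"
  shows "x = y"
proof -
  obtain h where h: "Bchain m h" "x = crv (prim (h 0))" by (rule K_rep[OF x])
  obtain g where g: "Bchain m g" "y = crv (prim (g 0))" by (rule K_rep[OF y])
  have hg: "g 0 s = h 0 s" if "s \<in> {-1<..<1}" for s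
    using e[OF that] unfolding h(2) g(2) Bchain_curve(2)[OF h(1) that] Bchain_curve(2)[OF g(1) that] by simp
  have a: "acd (prim (h 0)) (h 0)" "acd (prim (g 0)) (g 0)"
    using L2_local(1)[OF BchainD(2)[OF h(1), of 0]] L2_local(1)[OF BchainD(2)[OF g(1), of 0]] by (auto intro: acd_prim)
  have "acd (prim (g 0)) (h 0)" by (rule acd_cong[OF a(2)]) (auto simp: hg)
  then have "prim (h 0) s = prim (g 0) s" if "s \<in> {-1<..<1}" for s by (rule acd_eqI[OF a(1) _ _ that]) simp
  then show ?thesis unfolding h(2) g(2) by (intro crv_eqI AE_M1I acd_measurable[OF a(1)] acd_measurable[OF a(2)])
qed

lemma dv_linear:
  assumes x: "x \<in> hcarrier KK" and y: "y \<in> hcarrier KK" and s: "s \<in> {-1<..<1}"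
  shows "dv (x + y) s = dv x s + dv y s" "dv (x - y) s = dv x s - dv y s" "dv (c *\<^sub>R x) s = complex_of_real c * dv x s"
proof -
  have M2: "2 \<le> Suc m" using m1 by simp
  obtain f where f: "Kchain (Suc m) f" "x = crv (f 0)" by (rule K_space_chain[OF x zero_less_Suc])
  obtain g where g: "Kchain (Suc m) g" "y = crv (g 0)" by (rule K_space_chain[OF y zero_less_Suc])
  show "dv (x + y) s = dv x s + dv y s"
    using dv_chain[OF Kchain_add[OF f(1) g(1)] M2 s] dv_chain[OF f(1) M2 s] dv_chain[OF g(1) M2 s]
    by (simp add: f(2) g(2) crv_chain_ops(1)[OF f(1) g(1)])
  show "dv (x - y) s = dv x s - dv y s"
    using dv_chain[OF Kchain_diff[OF f(1) g(1)] M2 s] dv_chain[OF f(1) M2 s] dv_chain[OF g(1) M2 s]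
    by (simp add: f(2) g(2) crv_chain_ops(2)[OF f(1) g(1)])
  show "dv (c *\<^sub>R x) s = complex_of_real c * dv x s"
    using dv_chain[OF Kchain_cmult[OF f(1), of "of_real c"] M2 s] dv_chain[OF f(1) M2 s]
    by (simp add: f(2) crv_chain_ops(3)[OF f(1) f(1)])
qed

lemma dv_bound:
  assumes s: "s \<in> {-1<..<1}"
  obtains C where "C \<ge> 0" "\<And>x. x \<in> hcarrier KK \<Longrightarrow> cmod (dv x s) \<le> C * hnorm KK x"
proof -
  obtain C where C: "C \<ge> 0" "\<And>h. Bchain m h \<Longrightarrow> (cmod (h 0 s))\<^sup>2 \<le> C * Nsum m h"
    by (rule Bchain_points[OF m1 s], rule that)
  show ?thesis
  proof (rule that[of "sqrt C"])
    show "0 \<le> sqrt C" using C(1) by simp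
    fix x assume x: "x \<in> hcarrier KK"
    obtain h where h: "Bchain m h" "x = crv (prim (h 0))" by (rule K_rep[OF x])
    have "(cmod (h 0 s))\<^sup>2 \<le> C * (hnorm KK x)\<^sup>2"
      using C(2)[OF h(1)] mult_left_mono[OF Bchain_curve(3)[OF h(1)] C(1)] unfolding h(2) by (rule order_trans)
    also have "\<dots> = (sqrt C * hnorm KK x)\<^sup>2" using C(1) by (simp add: power_mult_distrib)
    finally have "cmod (h 0 s) \<le> sqrt C * hnorm KK x"
      by (rule power2_le_imp_le) (use C(1) x in simp)
    then show "cmod (dv x s) \<le> sqrt C * hnorm KK x" unfolding h(2) Bchain_curve(2)[OF h(1) s] .
  qed
qed

text \<open>Together with \<open>BtendstoI_curve\<close> this identifies convergence of curves in
  norm with convergence of their chains.\<close>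

lemma Btendsto_curve:
  assumes F: "Btendsto m F f"
  shows "(\<lambda>n. hnorm KK (crv (prim (F n 0)) - crv (prim (f 0)))) \<longlonglongrightarrow> 0"
proof -
  obtain C where C: "C \<ge> 0" "\<And>h. Bchain m h \<Longrightarrow> Kchain (Suc m) (up h) \<and>
    (hnorm KK (crv (prim (h 0))))\<^sup>2 \<le> C * Nsum m h"
    by (rule Kchain_up[OF m1], rule that)
  let ?d = "\<lambda>n j s. F n j s - f j s"
  note Fn = BtendstoD(1)[OF F] and Ff = BtendstoD(2)[OF F]
  have B: "Bchain m (?d n)" for n by (rule Bchain_diff[OF Fn Ff])
  have e: "crv (prim (F n 0)) - crv (prim (f 0)) = crv (prim (?d n 0))" for n
  proof (rule K_eqI[OF _ Bchain_curve(1)[OF B]])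
    show "crv (prim (F n 0)) - crv (prim (f 0)) \<in> hcarrier KK"
      by (rule subspace_diff[OF K.subsp Bchain_curve(1)[OF Fn] Bchain_curve(1)[OF Ff]])
    show "dv (crv (prim (F n 0)) - crv (prim (f 0))) s = dv (crv (prim (?d n 0))) s" if s: "s \<in> {-1<..<1}" for s
      unfolding dv_linear(2)[OF Bchain_curve(1)[OF Fn] Bchain_curve(1)[OF Ff] s] Bchain_curve(2)[OF Fn s]
        Bchain_curve(2)[OF Ff s] Bchain_curve(2)[OF B s] ..
  qed
  let ?N = "\<lambda>n. sqrt (C * Nsum m (?d n))"
  have "(\<lambda>n. C * Nsum m (?d n)) \<longlonglongrightarrow> 0" using tendsto_mult_right_zero[OF BtendstoD(3)[OF F]] .
  then have "?N \<longlonglongrightarrow> sqrt 0" by (rule tendsto_real_sqrt)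
  then have lb: "?N \<longlonglongrightarrow> 0" by simp
  show ?thesis
  proof (rule tendsto_sandwich[OF _ _ tendsto_const lb])
    show "\<forall>\<^sub>F n in sequentially. hnorm KK (crv (prim (F n 0)) - crv (prim (f 0))) \<le> ?N n"
      unfolding e using C(2)[OF B] by (intro always_eventually allI real_le_rsqrt) blast
    show "\<forall>\<^sub>F n in sequentially. 0 \<le> hnorm KK (crv (prim (F n 0)) - crv (prim (f 0)))"
      unfolding e using Bchain_curve(1)[OF B] by (intro always_eventually allI K.hnorm_nonneg)
  qed
qed

lemma BtendstoI_curve:
  assumes F: "\<And>n. Bchain m (F n)" and f: "Bchain m f"
    and l: "(\<lambda>n. hnorm KK (crv (prim (F n 0)) - crv (prim (f 0)))) \<longlonglongrightarrow> 0"
  shows "Btendsto m F f"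
  unfolding Btendsto_def
proof (intro conjI allI F f)
  let ?d = "\<lambda>n j s. F n j s - f j s"
  have B: "Bchain m (?d n)" for n by (rule Bchain_diff[OF F f])
  have e: "crv (prim (?d n 0)) = crv (prim (F n 0)) - crv (prim (f 0))" for n
  proof (rule K_eqI[OF Bchain_curve(1)[OF B]])
    show "crv (prim (F n 0)) - crv (prim (f 0)) \<in> hcarrier KK"
      by (rule subspace_diff[OF K.subsp Bchain_curve(1)[OF F] Bchain_curve(1)[OF f]])
    show "dv (crv (prim (?d n 0))) s = dv (crv (prim (F n 0)) - crv (prim (f 0))) s" if s: "s \<in> {-1<..<1}" for s
      unfolding dv_linear(2)[OF Bchain_curve(1)[OF F] Bchain_curve(1)[OF f] s] Bchain_curve(2)[OF F s]
        Bchain_curve(2)[OF f s] Bchain_curve(2)[OF B s] ..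
  qed
  have lb: "(\<lambda>n. (hnorm KK (crv (prim (F n 0)) - crv (prim (f 0))))\<^sup>2) \<longlonglongrightarrow> 0"
    using tendsto_power[OF l, of 2] by simp
  show "(\<lambda>n. Nsum m (?d n)) \<longlonglongrightarrow> 0"
  proof (rule tendsto_sandwich[OF _ _ tendsto_const lb])
    show "\<forall>\<^sub>F n in sequentially. Nsum m (?d n) \<le> (hnorm KK (crv (prim (F n 0)) - crv (prim (f 0))))\<^sup>2"
      by (intro always_eventually allI) (rule Bchain_curve(3)[OF B, unfolded e])
  qed simp
qed

end

text \<open>
  For \<open>m = 1, 2\<close> the products in the chart of the algebra case are not available; instead the curves
  are parametrized by their angle functions, \<open>\<eta>' = exp (\<i> \<theta>)\<close>, which are the derivatives of the
  curves in a closed real subspace and unique up to multiples of \<open>2 \<pi>\<close>.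
\<close>

theorem A_space_angle_case:
  assumes m: "m = 1 \<or> m = 2"
  shows "\<exists>E :: curve hspace. hilbert_manifold E (subtopology (htopology (K_space (Suc m))) (A_space (Suc m)))"
proof -
  have m1: "1 \<le> m" using m by auto
  let ?I = "{-1<..<1} :: real set"
  let ?K = "K_space (Suc m)"
  note KP = pre_hilbert_KK[OF m1]
  interpret K: pre_hilbert ?K by (rule KP)
  note curve = Bchain_curve[OF m1] and rep = K_rep[OF m1] and eqI = K_eqI[OF m1] and lin = dv_linear[OF m1]
  \<comment> \<open>An angle function is stored as the curve having it as derivative; in this way
    the model space is a closed subspace of the same \<open>K_space\<close>.\<close>
  define R where "R = {x \<in> hcarrier ?K. \<forall>s\<in>?I. Im (dv x s) = 0}"
  define F where "F = ?K\<lparr>hcarrier := R\<rparr>"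
  have RK: "R \<subseteq> hcarrier ?K" by (auto simp: R_def)
  have FR: "hcarrier F = R" "hnorm F = hnorm ?K" by (simp_all add: F_def)
  have A: "A_space (Suc m) = {x \<in> hcarrier ?K. \<forall>s\<in>?I. cmod (dv x s) = 1}" by (rule A_space_eq) (use m1 in simp)
  have Rsub: "subspace R"
  proof (rule subspaceI)
    have z: "0 \<in> hcarrier ?K" by (rule subspace_0[OF K.subsp])
    have "Im (dv 0 s) = 0" if "s \<in> ?I" for s using lin(2)[OF z z that] by simp
    then show "0 \<in> R" using z unfolding R_def by blast
    fix x assume "x \<in> R"
    then have x: "x \<in> hcarrier ?K" "\<And>s. s \<in> ?I \<Longrightarrow> Im (dv x s) = 0" unfolding R_def by blast+
    show "c *\<^sub>R x \<in> R" for c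
      unfolding R_def
    proof (intro CollectI conjI ballI)
      show "c *\<^sub>R x \<in> hcarrier ?K" by (rule subspace_scale[OF K.subsp x(1)])
      show "Im (dv (c *\<^sub>R x) s) = 0" if "s \<in> ?I" for s using x(2)[OF that] unfolding lin(3)[OF x(1) x(1) that] by simp
    qed
    fix y assume "y \<in> R"
    then have y: "y \<in> hcarrier ?K" "\<And>s. s \<in> ?I \<Longrightarrow> Im (dv y s) = 0" unfolding R_def by blast+
    show "x + y \<in> R"
      unfolding R_def
    proof (intro CollectI conjI ballI)
      show "x + y \<in> hcarrier ?K" by (rule subspace_add[OF K.subsp x(1) y(1)])
      show "Im (dv (x + y) s) = 0" if "s \<in> ?I" for s
        using x(2)[OF that] y(2)[OF that] unfolding lin(1)[OF x(1) y(1) that] by simp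
    qed
  qed
  have Rcl: "closedin (htopology ?K) R"
  proof (rule K.closedin_htopologyI[OF RK])
    fix x assume x: "x \<in> hcarrier ?K" and ap: "\<And>e. e > 0 \<Longrightarrow> \<exists>y\<in>R. hnorm ?K (y - x) < e"
    have "Im (dv x s) = 0" if s: "s \<in> ?I" for s
    proof (rule ccontr)
      assume ne: "Im (dv x s) \<noteq> 0"
      obtain C where C: "C \<ge> 0" "\<And>x. x \<in> hcarrier ?K \<Longrightarrow> cmod (dv x s) \<le> C * hnorm ?K x"
        by (rule dv_bound[OF m1 s], rule that)
      define e where "e = \<bar>Im (dv x s)\<bar> / (C + 1)"
      have e: "e > 0" using ne C(1) by (simp add: e_def)
      obtain y where y: "y \<in> R" "hnorm ?K (y - x) < e" using ap[OF e] by blast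
      have yK: "y \<in> hcarrier ?K" using y RK by blast
      have "\<bar>Im (dv x s)\<bar> = \<bar>Im (dv (y - x) s)\<bar>" using y(1) s unfolding lin(2)[OF yK x s] R_def by simp
      also have "\<dots> \<le> C * hnorm ?K (y - x)"
        using abs_Im_le_cmod C(2)[OF subspace_diff[OF K.subsp yK x]] by (rule order_trans)
      also have "\<dots> \<le> C * e" using y(2) C(1) by (intro mult_left_mono) auto
      also have "\<dots> < (C + 1) * e" using e by simp
      also have "\<dots> = \<bar>Im (dv x s)\<bar>" using C(1) by (simp add: e_def)
      finally show False by simp
    qed
    then show "x \<in> R" using x by (simp add: R_def)
  qed
  have HF: "hilbert_space F" unfolding F_def
    by (rule K.hilbert_space_restrict[OF Rsub Rcl hilbert_space_K]) simp
  \<comment> \<open>The curve whose derivative is exp (\<i> \<theta>), for \<theta> the derivative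
    of x. Curves are determined by \<open>dv\<close>, which makes the description definite.\<close>
  define psi where "psi x = (THE y. y \<in> hcarrier ?K \<and> (\<forall>s\<in>?I. dv y s = exp (\<i> * dv x s)))" for x
  have psi_eq: "psi x = y" if y: "y \<in> hcarrier ?K" "\<And>s. s \<in> ?I \<Longrightarrow> dv y s = exp (\<i> * dv x s)" for x y
    unfolding psi_def
  proof (rule the_equality)
    show "y \<in> hcarrier ?K \<and> (\<forall>s\<in>?I. dv y s = exp (\<i> * dv x s))" using y by blast
    fix z assume z: "z \<in> hcarrier ?K \<and> (\<forall>s\<in>?I. dv z s = exp (\<i> * dv x s))"
    show "z = y"
    proof (rule eqI[OF conjunct1[OF z] y(1)])
      show "dv z s = dv y s" if s: "s \<in> ?I" for s using conjunct2[OF z] y(2)[OF s] s by simp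
    qed
  qed
  have Rrep: "Bchain m t \<Longrightarrow> crv (prim (t 0)) \<in> R \<longleftrightarrow> (\<forall>s\<in>?I. Im (t 0 s) = 0)" for t
    using curve(1,2)[of t] by (auto simp: R_def)
  have Arep: "Bchain m t \<Longrightarrow> crv (prim (t 0)) \<in> A_space (Suc m) \<longleftrightarrow> (\<forall>s\<in>?I. cmod (t 0 s) = 1)" for t
    using curve(1,2)[of t] by (auto simp: A)
  have psi_rep: "psi (crv (prim (t 0))) = crv (prim (cexp t 0))" "Bchain m (cexp t)" "crv (prim (cexp t 0)) \<in> A_space (Suc m)"
    if t: "Bchain m t" "\<forall>s\<in>?I. Im (t 0 s) = 0" for t
  proof -
    show B: "Bchain m (cexp t)" using t(2) by (intro cexp_Bchain[OF t(1) _ m]) blast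
    show "psi (crv (prim (t 0))) = crv (prim (cexp t 0))"
    proof (rule psi_eq[OF curve(1)[OF B]])
      show "dv (crv (prim (cexp t 0))) s = exp (\<i> * dv (crv (prim (t 0))) s)" if s: "s \<in> ?I" for s
        unfolding curve(2)[OF B s] curve(2)[OF t(1) s] by (simp add: cexp_def)
    qed
    show "crv (prim (cexp t 0)) \<in> A_space (Suc m)" unfolding Arep[OF B] using t(2) by (auto intro: cexp_unimodular)
  qed
  have psi_dv: "psi x \<in> hcarrier ?K" "psi x \<in> A_space (Suc m)" "\<And>s. s \<in> ?I \<Longrightarrow> dv (psi x) s = exp (\<i> * dv x s)" if x: "x \<in> R" for x
  proof -
    have xK: "x \<in> hcarrier ?K" using x RK by blast
    obtain t where t: "Bchain m t" "x = crv (prim (t 0))" by (rule rep[OF xK])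
    have r: "\<forall>s\<in>?I. Im (t 0 s) = 0" using x Rrep[OF t(1)] by (simp add: t(2))
    note p = psi_rep[OF t(1) r]
    show "psi x \<in> hcarrier ?K" unfolding t(2) p(1) by (rule curve(1)[OF p(2)])
    show "psi x \<in> A_space (Suc m)" unfolding t(2) p(1) by (rule p(3))
    show "dv (psi x) s = exp (\<i> * dv x s)" if s: "s \<in> ?I" for s
      unfolding t(2) p(1) curve(2)[OF p(2) s] curve(2)[OF t(1) s] by (simp add: cexp_def)
  qed
  have angle_lift: "crv (prim (angle c f 0)) \<in> R" "psi (crv (prim (angle c f 0))) = crv (prim (f 0))"
    if f: "Bchain m f" "\<forall>s\<in>?I. cmod (f 0 s) = 1" "exp (\<i> * complex_of_real c) = f 0 0" for f c
  proof -
    note B = angle_Bchain[OF f(1,2) m, of c] and E = angle_exp[OF f(1,2) m1 f(3)]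
    show "crv (prim (angle c f 0)) \<in> R" unfolding Rrep[OF B] using E(2) by blast
    show "psi (crv (prim (angle c f 0))) = crv (prim (f 0))"
    proof (rule psi_eq[OF curve(1)[OF f(1)]])
      show "dv (crv (prim (f 0))) s = exp (\<i> * dv (crv (prim (angle c f 0))) s)" if s: "s \<in> ?I" for s
        unfolding curve(2)[OF B s] curve(2)[OF f(1) s] E(1)[OF s] ..
    qed
  qed
  have seq: "(\<lambda>n. a n) \<longlonglongrightarrow> 0" if "\<And>n. 0 \<le> a n" "\<And>n. a n < inverse (real (Suc n))" for a :: "nat \<Rightarrow> real"
  proof (rule tendsto_sandwich[OF _ _ tendsto_const LIMSEQ_inverse_real_of_nat])
    show "\<forall>\<^sub>F n in sequentially. a n \<le> inverse (real (Suc n))" using that(2) by (intro always_eventually allI less_imp_le)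
  qed (use that in simp)
  have expArg: "exp (\<i> * complex_of_real (Arg z)) = z" if "cmod z = 1" for z
    using Arg_eq[of z] that by (cases "z = 0") auto
  have Isub: "(0::real) \<in> ?I" by simp
  have ip: "0 < inverse (real (Suc n))" for n by simp
  \<comment> \<open>The curve with constant derivative 1: adding c u shifts the angle by c.\<close>
  define u where "u = crv (prim (\<lambda>s. 1))"
  have uB: "Bchain m (\<lambda>j s. if j = 0 then 1 else 0)"
    unfolding Bchain_def
  proof (intro conjI allI impI ballI)
    show "acd (\<lambda>s. if j = 0 then 1 else 0) (\<lambda>s. if Suc j = 0 then 1 else 0)" for j by (cases "j = 0") (simp_all add: acd_const)
    show "L2 (Suc j) (\<lambda>s. if j = 0 then 1 else 0)" for j by (cases "j = 0") (simp_all add: L2_const_int)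
  qed simp
  have uR: "u \<in> R" and uK: "u \<in> hcarrier ?K" using Rrep[OF uB] curve(1)[OF uB] by (simp_all add: u_def)
  have ud: "dv u s = 1" if "s \<in> ?I" for s using curve(2)[OF uB that] by (simp add: u_def)
  have xcu: "x + c *\<^sub>R u \<in> hcarrier ?K" "\<And>s. s \<in> ?I \<Longrightarrow> dv (x + c *\<^sub>R u) s = dv x s + complex_of_real c"
    if x: "x \<in> hcarrier ?K" for x c
  proof -
    have cu: "c *\<^sub>R u \<in> hcarrier ?K" by (rule subspace_scale[OF K.subsp uK])
    show "x + c *\<^sub>R u \<in> hcarrier ?K" by (rule subspace_add[OF K.subsp x cu])
    show "dv (x + c *\<^sub>R u) s = dv x s + complex_of_real c" if s: "s \<in> ?I" for s
      unfolding lin(1)[OF x cu s] lin(3)[OF uK uK s] ud[OF s] by simp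
  qed
  obtain C where C: "C \<ge> 0" "\<And>x. x \<in> hcarrier ?K \<Longrightarrow> cmod (dv x 0) \<le> C * hnorm ?K x"
    by (rule dv_bound[OF m1 Isub], rule that)
  have "hilbert_manifold F (subtopology (htopology ?K) (A_space (Suc m)))"
  \<comment> \<open>The coordinate \<tau> is the angle at s = 0, and 2 \<pi> is the smallest
    positive shift that exp (\<i> \<theta>) does not see.\<close>
  proof (rule hilbert_manifold_translation_quotient[where \<psi> = psi and p = "2 * pi" and u = u and \<tau> = "\<lambda>x. Re (dv x 0)" and C = C,
        OF KP HF, unfolded FR])
    show "A_space (Suc m) \<subseteq> hcarrier ?K" unfolding A by blast
    show "psi ` R = A_space (Suc m)"
    proof (intro equalityI subsetI)
      fix z assume "z \<in> psi ` R"
      then show "z \<in> A_space (Suc m)" using psi_dv(2) by blast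
    next
      fix z assume z: "z \<in> A_space (Suc m)"
      then have zK: "z \<in> hcarrier ?K" unfolding A by blast
      obtain f where f: "Bchain m f" "z = crv (prim (f 0))" by (rule rep[OF zK])
      have n: "\<forall>s\<in>?I. cmod (f 0 s) = 1" using z unfolding f(2) Arep[OF f(1)] .
      note a = angle_lift[OF f(1) n expArg[OF bspec[OF n Isub]]]
      show "z \<in> psi ` R" using a by (metis f(2) image_eqI)
    qed
    show "0 < 2 * pi" by simp
    show "u \<in> R" by (rule uR)
    show "\<bar>Re (dv y 0) - Re (dv x 0)\<bar> \<le> C * hnorm ?K (y - x)" if "x \<in> R" "y \<in> R" for x y
    proof -
      have xy: "x \<in> hcarrier ?K" "y \<in> hcarrier ?K" using that RK by auto
      have "\<bar>Re (dv y 0) - Re (dv x 0)\<bar> = \<bar>Re (dv (y - x) 0)\<bar>" unfolding lin(2)[OF xy(2,1) Isub] by simp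
      also have "\<dots> \<le> C * hnorm ?K (y - x)"
        using abs_Re_le_cmod C(2)[OF subspace_diff[OF K.subsp xy(2,1)]] by (rule order_trans)
      finally show ?thesis .
    qed
    show "Re (dv (x + c *\<^sub>R u) 0) = Re (dv x 0) + c" if "x \<in> R" for x c
    proof -
      have xK: "x \<in> hcarrier ?K" using that RK by blast
      show ?thesis unfolding xcu(2)[OF xK Isub] by simp
    qed
    show "\<exists>c. y = x + c *\<^sub>R u \<and> (c = 0 \<or> 2 * pi \<le> \<bar>c\<bar>) \<and> (\<forall>z\<in>R. psi (z + c *\<^sub>R u) = psi z)"
      if x: "x \<in> R" and y: "y \<in> R" and e: "psi x = psi y" for x y
    proof -
      have xK: "x \<in> hcarrier ?K" and yK: "y \<in> hcarrier ?K" using x y RK by auto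
      define c where "c = Re (dv y 0) - Re (dv x 0)"
      have ee: "exp (\<i> * dv y s) = exp (\<i> * dv x s)" if "s \<in> ?I" for s
        using psi_dv(3)[OF x that] psi_dv(3)[OF y that] e by simp
      obtain t where t: "Bchain m t" "x = crv (prim (t 0))" by (rule rep[OF xK])
      obtain r where r: "Bchain m r" "y = crv (prim (r 0))" by (rule rep[OF yK])
      have td: "dv x s = t 0 s" "dv y s = r 0 s" if "s \<in> ?I" for s
        unfolding t(2) r(2) using curve(2)[OF t(1) that] curve(2)[OF r(1) that] by auto
      have "Im (dv x 0) = 0" "Im (dv y 0) = 0" using x y Isub unfolding R_def by blast+
      then have c0: "dv y 0 - dv x 0 = complex_of_real c" by (simp add: c_def complex_eq_iff)
      have a: "acd (t 0) (t 1)" "acd (r 0) (r 1)" using BchainD(1)[OF t(1), of 0] BchainD(1)[OF r(1), of 0] m1 by simp_all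
      have ds: "dv y s = dv x s + complex_of_real c" if s: "s \<in> ?I" for s
      proof -
        have e': "exp (\<i> * r 0 s) = exp (\<i> * t 0 s)" if "s \<in> ?I" for s using ee[OF that] unfolding td[OF that] .
        have "r 0 s - t 0 s = r 0 0 - t 0 0" by (rule angle_unique[OF a(2,1) e' s])
        then have "dv y s - dv x s = complex_of_real c" unfolding td[OF s] c0[symmetric] td[OF Isub] .
        then show ?thesis by (simp add: diff_eq_eq add.commute)
      qed
      have "exp (\<i> * complex_of_real c) = 1"
      proof -
        have "exp (\<i> * dv x 0) * exp (\<i> * complex_of_real c) = exp (\<i> * dv x 0)"
          using ee[OF Isub] unfolding ds[OF Isub] by (simp add: distrib_left exp_add)
        then show ?thesis by simp
      qed
      then obtain n :: int where n: "c = of_int (2 * n) * pi" unfolding exp_eq_1 by auto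
      have E1: "exp (\<i> * complex_of_real c) = 1" by fact
      have "c = 0 \<or> 2 * pi \<le> \<bar>c\<bar>"
      proof (cases "n = 0")
        case False
        then have "1 \<le> \<bar>real_of_int n\<bar>" by linarith
        then have "2 * pi * 1 \<le> 2 * pi * \<bar>real_of_int n\<bar>" by (intro mult_left_mono) auto
        moreover have "\<bar>c\<bar> = 2 * pi * \<bar>real_of_int n\<bar>" unfolding n by (simp add: abs_mult)
        ultimately show ?thesis by simp
      qed (simp add: n)
      moreover have "y = x + c *\<^sub>R u"
      proof (rule eqI[OF yK xcu(1)[OF xK]])
        show "dv y s = dv (x + c *\<^sub>R u) s" if s: "s \<in> ?I" for s unfolding xcu(2)[OF xK s] by (rule ds[OF s])
      qed
      moreover have "psi (z + c *\<^sub>R u) = psi z" if z: "z \<in> R" for z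
      proof (rule psi_eq[OF psi_dv(1)[OF z]])
        have zK: "z \<in> hcarrier ?K" using z RK by blast
        show "dv (psi z) s = exp (\<i> * dv (z + c *\<^sub>R u) s)" if s: "s \<in> ?I" for s
          unfolding psi_dv(3)[OF z s] xcu(2)[OF zK s] distrib_left exp_add E1 by simp
      qed
      ultimately show ?thesis by blast
    qed
    show "\<exists>d>0. \<forall>y\<in>R. hnorm ?K (y - x) < d \<longrightarrow> hnorm ?K (psi y - psi x) < e" if x: "x \<in> R" and e: "0 < e" for x e
    \<comment> \<open>The convergence lemmas are sequential, so a failure of continuity is turned
      into a sequence at distance below 1 / (n + 1).\<close>
    proof (rule ccontr)
      assume no: "\<not> (\<exists>d>0. \<forall>y\<in>R. hnorm ?K (y - x) < d \<longrightarrow> hnorm ?K (psi y - psi x) < e)"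
      have "\<exists>y. y \<in> R \<and> hnorm ?K (y - x) < inverse (real (Suc n)) \<and> \<not> hnorm ?K (psi y - psi x) < e" for n
        using no ip[of n] by blast
      then have "\<forall>n. \<exists>y. y \<in> R \<and> hnorm ?K (y - x) < inverse (real (Suc n)) \<and> \<not> hnorm ?K (psi y - psi x) < e" ..
      from choice[OF this] obtain Y where "\<forall>n. Y n \<in> R \<and> hnorm ?K (Y n - x) < inverse (real (Suc n)) \<and>
          \<not> hnorm ?K (psi (Y n) - psi x) < e" ..
      then have Y: "\<And>n. Y n \<in> R" "\<And>n. hnorm ?K (Y n - x) < inverse (real (Suc n))"
        "\<And>n. \<not> hnorm ?K (psi (Y n) - psi x) < e" by blast+
      have xK: "x \<in> hcarrier ?K" and YK: "\<And>n. Y n \<in> hcarrier ?K" using x Y(1) RK by auto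
      obtain t where t: "Bchain m t" "x = crv (prim (t 0))" by (rule rep[OF xK])
      have "\<exists>T. Bchain m T \<and> Y n = crv (prim (T 0))" for n by (rule rep[OF YK[of n]]) blast
      then have "\<forall>n. \<exists>T. Bchain m T \<and> Y n = crv (prim (T 0))" ..
      from choice[OF this] obtain T where "\<forall>n. Bchain m (T n) \<and> Y n = crv (prim (T n 0))" ..
      then have T: "\<And>n. Bchain m (T n)" "\<And>n. Y n = crv (prim (T n 0))" by blast+
      have tr: "\<forall>s\<in>?I. Im (t 0 s) = 0" using x Rrep[OF t(1)] by (simp add: t(2))
      have Tr: "\<forall>s\<in>?I. Im (T n 0 s) = 0" for n using Y(1)[of n] unfolding T(2) Rrep[OF T(1)] .
      have "(\<lambda>n. hnorm ?K (Y n - x)) \<longlonglongrightarrow> 0"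
        by (rule seq) (use Y(2) subspace_diff[OF K.subsp YK xK] in auto)
      then have "Btendsto m T t" unfolding T(2) t(2) by (rule BtendstoI_curve[OF m1 T(1) t(1)])
      then have "Btendsto m (\<lambda>n. cexp (T n)) (cexp t)" by (rule cexp_tendsto[OF _ _ _ m]) (use Tr tr in blast)+
      from Btendsto_curve[OF m1 this] have l: "(\<lambda>n. hnorm ?K (psi (Y n) - psi x)) \<longlonglongrightarrow> 0"
        unfolding T(2) t(2) psi_rep(1)[OF T(1) Tr] psi_rep(1)[OF t(1) tr] .
      have "\<forall>\<^sub>F n in sequentially. hnorm ?K (psi (Y n) - psi x) < e" by (rule order_tendstoD(2)[OF l e])
      then show False using eventually_happens'[OF sequentially_bot] Y(3) by blast
    qed
    show "\<exists>d>0. \<forall>z\<in>A_space (Suc m). hnorm ?K (z - psi x) < d \<longrightarrow> (\<exists>y\<in>R. hnorm ?K (y - x) < e \<and> psi y = z)"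
      if x: "x \<in> R" and e: "0 < e" for x e
    proof (rule ccontr)
      assume no: "\<not> (\<exists>d>0. \<forall>z\<in>A_space (Suc m). hnorm ?K (z - psi x) < d \<longrightarrow> (\<exists>y\<in>R. hnorm ?K (y - x) < e \<and> psi y = z))"
      have "\<exists>z. z \<in> A_space (Suc m) \<and> hnorm ?K (z - psi x) < inverse (real (Suc n)) \<and>
          \<not> (\<exists>y\<in>R. hnorm ?K (y - x) < e \<and> psi y = z)" for n
        using no ip[of n] by blast
      then have "\<forall>n. \<exists>z. z \<in> A_space (Suc m) \<and> hnorm ?K (z - psi x) < inverse (real (Suc n)) \<and>
          \<not> (\<exists>y\<in>R. hnorm ?K (y - x) < e \<and> psi y = z)" ..
      from choice[OF this] obtain Z where "\<forall>n. Z n \<in> A_space (Suc m) \<and> hnorm ?K (Z n - psi x) < inverse (real (Suc n)) \<and>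
          \<not> (\<exists>y\<in>R. hnorm ?K (y - x) < e \<and> psi y = Z n)" ..
      then have Z: "\<And>n. Z n \<in> A_space (Suc m)" "\<And>n. hnorm ?K (Z n - psi x) < inverse (real (Suc n))"
        "\<And>n y. y \<in> R \<Longrightarrow> hnorm ?K (y - x) < e \<Longrightarrow> psi y \<noteq> Z n" by blast+
      have xK: "x \<in> hcarrier ?K" using x RK by auto
      have ZK: "Z n \<in> hcarrier ?K" for n using Z(1)[of n] unfolding A by blast
      obtain t where t: "Bchain m t" "x = crv (prim (t 0))" by (rule rep[OF xK])
      have tr: "\<forall>s\<in>?I. Im (t 0 s) = 0" using x Rrep[OF t(1)] by (simp add: t(2))
      have "\<exists>f. Bchain m f \<and> Z n = crv (prim (f 0))" for n by (rule rep[OF ZK[of n]]) blast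
      then have "\<forall>n. \<exists>f. Bchain m f \<and> Z n = crv (prim (f 0))" ..
      from choice[OF this] obtain f where "\<forall>n. Bchain m (f n) \<and> Z n = crv (prim (f n 0))" ..
      then have f: "\<And>n. Bchain m (f n)" "\<And>n. Z n = crv (prim (f n 0))" by blast+
      have fu: "\<forall>s\<in>?I. cmod (f n 0 s) = 1" for n using Z(1)[of n] unfolding f(2) Arep[OF f(1)] .
      then have fu': "\<forall>n. \<forall>s\<in>?I. cmod (f n 0 s) = 1" by blast
      note p = psi_rep[OF t(1) tr]
      have gu: "\<forall>s\<in>?I. cmod (cexp t 0 s) = 1" using tr by (intro ballI cexp_unimodular) blast
      have g0: "cmod (cexp t 0 0) = 1" by (rule bspec[OF gu Isub])
      have "(\<lambda>n. hnorm ?K (Z n - psi x)) \<longlonglongrightarrow> 0"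
        by (rule seq) (use Z(2) subspace_diff[OF K.subsp ZK psi_dv(1)[OF x]] in auto)
      then have B: "Btendsto m f (cexp t)" unfolding f(2) t(2) p(1) by (rule BtendstoI_curve[OF m1 f(1) p(2)])
      define c where "c = Re (t 0 0)"
      have tc: "t 0 0 = complex_of_real c" using tr Isub by (simp add: c_def complex_eq_iff)
      have ec: "exp (\<i> * complex_of_real c) = cexp t 0 0" by (simp add: cexp_def tc)
      \<comment> \<open>The initial values of \<open>f n\<close> approach that of the limit, so
        their quotient tends to 1, where \<open>Arg\<close> is continuous. Hence c + Arg (q n) are
        initial angles of \<open>f n\<close> that tend to c, which selects the lifts close to
        x.\<close>
      define q where "q n = f n 0 0 / cexp t 0 0" for n
      have qn: "cmod (q n) = 1" for n using bspec[OF fu Isub, of n] g0 by (simp add: q_def norm_divide)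
      have "q \<longlonglongrightarrow> cexp t 0 0 / cexp t 0 0"
        unfolding q_def[abs_def] using g0 by (intro tendsto_divide Btendsto_point[OF B m1 Isub] tendsto_const) auto
      moreover have "cexp t 0 0 / cexp t 0 0 = 1" using g0 by auto
      ultimately have ql: "q \<longlonglongrightarrow> 1" by simp
      have "isCont Arg 1" by (rule continuous_at_Arg) (simp add: complex_nonpos_Reals_iff)
      from isCont_tendsto_compose[OF this ql] have "(\<lambda>n. Arg (q n)) \<longlonglongrightarrow> 0" by simp
      from tendsto_add[OF tendsto_const this] have "(\<lambda>n. c + Arg (q n)) \<longlonglongrightarrow> c + 0" .
      then have cl: "(\<lambda>n. c + Arg (q n)) \<longlonglongrightarrow> c" by simp
      have ecn: "exp (\<i> * complex_of_real (c + Arg (q n))) = f n 0 0" for n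
      proof -
        have "exp (\<i> * complex_of_real (c + Arg (q n))) = exp (\<i> * complex_of_real c) * exp (\<i> * complex_of_real (Arg (q n)))"
          by (simp add: distrib_left exp_add)
        also have "\<dots> = f n 0 0" unfolding ec expArg[OF qn] using g0 by (auto simp: q_def)
        finally show ?thesis .
      qed
      define Y where "Y n = crv (prim (angle (c + Arg (q n)) (f n) 0))" for n
      note a = angle_lift[OF f(1) fu ecn]
      have BB: "Btendsto m (\<lambda>n. angle (c + Arg (q n)) (f n)) (angle c (cexp t))" by (rule angle_tendsto[OF B m fu' gu cl])
      note l = Btendsto_curve[OF m1 BB]
      have aB: "Bchain m (angle c (cexp t))" by (rule angle_Bchain[OF p(2) gu m])
      \<comment> \<open>Taking the angle of exp (\<i> t) with the initial value of t returns t, by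
        \<open>angle_unique\<close>; so the lifts converge to x itself and not to a
        translate.\<close>
      have "crv (prim (angle c (cexp t) 0)) = x"
      proof (rule eqI[OF curve(1)[OF aB] xK])
        fix s assume s: "s \<in> ?I"
        have ad: "acd (t 0) (t 1)" using BchainD(1)[OF t(1), of 0] m1 by simp
        have ee: "exp (\<i> * angle c (cexp t) 0 s) = exp (\<i> * t 0 s)" if "s \<in> ?I" for s
          unfolding angle_exp(1)[OF p(2) gu m1 ec that] by (simp add: cexp_def)
        have "angle c (cexp t) 0 s - t 0 s = angle c (cexp t) 0 0 - t 0 0"
          by (rule angle_unique[OF angle_acd(1)[OF p(2) gu m1] ad ee s])
        then have "angle c (cexp t) 0 s = t 0 s" unfolding angle_acd(2)[OF p(2) gu m1] tc by simp
        then show "dv (crv (prim (angle c (cexp t) 0))) s = dv x s"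
          unfolding t(2) curve(2)[OF aB s] curve(2)[OF t(1) s] .
      qed
      with l have l': "(\<lambda>n. hnorm ?K (Y n - x)) \<longlonglongrightarrow> 0" by (simp add: Y_def)
      have "\<forall>\<^sub>F n in sequentially. hnorm ?K (Y n - x) < e" by (rule order_tendstoD(2)[OF l' e])
      then obtain n where n: "hnorm ?K (Y n - x) < e" using eventually_happens'[OF sequentially_bot] by blast
      have YR: "Y n \<in> R" unfolding Y_def by (rule a(1))
      have "psi (Y n) = Z n" unfolding Y_def f(2) by (rule a(2))
      then show False using Z(3)[OF YR n] by blast
    qed
  qed
  then show ?thesis by blast
qed

theorem theorem2p2:
  fixes m :: nat
  shows "(1 \<le> m \<longrightarrow>
            (\<exists>E :: curve hspace.
               hilbert_manifold E (subtopology (htopology (K_space (m + 1))) (A_space (m + 1))))) \<and>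
         (3 \<le> m \<longrightarrow> hilbert_submanifold (K_space (m + 1)) (A_space (m + 1)))"
proof (intro conjI impI)
  assume m: "1 \<le> m"
  show "\<exists>E :: curve hspace. hilbert_manifold E (subtopology (htopology (K_space (m + 1))) (A_space (m + 1)))"
  proof (cases "3 \<le> m")
    case True
    then show ?thesis using A_space_algebra_case by blast
  next
    case False
    then have "m = 1 \<or> m = 2" using m by auto
    from A_space_angle_case[OF this] show ?thesis by simp
  qed
next
  assume "3 \<le> m"
  then show "hilbert_submanifold (K_space (m + 1)) (A_space (m + 1))" using A_space_algebra_case by blast
qed

end
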